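(* Let $X$ be a smooth irreducible projective curve over a finite field, let $K$ be its field of rational functions, and let $n$ be a positive integer. If $N$ is the total number of spinor genera of maximal $X$-orders in the matrix algebra $\mathbb{M}_n(K)$, then at least $\frac{N}{n}-1$ of these spinor genera contain non-split maximal $X$-orders.
   Context: For a closed point $\wp\in X$, $K_\wp$ is the completion of $K$ at $\wp$ and $\mathcal{O}_\wp$ its ring of integers. An $X$-lattice in a finite-dimensional $K$-vector space $V$ is a locally free subsheaf of $\mathcal{O}_X$-modules, of rank $\dim_K V$, of the constant sheaf $V$; it is determined by its completions $\Lambda_\wp$ ($\wp\in X$). An $X$-order in $\mathbb{M}_n(K)$ is an $X$-lattice in $\mathbb{M}_n(K)$ that is a sheaf of orders (equivalently, every completion is an order); a maximal $X$-order is one that is maximal (equivalently, every completion is a maximal order). Two maximal $X$-orders $\mathfrak{D},\mathfrak{D}'$ in $\mathbb{M}_n(K)$ are in the same spinor genus if there are $h\in \mathrm{GL}_n(K)$ and, for every $\wp\in X$, an element $g_\wp\in \mathrm{GL}_n(K_\wp)$ with reduced norm (determinant) in $K_\wp^{*n}$, such that $\mathfrak{D}'_\wp=g_\wp h\,\mathfrak{D}_\wp\, h^{-1}g_\wp^{-1}$ for all $\wp\in X$. (All maximal $X$-orders lie in one genus; the number of spinor genera is finite.) A maximal $X$-order $\mathfrak{D}$ in $\mathbb{M}_n(K)$ is split if it contains a $\mathrm{GL}_n(K)$-conjugate of the order of diagonal matrices $\mathcal{O}_X\times\cdots\times\mathcal{O}_X=\bigoplus_i\mathcal{O}_XE_{i,i}$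 ($n$ factors), where $E_{i,i}$ are the diagonal matrix units. *)

theory Defs
  imports
    "HOL-Analysis.Abstract_Topology"
    "HOL-Algebra.Algebraic_Closure_Type"
    "HOL-Algebra.Generated_Fields"
    "Jordan_Normal_Form.Determinant"
begin

section \<open>Smooth projective curves\<close>

text \<open>
  The function field is the type \<open>'a\<close> itself, viewed as a \<open>HOL-Algebra\<close> ring where needed.

  An integral closed subscheme of projective \<open>d\<close>-space over \<open>k\<close> is given by the homogeneous
  coordinates \<open>x 0, \<dots>, x d\<close> of its generic point, which may be taken in the function field.
  Its affine charts are the spectra of the rings \<open>k[x 0 / x i, \<dots>, x d / x i]\<close>, where \<open>x i \<noteq> 0\<close>
  (the chart is empty otherwise).
  Since the scheme is integral and separated, a point is determined by its local ring, a
  subring of the function field; a closed point is identified with that subring.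
  The generic point is left out: it lies in every nonempty open set, so that the open sets of
  the scheme correspond to the open sets of the space of closed points.
\<close>

abbreviation fun_field :: "'a::field ring" where
  "fun_field \<equiv> ring_of_type_algebra"

definition chart_ring :: "'a::field set \<Rightarrow> nat \<Rightarrow> (nat \<Rightarrow> 'a) \<Rightarrow> nat \<Rightarrow> 'a set" where
  "chart_ring k d x i = generate_ring fun_field (k \<union> {x j / x i | j. j \<le> d})"

definition localization_at :: "'a::field set \<Rightarrow> 'a set \<Rightarrow> 'a set" where
  "localization_at A M = {a / s | a s. a \<in> A \<and> s \<in> A - M}"

text \<open>The closed points of the principal open subset \<open>a \<noteq> 0\<close> of the chart \<open>x i \<noteq> 0\<close>.\<close>

definition principal_open ::
    "'a::field set \<Rightarrow> nat \<Rightarrow> (nat \<Rightarrow> 'a) \<Rightarrow> nat \<Rightarrow> 'a \<Rightarrow> 'a set set" where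
  "principal_open k d x i a =
     {localization_at (chart_ring k d x i) M | M.
        maximalideal M (fun_field\<lparr>carrier := chart_ring k d x i\<rparr>) \<and> a \<notin> M}"

definition projective_model :: "'a::field set \<Rightarrow> nat \<Rightarrow> (nat \<Rightarrow> 'a) \<Rightarrow> 'a set topology" where
  "projective_model k d x = topology_generated_by
     {principal_open k d x i a | i a. i \<le> d \<and> x i \<noteq> 0 \<and> a \<in> chart_ring k d x i}"

definition local_maximal_ideal :: "'a::field set \<Rightarrow> 'a set" where
  "local_maximal_ideal P = {a \<in> P. \<forall>b \<in> P. a * b \<noteq> 1}"

text \<open>Since localizations of finitely generated algebras over a field are noetherian, a local
  ring of this kind is regular of dimension one if and only if its maximal ideal is generated
  by a single nonzero element.\<close>

definition regular_local_dim_one :: "'a::field set \<Rightarrow> bool" where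
  "regular_local_dim_one P \<longleftrightarrow> (\<exists>t. t \<noteq> 0 \<and> local_maximal_ideal P = (\<lambda>a. t * a) ` P)"

definition has_trdeg_one :: "'a::field set \<Rightarrow> bool" where
  "has_trdeg_one k \<longleftrightarrow>
     (\<exists>t. (ring.transcendental fun_field over k) t \<and>
          (\<forall>a. (ring.algebraic fun_field over (generate_field fun_field (insert t k))) a))"

text \<open>\<open>C\<close> is a smooth irreducible projective curve over the finite field \<open>k\<close> whose field of
  rational functions is \<open>'a\<close>.  As finite fields are perfect, smoothness amounts to regularity of
  the local rings at all closed points.\<close>

definition smooth_projective_curve :: "'a::field set \<Rightarrow> 'a set topology \<Rightarrow> bool" where
  "smooth_projective_curve k C \<longleftrightarrow>
     subfield k fun_field \<and> finite k \<and> has_trdeg_one k \<and>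
     (\<exists>d x. C = projective_model k d x \<and>
        (\<exists>i\<le>d. x i \<noteq> 0) \<and>
        generate_field fun_field (k \<union> {x j / x i | i j. i \<le> d \<and> j \<le> d \<and> x i \<noteq> 0}) = UNIV) \<and>
     (\<forall>P \<in> topspace C. regular_local_dim_one P)"

text \<open>Sections of the structure sheaf over a nonempty open set: the rational functions that
  are regular at all its points.\<close>

definition structure_sheaf :: "'a::field set set \<Rightarrow> 'a set" where
  "structure_sheaf U = \<Inter> U"


section \<open>Completions\<close>

text \<open>With \<open>v\<close> the valuation at \<open>P\<close>, the condition \<open>z \<in> (\<lambda>a. c * a) ` P\<close> says \<open>v z \<ge> v c\<close>.\<close>

definition Cauchy_at :: "'a::field set \<Rightarrow> (nat \<Rightarrow> 'a) \<Rightarrow> bool" where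
  "Cauchy_at P f \<longleftrightarrow>
     (\<forall>c. c \<noteq> 0 \<longrightarrow> (\<exists>N. \<forall>i\<ge>N. \<forall>j\<ge>N. f i - f j \<in> (\<lambda>a. c * a) ` P))"

definition null_at :: "'a::field set \<Rightarrow> (nat \<Rightarrow> 'a) \<Rightarrow> bool" where
  "null_at P f \<longleftrightarrow> (\<forall>c. c \<noteq> 0 \<longrightarrow> (\<exists>N. \<forall>i\<ge>N. f i \<in> (\<lambda>a. c * a) ` P))"

definition Cauchy_ring :: "'a::field set \<Rightarrow> (nat \<Rightarrow> 'a) ring" where
  "Cauchy_ring P =
     \<lparr>carrier = {f. Cauchy_at P f},
      monoid.mult = (\<lambda>f g i. f i * g i), one = (\<lambda>i. 1),
      ring.zero = (\<lambda>i. 0), add = (\<lambda>f g i. f i + g i)\<rparr>"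

definition completion :: "'a::field set \<Rightarrow> (nat \<Rightarrow> 'a) set ring" where
  "completion P = Cauchy_ring P Quot {f. null_at P f}"

definition limit_class :: "'a::field set \<Rightarrow> (nat \<Rightarrow> 'a) \<Rightarrow> (nat \<Rightarrow> 'a) set" where
  "limit_class P f = {h. null_at P h} +>\<^bsub>Cauchy_ring P\<^esub> f"

definition to_completion :: "'a::field set \<Rightarrow> 'a \<Rightarrow> (nat \<Rightarrow> 'a) set" where
  "to_completion P a = limit_class P (\<lambda>i. a)"


section \<open>Matrices over a ring given by a record\<close>

definition mat_ring :: "('r, 'm) ring_scheme \<Rightarrow> nat \<Rightarrow> 'r mat ring" where
  "mat_ring R n =
     \<lparr>carrier = {A \<in> carrier_mat n n. \<forall>i<n. \<forall>j<n. A $$ (i, j) \<in> carrier R},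
      monoid.mult = (\<lambda>A B. mat n n (\<lambda>(i, j). \<Oplus>\<^bsub>R\<^esub>l\<in>{..<n}. A $$ (i, l) \<otimes>\<^bsub>R\<^esub> B $$ (l, j))),
      one = mat n n (\<lambda>(i, j). if i = j then \<one>\<^bsub>R\<^esub> else \<zero>\<^bsub>R\<^esub>),
      ring.zero = mat n n (\<lambda>(i, j). \<zero>\<^bsub>R\<^esub>),
      add = (\<lambda>A B. mat n n (\<lambda>(i, j). A $$ (i, j) \<oplus>\<^bsub>R\<^esub> B $$ (i, j)))\<rparr>"

definition ring_det :: "('r, 'm) ring_scheme \<Rightarrow> nat \<Rightarrow> 'r mat \<Rightarrow> 'r" where
  "ring_det R n A =
     (\<Oplus>\<^bsub>R\<^esub>p\<in>{p. p permutes {..<n}}.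
        (if evenperm p then \<one>\<^bsub>R\<^esub> else \<ominus>\<^bsub>R\<^esub> \<one>\<^bsub>R\<^esub>) \<otimes>\<^bsub>R\<^esub> (\<Otimes>\<^bsub>R\<^esub>i\<in>{..<n}. A $$ (i, p i)))"

definition conj_by :: "('r, 'm) ring_scheme \<Rightarrow> 'r \<Rightarrow> 'r \<Rightarrow> 'r" where
  "conj_by M u A = u \<otimes>\<^bsub>M\<^esub> A \<otimes>\<^bsub>M\<^esub> inv\<^bsub>M\<^esub> u"


section \<open>Lattices and orders in the matrix algebra\<close>

abbreviation mat_alg :: "nat \<Rightarrow> 'a::field mat ring" where
  "mat_alg n \<equiv> ring_mat TYPE('a) n ()"

text \<open>Subsheaves of \<open>O_C\<close>-modules of the constant sheaf with value the matrix algebra.  As the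
  restriction maps of the constant sheaf between nonempty open sets are identities, the sheaf
  axioms amount to the condition on nonempty unions.\<close>

definition matrix_subsheaf ::
    "'a::field set topology \<Rightarrow> nat \<Rightarrow> ('a set set \<Rightarrow> 'a mat set) \<Rightarrow> bool" where
  "matrix_subsheaf C n F \<longleftrightarrow>
     F \<in> extensional {U. openin C U} \<and>
     F {} = {0\<^sub>m n n} \<and>
     (\<forall>U. openin C U \<and> U \<noteq> {} \<longrightarrow>
        F U \<subseteq> carrier_mat n n \<and> 0\<^sub>m n n \<in> F U \<and>
        (\<forall>A\<in>F U. \<forall>B\<in>F U. A + B \<in> F U) \<and>
        (\<forall>c\<in>structure_sheaf U. \<forall>A\<in>F U. c \<cdot>\<^sub>m A \<in> F U)) \<and>
     (\<forall>\<U>. \<U> \<noteq> {} \<and> (\<forall>W\<in>\<U>. openin C W \<and> W \<noteq> {}) \<longrightarrow> F (\<Union>\<U>) = (\<Inter>W\<in>\<U>. F W))"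

definition mat_lincomb :: "nat \<Rightarrow> nat \<Rightarrow> (nat \<Rightarrow> 'a::field mat) \<Rightarrow> (nat \<Rightarrow> 'a) \<Rightarrow> 'a mat" where
  "mat_lincomb n r e c = mat n n (\<lambda>(i, j). \<Sum>l<r. c l * e l $$ (i, j))"

text \<open>Local freeness of rank \<open>r\<close>: near every point, \<open>c \<mapsto> \<Sum>\<^sub>l c l e l\<close> is an isomorphism from the
  free \<open>O_C\<close>-module of rank \<open>r\<close>.\<close>

definition locally_free ::
    "'a::field set topology \<Rightarrow> nat \<Rightarrow> nat \<Rightarrow> ('a set set \<Rightarrow> 'a mat set) \<Rightarrow> bool" where
  "locally_free C n r F \<longleftrightarrow>
     (\<forall>P \<in> topspace C. \<exists>U e. openin C U \<and> P \<in> U \<and>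
        (\<forall>W. openin C W \<and> W \<noteq> {} \<and> W \<subseteq> U \<longrightarrow>
           bij_betw (mat_lincomb n r e) ({..<r} \<rightarrow>\<^sub>E structure_sheaf W) (F W)))"

definition matrix_lattice ::
    "'a::field set topology \<Rightarrow> nat \<Rightarrow> ('a set set \<Rightarrow> 'a mat set) \<Rightarrow> bool" where
  "matrix_lattice C n F \<longleftrightarrow> matrix_subsheaf C n F \<and> locally_free C n (n * n) F"

definition matrix_order ::
    "'a::field set topology \<Rightarrow> nat \<Rightarrow> ('a set set \<Rightarrow> 'a mat set) \<Rightarrow> bool" where
  "matrix_order C n D \<longleftrightarrow> matrix_lattice C n D \<and>
     (\<forall>U. openin C U \<and> U \<noteq> {} \<longrightarrow>
        1\<^sub>m n \<in> D U \<and> (\<forall>A\<in>D U. \<forall>B\<in>D U. A * B \<in> D U))"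

definition maximal_orders ::
    "'a::field set topology \<Rightarrow> nat \<Rightarrow> ('a set set \<Rightarrow> 'a mat set) set" where
  "maximal_orders C n = {D. matrix_order C n D \<and>
     (\<forall>E. matrix_order C n E \<and> (\<forall>U. openin C U \<longrightarrow> D U \<subseteq> E U) \<longrightarrow> E = D)}"

definition stalk :: "'a set topology \<Rightarrow> ('a set set \<Rightarrow> 'a mat set) \<Rightarrow> 'a set \<Rightarrow> 'a mat set" where
  "stalk C F P = \<Union> (F ` {U. openin C U \<and> P \<in> U})"

text \<open>The completion at \<open>P\<close>, realised as the set of limits, in the matrix algebra over the
  completed field, of the entrywise Cauchy sequences in the stalk.\<close>

definition completed_stalk ::
    "'a::field set topology \<Rightarrow> nat \<Rightarrow> ('a set set \<Rightarrow> 'a mat set) \<Rightarrow> 'a set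
      \<Rightarrow> (nat \<Rightarrow> 'a) set mat set" where
  "completed_stalk C n F P =
     {mat n n (\<lambda>(i, j). limit_class P (\<lambda>m. f m $$ (i, j))) | f.
        (\<forall>m. f m \<in> stalk C F P) \<and> (\<forall>i<n. \<forall>j<n. Cauchy_at P (\<lambda>m. f m $$ (i, j)))}"


section \<open>Spinor genera and split orders\<close>

definition same_spinor_genus :: "'a::field set topology \<Rightarrow> nat \<Rightarrow>
    ('a set set \<Rightarrow> 'a mat set) \<Rightarrow> ('a set set \<Rightarrow> 'a mat set) \<Rightarrow> bool" where
  "same_spinor_genus C n D D' \<longleftrightarrow>
     (\<exists>h \<in> Units (mat_alg n). \<exists>g. \<forall>P \<in> topspace C.
        g P \<in> Units (mat_ring (completion P) n) \<and>
        (\<exists>u \<in> Units (completion P).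
           ring_det (completion P) n (g P) = u [^]\<^bsub>completion P\<^esub> n) \<and>
        completed_stalk C n D' P =
          (\<lambda>A. conj_by (mat_ring (completion P) n) (g P)
                 (conj_by (mat_ring (completion P) n) (map_mat (to_completion P) h) A))
            ` completed_stalk C n D P)"

definition spinor_genera ::
    "'a::field set topology \<Rightarrow> nat \<Rightarrow> ('a set set \<Rightarrow> 'a mat set) set set" where
  "spinor_genera C n = maximal_orders C n //
     {(D, D'). D \<in> maximal_orders C n \<and> D' \<in> maximal_orders C n \<and> same_spinor_genus C n D D'}"

definition split_order ::
    "'a::field set topology \<Rightarrow> nat \<Rightarrow> ('a set set \<Rightarrow> 'a mat set) \<Rightarrow> bool" where
  "split_order C n D \<longleftrightarrow>
     (\<exists>h \<in> Units (mat_alg n). \<forall>U. openin C U \<and> U \<noteq> {} \<longrightarrow>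
        (\<forall>c \<in> {..<n} \<rightarrow> structure_sheaf U. conj_by (mat_alg n) h (mat_diag n c) \<in> D U))"

end

theory Submission imports Defs begin

text \<open>
  Why the theorem is true.  A maximal \<open>X\<close>-order is the sheaf of endomorphisms of a vector bundle of
  rank \<open>n\<close>, described here by a basis \<open>g P\<close> of each of its stalks in \<open>K\<^sup>n\<close>
  (\<open>maximal_order_End\<close>, \<open>End_order_maximal\<close>).  Conjugation by \<open>h\<close> changes the divisor of the
  determinant bundle by the principal divisor of \<open>det h\<close>; a local conjugation by an element whose
  determinant is an \<open>n\<close>-th power, and the choice of the bundle for a given order, change it by a
  multiple of \<open>n\<close>.  Nothing else is remembered by the spinor genus, so that the spinor genera
  correspond to the classes of divisors modulo principal divisors and multiples of \<open>n\<close>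
  (\<open>same_spinor_genus_iff\<close>, \<open>spinor_genera_eq\<close>).  There are finitely many of these by the usual
  argument: every class contains an effective divisor of bounded degree (\<open>riemann_inequality\<close>,
  \<open>finite_class_group\<close>).

  Let \<open>\<delta>\<close> be the least positive degree of a divisor.  A divisor \<open>D\<close> of degree \<open>- \<delta>\<close> has no sections.
  If \<open>H\<^sup>1\<close> of one such divisor vanishes, then all divisors of degree 0 are principal
  (\<open>degree_0_principal\<close>); the degree determines the class, there are at most \<open>n\<close> spinor genera, and
  the bound \<open>N / n - 1\<close> is not positive.  Otherwise \<open>H\<^sup>1\<close> of every divisor of degree \<open>- \<delta>\<close> is nonzero.
  As every divisor differs by a multiple of one of degree \<open>\<delta>\<close> from one of degree \<open>- \<delta>\<close>, at least
  \<open>N / n\<close> classes contain a divisor \<open>D\<close> of degree \<open>- \<delta>\<close> (\<open>class_count\<close>).  For each of these a nonzero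
  class in \<open>H\<^sup>1(O(D))\<close> gives an extension of \<open>O\<^sup>n\<^sup>-\<^sup>1\<close> by \<open>O(D)\<close> that does not split, and for \<open>n \<ge> 2\<close> its
  order of endomorphisms is not split (\<open>extension_not_split\<close>).  Indeed a splitting of the order
  writes the bundle as a direct sum of line bundles \<open>L\<^sub>1, \<dots>, L\<^sub>n\<close>.  If some \<open>L\<^sub>i\<close> maps to zero in
  \<open>O\<^sup>n\<^sup>-\<^sup>1\<close>, it is the subbundle \<open>O(D)\<close>, which would be a direct summand.  Otherwise all \<open>L\<^sub>i\<close> have
  degree at most 0; as their degrees are multiples of \<open>\<delta>\<close> with sum \<open>- \<delta>\<close>, all of them but one have
  degree 0 and a nonzero map to \<open>O\<close>, hence are trivial.  Then the bundle has as many sections as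
  \<open>O\<^sup>n\<^sup>-\<^sup>1\<close>, so that the sections of \<open>O\<^sup>n\<^sup>-\<^sup>1\<close> lift and the extension splits after all.

  The theory of divisors rests on counting: the constant field is finite and spaces of sections
  are compared by the orders of finite groups.  Everything about divisors uses the closed points
  of the curve only as a set of discrete valuation rings with the properties collected in the
  locale \<open>places\<close>.  That the closed points of a smooth projective curve have these properties, and
  that the nonempty open sets are the cofinite sets of closed points, is derived from the
  coordinate rings of the affine charts.
\<close>

section \<open>Discrete valuation rings inside a field\<close>

definition unit_of :: "'a::field set \<Rightarrow> 'a \<Rightarrow> bool" where
  "unit_of P u \<longleftrightarrow> u \<noteq> 0 \<and> u \<in> P \<and> inverse u \<in> P"

definition is_uniformizer :: "'a::field set \<Rightarrow> 'a \<Rightarrow> bool" where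
  "is_uniformizer P t \<longleftrightarrow> t \<noteq> 0 \<and> t \<in> P \<and> inverse t \<notin> P \<and>
     (\<forall>z. z \<noteq> 0 \<longrightarrow> (\<exists>i::int. \<exists>u. unit_of P u \<and> z = t powi i * u))"

text \<open>A discrete valuation ring whose fraction field is the whole type.\<close>

locale dvr =
  fixes P :: "'a::field set"
  assumes one_in: "1 \<in> P"
    and add_in: "\<lbrakk>a \<in> P; b \<in> P\<rbrakk> \<Longrightarrow> a + b \<in> P"
    and mult_in: "\<lbrakk>a \<in> P; b \<in> P\<rbrakk> \<Longrightarrow> a * b \<in> P"
    and uminus_in: "a \<in> P \<Longrightarrow> - a \<in> P"
    and uniformizer_ex: "\<exists>t. is_uniformizer P t"

definition uniformizer :: "'a::field set \<Rightarrow> 'a" where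
  "uniformizer P = (SOME t. is_uniformizer P t)"

definition ord :: "'a::field set \<Rightarrow> 'a \<Rightarrow> int" where
  "ord P z = (THE i. \<exists>u. unit_of P u \<and> z = uniformizer P powi i * u)"

text \<open>The fractional ideals, as powers of the maximal ideal.\<close>

definition fideal :: "'a::field set \<Rightarrow> int \<Rightarrow> 'a set" where
  "fideal P i = {z. z = 0 \<or> ord P z \<ge> i}"

context dvr
begin

lemma zero_in: "0 \<in> P"
  using add_in[OF one_in uminus_in[OF one_in]] by simp

lemma power_in: "a \<in> P \<Longrightarrow> a ^ n \<in> P"
  by (induction n) (auto intro: one_in mult_in)

lemma uniformizer: "is_uniformizer P (uniformizer P)"
  unfolding uniformizer_def using uniformizer_ex by (rule someI_ex)

lemma unif_neq_0 [simp]: "uniformizer P \<noteq> 0"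
  using uniformizer by (simp add: is_uniformizer_def)

lemma unit_mult: "unit_of P u \<Longrightarrow> unit_of P v \<Longrightarrow> unit_of P (u * v)"
  by (auto simp: unit_of_def intro: mult_in)

lemma unit_inverse: "unit_of P u \<Longrightarrow> unit_of P (inverse u)"
  by (auto simp: unit_of_def)

lemma unit_1: "unit_of P 1"
  by (auto simp: unit_of_def one_in)

lemma unif_powi_unit_imp:
  assumes "unit_of P (uniformizer P powi i)" shows "i = 0"
proof (rule ccontr)
  let ?t = "uniformizer P"
  have t: "?t \<in> P" "inverse ?t \<notin> P" using uniformizer by (auto simp: is_uniformizer_def)
  assume "i \<noteq> 0"
  have *: False if j: "j > 0" and u: "unit_of P (?t powi j)" for j :: int
  proof -
    have "inverse ?t = inverse (?t powi j) * ?t ^ nat (j - 1)"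
    proof -
      have "?t powi j = ?t * ?t ^ nat (j - 1)"
        using j power_int_add_1'[of ?t "j - 1"] by (simp add: power_int_def)
      then show ?thesis by (simp add: field_simps)
    qed
    moreover have "inverse (?t powi j) * ?t ^ nat (j - 1) \<in> P"
      using u t by (auto intro!: mult_in power_in simp: unit_of_def)
    ultimately show False using t by simp
  qed
  show False
  proof (cases "i > 0")
    case True
    then show ?thesis using * assms by blast
  next
    case False
    then have "unit_of P (?t powi (- i))" using unit_inverse[OF assms] by (simp add: power_int_minus)
    then show ?thesis using *[of "- i"] False \<open>i \<noteq> 0\<close> by simp
  qed
qed

lemma ord_eqI:
  assumes "unit_of P u" "z = uniformizer P powi i * u"
  shows "ord P z = i"
  unfolding ord_def
proof (rule the_equality)
  show "\<exists>u. unit_of P u \<and> z = uniformizer P powi i * u" using assms by blast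
  fix j assume "\<exists>u. unit_of P u \<and> z = uniformizer P powi j * u"
  then obtain v where v: "unit_of P v" "z = uniformizer P powi j * v" by blast
  have "uniformizer P powi (j - i) = u * inverse v"
    using assms v by (auto simp: power_int_diff field_simps unit_of_def)
  then have "unit_of P (uniformizer P powi (j - i))"
    using unit_mult[OF assms(1) unit_inverse[OF v(1)]] by simp
  then show "j = i" using unif_powi_unit_imp by fastforce
qed

lemma ord_decomp:
  assumes "z \<noteq> 0" obtains u where "unit_of P u" "z = uniformizer P powi (ord P z) * u"
proof -
  obtain i u where "unit_of P u" "z = uniformizer P powi i * u"
    using uniformizer assms by (auto simp: is_uniformizer_def)
  with ord_eqI[OF this] that show ?thesis by simp
qed

lemma ord_mult: assumes "a \<noteq> 0" "b \<noteq> 0" shows "ord P (a * b) = ord P a + ord P b"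
proof -
  obtain u where u: "unit_of P u" "a = uniformizer P powi (ord P a) * u" by (rule ord_decomp[OF assms(1)])
  obtain v where v: "unit_of P v" "b = uniformizer P powi (ord P b) * v" by (rule ord_decomp[OF assms(2)])
  note uv = u v
  show ?thesis
  proof (rule ord_eqI[OF unit_mult[OF uv(1,3)]])
    show "a * b = uniformizer P powi (ord P a + ord P b) * (u * v)"
      using arg_cong2[OF uv(2,4), of "(*)"] by (simp add: power_int_add ac_simps)
  qed
qed

lemma ord_1 [simp]: "ord P 1 = 0"
  by (rule ord_eqI[OF unit_1]) simp

lemma ord_inverse: assumes "a \<noteq> 0" shows "ord P (inverse a) = - ord P a"
  using ord_mult[of a "inverse a"] assms by simp

lemma ord_divide: assumes "a \<noteq> 0" "b \<noteq> 0" shows "ord P (a / b) = ord P a - ord P b"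
  using ord_mult[of a "inverse b"] assms ord_inverse by (simp add: divide_inverse)

lemma ord_power: assumes "a \<noteq> 0" shows "ord P (a ^ n) = int n * ord P a"
  using assms by (induction n) (auto simp: ord_mult algebra_simps)

lemma ord_unif [simp]: "ord P (uniformizer P) = 1"
  by (rule ord_eqI[OF unit_1]) simp

lemma ord_unif_powi [simp]: "ord P (uniformizer P powi i) = i"
  by (rule ord_eqI[OF unit_1]) simp

lemma unit_iff: "unit_of P z \<longleftrightarrow> z \<noteq> 0 \<and> ord P z = 0"
proof
  assume "unit_of P z"
  then show "z \<noteq> 0 \<and> ord P z = 0" using ord_eqI[of z z 0] by (auto simp: unit_of_def)
next
  assume "z \<noteq> 0 \<and> ord P z = 0"
  then show "unit_of P z" using ord_decomp[of z] by auto
qed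

lemma mem_iff: "z \<in> P \<longleftrightarrow> z = 0 \<or> ord P z \<ge> 0"
proof (cases "z = 0")
  case False
  let ?t = "uniformizer P"
  have t: "?t \<in> P" using uniformizer by (auto simp: is_uniformizer_def)
  have *: "w \<in> P" if w: "w \<noteq> 0" "ord P w \<ge> 0" for w
  proof -
    obtain u where "unit_of P u" "w = ?t powi (ord P w) * u" by (rule ord_decomp[OF w(1)])
    moreover have "?t powi (ord P w) = ?t ^ nat (ord P w)" using w(2) by (simp add: power_int_def)
    ultimately have "w = ?t ^ nat (ord P w) * u" by metis
    then show ?thesis using mult_in[OF power_in[OF t]] \<open>unit_of P u\<close> unit_of_def by metis
  qed
  have "ord P z \<ge> 0" if "z \<in> P"
  proof (rule ccontr)
    assume "\<not> ord P z \<ge> 0"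
    then have "inverse z \<in> P" using * False by (simp add: ord_inverse)
    then have "unit_of P z" using that False by (simp add: unit_of_def)
    then show False using \<open>\<not> ord P z \<ge> 0\<close> unit_iff by auto
  qed
  then show ?thesis using * False by auto
qed (simp add: zero_in)

lemma ord_nonneg: "z \<in> P \<Longrightarrow> z \<noteq> 0 \<Longrightarrow> ord P z \<ge> 0"
  by (simp add: mem_iff)

lemma fideal_0: "fideal P 0 = P"
  by (auto simp: fideal_def mem_iff)

lemma fideal_iff: "z \<in> fideal P i \<longleftrightarrow> z * uniformizer P powi (- i) \<in> P"
  by (cases "z = 0") (auto simp: fideal_def mem_iff ord_mult)

lemma zero_fideal [simp]: "0 \<in> fideal P i"
  by (simp add: fideal_def)

lemma fideal_add: "a \<in> fideal P i \<Longrightarrow> b \<in> fideal P i \<Longrightarrow> a + b \<in> fideal P i"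
  by (auto simp: fideal_iff ring_distribs intro: add_in)

lemma fideal_uminus: "a \<in> fideal P i \<Longrightarrow> - a \<in> fideal P i"
  using uminus_in by (fastforce simp: fideal_iff)

lemma fideal_diff: "a \<in> fideal P i \<Longrightarrow> b \<in> fideal P i \<Longrightarrow> a - b \<in> fideal P i"
  using fideal_add[of a i "- b"] fideal_uminus by simp

lemma fideal_sum: "(\<And>x. x \<in> I \<Longrightarrow> f x \<in> fideal P i) \<Longrightarrow> sum f I \<in> fideal P i"
  by (induction I rule: infinite_finite_induct) (auto intro: fideal_add)

lemma fideal_mult: "a \<in> fideal P i \<Longrightarrow> b \<in> fideal P j \<Longrightarrow> a * b \<in> fideal P (i + j)"
  by (cases "a = 0 \<or> b = 0") (auto simp: fideal_def ord_mult)

lemma fideal_mult_left: "a \<in> P \<Longrightarrow> b \<in> fideal P j \<Longrightarrow> a * b \<in> fideal P j"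
  using fideal_mult[of a 0 b j] by (simp add: fideal_0)

lemma fideal_antimono: "i \<le> j \<Longrightarrow> fideal P j \<subseteq> fideal P i"
  by (auto simp: fideal_def)

lemma ord_add: assumes "a + b \<noteq> 0" "a \<in> fideal P i" "b \<in> fideal P i" shows "ord P (a + b) \<ge> i"
  using fideal_add[OF assms(2,3)] assms(1) by (simp add: fideal_def)

lemma ord_uminus: "ord P (- a) = ord P a"
proof (cases "a = 0")
  case False
  then have "ord P (- a) \<ge> ord P a" "ord P (- (- a)) \<ge> ord P (- a)"
    using fideal_uminus[of a "ord P a"] fideal_uminus[of "- a" "ord P (- a)"]
    by (auto simp: fideal_def)
  then show ?thesis by simp
qed simp

lemma ord_add_dominant:
  assumes "a \<noteq> 0" "b \<in> fideal P (ord P a + 1)"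
  shows "a + b \<noteq> 0" "ord P (a + b) = ord P a"
proof -
  show nz: "a + b \<noteq> 0"
  proof
    assume "a + b = 0"
    then have "a = - b" by (simp add: eq_neg_iff_add_eq_0)
    then show False using assms fideal_uminus[OF assms(2)] by (auto simp: fideal_def)
  qed
  have b: "b \<in> fideal P (ord P a)" using assms(2) fideal_antimono[of "ord P a" "ord P a + 1"] by auto
  have "ord P (a + b) \<ge> ord P a" by (rule ord_add[OF nz _ b]) (simp add: fideal_def)
  moreover have "\<not> ord P (a + b) \<ge> ord P a + 1"
  proof
    assume "ord P (a + b) \<ge> ord P a + 1"
    then have "a + b - b \<in> fideal P (ord P a + 1)"
      using assms(2) by (intro fideal_diff) (auto simp: fideal_def)
    then show False using assms(1) by (simp add: fideal_def)
  qed
  ultimately show "ord P (a + b) = ord P a" by linarith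
qed

lemma ord_prod: "finite I \<Longrightarrow> (\<And>x. x \<in> I \<Longrightarrow> f x \<noteq> 0) \<Longrightarrow> ord P (prod f I) = (\<Sum>x\<in>I. ord P (f x))"
  by (induction I rule: finite_induct) (auto simp: ord_mult)

lemma sum_in: "(\<And>x. x \<in> I \<Longrightarrow> f x \<in> P) \<Longrightarrow> sum f I \<in> P"
  using fideal_sum[of I f 0] by (simp add: fideal_0)

lemma prod_in: "(\<And>x. x \<in> I \<Longrightarrow> f x \<in> P) \<Longrightarrow> prod f I \<in> P"
  by (induction I rule: infinite_finite_induct) (auto intro: mult_in one_in)

lemma diff_in: "a \<in> P \<Longrightarrow> b \<in> P \<Longrightarrow> a - b \<in> P"
  using add_in[of a "- b"] uminus_in by simp

text \<open>A strictly larger ring contains an element of negative order, whose powers clear any denominator.\<close>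

lemma maximal_subring:
  assumes "P \<subseteq> R" and R: "\<And>a b. a \<in> R \<Longrightarrow> b \<in> R \<Longrightarrow> a * b \<in> R" and "R \<noteq> UNIV"
  shows "R = P"
proof (rule ccontr)
  assume "R \<noteq> P"
  then obtain z where z: "z \<in> R" "z \<notin> P" using assms(1) by blast
  have z0: "z \<noteq> 0" "ord P z < 0" using z(2) by (auto simp: mem_iff)
  have pw: "z ^ n \<in> R" for n
    using z one_in assms(1) by (induction n) (auto intro: R)
  have "w \<in> R" for w
  proof (cases "w = 0")
    case True then show ?thesis using zero_in assms(1) by auto
  next
    case False
    define n where "n = nat (- ord P w)"
    have "int n * ord P z \<le> int n * (-1)" using z0 by (intro mult_left_mono) auto
    then have "ord P (w * inverse (z ^ n)) \<ge> 0"
      using False z0 by (auto simp: ord_mult ord_inverse ord_power n_def)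
    then have "w * inverse (z ^ n) \<in> P" by (simp add: mem_iff)
    then have "w * inverse (z ^ n) * z ^ n \<in> R" using pw[of n] assms(1) by (intro R[of "w * inverse (z ^ n)"]) auto
    then show ?thesis using z0 by (simp add: mult.assoc)
  qed
  then show False using assms(3) by auto
qed

end

section \<open>Counting cosets\<close>

definition coset :: "'a::ab_group_add set \<Rightarrow> 'a \<Rightarrow> 'a set" where
  "coset B a = {x. x - a \<in> B}"

definition add_subgroup :: "'a::ab_group_add set \<Rightarrow> bool" where
  "add_subgroup B \<longleftrightarrow> 0 \<in> B \<and> (\<forall>a\<in>B. \<forall>b\<in>B. a - b \<in> B)"

lemma add_subgroupD:
  assumes "add_subgroup B"
  shows "0 \<in> B" "a \<in> B \<Longrightarrow> - a \<in> B" "a \<in> B \<Longrightarrow> b \<in> B \<Longrightarrow> a - b \<in> B" "a \<in> B \<Longrightarrow> b \<in> B \<Longrightarrow> a + b \<in> B"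
proof -
  show z: "0 \<in> B" and d: "a \<in> B \<Longrightarrow> b \<in> B \<Longrightarrow> a - b \<in> B" for a b using assms by (auto simp: add_subgroup_def)
  show m: "a \<in> B \<Longrightarrow> - a \<in> B" for a using d[OF z] by simp
  show "a \<in> B \<Longrightarrow> b \<in> B \<Longrightarrow> a + b \<in> B" using d[of a "- b"] m by simp
qed

lemma coset_eq_iff: assumes "add_subgroup B" shows "coset B a = coset B b \<longleftrightarrow> a - b \<in> B"
proof
  assume "coset B a = coset B b"
  moreover have "a \<in> coset B a" using add_subgroupD(1)[OF assms] by (simp add: coset_def)
  ultimately have "a \<in> coset B b" by simp
  then show "a - b \<in> B" by (simp add: coset_def)
next
  assume ab: "a - b \<in> B"
  have "x - a \<in> B \<longleftrightarrow> x - b \<in> B" for x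
  proof
    assume "x - a \<in> B"
    from add_subgroupD(4)[OF assms this ab] show "x - b \<in> B" by simp
  next
    assume "x - b \<in> B"
    from add_subgroupD(3)[OF assms this ab] show "x - a \<in> B" by (simp add: algebra_simps)
  qed
  then show "coset B a = coset B b" by (simp add: coset_def)
qed

lemma card_coset_tower:
  assumes A: "add_subgroup A" and B: "add_subgroup B" and C: "add_subgroup C" and "C \<subseteq> B" "B \<subseteq> A"
    and fAB: "finite (coset B ` A)" and fBC: "finite (coset C ` B)"
  shows "finite (coset C ` A)" "card (coset C ` A) = card (coset B ` A) * card (coset C ` B)"
proof -
  define rep where "rep I = (SOME a. a \<in> A \<and> coset B a = I)" for I
  have rep: "rep I \<in> A" "coset B (rep I) = I" if "I \<in> coset B ` A" for I
  proof -
    have "\<exists>a. a \<in> A \<and> coset B a = I" using that by auto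
    then have "rep I \<in> A \<and> coset B (rep I) = I" unfolding rep_def by (rule someI_ex)
    then show "rep I \<in> A" "coset B (rep I) = I" by auto
  qed
  define h where "h = (\<lambda>(I, Y). {x. x - rep I \<in> Y})"
  have h: "h (I, coset C b) = coset C (rep I + b)" for I b
    by (auto simp: h_def coset_def algebra_simps)
  have "bij_betw h (coset B ` A \<times> coset C ` B) (coset C ` A)"
  proof (rule bij_betw_imageI)
    show "inj_on h (coset B ` A \<times> coset C ` B)"
    proof (rule inj_onI, clarify)
      fix a b a' b' assume a: "a \<in> A" "b \<in> B" "a' \<in> A" "b' \<in> B"
        and e: "h (coset B a, coset C b) = h (coset B a', coset C b')"
      let ?r = "rep (coset B a)" and ?r' = "rep (coset B a')"
      have 1: "?r + b - (?r' + b') \<in> C" using e unfolding h coset_eq_iff[OF C] .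
      have "?r + b - (?r' + b') - (b - b') \<in> B"
      proof (rule add_subgroupD(3)[OF B])
        show "?r + b - (?r' + b') \<in> B" using 1 \<open>C \<subseteq> B\<close> by blast
        show "b - b' \<in> B" by (rule add_subgroupD(3)[OF B a(2) a(4)])
      qed
      then have "?r - ?r' \<in> B" by (simp add: algebra_simps)
      then have "coset B ?r = coset B ?r'" by (simp add: coset_eq_iff[OF B])
      then have 2: "coset B a = coset B a'" using rep a by simp
      with 1 have "b - b' \<in> C" by simp
      with 2 show "coset B a = coset B a' \<and> coset C b = coset C b'" by (simp add: coset_eq_iff[OF C])
    qed
    show "h ` (coset B ` A \<times> coset C ` B) = coset C ` A"
    proof (intro equalityI subsetI)
      fix Z assume "Z \<in> h ` (coset B ` A \<times> coset C ` B)"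
      then obtain a b where ab: "a \<in> A" "b \<in> B" "Z = h (coset B a, coset C b)" by auto
      have "rep (coset B a) + b \<in> A"
        using rep(1)[of "coset B a"] ab \<open>B \<subseteq> A\<close> by (intro add_subgroupD(4)[OF A]) auto
      then show "Z \<in> coset C ` A" unfolding ab(3) h by (rule imageI)
    next
      fix Z assume "Z \<in> coset C ` A"
      then obtain a where a: "a \<in> A" "Z = coset C a" by auto
      let ?b = "a - rep (coset B a)"
      have "?b \<in> B" using rep[of "coset B a"] a coset_eq_iff[OF B, of a "rep (coset B a)"] by auto
      moreover have "Z = h (coset B a, coset C ?b)" using a by (simp add: h)
      ultimately show "Z \<in> h ` (coset B ` A \<times> coset C ` B)"
        using imageI[OF a(1), of "coset B"] imageI[of ?b B "coset C"]
        by (intro image_eqI[of Z h]) auto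
    qed
  qed
  from bij_betw_finite[OF this] bij_betw_same_card[OF this] fAB fBC
  show "finite (coset C ` A)" "card (coset C ` A) = card (coset B ` A) * card (coset C ` B)"
    by (auto simp: card_cartesian_product)
qed

lemma coset_zero: "coset {0} ` A = (\<lambda>a. {a}) ` A"
  by (auto simp: coset_def)

lemma card_eq_coset_mult:
  assumes A: "add_subgroup A" and B: "add_subgroup B" and "B \<subseteq> A"
    and "finite (coset B ` A)" and "finite B"
  shows "finite A" "card A = card (coset B ` A) * card B"
proof -
  have z: "add_subgroup {0::'a}" by (simp add: add_subgroup_def)
  have i: "inj_on (\<lambda>a. {a}) I" for I :: "'a set" by (rule inj_onI) simp
  have "finite (coset {0} ` B)" using assms by simp
  from card_coset_tower[OF A B z _ assms(3,4) this] add_subgroupD(1)[OF B]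
  have "finite ((\<lambda>a. {a}) ` A)" "card ((\<lambda>a. {a}) ` A) = card (coset B ` A) * card ((\<lambda>a. {a}) ` B)"
    by (auto simp: coset_zero)
  note * = this
  show "finite A" by (rule finite_imageD[OF *(1) i])
  show "card A = card (coset B ` A) * card B"
    using *(2) card_image[OF i, of A] card_image[OF i, of B] by simp
qed


text \<open>The index of nested vector spaces over a finite field is a power of its order: adjoin one
  vector to the smaller space, which multiplies it by a line.\<close>

lemma card_coset_power:
  fixes A B k :: "'a::field set"
  assumes k: "add_subgroup k" "1 \<in> k" "finite k" "\<And>c. c \<in> k \<Longrightarrow> inverse c \<in> k"
      "\<And>c d. c \<in> k \<Longrightarrow> d \<in> k \<Longrightarrow> c * d \<in> k"
    and A: "add_subgroup A" "\<And>c a. c \<in> k \<Longrightarrow> a \<in> A \<Longrightarrow> c * a \<in> A"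
    and B: "add_subgroup B" "\<And>c a. c \<in> k \<Longrightarrow> a \<in> B \<Longrightarrow> c * a \<in> B" and "B \<subseteq> A"
    and "finite (coset B ` A)"
  shows "\<exists>d. card (coset B ` A) = card k ^ d"
  using B \<open>B \<subseteq> A\<close> \<open>finite (coset B ` A)\<close>
proof (induction "card (coset B ` A)" arbitrary: B rule: less_induct)
  case (less B)
  show ?case
  proof (cases "B = A")
    case True
    have "coset B ` A = (\<lambda>_. coset B 0) ` A"
      using True by (intro image_cong refl, subst coset_eq_iff[OF less.prems(1)]) auto
    then have "coset B ` A = {coset B 0}"
      using image_constant[OF add_subgroupD(1)[OF A(1)], of "coset B 0"] by simp
    then have "card (coset B ` A) = card k ^ 0" by simp
    then show ?thesis by blast
  next
    case False
    then obtain v where v: "v \<in> A" "v \<notin> B" using less.prems by blast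
    define B' where "B' = {b + c * v | b c. b \<in> B \<and> c \<in> k}"
    have B'I: "b + c * v \<in> B'" if "b \<in> B" "c \<in> k" for b c using that by (auto simp: B'_def)
    have sB': "add_subgroup B'"
      unfolding add_subgroup_def
    proof (intro conjI ballI)
      show "0 \<in> B'" using B'I[of 0 0] add_subgroupD(1)[OF less.prems(1)] add_subgroupD(1)[OF k(1)] by simp
      fix x y assume "x \<in> B'" "y \<in> B'"
      then obtain b c b' c' where "b \<in> B" "c \<in> k" "b' \<in> B" "c' \<in> k" "x = b + c * v" "y = b' + c' * v"
        by (auto simp: B'_def)
      then show "x - y \<in> B'"
        using B'I[of "b - b'" "c - c'"] add_subgroupD(3)[OF less.prems(1)] add_subgroupD(3)[OF k(1)]
        by (simp add: algebra_simps)
    qed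
    have kB': "c * a \<in> B'" if c: "c \<in> k" and "a \<in> B'" for c a
    proof -
      obtain b d where "b \<in> B" "d \<in> k" "a = b + d * v" using \<open>a \<in> B'\<close> by (auto simp: B'_def)
      then show ?thesis using B'I[of "c * b" "c * d"] c less.prems(2) k(5)
        by (simp add: distrib_left mult.assoc)
    qed
    have BB': "B \<subseteq> B'" using B'I[of _ 0] add_subgroupD(1)[OF k(1)] by auto
    have "B' \<subseteq> A"
    proof
      fix x assume "x \<in> B'"
      then obtain b c where x: "b \<in> B" "c \<in> k" "x = b + c * v" by (auto simp: B'_def)
      have "b \<in> A" "c * v \<in> A" using x v less.prems(3) A(2) by auto
      then show "x \<in> A" unfolding x(3) by (rule add_subgroupD(4)[OF A(1)])
    qed
    have cv: "c = 0" if "c * v \<in> B" "c \<in> k" for c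
    proof (rule ccontr)
      assume "c \<noteq> 0"
      then have "inverse c * (c * v) = v" by (simp add: mult.assoc[symmetric])
      then show False using less.prems(2)[OF k(4)[OF that(2)] that(1)] v(2) by metis
    qed
    have "coset B ` B' = (\<lambda>c. coset B (c * v)) ` k"
    proof (intro equalityI subsetI)
      fix Y assume "Y \<in> coset B ` B'"
      then obtain b c where "b \<in> B" "c \<in> k" "Y = coset B (b + c * v)" by (auto simp: B'_def)
      moreover have "coset B (b + c * v) = coset B (c * v)"
        using \<open>b \<in> B\<close> coset_eq_iff[OF less.prems(1)] by simp
      ultimately show "Y \<in> (\<lambda>c. coset B (c * v)) ` k" by simp
    next
      fix Y assume "Y \<in> (\<lambda>c. coset B (c * v)) ` k"
      then show "Y \<in> coset B ` B'" using B'I[of 0] add_subgroupD(1)[OF less.prems(1)] by auto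
    qed
    moreover have "inj_on (\<lambda>c. coset B (c * v)) k"
    proof (rule inj_onI)
      fix c d assume "c \<in> k" "d \<in> k" "coset B (c * v) = coset B (d * v)"
      then have "(c - d) * v \<in> B" "c - d \<in> k"
        using add_subgroupD(3)[OF k(1)] by (auto simp: coset_eq_iff[OF less.prems(1)] left_diff_distrib)
      then show "c = d" using cv by fastforce
    qed
    ultimately have cB': "card (coset B ` B') = card k" and fB': "finite (coset B ` B')"
      using k(3) by (auto simp: card_image)
    have fA: "finite (coset B' ` A)"
    proof -
      have "coset B' a = coset B' (SOME x. x \<in> A \<and> coset B x = coset B a)" if "a \<in> A" for a
      proof -
        have "coset B (SOME x. x \<in> A \<and> coset B x = coset B a) = coset B a"
          using someI_ex[of "\<lambda>x. x \<in> A \<and> coset B x = coset B a"] that by blast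
        then have "a - (SOME x. x \<in> A \<and> coset B x = coset B a) \<in> B" using coset_eq_iff[OF less.prems(1)] by metis
        then show ?thesis using BB' coset_eq_iff[OF sB'] by blast
      qed
      then have "coset B' ` A \<subseteq> (\<lambda>Y. coset B' (SOME x. x \<in> A \<and> coset B x = Y)) ` (coset B ` A)"
        by (intro image_subsetI, rule image_eqI) auto
      then show ?thesis using finite_surj[OF less.prems(4)] by simp
    qed
    have tower: "card (coset B ` A) = card (coset B' ` A) * card k"
      using card_coset_tower(2)[OF A(1) sB' less.prems(1) BB' \<open>B' \<subseteq> A\<close> fA fB'] cB' by simp
    have k2: "card k \<ge> 2"
    proof -
      have "{0, 1} \<subseteq> k" using add_subgroupD(1)[OF k(1)] k(2) by auto
      from card_mono[OF k(3) this] show ?thesis by simp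
    qed
    have "card (coset B' ` A) > 0" using fA add_subgroupD(1)[OF A(1)] by (auto simp: card_gt_0_iff)
    then have "card (coset B' ` A) < card (coset B ` A)" unfolding tower using k2 by simp
    from less.hyps[OF this sB' kB' \<open>B' \<subseteq> A\<close> fA]
    obtain d where "card (coset B' ` A) = card k ^ d" by blast
    then have "card (coset B ` A) = card k ^ (Suc d)" using tower by simp
    then show ?thesis by blast
  qed
qed

lemma card_image_eq_rel:
  assumes "\<And>a b. a \<in> A \<Longrightarrow> b \<in> A \<Longrightarrow> f a = f b \<longleftrightarrow> g a = g b"
  shows "card (f ` A) = card (g ` A)" "finite (f ` A) \<longleftrightarrow> finite (g ` A)"
proof -
  let ?h = "\<lambda>y. g (inv_into A f y)"
  have h: "?h (f a) = g a" if "a \<in> A" for a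
    using assms[of "inv_into A f (f a)" a] that inv_into_into[of "f a" f A] f_inv_into_f[of "f a" f A] by auto
  have "bij_betw ?h (f ` A) (g ` A)"
  proof (rule bij_betw_imageI)
    show "inj_on ?h (f ` A)" using h assms by (auto simp: inj_on_def)
    show "?h ` f ` A = g ` A" using h by (auto simp: image_image)
  qed
  from bij_betw_same_card[OF this] bij_betw_finite[OF this]
  show "card (f ` A) = card (g ` A)" "finite (f ` A) \<longleftrightarrow> finite (g ` A)" by auto
qed

lemma (in dvr) fideal_subgroup: "add_subgroup (fideal P i)"
  by (auto simp: add_subgroup_def intro: fideal_diff)

lemma (in dvr) fideal_self: "a \<in> fideal P (ord P a)"
  by (simp add: fideal_def)

section \<open>Places of a function field with finite constant field\<close>

text \<open>The closed points of a complete regular curve over the finite field \<open>k\<close>, as the set \<open>S\<close> of their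
  local rings.  Completeness of the curve enters through the finiteness of the ring of global functions.\<close>

locale places =
  fixes k :: "'a::field set" and S :: "'a set set"
  assumes finite_k: "finite k"
    and k_subgroup: "add_subgroup k"
    and one_k: "1 \<in> k"
    and inverse_k: "c \<in> k \<Longrightarrow> inverse c \<in> k"
    and mult_k: "c \<in> k \<Longrightarrow> d \<in> k \<Longrightarrow> c * d \<in> k"
    and dvr_S: "P \<in> S \<Longrightarrow> dvr P"
    and k_subset: "P \<in> S \<Longrightarrow> k \<subseteq> P"
    and finite_residue: "P \<in> S \<Longrightarrow> finite (coset (fideal P 1) ` P)"
    and finite_poles: "finite {P \<in> S. f \<notin> P}"
    and finite_constants: "finite (\<Inter> S)"
    and infinite_field: "infinite (UNIV :: 'a set)"
    and incomparable: "P \<in> S \<Longrightarrow> Q \<in> S \<Longrightarrow> P \<subseteq> Q \<Longrightarrow> P = Q"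
begin

text \<open>The degree of a point is the dimension over \<open>k\<close> of its residue field, read off from the number of
  elements of the latter; it exists by \<open>card_coset_power\<close>.\<close>

definition "deg_pt P = (SOME d. card (coset (fideal P 1) ` P) = card k ^ d)"

lemma card_k: "card k \<ge> 2"
proof -
  have "{0, 1} \<subseteq> k" using add_subgroupD(1)[OF k_subgroup] one_k by auto
  from card_mono[OF finite_k this] show ?thesis by simp
qed

lemma card_residue: assumes "P \<in> S" shows "card (coset (fideal P 1) ` P) = card k ^ deg_pt P"
proof -
  interpret dvr P using dvr_S assms by auto
  have "\<exists>d. card (coset (fideal P 1) ` P) = card k ^ d"
  proof (rule card_coset_power[OF k_subgroup one_k finite_k inverse_k mult_k])
    show "add_subgroup P" using fideal_subgroup[of 0] by (simp add: fideal_0)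
    show "add_subgroup (fideal P 1)" by (rule fideal_subgroup)
    show "fideal P 1 \<subseteq> P" using fideal_antimono[of 0 1] by (simp add: fideal_0)
    show "finite (coset (fideal P 1) ` P)" using finite_residue assms by auto
    show "c * a \<in> P" if "c \<in> k" "a \<in> P" for c a using that k_subset assms mult_in by auto
    show "c * a \<in> fideal P 1" if "c \<in> k" "a \<in> fideal P 1" for c a
      using that k_subset assms fideal_mult_left by blast
  qed auto
  then show ?thesis unfolding deg_pt_def by (rule someI_ex)
qed

lemma deg_pt_pos: assumes "P \<in> S" shows "deg_pt P > 0"
proof (rule ccontr)
  interpret dvr P using dvr_S assms by auto
  assume "\<not> deg_pt P > 0"
  then have "card (coset (fideal P 1) ` P) = 1" using card_residue[OF assms] by simp
  then have "coset (fideal P 1) 0 = coset (fideal P 1) 1"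
    using zero_in one_in by (metis card_1_singletonE imageI singletonD)
  then have "0 - 1 \<in> fideal P 1" by (simp only: coset_eq_iff[OF fideal_subgroup])
  then show False by (simp add: fideal_def ord_uminus)
qed

text \<open>Multiplication by a power of a uniformizer identifies the quotient with the residue field.\<close>

lemma card_coset_graded:
  assumes "P \<in> S"
  shows "finite (coset (fideal P (i + 1)) ` fideal P i)"
    "card (coset (fideal P (i + 1)) ` fideal P i) = card k ^ deg_pt P"
proof -
  interpret dvr P using dvr_S assms by auto
  let ?t = "uniformizer P powi i"
  have t: "?t \<noteq> 0" by simp
  have im: "fideal P i = (*) ?t ` P"
  proof (intro equalityI subsetI)
    fix z assume "z \<in> fideal P i"
    then have "z / ?t \<in> P" by (simp add: fideal_iff power_int_minus divide_inverse)
    then show "z \<in> (*) ?t ` P" by (intro image_eqI[of _ _ "z / ?t"]) auto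
  next
    fix z assume "z \<in> (*) ?t ` P"
    then obtain x where "x \<in> P" "z = ?t * x" by blast
    moreover have "?t \<in> fideal P i" by (simp add: fideal_def)
    ultimately show "z \<in> fideal P i" using fideal_mult_left[of x ?t i] by (simp add: mult.commute)
  qed
  have "?t * a - ?t * b \<in> fideal P (i + 1) \<longleftrightarrow> a - b \<in> fideal P 1" for a b
    by (cases "a = b") (simp_all add: fideal_def ord_mult right_diff_distrib[symmetric])
  then have r: "coset (fideal P (i + 1)) (?t * a) = coset (fideal P (i + 1)) (?t * b) \<longleftrightarrow>
      coset (fideal P 1) a = coset (fideal P 1) b" for a b
    by (simp only: coset_eq_iff[OF fideal_subgroup])
  have e: "coset (fideal P (i + 1)) ` fideal P i = (\<lambda>a. coset (fideal P (i + 1)) (?t * a)) ` P"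
    by (simp only: im image_image)
  show "finite (coset (fideal P (i + 1)) ` fideal P i)"
    "card (coset (fideal P (i + 1)) ` fideal P i) = card k ^ deg_pt P"
    unfolding e using card_image_eq_rel[where A = P, OF r] finite_residue[OF assms] card_residue[OF assms] by simp_all
qed

lemma card_coset_fideal:
  assumes "P \<in> S"
  shows "finite (coset (fideal P (i + int m)) ` fideal P i) \<and>
    card (coset (fideal P (i + int m)) ` fideal P i) = card k ^ (m * deg_pt P)"
proof (induction m)
  interpret dvr P using dvr_S assms by auto
  case 0
  have "coset (fideal P i) ` fideal P i = (\<lambda>_. coset (fideal P i) 0) ` fideal P i"
    by (intro image_cong refl, subst coset_eq_iff[OF fideal_subgroup]) auto
  then have "coset (fideal P i) ` fideal P i = {coset (fideal P i) 0}"
    using image_constant[OF zero_fideal, of "coset (fideal P i) 0" i] by simp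
  then show ?case by simp
next
  interpret dvr P using dvr_S assms by auto
  case (Suc m)
  have 1: "i + int (Suc m) = i + int m + 1" by simp
  note t = card_coset_tower[OF fideal_subgroup fideal_subgroup fideal_subgroup fideal_antimono fideal_antimono
      conjunct1[OF Suc] card_coset_graded(1)[OF assms]]
  show ?case unfolding 1
  proof
    show "finite (coset (fideal P (i + int m + 1)) ` fideal P i)" by (rule t(1)) auto
    have "card (coset (fideal P (i + int m + 1)) ` fideal P i) = card k ^ (m * deg_pt P) * card k ^ deg_pt P"
      using t(2) Suc card_coset_graded(2)[OF assms] by simp
    then show "card (coset (fideal P (i + int m + 1)) ` fideal P i) = card k ^ (Suc m * deg_pt P)"
      by (simp add: power_add mult.commute)
  qed
qed

subsection \<open>Weak approximation\<close>

text \<open>Neither ring contains the other one: divide an element of \<open>P - Q\<close> by an element of \<open>Q - P\<close>.\<close>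

lemma separate_two:
  assumes "P \<in> S" "Q \<in> S" "P \<noteq> Q" shows "\<exists>y. y \<noteq> 0 \<and> ord P y > 0 \<and> ord Q y < 0"
proof -
  interpret P: dvr P using dvr_S assms by auto
  interpret Q: dvr Q using dvr_S assms by auto
  obtain y where y: "y \<in> P" "y \<notin> Q" using incomparable[of P Q] assms by auto
  obtain w where w: "w \<in> Q" "w \<notin> P" using incomparable[of Q P] assms by auto
  have "y \<noteq> 0" "w \<noteq> 0" using y w P.zero_in Q.zero_in by auto
  then have "ord P (y / w) > 0" "ord Q (y / w) < 0" "y / w \<noteq> 0"
    using y w by (auto simp: P.mem_iff Q.mem_iff P.ord_divide Q.ord_divide)
  then show ?thesis by blast
qed

lemma abs_le_sum: "finite F \<Longrightarrow> Q \<in> F \<Longrightarrow> \<bar>f Q :: int\<bar> \<le> (\<Sum>Q\<in>F. \<bar>f Q\<bar>)"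
  by (rule member_le_sum) auto

text \<open>Induction on \<open>F\<close>.  Let \<open>z\<close> separate \<open>P\<close> from \<open>F\<close>, and let \<open>y\<close> separate \<open>P\<close> from one more point \<open>R\<close>.  According
  as \<open>z\<close> has a pole, a nonzero value or a zero at \<open>R\<close>, the next element is \<open>z\<close>, \<open>z ^ r * y\<close> or
  \<open>y * (1 + z ^ r)\<close> for large \<open>r\<close>.\<close>

lemma separate_many:
  assumes "finite F" "F \<subseteq> S" "P \<in> S" "P \<notin> F"
  shows "\<exists>z. z \<noteq> 0 \<and> ord P z > 0 \<and> (\<forall>Q\<in>F. ord Q z < 0)"
  using assms
proof (induction F rule: finite_induct)
  case empty
  interpret dvr P using dvr_S assms by auto
  show ?case by (intro exI[of _ "uniformizer P"]) simp
next
  case (insert R F)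
  interpret P: dvr P using dvr_S assms by auto
  interpret R: dvr R using dvr_S insert by auto
  obtain z where z: "z \<noteq> 0" "ord P z > 0" "\<And>Q. Q \<in> F \<Longrightarrow> ord Q z < 0" using insert by auto
  obtain y where y: "y \<noteq> 0" "ord P y > 0" "ord R y < 0"
    using separate_two[of P R] insert by auto
  define r where "r = nat (\<Sum>Q\<in>F. \<bar>ord Q y\<bar>) + 1"
  have r: "int r * ord Q z + ord Q y < 0" "int r * ord Q z < 0" if "Q \<in> F" for Q
  proof -
    have 1: "int r \<ge> \<bar>ord Q y\<bar> + 1"
      using abs_le_sum[OF insert(1) that, of "\<lambda>Q. ord Q y"] by (simp add: r_def)
    have "int r * ord Q z \<le> int r * (-1)" using z(3)[OF that] by (intro mult_left_mono) auto
    then show "int r * ord Q z + ord Q y < 0" "int r * ord Q z < 0" using 1 by auto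
  qed
  have zr: "z ^ r \<noteq> 0" using z by simp
  consider "ord R z < 0" | "ord R z = 0" | "ord R z > 0" by linarith
  then show ?case
  proof cases
    case 1
    then show ?thesis using z by auto
  next
    case 2
    have "ord P (z ^ r * y) > 0" using y z by (simp add: P.ord_mult P.ord_power add_nonneg_pos)
    moreover have "ord R (z ^ r * y) < 0" using y z 2 by (simp add: R.ord_mult R.ord_power)
    moreover have "ord Q (z ^ r * y) < 0" if "Q \<in> F" for Q
    proof -
      interpret Q: dvr Q using dvr_S insert that by auto
      show ?thesis using r[OF that] y z by (simp add: Q.ord_mult Q.ord_power)
    qed
    ultimately show ?thesis using y zr by (intro exI[of _ "z ^ r * y"]) auto
  next
    case 3
    have r0: "int r * j > 0" if "j > 0" for j using that by (intro mult_pos_pos) (auto simp: r_def intro!: add_pos_nonneg sum_nonneg)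
    have "z ^ r \<in> fideal P (ord P 1 + 1)" using z r0[of "ord P z"] by (auto simp: fideal_def P.ord_power)
    from P.ord_add_dominant[OF _ this]
    have nz: "1 + z ^ r \<noteq> 0" and oP: "ord P (1 + z ^ r) = 0" by auto
    have "z ^ r \<in> fideal R (ord R 1 + 1)" using z 3 r0[of "ord R z"] by (auto simp: fideal_def R.ord_power)
    from R.ord_add_dominant[OF _ this]
    have oR: "ord R (1 + z ^ r) = 0" by auto
    have "ord Q (y * (1 + z ^ r)) < 0" if "Q \<in> F" for Q
    proof -
      interpret Q: dvr Q using dvr_S insert that by auto
      have "ord Q (z ^ r + 1) = ord Q (z ^ r)"
        by (rule Q.ord_add_dominant) (use z r[OF that] in \<open>auto simp: fideal_def Q.ord_power\<close>)
      then show ?thesis using r[OF that] y z nz by (simp add: Q.ord_mult Q.ord_power add.commute)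
    qed
    then show ?thesis using y nz oP oR
      by (intro exI[of _ "y * (1 + z ^ r)"]) (auto simp: P.ord_mult R.ord_mult)
  qed
qed

text \<open>If \<open>z\<close> vanishes at \<open>P\<close> and has poles on \<open>F\<close>, then \<open>1 / (1 + z ^ N)\<close> is close to 1 at \<open>P\<close> and close to 0
  at the points of \<open>F\<close> for large \<open>N\<close>.\<close>

lemma approximate_indicator:
  assumes "finite F" "F \<subseteq> S" "P \<in> S" "P \<notin> F"
  shows "\<exists>z. z - 1 \<in> fideal P m \<and> (\<forall>Q\<in>F. z \<in> fideal Q m)"
proof -
  obtain z where z: "z \<noteq> 0" "ord P z > 0" "\<And>Q. Q \<in> F \<Longrightarrow> ord Q z < 0"
    using separate_many[OF assms] by auto
  interpret P: dvr P using dvr_S assms by auto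
  define r where "r = nat m + 1"
  have r: "int r \<ge> m" "r > 0" by (auto simp: r_def)
  have "int r * ord P z > 0" using z r by simp
  then have "z ^ r \<in> fideal P (ord P 1 + 1)" using z by (auto simp: fideal_def P.ord_power)
  from P.ord_add_dominant[OF _ this]
  have nz: "1 + z ^ r \<noteq> 0" and oP: "ord P (1 + z ^ r) = 0" by auto
  have "1 / (1 + z ^ r) - 1 = - (z ^ r / (1 + z ^ r))" using nz by (simp add: field_simps)
  moreover have "ord P (z ^ r / (1 + z ^ r)) \<ge> m"
  proof -
    have "int r * 1 \<le> int r * ord P z" using z by (intro mult_left_mono) auto
    then have "m \<le> int r * ord P z" using r(1) by linarith
    then show ?thesis using z nz oP r by (simp add: P.ord_divide P.ord_power)
  qed
  ultimately have "1 / (1 + z ^ r) - 1 \<in> fideal P m" by (simp add: fideal_def P.ord_uminus)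
  moreover have "1 / (1 + z ^ r) \<in> fideal Q m" if "Q \<in> F" for Q
  proof -
    interpret Q: dvr Q using dvr_S assms that by auto
    have "int r * ord Q z \<le> int r * (-1)" using z(3)[OF that] by (intro mult_left_mono) auto
    then have 1: "int r * ord Q z \<le> - m" "int r * ord Q z < 0" using r by linarith+
    have "ord Q (z ^ r + 1) = ord Q (z ^ r)"
      by (rule Q.ord_add_dominant) (use z 1 in \<open>auto simp: fideal_def Q.ord_power\<close>)
    then show ?thesis using 1 nz z by (simp add: fideal_def Q.ord_divide Q.ord_power add.commute)
  qed
  ultimately show ?thesis by blast
qed

theorem weak_approximation:
  assumes "finite F" "F \<subseteq> S"
  shows "\<exists>r. \<forall>P\<in>F. r - a P \<in> fideal P m"
proof -
  define M where "M = m + (\<Sum>(P, Q)\<in>F \<times> F. \<bar>ord Q (a P)\<bar>)"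
  have M: "m \<le> ord Q (a P) + M" if "P \<in> F" "Q \<in> F" for P Q
    using abs_le_sum[of "F \<times> F" "(P, Q)" "\<lambda>(P, Q). ord Q (a P)"] that assms
    by (auto simp: M_def case_prod_beta)
  have "\<exists>z. z - 1 \<in> fideal P M \<and> (\<forall>Q\<in>F - {P}. z \<in> fideal Q M)" if "P \<in> F" for P
    using approximate_indicator[of "F - {P}" P M] assms that by auto
  then obtain z where z: "\<And>P. P \<in> F \<Longrightarrow> z P - 1 \<in> fideal P M"
    "\<And>P Q. P \<in> F \<Longrightarrow> Q \<in> F \<Longrightarrow> P \<noteq> Q \<Longrightarrow> z P \<in> fideal Q M" by (metis DiffI singletonD)
  have "(\<Sum>P\<in>F. a P * z P) - a Q \<in> fideal Q m" if Q: "Q \<in> F" for Q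
  proof -
    interpret Q: dvr Q using dvr_S assms that by auto
    have e: "(\<Sum>P\<in>F. a P * z P) - a Q = a Q * (z Q - 1) + (\<Sum>P\<in>F - {Q}. a P * z P)"
      using sum.remove[OF assms(1) Q, of "\<lambda>P. a P * z P"] by (simp add: algebra_simps)
    have *: "a P * w \<in> fideal Q m" if "P \<in> F" "w \<in> fideal Q M" for P w
      using Q.fideal_mult[OF Q.fideal_self[of "a P"] that(2)] Q.fideal_antimono[OF M[OF that(1) Q]] by blast
    show ?thesis unfolding e
    proof (intro Q.fideal_add Q.fideal_sum *)
      show "Q \<in> F" "z Q - 1 \<in> fideal Q M" using Q z(1) by auto
      fix P assume "P \<in> F - {Q}"
      then show "P \<in> F" "z P \<in> fideal Q M" using z(2)[of P Q] Q by auto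
    qed
  qed
  then show ?thesis by blast
qed

end

context places
begin

subsection \<open>Divisors\<close>

definition "Div = {D :: 'a set \<Rightarrow> int. finite {P. D P \<noteq> 0} \<and> {P. D P \<noteq> 0} \<subseteq> S}"

definition deg :: "('a set \<Rightarrow> int) \<Rightarrow> int" where
  "deg D = (\<Sum>P | D P \<noteq> 0. D P * int (deg_pt P))"

text \<open>The divisor of zeros and poles of \<open>f\<close>.\<close>

definition prin :: "'a \<Rightarrow> 'a set \<Rightarrow> int" where
  "prin f = (\<lambda>P. if P \<in> S then ord P f else 0)"

text \<open>The global sections of \<open>O(D)\<close>.\<close>

definition sections :: "('a set \<Rightarrow> int) \<Rightarrow> 'a set" where
  "sections D = {f. \<forall>P\<in>S. f \<in> fideal P (- D P)}"

lemma DivI: "finite F \<Longrightarrow> F \<subseteq> S \<Longrightarrow> (\<And>P. P \<notin> F \<Longrightarrow> D P = 0) \<Longrightarrow> D \<in> Div"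
  unfolding Div_def using finite_subset[of "{P. D P \<noteq> 0}" F] by blast

lemma Div_finite: "D \<in> Div \<Longrightarrow> finite {P. D P \<noteq> 0}" by (simp add: Div_def)
lemma Div_outside: "D \<in> Div \<Longrightarrow> P \<notin> S \<Longrightarrow> D P = 0" by (auto simp: Div_def)

lemma Div_comb:
  assumes "D \<in> Div" "E \<in> Div" "f 0 0 = 0"
  shows "(\<lambda>P. f (D P) (E P)) \<in> Div"
proof (rule DivI)
  show "finite ({P. D P \<noteq> 0} \<union> {P. E P \<noteq> 0})" "{P. D P \<noteq> 0} \<union> {P. E P \<noteq> 0} \<subseteq> S"
    using assms by (auto simp: Div_def)
qed (use assms in auto)

lemma Div_add: "D \<in> Div \<Longrightarrow> E \<in> Div \<Longrightarrow> (\<lambda>P. D P + E P) \<in> Div"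
  by (rule Div_comb) auto
lemma Div_diff: "D \<in> Div \<Longrightarrow> E \<in> Div \<Longrightarrow> (\<lambda>P. D P - E P) \<in> Div"
  by (rule Div_comb) auto
lemma Div_map: "D \<in> Div \<Longrightarrow> f 0 = 0 \<Longrightarrow> (\<lambda>P. f (D P)) \<in> Div"
  using Div_comb[of D D "\<lambda>a b. f a"] by simp
lemma Div_scale: "D \<in> Div \<Longrightarrow> (\<lambda>P. c * D P) \<in> Div"
  by (rule Div_map) auto
lemma Div_zero: "(\<lambda>P. 0) \<in> Div"
  by (rule DivI[of "{}"]) auto

lemma deg_on: "finite F \<Longrightarrow> (\<And>P. P \<notin> F \<Longrightarrow> D P = 0) \<Longrightarrow> deg D = (\<Sum>P\<in>F. D P * int (deg_pt P))"
  unfolding deg_def by (rule sum.mono_neutral_left) auto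

lemma deg_add: assumes "D \<in> Div" "E \<in> Div" shows "deg (\<lambda>P. D P + E P) = deg D + deg E"
proof -
  let ?F = "{P. D P \<noteq> 0} \<union> {P. E P \<noteq> 0}"
  have "finite ?F" using assms by (auto simp: Div_def)
  then show ?thesis
    by (subst (1 2 3) deg_on[of ?F]) (auto simp: sum.distrib ring_distribs)
qed

lemma deg_scale: assumes "D \<in> Div" shows "deg (\<lambda>P. c * D P) = c * deg D"
  using assms by (subst (1 2) deg_on[of "{P. D P \<noteq> 0}"]) (auto simp: Div_def sum_distrib_left mult.assoc)

lemma deg_diff: assumes "D \<in> Div" "E \<in> Div" shows "deg (\<lambda>P. D P - E P) = deg D - deg E"
  using deg_add[OF assms(1) Div_scale[OF assms(2), of "-1"]] deg_scale[OF assms(2), of "-1"] by simp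

lemma deg_zero [simp]: "deg (\<lambda>P. 0) = 0"
  by (simp add: deg_def)

lemma deg_mono: assumes "D \<in> Div" "E \<in> Div" "\<And>P. D P \<le> E P" shows "deg D \<le> deg E"
proof -
  let ?F = "{P. D P \<noteq> 0} \<union> {P. E P \<noteq> 0}"
  have "finite ?F" using assms by (auto simp: Div_def)
  then show ?thesis using assms(3)
    by (subst (1 2) deg_on[of ?F]) (auto intro!: sum_mono mult_right_mono)
qed

lemma deg_nonneg: "D \<in> Div \<Longrightarrow> (\<And>P. 0 \<le> D P) \<Longrightarrow> 0 \<le> deg D"
  using deg_mono[OF Div_zero] by fastforce

lemma effective_deg_0:
  assumes "D \<in> Div" "\<And>P. 0 \<le> D P" "deg D \<le> 0" shows "D P = 0"
proof (rule ccontr)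
  assume a: "D P \<noteq> 0"
  then have "P \<in> S" using assms(1) Div_outside by blast
  have "0 < D P * int (deg_pt P)"
    using a assms(2)[of P] deg_pt_pos[OF \<open>P \<in> S\<close>] by (intro mult_pos_pos) auto
  also have "\<dots> \<le> deg D"
    unfolding deg_def using a assms(1,2) by (intro member_le_sum) (auto simp: Div_def)
  finally show False using assms(3) by simp
qed

lemma Div_upd: "D \<in> Div \<Longrightarrow> P \<in> S \<Longrightarrow> D(P := j) \<in> Div"
  by (rule DivI[of "insert P {P. D P \<noteq> 0}"]) (auto simp: Div_def)

lemma deg_upd:
  assumes "D \<in> Div" "P \<in> S" shows "deg (D(P := D P + j)) = deg D + j * int (deg_pt P)"
proof -
  have "(\<lambda>Q. 0)(P := j) \<in> Div" by (rule Div_upd[OF Div_zero assms(2)])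
  moreover have "D(P := D P + j) = (\<lambda>Q. D Q + ((\<lambda>Q. 0)(P := j)) Q)" by auto
  moreover have "deg ((\<lambda>Q. 0)(P := j)) = j * int (deg_pt P)"
    by (subst deg_on[of "{P}"]) auto
  ultimately show ?thesis using deg_add[OF assms(1)] by metis
qed

lemma prin_mult: "f \<noteq> 0 \<Longrightarrow> g \<noteq> 0 \<Longrightarrow> prin (f * g) = (\<lambda>P. prin f P + prin g P)"
  using dvr.ord_mult[OF dvr_S] by (auto simp: prin_def)

lemma prin_inverse: "f \<noteq> 0 \<Longrightarrow> prin (inverse f) = (\<lambda>P. - prin f P)"
  using dvr.ord_inverse[OF dvr_S] by (auto simp: prin_def)

lemma prin_1: "prin 1 = (\<lambda>P. 0)"
  using dvr.ord_1[OF dvr_S] by (auto simp: prin_def)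

lemma prin_Div: assumes "f \<noteq> 0" shows "prin f \<in> Div"
proof (rule DivI[of "{P \<in> S. f \<notin> P} \<union> {P \<in> S. inverse f \<notin> P}"])
  fix P assume P: "P \<notin> {P \<in> S. f \<notin> P} \<union> {P \<in> S. inverse f \<notin> P}"
  show "prin f P = 0"
  proof (cases "P \<in> S")
    case True
    interpret dvr P using dvr_S True by auto
    show ?thesis using P True assms by (auto simp: prin_def mem_iff ord_inverse)
  qed (simp add: prin_def)
qed (use finite_poles in auto)

subsection \<open>Spaces of sections\<close>

lemma sections_subgroup: "add_subgroup (sections D)"
  using dvr.fideal_diff[OF dvr_S] dvr.zero_fideal[OF dvr_S]
  by (auto simp: add_subgroup_def sections_def)

lemma zero_in_sections: "0 \<in> sections D"
  using add_subgroupD(1)[OF sections_subgroup] .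

lemma sections_mono: "(\<And>P. P \<in> S \<Longrightarrow> D P \<le> E P) \<Longrightarrow> sections D \<subseteq> sections E"
proof
  fix f assume le: "\<And>P. P \<in> S \<Longrightarrow> D P \<le> E P" and f: "f \<in> sections D"
  have "f \<in> fideal P (- E P)" if P: "P \<in> S" for P
    using dvr.fideal_antimono[OF dvr_S[OF P], of "- E P" "- D P"] le[OF P] f P by (auto simp: sections_def)
  then show "f \<in> sections E" by (simp add: sections_def)
qed

lemma sections_zero: "sections (\<lambda>P. 0) = \<Inter> S"
proof -
  have "f \<in> fideal P (- 0) \<longleftrightarrow> f \<in> P" if "P \<in> S" for f P using dvr.fideal_0[OF dvr_S[OF that]] by simp
  then show ?thesis unfolding sections_def by blast
qed

lemma sections_iff: "f \<noteq> 0 \<Longrightarrow> f \<in> sections D \<longleftrightarrow> (\<forall>P\<in>S. 0 \<le> D P + prin f P)"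
  by (auto simp: sections_def fideal_def prin_def)

lemma sections_scale:
  assumes "f \<noteq> 0" shows "bij_betw ((*) f) (sections D) (sections (\<lambda>P. D P - prin f P))"
proof (rule bij_betw_imageI)
  show "inj_on ((*) f) (sections D)" using assms by (auto simp: inj_on_def)
  have 1: "g * h \<in> sections (\<lambda>P. E P - prin g P)" if "g \<noteq> 0" "h \<in> sections E" for g h E
  proof (cases "h = 0")
    case True
    then show ?thesis using zero_in_sections by simp
  next
    case False
    then show ?thesis using that by (simp add: sections_iff prin_mult)
  qed
  have "h \<in> (*) f ` sections D" if "h \<in> sections (\<lambda>P. D P - prin f P)" for h
    using 1[OF _ that, of "inverse f"] assms by (intro image_eqI[of _ _ "inverse f * h"]) (auto simp: prin_inverse)
  then show "(*) f ` sections D = sections (\<lambda>P. D P - prin f P)"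
    using 1[OF assms] by blast
qed

lemma card_sections_scale: "f \<noteq> 0 \<Longrightarrow> card (sections (\<lambda>P. D P - prin f P)) = card (sections D)"
  using bij_betw_same_card[OF sections_scale] by metis

text \<open>\<open>approximable D\<close> says that \<open>H\<^sup>1\<close> of the line bundle of \<open>D\<close> vanishes: the
  obstruction to solving all approximation problems modulo \<open>O(D)\<close> by one function.\<close>

definition approximable :: "('a set \<Rightarrow> int) \<Rightarrow> bool" where
  "approximable D \<longleftrightarrow> (\<forall>a. finite {P \<in> S. a P \<noteq> 0} \<longrightarrow> (\<exists>f. \<forall>P\<in>S. f - a P \<in> fideal P (- D P)))"

lemma approximable_mono:
  assumes "approximable D" "\<And>P. D P \<le> E P" shows "approximable E"
  unfolding approximable_def
proof (intro allI impI)
  fix a :: "'a set \<Rightarrow> 'a" assume "finite {P \<in> S. a P \<noteq> 0}"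
  from assms(1)[unfolded approximable_def, rule_format, OF this]
  obtain f where f: "\<And>P. P \<in> S \<Longrightarrow> f - a P \<in> fideal P (- D P)" by blast
  have "f - a P \<in> fideal P (- E P)" if "P \<in> S" for P
    using dvr.fideal_antimono[OF dvr_S[OF that], of "- E P" "- D P"] f[OF that] assms(2)[of P] by auto
  then show "\<exists>f. \<forall>P\<in>S. f - a P \<in> fideal P (- E P)" by blast
qed

text \<open>The quotient \<open>L(D + P) / L(D)\<close> embeds into the one-dimensional quotient of fractional ideals at
  \<open>P\<close>, and the cokernel embeds into \<open>H\<^sup>1(O(D))\<close>.\<close>

lemma card_sections_step:
  assumes P: "P \<in> S" and fin: "finite (sections D)"
  defines "E \<equiv> D(P := D P + 1)"
  shows "finite (sections E)" "card (sections E) \<le> card (sections D) * card k ^ deg_pt P"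
    "approximable D \<Longrightarrow> card (sections E) = card (sections D) * card k ^ deg_pt P"
proof -
  interpret P: dvr P using dvr_S P by auto
  have sub: "sections D \<subseteq> sections E" by (rule sections_mono) (simp add: E_def)
  have EP: "sections E \<subseteq> fideal P (- D P - 1)" using P by (auto simp: sections_def E_def)
  have "f - g \<in> sections D \<longleftrightarrow> f - g \<in> fideal P (- D P)" if "f \<in> sections E" "g \<in> sections E" for f g
  proof -
    have "f - g \<in> sections E" using that add_subgroupD(3)[OF sections_subgroup] by auto
    then show ?thesis using P by (auto simp: sections_def E_def split: if_splits)
  qed
  then have rel: "coset (sections D) f = coset (sections D) g \<longleftrightarrow>
      coset (fideal P (- D P)) f = coset (fideal P (- D P)) g" if "f \<in> sections E" "g \<in> sections E" for f g
    using that by (simp only: coset_eq_iff[OF sections_subgroup] coset_eq_iff[OF P.fideal_subgroup])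
  note c = card_image_eq_rel[where A = "sections E", OF rel]
  let ?G = "coset (fideal P (- D P)) ` fideal P (- D P - 1)"
  have G: "finite ?G" "card ?G = card k ^ deg_pt P"
    using card_coset_graded[OF P, of "- D P - 1"] by simp_all
  have im: "coset (fideal P (- D P)) ` sections E \<subseteq> ?G" by (rule image_mono[OF EP])
  then have f: "finite (coset (sections D) ` sections E)" using c(2) finite_subset[OF _ G(1)] by auto
  note t = card_eq_coset_mult[OF sections_subgroup sections_subgroup sub f fin]
  show "finite (sections E)" by (rule t(1))
  have le: "card (coset (sections D) ` sections E) \<le> card k ^ deg_pt P"
    using card_mono[OF G(1) im] c(1) G(2) by simp
  show "card (sections E) \<le> card (sections D) * card k ^ deg_pt P"
    using t(2) mult_le_mono1[OF le, of "card (sections D)"] by (simp add: mult.commute)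
  assume appr: "approximable D"
  have "?G \<subseteq> coset (fideal P (- D P)) ` sections E"
  proof
    fix Y assume "Y \<in> ?G"
    then obtain a where a: "a \<in> fideal P (- D P - 1)" "Y = coset (fideal P (- D P)) a" by auto
    define b where "b Q = (if Q = P then a else 0)" for Q
    have "{Q \<in> S. b Q \<noteq> 0} \<subseteq> {P}" by (auto simp: b_def)
    then have "finite {Q \<in> S. b Q \<noteq> 0}" using finite_subset by blast
    from appr[unfolded approximable_def, rule_format, OF this]
    obtain f where f: "\<And>Q. Q \<in> S \<Longrightarrow> f - b Q \<in> fideal Q (- D Q)" by blast
    have fP: "f - a \<in> fideal P (- D P)" using f[OF P] by (simp add: b_def)
    have "f \<in> sections E"
      unfolding sections_def
    proof (intro CollectI ballI)
      fix Q assume Q: "Q \<in> S"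
      show "f \<in> fideal Q (- E Q)"
      proof (cases "Q = P")
        case True
        have "f - a \<in> fideal P (- D P - 1)" using fP P.fideal_antimono[of "- D P - 1" "- D P"] by auto
        from P.fideal_add[OF this a(1)] show ?thesis using True by (simp add: E_def)
      next
        case False
        then show ?thesis using f[OF Q] by (simp add: E_def b_def)
      qed
    qed
    moreover have "Y = coset (fideal P (- D P)) f"
      unfolding a(2) by (rule sym, subst coset_eq_iff[OF P.fideal_subgroup], rule fP)
    ultimately show "Y \<in> coset (fideal P (- D P)) ` sections E" by blast
  qed
  with im have "coset (fideal P (- D P)) ` sections E = ?G" by (rule equalityI)
  then show "card (sections E) = card (sections D) * card k ^ deg_pt P"
    using t(2) c(1) G(2) by simp
qed

text \<open>With equality, this is the Riemann-Roch formula for divisors \<open>D \<le> E\<close> with \<open>H\<^sup>1(O(D)) = 0\<close>,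
  in terms of cardinalities.\<close>

lemma card_sections_le:
  assumes D: "D \<in> Div" and E: "E \<in> Div" and "\<And>P. D P \<le> E P" and fin: "finite (sections D)"
  shows "finite (sections E) \<and> card (sections E) \<le> card (sections D) * card k ^ nat (deg E - deg D) \<and>
    (approximable D \<longrightarrow> card (sections E) = card (sections D) * card k ^ nat (deg E - deg D))"
  using E assms(3)
proof (induction "nat (deg E - deg D)" arbitrary: E rule: less_induct)
  case (less E)
  show ?case
  proof (cases "E = D")
    case True
    then show ?thesis using fin by simp
  next
    case False
    then obtain P where P0: "E P \<noteq> D P" by blast
    then have P: "P \<in> S" using Div_outside[OF D, of P] Div_outside[OF less.prems(1), of P] by metis
    define E' where "E' = E(P := E P - 1)"
    have E': "E' \<in> Div" unfolding E'_def by (rule Div_upd[OF less.prems(1) P])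
    have le: "D Q \<le> E' Q" for Q using less.prems(2)[of Q] less.prems(2)[of P] P0 by (auto simp: E'_def)
    have EE: "E = E'(P := E' P + 1)" by (auto simp: E'_def)
    have dE: "deg E = deg E' + int (deg_pt P)" using deg_upd[OF E' P, of 1] EE by simp
    have dD: "deg D \<le> deg E'" by (rule deg_mono[OF D E' le])
    have "nat (deg E' - deg D) < nat (deg E - deg D)" using dE dD deg_pt_pos[OF P] by simp
    note IH = less.hyps[OF this E' le]
    have n: "nat (deg E - deg D) = nat (deg E' - deg D) + deg_pt P" using dE dD by simp
    note st = card_sections_step[OF P, of E', folded EE]
    have "card (sections E) \<le> card (sections E') * card k ^ deg_pt P" using st(2) IH by blast
    also have "\<dots> \<le> card (sections D) * card k ^ nat (deg E' - deg D) * card k ^ deg_pt P"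
      using IH by (intro mult_le_mono1) auto
    also have "\<dots> = card (sections D) * card k ^ nat (deg E - deg D)" by (simp add: n power_add)
    finally have "card (sections E) \<le> card (sections D) * card k ^ nat (deg E - deg D)" .
    moreover have "card (sections E) = card (sections D) * card k ^ nat (deg E - deg D)" if "approximable D"
      using st(3) IH that approximable_mono[OF that le] by (simp add: n power_add)
    ultimately show ?thesis using st(1) IH by blast
  qed
qed

lemma finite_sections: assumes "D \<in> Div" shows "finite (sections D)"
proof -
  let ?E = "\<lambda>P. max 0 (D P)"
  have E: "?E \<in> Div" by (rule Div_map[OF assms]) simp
  have "finite (sections (\<lambda>P. 0))" using finite_constants by (simp add: sections_zero)
  with card_sections_le[OF Div_zero E] have "finite (sections ?E)" by auto
  then show ?thesis using sections_mono[of D ?E] finite_subset by auto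
qed



lemma card_sections_pos: "D \<in> Div \<Longrightarrow> card (sections D) > 0"
  using finite_sections zero_in_sections by (auto simp: card_gt_0_iff)

lemma nonzero_section: assumes "card (sections D) > 1" shows "\<exists>f. f \<noteq> 0 \<and> f \<in> sections D"
proof (rule ccontr)
  assume "\<not> ?thesis"
  then have "sections D \<subseteq> {0}" by auto
  from card_mono[OF _ this] assms show False by simp
qed

subsection \<open>Principal divisors have degree zero\<close>

lemma bounded_poles:
  assumes "finite F" shows "\<exists>B\<in>Div. (\<forall>P. 0 \<le> B P) \<and> F \<subseteq> sections B"
  using assms
proof (induction F rule: finite_induct)
  case empty
  show ?case using Div_zero by auto
next
  case (insert f F)
  then obtain B where B: "B \<in> Div" "\<And>P. 0 \<le> B P" "F \<subseteq> sections B" by blast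
  show ?case
  proof (cases "f = 0")
    case True
    then show ?thesis using B zero_in_sections by auto
  next
    case False
    define B' where "B' = (\<lambda>P. max (B P) (- prin f P))"
    have "B' \<in> Div" unfolding B'_def by (rule Div_comb[OF B(1) prin_Div[OF False]]) simp
    moreover have "0 \<le> B' P" for P using B(2)[of P] by (simp add: B'_def)
    moreover have "F \<subseteq> sections B'" using B(3) sections_mono[of B B'] by (auto simp: B'_def)
    moreover have "f \<in> sections B'" using False by (auto simp: sections_iff B'_def)
    ultimately show ?thesis by blast
  qed
qed

text \<open>By weak approximation every class modulo the effective divisor \<open>Z\<close> has a representative in
  the function field.\<close>

lemma representatives_modulo:
  assumes Z: "Z \<in> Div" "\<And>P. 0 \<le> Z P"
  obtains R where "finite R" "card R = card k ^ nat (deg Z)"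
    "\<And>r P. r \<in> R \<Longrightarrow> Z P \<noteq> 0 \<Longrightarrow> r \<in> P"
    "\<And>r s. r \<in> R \<Longrightarrow> s \<in> R \<Longrightarrow> (\<And>P. Z P \<noteq> 0 \<Longrightarrow> r - s \<in> fideal P (Z P)) \<Longrightarrow> r = s"
proof -
  define F where "F = {P. Z P \<noteq> 0}"
  have F: "finite F" "F \<subseteq> S" using Z by (auto simp: F_def Div_def)
  define G where "G = PiE F (\<lambda>P. coset (fideal P (Z P)) ` P)"
  have ex: "\<exists>r. \<forall>P\<in>F. r \<in> P \<and> coset (fideal P (Z P)) r = \<phi> P" if "\<phi> \<in> G" for \<phi>
  proof -
    have "\<forall>P\<in>F. \<exists>a. a \<in> P \<and> \<phi> P = coset (fideal P (Z P)) a" using that by (auto simp: G_def PiE_def Pi_def)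
    then obtain a where a: "\<And>P. P \<in> F \<Longrightarrow> a P \<in> P \<and> \<phi> P = coset (fideal P (Z P)) (a P)" by metis
    define m where "m = (\<Sum>P\<in>F. \<bar>Z P\<bar>)"
    have m: "Z P \<le> m" "0 \<le> m" if "P \<in> F" for P using abs_le_sum[OF F(1) that, of Z] by (auto simp: m_def)
    obtain r where r: "\<And>P. P \<in> F \<Longrightarrow> r - a P \<in> fideal P m" using weak_approximation[OF F] by metis
    have "r \<in> P \<and> coset (fideal P (Z P)) r = \<phi> P" if P: "P \<in> F" for P
    proof -
      interpret dvr P using dvr_S F P by auto
      have 1: "r - a P \<in> fideal P (Z P)" "r - a P \<in> P"
        using r[OF P] fideal_antimono[OF m(1)[OF P]] fideal_antimono[OF m(2)[OF P]] fideal_0 by auto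
      have "r \<in> P" using add_in[OF 1(2), of "a P"] a[OF P] by simp
      moreover have "coset (fideal P (Z P)) r = \<phi> P" using 1(1) a[OF P] coset_eq_iff[OF fideal_subgroup] by metis
      ultimately show ?thesis by blast
    qed
    then show ?thesis by blast
  qed
  then obtain r where r: "\<And>\<phi> P. \<phi> \<in> G \<Longrightarrow> P \<in> F \<Longrightarrow> r \<phi> \<in> P \<and> coset (fideal P (Z P)) (r \<phi>) = \<phi> P"
    by metis
  have c: "finite (coset (fideal P (Z P)) ` P) \<and> card (coset (fideal P (Z P)) ` P) = card k ^ nat (Z P * int (deg_pt P))"
    if "P \<in> F" for P
    using card_coset_fideal[of P 0 "nat (Z P)"] that F Z(2)[of P] dvr.fideal_0[OF dvr_S] by (auto simp: nat_mult_distrib)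
  have "card G = (\<Prod>P\<in>F. card k ^ nat (Z P * int (deg_pt P)))"
    using F c by (simp add: G_def card_PiE)
  also have "\<dots> = card k ^ (\<Sum>P\<in>F. nat (Z P * int (deg_pt P)))" by (simp add: power_sum)
  also have "(\<Sum>P\<in>F. nat (Z P * int (deg_pt P))) = nat (deg Z)"
  proof -
    have "int (\<Sum>P\<in>F. nat (Z P * int (deg_pt P))) = deg Z"
      unfolding deg_def F_def using Z(2) by simp
    then show ?thesis by linarith
  qed
  finally have cG: "card G = card k ^ nat (deg Z)" .
  have fG: "finite G" unfolding G_def using F c by (intro finite_PiE) auto
  have inj: "\<phi> = \<psi>" if "\<phi> \<in> G" "\<psi> \<in> G" "\<And>P. P \<in> F \<Longrightarrow> r \<phi> - r \<psi> \<in> fideal P (Z P)" for \<phi> \<psi>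
  proof (rule PiE_ext)
    show "\<phi> \<in> PiE F (\<lambda>P. coset (fideal P (Z P)) ` P)" "\<psi> \<in> PiE F (\<lambda>P. coset (fideal P (Z P)) ` P)"
      using that by (auto simp: G_def)
    fix P assume P: "P \<in> F"
    interpret dvr P using dvr_S F P by auto
    have "coset (fideal P (Z P)) (r \<phi>) = coset (fideal P (Z P)) (r \<psi>)"
      using that(3)[OF P] by (simp only: coset_eq_iff[OF fideal_subgroup])
    then show "\<phi> P = \<psi> P" using r that(1,2) P by metis
  qed
  have "inj_on r G" using inj dvr.zero_fideal[OF dvr_S] F(2) by (intro inj_onI) force
  show ?thesis
  proof (rule that[of "r ` G"])
    show "finite (r ` G)" "card (r ` G) = card k ^ nat (deg Z)"
      using fG cG \<open>inj_on r G\<close> by (auto simp: card_image)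
    show "t \<in> P" if "t \<in> r ` G" "Z P \<noteq> 0" for t P using that r by (auto simp: F_def)
    show "t = s" if "t \<in> r ` G" "s \<in> r ` G" "\<And>P. Z P \<noteq> 0 \<Longrightarrow> t - s \<in> fideal P (Z P)" for t s
      using that inj by (auto simp: F_def)
  qed
qed

end

context places
begin

definition "zeros x = (\<lambda>P. max 0 (prin x P))"
definition "poles x = (\<lambda>P. max 0 (- prin x P))"

lemma zeros_poles_Div: assumes "x \<noteq> 0" shows "zeros x \<in> Div" "poles x \<in> Div"
  unfolding zeros_def poles_def by (rule Div_map[OF prin_Div[OF assms]]; simp)+

lemma zeros_poles_nonneg: "0 \<le> zeros x P" "0 \<le> poles x P"
  by (auto simp: zeros_def poles_def)

lemma deg_prin_zeros_poles: assumes "x \<noteq> 0" shows "deg (prin x) = deg (zeros x) - deg (poles x)"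
proof -
  have "prin x = (\<lambda>P. zeros x P - poles x P)" by (auto simp: zeros_def poles_def)
  then show ?thesis using deg_diff[OF zeros_poles_Div[OF assms]] by simp
qed

text \<open>The elements of \<open>R\<close> are distinct modulo \<open>x\<close> at the zeros of \<open>x\<close>, so they are digits for an expansion
  in powers of \<open>x\<close>: the lowest digit is determined modulo \<open>x\<close>; subtract it and divide by \<open>x\<close>.\<close>

lemma power_sums_distinct:
  assumes x: "x \<noteq> 0"
    and R: "\<And>r P. r \<in> R \<Longrightarrow> zeros x P \<noteq> 0 \<Longrightarrow> r \<in> P"
    "\<And>r s. r \<in> R \<Longrightarrow> s \<in> R \<Longrightarrow> (\<And>P. zeros x P \<noteq> 0 \<Longrightarrow> r - s \<in> fideal P (zeros x P)) \<Longrightarrow> r = s"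
  shows "\<lbrakk>\<And>i. i < N \<Longrightarrow> f i \<in> R; \<And>i. i < N \<Longrightarrow> g i \<in> R; (\<Sum>i<N. f i * x ^ i) = (\<Sum>i<N. g i * x ^ i); i < N\<rbrakk>
    \<Longrightarrow> f i = g i"
proof (induction N arbitrary: f g i)
  case (Suc N)
  define F where "F = (\<Sum>i<N. f (Suc i) * x ^ i)"
  define G where "G = (\<Sum>i<N. g (Suc i) * x ^ i)"
  have shift: "(\<Sum>i<Suc N. h i * x ^ i) = h 0 + x * (\<Sum>i<N. h (Suc i) * x ^ i)" for h
    unfolding sum.lessThan_Suc_shift by (simp add: sum_distrib_left ac_simps)
  have e: "f 0 + x * F = g 0 + x * G" using Suc.prems(3) unfolding shift F_def G_def .
  have "f 0 - g 0 \<in> fideal P (zeros x P)" if P: "zeros x P \<noteq> 0" for P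
  proof -
    have PS: "P \<in> S" using P by (auto simp: zeros_def prin_def split: if_splits)
    interpret dvr P using dvr_S PS by auto
    have o: "zeros x P = ord P x" "ord P x \<ge> 0" using P PS by (auto simp: zeros_def prin_def max_def split: if_splits)
    then have xP: "x \<in> P" by (simp add: mem_iff)
    have "G - F \<in> P" unfolding F_def G_def
      using R(1)[OF _ P] Suc.prems(1,2) xP by (intro diff_in sum_in mult_in power_in) auto
    then have "(G - F) * x \<in> fideal P (ord P x)" using fideal_self by (rule fideal_mult_left)
    moreover have "f 0 - g 0 = (G - F) * x" using e by (simp add: algebra_simps)
    ultimately show ?thesis using o by simp
  qed
  then have 0: "f 0 = g 0" using Suc.prems(1,2) by (intro R(2)) auto
  then have "F = G" using e x by simp
  show ?case
  proof (cases i)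
    case 0
    then show ?thesis using \<open>f 0 = g 0\<close> by simp
  next
    case (Suc j)
    then show ?thesis using Suc.IH[of "\<lambda>i. f (Suc i)" "\<lambda>i. g (Suc i)" j] Suc.prems \<open>F = G\<close>
      by (auto simp: F_def G_def)
  qed
qed simp

text \<open>The expansions with \<open>N\<close> digits from a fixed finite set \<open>R\<close> are distinct functions, and their poles
  are bounded by those of \<open>R\<close> and \<open>N\<close> times those of \<open>x\<close>.\<close>

lemma many_sections:
  assumes x: "x \<noteq> 0"
  obtains B where "B \<in> Div" "\<And>P. 0 \<le> B P"
    "\<And>N. card k ^ (nat (deg (zeros x)) * N) \<le> card (sections (\<lambda>P. B P + int N * poles x P))"
proof -
  obtain R where R: "finite R" "card R = card k ^ nat (deg (zeros x))"
    "\<And>r P. r \<in> R \<Longrightarrow> zeros x P \<noteq> 0 \<Longrightarrow> r \<in> P"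
    "\<And>r s. r \<in> R \<Longrightarrow> s \<in> R \<Longrightarrow> (\<And>P. zeros x P \<noteq> 0 \<Longrightarrow> r - s \<in> fideal P (zeros x P)) \<Longrightarrow> r = s"
    using representatives_modulo[OF zeros_poles_Div(1)[OF x] zeros_poles_nonneg(1)] by blast
  obtain B where B: "B \<in> Div" "\<And>P. 0 \<le> B P" "R \<subseteq> sections B" using bounded_poles[OF R(1)] by blast
  have "card k ^ (nat (deg (zeros x)) * N) \<le> card (sections (\<lambda>P. B P + int N * poles x P))" (is "_ \<le> card ?L") for N
  proof -
    let ?G = "PiE {..<N} (\<lambda>_. R)" and ?h = "\<lambda>f. \<Sum>i<N. f i * x ^ i"
    have "inj_on ?h ?G"
    proof (rule inj_onI)
      fix f g assume fg: "f \<in> ?G" "g \<in> ?G" "?h f = ?h g"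
      show "f = g"
      proof (rule PiE_ext[OF fg(1,2)])
        fix i assume "i \<in> {..<N}"
        then have i: "i < N" by simp
        show "f i = g i"
        proof (rule power_sums_distinct[where N = N and R = R and x = x])
          show "r \<in> P" if "r \<in> R" "zeros x P \<noteq> 0" for r P by (rule R(3)[OF that])
          show "r = s" if "r \<in> R" "s \<in> R" "\<And>P. zeros x P \<noteq> 0 \<Longrightarrow> r - s \<in> fideal P (zeros x P)" for r s
            by (rule R(4)[OF that])
          show "f j \<in> R" if "j < N" for j using fg(1) that by auto
          show "g j \<in> R" if "j < N" for j using fg(2) that by auto
        qed (rule x fg(3) i)+
      qed
    qed
    moreover have "?h f \<in> ?L" if f: "f \<in> ?G" for f
      unfolding sections_def
    proof (intro CollectI ballI)
      fix P assume P: "P \<in> S"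
      interpret dvr P using dvr_S P by auto
      show "?h f \<in> fideal P (- (B P + int N * poles x P))"
      proof (rule fideal_sum)
        fix i assume i: "i \<in> {..<N}"
        have "f i \<in> R" using f i by auto
        then have 1: "f i \<in> fideal P (- B P)" using B(3) P by (auto simp: sections_def)
        have "- (int N * poles x P) \<le> - (int i * poles x P)"
          using i zeros_poles_nonneg(2) by (simp add: mult_right_mono)
        also have "\<dots> \<le> int i * ord P x"
          using mult_left_mono[of "- poles x P" "ord P x" "int i"] P by (simp add: poles_def prin_def)
        finally have 2: "x ^ i \<in> fideal P (- (int N * poles x P))" using x by (simp add: fideal_def ord_power)
        show "f i * x ^ i \<in> fideal P (- (B P + int N * poles x P))"
          using fideal_mult[OF 1 2] by simp
      qed
    qed
    then have "?h ` ?G \<subseteq> ?L" by blast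
    moreover have "finite ?L"
      by (intro finite_sections Div_add Div_scale B(1) zeros_poles_Div x)
    ultimately have "card ?G \<le> card ?L" using card_inj_on_le by blast
    then show ?thesis by (simp add: card_PiE R(2) power_mult)
  qed
  with B show ?thesis using that by blast
qed

text \<open>The number of sections found in \<open>many_sections\<close> grows with \<open>N\<close> like the \<open>N\<close>-th power of
  \<open>card k ^ deg (zeros x)\<close>, while the divisor allows for a growth by \<open>card k ^ deg (poles x)\<close> only.\<close>

lemma deg_zeros_le_deg_poles: assumes x: "x \<noteq> 0" shows "deg (zeros x) \<le> deg (poles x)"
proof (rule ccontr)
  assume a: "\<not> deg (zeros x) \<le> deg (poles x)"
  obtain B where B: "B \<in> Div" "\<And>P. 0 \<le> B P"
    "\<And>N. card k ^ (nat (deg (zeros x)) * N) \<le> card (sections (\<lambda>P. B P + int N * poles x P))"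
    using many_sections[OF x] by blast
  note T = zeros_poles_Div(2)[OF x]
  have dT: "deg (poles x) \<ge> 0" by (rule deg_nonneg[OF T zeros_poles_nonneg(2)])
  have dB: "deg B \<ge> 0" by (rule deg_nonneg[OF B(1,2)])
  define c where "c = card (sections (\<lambda>P. 0)) * card k ^ nat (deg B)"
  have "card k ^ N \<le> c" for N
  proof -
    let ?E = "\<lambda>P. B P + int N * poles x P"
    have E: "?E \<in> Div" by (intro Div_add Div_scale B(1) T)
    have dE: "nat (deg ?E) = nat (deg B) + N * nat (deg (poles x))"
      using dT dB by (simp add: deg_add[OF B(1) Div_scale[OF T]] deg_scale[OF T] nat_add_distrib nat_mult_distrib)
    have "nat (deg (poles x)) + 1 \<le> nat (deg (zeros x))" using a dT by linarith
    then have "N + N * nat (deg (poles x)) \<le> nat (deg (zeros x)) * N"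
      using mult_le_mono1[of "nat (deg (poles x)) + 1" "nat (deg (zeros x))" N] by (simp add: algebra_simps)
    then have "card k ^ N * card k ^ (N * nat (deg (poles x))) \<le> card k ^ (nat (deg (zeros x)) * N)"
      using card_k by (subst power_add[symmetric], intro power_increasing) auto
    also have "\<dots> \<le> card (sections ?E)" by (rule B(3))
    also have "\<dots> \<le> card (sections (\<lambda>P. 0)) * card k ^ nat (deg ?E)"
      using card_sections_le[OF Div_zero E] finite_sections[OF Div_zero] B(2) zeros_poles_nonneg(2) by auto
    also have "\<dots> = c * card k ^ (N * nat (deg (poles x)))" by (simp add: dE c_def power_add)
    finally show ?thesis using card_k by simp
  qed
  \<comment> \<open>an unbounded left-hand side against a constant\<close>
  from this[of c] have "card k ^ c \<le> c" .
  moreover have "c < 2 ^ c" by (rule less_exp)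
  moreover have "2 ^ c \<le> card k ^ c" using card_k by (intro power_mono) auto
  ultimately show False by linarith
qed

theorem deg_prin: assumes x: "x \<noteq> 0" shows "deg (prin x) = 0"
proof -
  have "deg (prin y) \<le> 0" if "y \<noteq> 0" for y
    using deg_zeros_le_deg_poles[OF that] deg_prin_zeros_poles[OF that] by simp
  from this[OF x] this[of "inverse x"] show ?thesis
    using x deg_scale[OF prin_Div[OF x], of "-1"] by (simp add: prin_inverse)
qed

lemma section_deg_nonneg:
  assumes "D \<in> Div" "f \<noteq> 0" "f \<in> sections D"
  shows "(\<lambda>P. D P + prin f P) \<in> Div" "0 \<le> D P + prin f P" "deg (\<lambda>P. D P + prin f P) = deg D" "0 \<le> deg D"
proof -
  show 1: "(\<lambda>P. D P + prin f P) \<in> Div" by (intro Div_add assms prin_Div)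
  show 2: "0 \<le> D P + prin f P" for P
    using assms sections_iff[OF assms(2)] Div_outside[OF 1, of P] by (cases "P \<in> S") auto
  show 3: "deg (\<lambda>P. D P + prin f P) = deg D"
    by (simp add: deg_add[OF assms(1) prin_Div[OF assms(2)]] deg_prin[OF assms(2)])
  show "0 \<le> deg D" using deg_nonneg[OF 1 2] 3 by simp
qed

subsection \<open>Riemann's inequality and finiteness\<close>

text \<open>The field is infinite, whereas there are only finitely many functions without poles.\<close>

lemma nonconstant: obtains x P where "x \<noteq> 0" "P \<in> S" "ord P x < 0"
proof -
  have "\<Inter> S \<noteq> UNIV" using finite_constants infinite_field by metis
  then obtain x P where xP: "P \<in> S" "x \<notin> P" by blast
  interpret dvr P using dvr_S xP by auto
  show ?thesis using that[of x P] xP by (auto simp: mem_iff)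
qed

text \<open>Among more powers of \<open>x\<close> than there are residues, two agree modulo the maximal ideal.\<close>

lemma power_pigeonhole:
  assumes "P \<in> S" "x \<in> P"
  obtains a b where "a < b" "b \<le> card k ^ deg_pt P" "x ^ a - x ^ b \<in> fideal P 1"
proof -
  interpret dvr P using dvr_S assms by auto
  let ?f = "\<lambda>i. coset (fideal P 1) (x ^ i)"
  have "?f ` {..card k ^ deg_pt P} \<subseteq> coset (fideal P 1) ` P" using power_in[OF assms(2)] by blast
  then have "card (?f ` {..card k ^ deg_pt P}) \<le> card k ^ deg_pt P"
    using card_mono[OF finite_residue[OF assms(1)]] card_residue[OF assms(1)] by metis
  then have "\<not> inj_on ?f {..card k ^ deg_pt P}" using card_image[of ?f "{..card k ^ deg_pt P}"] by auto
  then obtain a b where ab: "a \<le> card k ^ deg_pt P" "b \<le> card k ^ deg_pt P" "a \<noteq> b" "?f a = ?f b"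
    by (auto simp: inj_on_def)
  have d: "x ^ a - x ^ b \<in> fideal P 1" using ab(4) coset_eq_iff[OF fideal_subgroup] by blast
  then have d': "x ^ b - x ^ a \<in> fideal P 1" using fideal_uminus[OF d] by simp
  show ?thesis using that d d' ab by (metis linorder_neqE_nat)
qed

lemma powers_distinct:
  assumes "P \<in> S" "x \<noteq> 0" "ord P x < 0" "a < b" shows "x ^ a - x ^ b \<noteq> 0"
proof
  interpret dvr P using dvr_S assms by auto
  assume "x ^ a - x ^ b = 0"
  then have "ord P (x ^ a) = ord P (x ^ b)" by simp
  then show False using assms by (simp add: ord_power)
qed

text \<open>On the affine curve where \<open>x\<close> is regular, \<open>x ^ a - x ^ b\<close> with suitable exponents vanishes at a given
  point.  A product of powers of such functions vanishes to the orders prescribed by \<open>D\<close>.\<close>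

lemma affine_principal_bound:
  assumes x: "x \<noteq> 0" "P0 \<in> S" "ord P0 x < 0" and D: "D \<in> Div"
  obtains f where "f \<noteq> 0" "\<And>P. P \<in> S \<Longrightarrow> poles x P = 0 \<Longrightarrow> D P \<le> ord P f"
proof -
  define F where "F = {P. D P > 0 \<and> poles x P = 0}"
  have F: "finite F" "F \<subseteq> S"
  proof -
    have "F \<subseteq> {P. D P \<noteq> 0}" by (auto simp: F_def)
    then show "finite F" "F \<subseteq> S" using D finite_subset by (auto simp: Div_def)
  qed
  have xin: "x \<in> P" if "P \<in> S" "poles x P = 0" for P
    using that dvr.mem_iff[OF dvr_S] by (auto simp: poles_def prin_def max_def split: if_splits)
  have "\<exists>y. y \<noteq> 0 \<and> y \<in> fideal P 1 \<and> (\<forall>Q\<in>S. poles x Q = 0 \<longrightarrow> y \<in> Q)" if P: "P \<in> F" for P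
  proof -
    have PS: "P \<in> S" "x \<in> P" using P F xin by (auto simp: F_def)
    obtain a b where ab: "a < b" "x ^ a - x ^ b \<in> fideal P 1" using power_pigeonhole[OF PS] by blast
    moreover have "x ^ a - x ^ b \<in> Q" if "Q \<in> S" "poles x Q = 0" for Q
    proof -
      interpret dvr Q using dvr_S that by auto
      show ?thesis using xin[OF that] by (intro diff_in power_in)
    qed
    ultimately show ?thesis using powers_distinct[OF x(2,1,3) ab(1)] by blast
  qed
  then obtain y where y: "\<And>P. P \<in> F \<Longrightarrow> y P \<noteq> 0" "\<And>P. P \<in> F \<Longrightarrow> y P \<in> fideal P 1"
    "\<And>P Q. P \<in> F \<Longrightarrow> Q \<in> S \<Longrightarrow> poles x Q = 0 \<Longrightarrow> y P \<in> Q" by metis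
  define f where "f = (\<Prod>P\<in>F. y P ^ nat (D P))"
  have f0: "f \<noteq> 0" using F y(1) by (simp add: f_def)
  show ?thesis
  proof (rule that[OF f0])
    fix P assume P: "P \<in> S" "poles x P = 0"
    interpret dvr P using dvr_S P by auto
    have o: "ord P f = (\<Sum>Q\<in>F. int (nat (D Q)) * ord P (y Q))"
      unfolding f_def using F y(1) by (subst ord_prod) (auto simp: ord_power)
    have nn: "0 \<le> int (nat (D Q)) * ord P (y Q)" if "Q \<in> F" for Q
      using ord_nonneg[OF y(3)[OF that P] y(1)[OF that]] by simp
    show "D P \<le> ord P f"
    proof (cases "P \<in> F")
      case True
      have "ord P (y P) \<ge> 1" using y(1,2)[OF True] by (simp add: fideal_def)
      then have "D P * 1 \<le> int (nat (D P)) * ord P (y P)" using True by (simp add: F_def)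
      also have "\<dots> \<le> ord P f" unfolding o by (rule member_le_sum[OF True nn F(1)]) auto
      finally show ?thesis by simp
    next
      case False
      then have "D P \<le> 0" using P by (auto simp: F_def)
      moreover have "0 \<le> ord P f" unfolding o by (rule sum_nonneg) (rule nn)
      ultimately show ?thesis by linarith
    qed
  qed
qed

text \<open>Up to a principal divisor, \<open>D\<close> lies below \<open>B + N T\<close>, where \<open>T\<close> are the poles of a function \<open>x\<close> and \<open>B\<close> is
  as in \<open>many_sections\<close>; the constant is \<open>deg B\<close>.  Lowering \<open>B + N T\<close> to \<open>D\<close> divides the number of sections
  by at most \<open>card k\<close> to the difference of the degrees, and some nonzero section is left.\<close>

theorem riemann_inequality:
  obtains g where "\<And>D. D \<in> Div \<Longrightarrow> deg D > g \<Longrightarrow> \<exists>f. f \<noteq> 0 \<and> f \<in> sections D"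
proof -
  obtain x P0 where x: "x \<noteq> 0" "P0 \<in> S" "ord P0 x < 0" using nonconstant .
  let ?T = "poles x"
  note T = zeros_poles_Div(2)[OF x(1)]
  have dZ: "deg (zeros x) = deg ?T" using deg_prin[OF x(1)] deg_prin_zeros_poles[OF x(1)] by simp
  have dT: "deg ?T \<ge> 0" by (rule deg_nonneg[OF T zeros_poles_nonneg(2)])
  obtain B where B: "B \<in> Div" "\<And>P. 0 \<le> B P"
    "\<And>N. card k ^ (nat (deg (zeros x)) * N) \<le> card (sections (\<lambda>P. B P + int N * ?T P))"
    using many_sections[OF x(1)] by blast
  have "\<exists>f. f \<noteq> 0 \<and> f \<in> sections D" if D: "D \<in> Div" "deg D > deg B" for D
  proof -
    obtain f where f: "f \<noteq> 0" "\<And>P. P \<in> S \<Longrightarrow> ?T P = 0 \<Longrightarrow> D P \<le> ord P f"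
      using affine_principal_bound[OF x D(1)] by blast
    define E where "E = (\<lambda>P. D P - prin f P)"
    have E: "E \<in> Div" unfolding E_def by (intro Div_diff D prin_Div f)
    have dE: "deg E = deg D" unfolding E_def by (simp add: deg_diff[OF D(1) prin_Div[OF f(1)]] deg_prin[OF f(1)])
    \<comment> \<open>large enough to dominate \<open>E\<close> at the poles of \<open>x\<close>\<close>
    define N where "N = nat (\<Sum>P | ?T P \<noteq> 0. \<bar>E P\<bar>)"
    let ?H = "\<lambda>P. B P + int N * ?T P"
    have H: "?H \<in> Div" by (intro Div_add Div_scale B T)
    have EH: "E P \<le> ?H P" for P
    proof (cases "?T P = 0")
      case True
      then show ?thesis
        using f(2)[of P] Div_outside[OF E, of P] B(2)[of P] by (cases "P \<in> S") (auto simp: E_def prin_def)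
    next
      case False
      have "E P \<le> int N" using abs_le_sum[OF Div_finite[OF T], of P E] False by (simp add: N_def)
      also have "\<dots> \<le> int N * ?T P"
        using False zeros_poles_nonneg(2)[of x P] mult_left_mono[of 1 "?T P" "int N"] by simp
      finally show ?thesis using B(2)[of P] by simp
    qed
    have dH: "deg ?H = deg B + int N * deg ?T" by (simp add: deg_add[OF B(1) Div_scale[OF T]] deg_scale[OF T])
    have "deg E \<le> deg ?H" by (rule deg_mono[OF E H EH])
    then have lt: "nat (deg ?H - deg E) < nat (deg ?T) * N"
      using dH dE D(2) dT by (simp add: nat_less_iff mult.commute)
    have "card k ^ (nat (deg ?T) * N) \<le> card (sections ?H)" using B(3)[of N] dZ by simp
    also have "\<dots> \<le> card (sections E) * card k ^ nat (deg ?H - deg E)"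
      using card_sections_le[OF E H EH finite_sections[OF E]] by blast
    finally have le: "card k ^ (nat (deg ?T) * N) \<le> card (sections E) * card k ^ nat (deg ?H - deg E)" .
    have "card (sections E) > 1"
    proof (rule ccontr)
      assume "\<not> card (sections E) > 1"
      then have "card (sections E) * card k ^ nat (deg ?H - deg E) \<le> 1 * card k ^ nat (deg ?H - deg E)"
        by (intro mult_le_mono1) simp
      moreover have "card k ^ nat (deg ?H - deg E) < card k ^ (nat (deg ?T) * N)"
        using card_k lt by (intro power_strict_increasing) auto
      ultimately show False using le by linarith
    qed
    then have "card (sections D) > 1" using card_sections_scale[OF f(1), of D] by (simp add: E_def)
    then show ?thesis by (rule nonzero_section)
  qed
  then show ?thesis using that by blast
qed

text \<open>A point of bounded degree is a pole of a fixed nonconstant \<open>x\<close>, or a zero of one of finitely many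
  functions \<open>x ^ a - x ^ b\<close>.\<close>

lemma finite_bounded_degree: "finite {P \<in> S. deg_pt P \<le> d}"
proof -
  obtain x P0 where x: "x \<noteq> 0" "P0 \<in> S" "ord P0 x < 0" using nonconstant .
  define I where "I = {(a, b). a < b \<and> b \<le> card k ^ d}"
  have "I \<subseteq> {..card k ^ d} \<times> {..card k ^ d}" by (auto simp: I_def)
  then have I: "finite I" by (rule finite_subset) auto
  have "{P \<in> S. deg_pt P \<le> d} \<subseteq> {P. poles x P \<noteq> 0} \<union> (\<Union>(a, b)\<in>I. {P. prin (x ^ a - x ^ b) P \<noteq> 0})"
  proof clarify
    fix P assume P: "P \<in> S" "deg_pt P \<le> d" "P \<notin> (\<Union>(a, b)\<in>I. {P. prin (x ^ a - x ^ b) P \<noteq> 0})" "poles x P = 0"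
    interpret dvr P using dvr_S P by auto
    have "x \<in> P" using P by (auto simp: mem_iff poles_def prin_def max_def split: if_splits)
    then obtain a b where ab: "a < b" "b \<le> card k ^ deg_pt P" "x ^ a - x ^ b \<in> fideal P 1"
      using power_pigeonhole[OF P(1)] by blast
    have "card k ^ deg_pt P \<le> card k ^ d" using card_k P(2) by (intro power_increasing) auto
    then have "(a, b) \<in> I" using ab by (simp add: I_def)
    moreover have "prin (x ^ a - x ^ b) P \<noteq> 0"
      using powers_distinct[OF x(2,1,3) ab(1)] ab(3) P(1) by (auto simp: prin_def fideal_def)
    ultimately show False using P(3) by blast
  qed
  moreover have "finite ({P. poles x P \<noteq> 0} \<union> (\<Union>(a, b)\<in>I. {P. prin (x ^ a - x ^ b) P \<noteq> 0}))"
    using I powers_distinct[OF x(2,1,3)] Div_finite[OF prin_Div] Div_finite[OF zeros_poles_Div(2)[OF x(1)]]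
    by (auto simp: I_def)
  ultimately show ?thesis by (rule finite_subset)
qed

lemma finite_effective: "finite {D \<in> Div. (\<forall>P. 0 \<le> D P) \<and> deg D \<le> d}"
proof -
  let ?A = "{P \<in> S. deg_pt P \<le> nat d}"
  have "{D \<in> Div. (\<forall>P. 0 \<le> D P) \<and> deg D \<le> d} \<subseteq> {D. \<forall>P. (P \<in> ?A \<longrightarrow> D P \<in> {0..d}) \<and> (P \<notin> ?A \<longrightarrow> D P = 0)}"
  proof (rule subsetI, rule CollectI, rule allI)
    fix D P assume "D \<in> {D \<in> Div. (\<forall>P. 0 \<le> D P) \<and> deg D \<le> d}"
    then have D: "D \<in> Div" "\<And>P. 0 \<le> D P" "deg D \<le> d" by auto
    show "(P \<in> ?A \<longrightarrow> D P \<in> {0..d}) \<and> (P \<notin> ?A \<longrightarrow> D P = 0)"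
    proof (cases "D P = 0")
      case True
      then show ?thesis using deg_nonneg[OF D(1,2)] D(3) by auto
    next
      case False
      then have PS: "P \<in> S" using Div_outside[OF D(1)] by metis
      have "D P * int (deg_pt P) \<le> deg D"
        unfolding deg_def using False D(2) Div_finite[OF D(1)] by (intro member_le_sum) auto
      moreover have "D P \<le> D P * int (deg_pt P)"
        using mult_left_mono[of 1 "int (deg_pt P)" "D P"] deg_pt_pos[OF PS] D(2)[of P] by simp
      moreover have "int (deg_pt P) \<le> D P * int (deg_pt P)"
        using mult_right_mono[of 1 "D P" "int (deg_pt P)"] False D(2)[of P] by simp
      ultimately show ?thesis using D(2)[of P] D(3) PS by auto
    qed
  qed
  then show ?thesis by (rule finite_subset) (intro finite_set_of_finite_funs finite_bounded_degree finite_atLeastAtMost_int)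
qed

end

context places
begin

subsection \<open>The divisor class group modulo \<open>n\<close>\<close>

definition class_rel :: "nat \<Rightarrow> (('a set \<Rightarrow> int) \<times> ('a set \<Rightarrow> int)) set" where
  "class_rel n = {(D, E). D \<in> Div \<and> E \<in> Div \<and>
     (\<exists>f B. f \<noteq> 0 \<and> B \<in> Div \<and> (\<forall>P. E P = D P + prin f P + int n * B P))}"

lemma class_relI:
  assumes "D \<in> Div" "f \<noteq> 0" "B \<in> Div" "\<And>P. E P = D P + prin f P + int n * B P"
  shows "(D, E) \<in> class_rel n"
proof -
  have "E = (\<lambda>P. D P + prin f P + int n * B P)" using assms(4) by auto
  then have "E \<in> Div" by (auto intro!: Div_add Div_scale prin_Div assms)
  then show ?thesis using assms by (auto simp: class_rel_def)
qed

lemma class_rel_equiv: "equiv Div (class_rel n)"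
proof (rule equivI)
  show "class_rel n \<subseteq> Div \<times> Div" by (auto simp: class_rel_def)
  show "refl_on Div (class_rel n)"
  proof (rule refl_onI)
    fix D assume "D \<in> Div"
    then show "(D, D) \<in> class_rel n"
      by (intro class_relI[of D 1 "\<lambda>P. 0"]) (simp_all add: prin_1 Div_zero)
  qed
  show "sym (class_rel n)"
  proof (rule symI)
    fix D E assume "(D, E) \<in> class_rel n"
    then obtain f B where "f \<noteq> 0" "B \<in> Div" "\<And>P. E P = D P + prin f P + int n * B P" "E \<in> Div"
      by (auto simp: class_rel_def)
    then show "(E, D) \<in> class_rel n"
      using Div_scale[of B "-1"] by (intro class_relI[of E "inverse f" "\<lambda>P. - 1 * B P"]) (auto simp: prin_inverse)
  qed
  show "trans (class_rel n)"
  proof (rule transI)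
    fix D E H assume "(D, E) \<in> class_rel n" "(E, H) \<in> class_rel n"
    then obtain f B f' B' where "D \<in> Div" "f \<noteq> 0" "B \<in> Div" "\<And>P. E P = D P + prin f P + int n * B P"
      "f' \<noteq> 0" "B' \<in> Div" "\<And>P. H P = E P + prin f' P + int n * B' P"
      by (auto simp: class_rel_def)
    then show "(D, H) \<in> class_rel n"
      by (intro class_relI[of D "f * f'" "\<lambda>P. B P + B' P"]) (auto simp: prin_mult Div_add ring_distribs)
  qed
qed

lemma class_rel_add:
  assumes "(D, E) \<in> class_rel n" "H \<in> Div"
  shows "((\<lambda>P. D P + H P), (\<lambda>P. E P + H P)) \<in> class_rel n"
proof -
  obtain f B where "D \<in> Div" "f \<noteq> 0" "B \<in> Div" "\<And>P. E P = D P + prin f P + int n * B P"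
    using assms by (auto simp: class_rel_def)
  then show ?thesis using assms by (intro class_relI[of _ f B]) (auto intro: Div_add)
qed

abbreviation "class_group n \<equiv> Div // class_rel n"

lemma point_exists: obtains P where "P \<in> S"
  using nonconstant by blast

text \<open>Adding a multiple of \<open>n P\<^sub>0\<close> moves the degree into the interval of length \<open>n deg P\<^sub>0\<close> just above the
  constant of Riemann's inequality, where every divisor is equivalent to an effective one.\<close>

theorem finite_class_group: assumes n: "n > 0" shows "finite (class_group n)"
proof -
  obtain P0 where P0: "P0 \<in> S" by (rule point_exists)
  obtain g where g: "\<And>D. D \<in> Div \<Longrightarrow> deg D > g \<Longrightarrow> \<exists>f. f \<noteq> 0 \<and> f \<in> sections D"
    using riemann_inequality by blast
  define p where "p = int n * int (deg_pt P0)"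
  have p: "p > 0" using n deg_pt_pos[OF P0] by (simp add: p_def)
  let ?E = "{D \<in> Div. (\<forall>P. 0 \<le> D P) \<and> deg D \<le> g + p}"
  have "class_group n \<subseteq> (\<lambda>D. class_rel n `` {D}) ` ?E"
  proof
    fix c assume "c \<in> class_group n"
    then obtain D where D: "D \<in> Div" "c = class_rel n `` {D}" by (rule quotientE)
    define m where "m = (g - deg D) div p + 1"
    define B where "B = (\<lambda>P. 0 :: int)(P0 := m)"
    have B: "B \<in> Div" unfolding B_def by (rule Div_upd[OF Div_zero P0])
    have dB: "deg B = m * int (deg_pt P0)" using deg_upd[OF Div_zero P0, of m] by (simp add: B_def)
    define E where "E = (\<lambda>P. D P + int n * B P)"
    have E: "E \<in> Div" unfolding E_def by (intro Div_add D Div_scale B)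
    have "deg E = deg D + m * p"
      unfolding E_def by (simp add: deg_add[OF D(1) Div_scale[OF B]] deg_scale[OF B] dB p_def)
    moreover have "g - deg D < m * p" "m * p \<le> g - deg D + p"
    proof -
      have "(g - deg D) div p * p + (g - deg D) mod p = g - deg D" by (rule div_mult_mod_eq)
      moreover have "0 \<le> (g - deg D) mod p" "(g - deg D) mod p < p" using p by auto
      moreover have "m * p = (g - deg D) div p * p + p" by (simp add: m_def distrib_right)
      ultimately show "g - deg D < m * p" "m * p \<le> g - deg D + p" by linarith+
    qed
    ultimately have dE: "deg E > g" "deg E \<le> g + p" by linarith+
    obtain f where f: "f \<noteq> 0" "f \<in> sections E" using g[OF E dE(1)] by blast
    define H where "H = (\<lambda>P. E P + prin f P)"
    have HE: "H \<in> ?E" using section_deg_nonneg[OF E f] dE by (simp add: H_def)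
    have "(D, H) \<in> class_rel n"
      by (rule class_relI[OF D(1) f(1) B]) (simp add: H_def E_def)
    from equiv_class_eq[OF class_rel_equiv this] D(2) have cH: "c = class_rel n `` {H}" by simp
    show "c \<in> (\<lambda>D. class_rel n `` {D}) ` ?E" unfolding cH by (rule imageI[OF HE])
  qed
  then show ?thesis by (rule finite_subset) (rule finite_imageI[OF finite_effective])
qed

lemma minimal_degree:
  obtains \<delta> D0 where "\<delta> > 0" "D0 \<in> Div" "deg D0 = \<delta>" "\<And>D. D \<in> Div \<Longrightarrow> deg D > 0 \<Longrightarrow> \<delta> \<le> deg D"
    "\<And>D. D \<in> Div \<Longrightarrow> \<delta> dvd deg D"
proof -
  obtain P0 where P0: "P0 \<in> S" by (rule point_exists)
  let ?P = "\<lambda>d::nat. d > 0 \<and> (\<exists>D\<in>Div. deg D = int d)"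
  have "?P (deg_pt P0)"
  proof (intro conjI bexI)
    show "deg_pt P0 > 0" by (rule deg_pt_pos[OF P0])
    show "(\<lambda>P. 0)(P0 := 1) \<in> Div" by (rule Div_upd[OF Div_zero P0])
    show "deg ((\<lambda>P. 0)(P0 := 1)) = int (deg_pt P0)" using deg_upd[OF Div_zero P0, of 1] by simp
  qed
  then have L: "?P (LEAST d. ?P d)" by (rule LeastI)
  define d where "d = (LEAST d. ?P d)"
  obtain D0 where D0: "D0 \<in> Div" "deg D0 = int d" "d > 0" using L by (auto simp: d_def)
  have min: "int d \<le> deg D" if "D \<in> Div" "deg D > 0" for D
  proof -
    have "?P (nat (deg D))" using that by auto
    then have "d \<le> nat (deg D)" unfolding d_def by (rule Least_le)
    then show ?thesis using that by simp
  qed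
  have "int d dvd deg D" if D: "D \<in> Div" for D
  proof -
    let ?E = "\<lambda>P. D P - (deg D div int d) * D0 P"
    have E: "?E \<in> Div" by (intro Div_diff D Div_scale D0)
    have dE: "deg ?E = deg D mod int d"
      by (simp add: deg_diff[OF D Div_scale[OF D0(1)]] deg_scale[OF D0(1)] D0(2) minus_div_mult_eq_mod)
    have "\<not> deg ?E > 0" using min[OF E] D0(3) dE pos_mod_bound[of "int d" "deg D"] by linarith
    moreover have "0 \<le> deg D mod int d" using D0(3) by simp
    ultimately have "deg D mod int d = 0" using dE by linarith
    then show ?thesis by (simp add: dvd_eq_mod_eq_0)
  qed
  then show ?thesis using that[of "int d" D0] D0 min by simp
qed

text \<open>\<open>E\<close> has neither sections nor \<open>H\<^sup>1\<close>, so that the number of sections of a divisor above \<open>E\<close> is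
  known exactly.  Descending from such a divisor to \<open>D\<close> shows that \<open>D\<close> has a nonzero section, whose
  zeros must be exactly \<open>D\<close>.\<close>

lemma degree_0_principal:
  assumes E: "E \<in> Div" "deg E < 0" "approximable E" and D: "D \<in> Div" "deg D = 0"
  shows "\<exists>f. f \<noteq> 0 \<and> D = prin f"
proof -
  have "sections E = {0}"
  proof -
    have "f = 0" if "f \<in> sections E" for f
      using section_deg_nonneg(4)[OF E(1) _ that] E(2) by fastforce
    then show ?thesis using zero_in_sections by blast
  qed
  then have cE: "card (sections E) = 1" by simp
  let ?H = "\<lambda>P. max (D P) (E P)"
  have H: "?H \<in> Div" by (rule Div_comb[OF D(1) E(1)]) simp
  have "deg D \<le> deg ?H" by (rule deg_mono[OF D(1) H]) simp
  have "card (sections ?H) = card k ^ nat (deg ?H - deg E)"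
    using card_sections_le[OF E(1) H _ finite_sections[OF E(1)]] E(3) cE by simp
  moreover have "card (sections ?H) \<le> card (sections D) * card k ^ nat (deg ?H - deg D)"
    using card_sections_le[OF D(1) H _ finite_sections[OF D(1)]] by simp
  moreover have "card k ^ nat (deg ?H - deg D) < card k ^ nat (deg ?H - deg E)"
    using card_k E(2) D(2) \<open>deg D \<le> deg ?H\<close> by (intro power_strict_increasing) auto
  ultimately have "\<not> card (sections D) * card k ^ nat (deg ?H - deg D) \<le> 1 * card k ^ nat (deg ?H - deg D)"
    by linarith
  then have "card (sections D) > 1" by (meson mult_le_mono1 not_le_imp_less)
  then obtain f where f: "f \<noteq> 0" "f \<in> sections D" using nonzero_section by blast
  have "D P + prin f P = 0" for P
    using effective_deg_0[OF section_deg_nonneg(1,2)[OF D(1) f]] section_deg_nonneg(3)[OF D(1) f] D(2) by simp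
  then have "D P = prin (inverse f) P" for P using f(1) prin_inverse[OF f(1)] by (simp add: add_eq_0_iff2)
  then show ?thesis using f(1) by (intro exI[of _ "inverse f"]) auto
qed

text \<open>If divisors of degree 0 are principal, then the multiples \<open>i D\<^sub>0\<close>, \<open>i < n\<close>, of a divisor of degree \<open>\<delta>\<close>
  represent all classes.  In general, translation by the multiples \<open>i D\<^sub>0\<close> takes the classes of
  degree \<open>- \<delta>\<close> to all classes.\<close>

theorem class_count:
  assumes n: "n > 0"
  obtains (cyclic) "card (class_group n) \<le> n"
    | (nonvanishing) \<delta> where "\<delta> > 0" "\<And>D. D \<in> Div \<Longrightarrow> deg D > 0 \<Longrightarrow> \<delta> \<le> deg D"
      "\<And>D. D \<in> Div \<Longrightarrow> deg D = - \<delta> \<Longrightarrow> \<not> approximable D"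
      "card (class_group n) \<le> n * card {c \<in> class_group n. \<exists>D\<in>c. deg D = - \<delta>}"
proof -
  obtain \<delta> D0 where \<delta>: "\<delta> > 0" "D0 \<in> Div" "deg D0 = \<delta>" "\<And>D. D \<in> Div \<Longrightarrow> deg D > 0 \<Longrightarrow> \<delta> \<le> deg D"
    "\<And>D. D \<in> Div \<Longrightarrow> \<delta> dvd deg D" using minimal_degree by blast
  note eq = class_rel_equiv[of n]
  show thesis
  proof (cases "\<exists>E\<in>Div. deg E = - \<delta> \<and> approximable E")
    case True
    then obtain E where E: "E \<in> Div" "deg E = - \<delta>" "approximable E" by blast
    have "class_group n \<subseteq> (\<lambda>i. class_rel n `` {\<lambda>P. int i * D0 P}) ` {..<n}"
    proof
      fix c assume "c \<in> class_group n"
      then obtain D where D: "D \<in> Div" "c = class_rel n `` {D}" by (rule quotientE)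
      define e where "e = deg D div \<delta>"
      have de: "deg D = e * \<delta>" using \<delta>(5)[OF D(1)] by (simp add: e_def)
      define i where "i = nat (e mod int n)"
      have i: "int i = e mod int n" "i < n" using n by (auto simp: i_def nat_less_iff)
      let ?A = "\<lambda>P. D P - e * D0 P"
      have "deg ?A = 0" by (simp add: deg_diff[OF D(1) Div_scale[OF \<delta>(2)]] deg_scale[OF \<delta>(2)] de \<delta>(3))
      moreover have "?A \<in> Div" by (intro Div_diff D Div_scale \<delta>)
      ultimately obtain f where f: "f \<noteq> 0" "?A = prin f" using degree_0_principal[OF E(1) _ E(3)] E(2) \<delta>(1) by auto
      have rel: "(\<lambda>P. int i * D0 P, D) \<in> class_rel n"
      proof (rule class_relI[OF _ f(1)])
        show "(\<lambda>P. (e div int n) * D0 P) \<in> Div" "(\<lambda>P. int i * D0 P) \<in> Div" by (intro Div_scale \<delta>)+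
        fix P
        have "e = int i + int n * (e div int n)" by (simp add: i)
        then have "e * D0 P = int i * D0 P + int n * ((e div int n) * D0 P)" by (metis distrib_right mult.assoc)
        then show "D P = int i * D0 P + prin f P + int n * ((e div int n) * D0 P)"
          using fun_cong[OF f(2), of P] by simp
      qed
      from equiv_class_eq[OF eq rel] D(2) have c: "c = class_rel n `` {\<lambda>P. int i * D0 P}" by simp
      show "c \<in> (\<lambda>i. class_rel n `` {\<lambda>P. int i * D0 P}) ` {..<n}" unfolding c by (rule imageI) (simp add: i(2))
    qed
    then have "card (class_group n) \<le> n" using surj_card_le[of "{..<n}"] by fastforce
    then show thesis by (rule cyclic)
  next
    case False
    let ?G = "{c \<in> class_group n. \<exists>D\<in>c. deg D = - \<delta>}"
    have fG: "finite ?G" using finite_class_group[OF n] by simp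
    let ?h = "\<lambda>(i, c). class_rel n `` {\<lambda>P. (SOME D. D \<in> c) P + int i * D0 P}"
    have "class_group n \<subseteq> ?h ` ({..<n} \<times> ?G)"
    proof
      fix c assume "c \<in> class_group n"
      then obtain D where D: "D \<in> Div" "c = class_rel n `` {D}" by (rule quotientE)
      define e where "e = deg D div \<delta>"
      have de: "deg D = e * \<delta>" using \<delta>(5)[OF D(1)] by (simp add: e_def)
      \<comment> \<open>the shift by 1 makes the remaining divisor \<open>D - (e + 1) D0\<close> of degree \<open>- \<delta>\<close>\<close>
      define i where "i = nat ((e + 1) mod int n)"
      have i: "int i = (e + 1) mod int n" "i < n" using n by (auto simp: i_def nat_less_iff)
      define m where "m = (e + 1) div int n"
      have e: "e + 1 = int i + int n * m" by (simp add: i m_def)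
      define D' where "D' = (\<lambda>P. D P - (e + 1) * D0 P)"
      have D': "D' \<in> Div" unfolding D'_def by (intro Div_diff D Div_scale \<delta>)
      have "deg D' = deg D - (e + 1) * deg D0"
        unfolding D'_def by (simp only: deg_diff[OF D(1) Div_scale[OF \<delta>(2)]] deg_scale[OF \<delta>(2)])
      then have "deg D' = - \<delta>" by (simp add: de \<delta>(3) algebra_simps)
      define c' where "c' = class_rel n `` {D'}"
      have c'G: "c' \<in> ?G"
        using D' \<open>deg D' = - \<delta>\<close> equiv_class_self[OF eq D'] by (auto simp: c'_def quotient_def)
      define D'' where "D'' = (SOME D. D \<in> c')"
      have "D'' \<in> c'"
        unfolding D''_def c'_def by (rule someI[of "\<lambda>D. D \<in> class_rel n `` {D'}", OF equiv_class_self[OF eq D']])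
      then have "(D', D'') \<in> class_rel n" by (simp add: c'_def)
      from class_rel_add[OF this Div_scale[OF \<delta>(2)], of "int i"]
      have 1: "(\<lambda>P. D' P + int i * D0 P, \<lambda>P. D'' P + int i * D0 P) \<in> class_rel n" .
      have 2: "(\<lambda>P. D' P + int i * D0 P, D) \<in> class_rel n"
      proof (rule class_relI[of _ 1 "\<lambda>P. m * D0 P"])
        show "(\<lambda>P. D' P + int i * D0 P) \<in> Div" "(\<lambda>P. m * D0 P) \<in> Div" by (intro Div_add Div_scale D' \<delta>)+
        fix P
        have "(e + 1) * D0 P = int i * D0 P + int n * (m * D0 P)" unfolding e by (simp add: distrib_right mult.assoc)
        then show "D P = D' P + int i * D0 P + prin 1 P + int n * (m * D0 P)" by (simp add: D'_def prin_1)
      qed simp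
      have "c = ?h (i, c')"
        using equiv_class_eq[OF eq 1] equiv_class_eq[OF eq 2] D(2) by (simp add: D''_def)
      moreover have "(i, c') \<in> {..<n} \<times> ?G" using i(2) c'G by blast
      ultimately show "c \<in> ?h ` ({..<n} \<times> ?G)" by (rule image_eqI)
    qed
    then have "card (class_group n) \<le> card ({..<n} \<times> ?G)" using fG by (intro surj_card_le) auto
    then show thesis using nonvanishing[OF \<delta>(1,4)] False by (simp add: card_cartesian_product)
  qed
qed

end

section \<open>Algebraic dependence over a finite field\<close>

locale finite_subfield =
  fixes k :: "'a::field set"
  assumes finite_k: "finite k"
    and k_subgroup: "add_subgroup k"
    and one_k: "1 \<in> k"
    and inverse_k: "c \<in> k \<Longrightarrow> inverse c \<in> k"
    and mult_k: "c \<in> k \<Longrightarrow> d \<in> k \<Longrightarrow> c * d \<in> k"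
begin

lemma zero_k: "0 \<in> k" and uminus_k: "c \<in> k \<Longrightarrow> - c \<in> k"
  and add_k: "c \<in> k \<Longrightarrow> d \<in> k \<Longrightarrow> c + d \<in> k" and diff_k: "c \<in> k \<Longrightarrow> d \<in> k \<Longrightarrow> c - d \<in> k"
  using add_subgroupD[OF k_subgroup] by auto

lemma sum_k: "(\<And>i. i \<in> I \<Longrightarrow> f i \<in> k) \<Longrightarrow> sum f I \<in> k"
  by (induction I rule: infinite_finite_induct) (auto intro: zero_k add_k)

lemma card_k2: "card k \<ge> 2"
proof -
  have "{0, 1} \<subseteq> k" using zero_k one_k by auto
  from card_mono[OF finite_k this] show ?thesis by simp
qed

definition kpoly :: "'a poly \<Rightarrow> bool" where "kpoly p \<longleftrightarrow> (\<forall>i. Polynomial.coeff p i \<in> k)"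

lemma kpoly_0: "kpoly 0" and kpoly_1: "kpoly 1"
  by (auto simp: kpoly_def zero_k one_k of_bool_def)

lemma kpoly_add: "kpoly p \<Longrightarrow> kpoly q \<Longrightarrow> kpoly (p + q)"
  by (auto simp: kpoly_def add_k)
lemma kpoly_uminus: "kpoly p \<Longrightarrow> kpoly (- p)"
  by (auto simp: kpoly_def uminus_k)
lemma kpoly_mult: "kpoly p \<Longrightarrow> kpoly q \<Longrightarrow> kpoly (p * q)"
  by (auto simp: kpoly_def coeff_mult intro!: sum_k mult_k)
lemma kpoly_monom: "c \<in> k \<Longrightarrow> kpoly (Polynomial.monom c i)"
  by (auto simp: kpoly_def zero_k)
lemma kpoly_sum: "(\<And>i. i \<in> I \<Longrightarrow> kpoly (f i)) \<Longrightarrow> kpoly (sum f I)"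
  by (induction I rule: infinite_finite_induct) (auto intro: kpoly_0 kpoly_add)
lemma kpoly_prod: "(\<And>i. i \<in> I \<Longrightarrow> kpoly (f i)) \<Longrightarrow> kpoly (prod f I)"
  by (induction I rule: infinite_finite_induct) (auto intro: kpoly_1 kpoly_mult)

definition vals :: "'a \<Rightarrow> nat \<Rightarrow> 'a set" where
  "vals s e = {poly p s | p. kpoly p \<and> Polynomial.degree p \<le> e}"

lemma valsI: "kpoly p \<Longrightarrow> Polynomial.degree p \<le> e \<Longrightarrow> poly p s \<in> vals s e"
  by (auto simp: vals_def)

lemma vals_mult: "u \<in> vals s e \<Longrightarrow> v \<in> vals s e' \<Longrightarrow> u * v \<in> vals s (e + e')"
proof -
  assume "u \<in> vals s e" "v \<in> vals s e'"
  then obtain p q where "kpoly p" "kpoly q" "Polynomial.degree p \<le> e" "Polynomial.degree q \<le> e'" "u = poly p s" "v = poly q s"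
    by (auto simp: vals_def)
  then show ?thesis
    using valsI[of "p * q" "e + e'" s] degree_mult_le[of p q] by (auto intro: kpoly_mult)
qed

lemma vals_add: "u \<in> vals s e \<Longrightarrow> v \<in> vals s e \<Longrightarrow> u + v \<in> vals s e"
proof -
  assume "u \<in> vals s e" "v \<in> vals s e"
  then obtain p q where "kpoly p" "kpoly q" "Polynomial.degree p \<le> e" "Polynomial.degree q \<le> e" "u = poly p s" "v = poly q s"
    by (auto simp: vals_def)
  then show ?thesis
    using valsI[of "p + q" e s] degree_add_le[of p e q] by (auto intro: kpoly_add)
qed

lemma vals_uminus: "u \<in> vals s e \<Longrightarrow> - u \<in> vals s e"
proof -
  assume "u \<in> vals s e"
  then obtain p where "kpoly p" "Polynomial.degree p \<le> e" "u = poly p s"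
    by (auto simp: vals_def)
  then show ?thesis using valsI[of "- p" e s] by (auto intro: kpoly_uminus)
qed

lemma vals_0: "0 \<in> vals s e" using valsI[OF kpoly_0] by simp
lemma vals_1: "1 \<in> vals s e" using valsI[OF kpoly_1] by simp
lemma vals_k: "c \<in> k \<Longrightarrow> c \<in> vals s e" using valsI[OF kpoly_monom[of c 0], of e s] by (simp add: monom_0)
lemma vals_diff: "u \<in> vals s e \<Longrightarrow> v \<in> vals s e \<Longrightarrow> u - v \<in> vals s e"
  using vals_add[of u s e "- v"] vals_uminus by simp
lemma card_vals: "finite (vals s e)" "card (vals s e) \<le> card k ^ Suc e"
proof -
  let ?G = "PiE {..e} (\<lambda>_. k)"
  have "vals s e \<subseteq> (\<lambda>c. \<Sum>i\<le>e. c i * s ^ i) ` ?G"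
  proof
    fix u assume "u \<in> vals s e"
    then obtain p where p: "kpoly p" "Polynomial.degree p \<le> e" "u = poly p s" by (auto simp: vals_def)
    have "u = (\<Sum>i\<le>e. Polynomial.coeff p i * s ^ i)"
      unfolding p(3) poly_altdef using p(2)
      by (intro sum.mono_neutral_left) (auto simp: coeff_eq_0)
    then have "u = (\<Sum>i\<le>e. restrict (Polynomial.coeff p) {..e} i * s ^ i)" by simp
    moreover have "restrict (Polynomial.coeff p) {..e} \<in> ?G" using p(1) by (auto simp: kpoly_def)
    ultimately show "u \<in> (\<lambda>c. \<Sum>i\<le>e. c i * s ^ i) ` ?G" by (rule image_eqI)
  qed
  note sub = this
  have fG: "finite ?G" by (intro finite_PiE finite_k finite_atMost)
  have cG: "card ?G = card k ^ Suc e" by (simp add: card_PiE)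
  show "finite (vals s e)" by (rule finite_surj[OF fG sub])
  show "card (vals s e) \<le> card k ^ Suc e" using surj_card_le[OF fG sub] cG by simp
qed

text \<open>A polynomial equation for \<open>y\<close> over \<open>k[s]\<close>, of degree \<open>m\<close> in \<open>y\<close> and with coefficients of degree at most
  \<open>e\<close> in \<open>s\<close>.\<close>

definition integral_eq :: "'a \<Rightarrow> 'a \<Rightarrow> nat \<Rightarrow> nat \<Rightarrow> (nat \<Rightarrow> 'a) \<Rightarrow> bool" where
  "integral_eq s y m e a \<longleftrightarrow> a m \<noteq> 0 \<and> (\<forall>i\<le>m. a i \<in> vals s e) \<and> (\<Sum>i\<le>m. a i * y ^ i) = 0"

text \<open>The equation allows to replace the power \<open>y ^ m\<close> by lower ones at the cost of a factor \<open>a m\<close>; the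
  degrees in \<open>s\<close> grow linearly with the number of replacements.\<close>

lemma power_reduction:
  assumes "integral_eq s y m e a" "j \<le> N"
  shows "\<exists>p. (\<forall>i<m. p i \<in> vals s (e * N)) \<and> a m ^ N * y ^ j = (\<Sum>i<m. p i * y ^ i)"
  using assms(2)
proof (induction N arbitrary: j)
  have a: "a m \<noteq> 0" "\<And>i. i \<le> m \<Longrightarrow> a i \<in> vals s e" "(\<Sum>i\<le>m. a i * y ^ i) = 0"
    using assms(1) by (auto simp: integral_eq_def)
  have m: "m > 0" using a by (cases m) auto
  {
    case 0
    have "(\<Sum>i<m. (if i = 0 then 1 else 0) * y ^ i) = 1"
      using m by (simp add: if_distrib[of "\<lambda>x. x * _"] cong: if_cong)
    then show ?case using 0 by (intro exI[of _ "\<lambda>i. if i = 0 then 1 else 0"]) (auto intro: vals_0 vals_1)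
  next
    case (Suc N)
    show ?case
    proof (cases "j \<le> N")
      case True
      with Suc.IH obtain p where p: "\<And>i. i < m \<Longrightarrow> p i \<in> vals s (e * N)" "a m ^ N * y ^ j = (\<Sum>i<m. p i * y ^ i)" by blast
      have "a m * p i \<in> vals s (e * Suc N)" if "i < m" for i
        using vals_mult[OF a(2)[of m] p(1)[OF that]] by simp
      moreover have "a m ^ Suc N * y ^ j = (\<Sum>i<m. (a m * p i) * y ^ i)"
        using p(2) by (simp add: sum_distrib_left mult.assoc)
      ultimately show ?thesis by (intro exI[of _ "\<lambda>i. a m * p i"]) auto
    next
      case False
      then have j: "j = Suc N" using Suc.prems by simp
      obtain p where p: "\<And>i. i < m \<Longrightarrow> p i \<in> vals s (e * N)" "a m ^ N * y ^ N = (\<Sum>i<m. p i * y ^ i)"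
        using Suc.IH[of N] by blast
      obtain l where l: "m = Suc l" using m by (cases m) auto
      define p' where "p' i = (if i = 0 then 0 else a m * p (i - 1)) - p l * a i" for i
      have p'in: "p' i \<in> vals s (e * Suc N)" if i: "i < m" for i
      proof -
        have "a m * p (i - 1) \<in> vals s (e * Suc N)" using vals_mult[OF a(2)[of m] p(1)[of "i - 1"]] i by simp
        moreover have "p l * a i \<in> vals s (e * Suc N)"
          using vals_mult[OF p(1)[of l] a(2)[of i]] i l by (simp add: add.commute)
        ultimately show ?thesis by (auto simp: p'_def intro: vals_diff vals_0 vals_uminus)
      qed
      have top: "a m * y ^ m = - (\<Sum>i<m. a i * y ^ i)"
        using a(3) by (simp add: lessThan_Suc_atMost[symmetric] eq_neg_iff_add_eq_0 add.commute)
      have "a m ^ Suc N * y ^ j = a m * y * (\<Sum>i<m. p i * y ^ i)" unfolding p(2)[symmetric] j by simp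
      also have "\<dots> = (\<Sum>i<l. a m * p i * y ^ Suc i) + p l * (a m * y ^ m)"
        unfolding l by (simp add: sum_distrib_left algebra_simps)
      also have "(\<Sum>i<l. a m * p i * y ^ Suc i) = (\<Sum>i<m. (if i = 0 then 0 else a m * p (i - 1)) * y ^ i)"
        unfolding l sum.lessThan_Suc_shift by simp
      also have "p l * (a m * y ^ m) = - (\<Sum>i<m. p l * a i * y ^ i)"
        unfolding top by (simp add: sum_distrib_left mult.assoc)
      also have "(\<Sum>i<m. (if i = 0 then 0 else a m * p (i - 1)) * y ^ i) + - (\<Sum>i<m. p l * a i * y ^ i) =
          (\<Sum>i<m. p' i * y ^ i)"
        by (simp add: p'_def left_diff_distrib sum_subtractf)
      finally show ?thesis using p'in by blast
    qed
  }
qed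

text \<open>There are more combinations of the monomials \<open>y ^ i * b ^ j\<close> with \<open>i, j \<le> N\<close> than values that
  they can take once powers have been reduced, so two combinations agree.\<close>

lemma dependent_pair:
  assumes y: "integral_eq s y m e a" and b: "integral_eq s b m' e' a'"
  shows "\<exists>N d. (\<forall>i j. d i j \<in> k) \<and> (\<exists>i\<le>N. \<exists>j\<le>N. d i j \<noteq> 0) \<and> (\<Sum>i\<le>N. \<Sum>j\<le>N. d i j * (y ^ i * b ^ j)) = 0"
proof -
  define E where "E = e + e'"
  \<comment> \<open>makes the number \<open>(N + 1)\<^sup>2\<close> of monomials exceed the dimension of \<open>V\<close> over \<open>k\<close>\<close>
  define N where "N = (E + 1) * (m * m')"
  \<comment> \<open>a space that contains all monomials after clearing denominators\<close>
  define V where "V = (\<lambda>p. \<Sum>i<m. \<Sum>j<m'. p (i, j) * (y ^ i * b ^ j)) ` (PiE ({..<m} \<times> {..<m'}) (\<lambda>_. vals s (E * N)))"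
  have VI: "(\<Sum>i<m. \<Sum>j<m'. p i j * (y ^ i * b ^ j)) \<in> V" if "\<And>i j. i < m \<Longrightarrow> j < m' \<Longrightarrow> p i j \<in> vals s (E * N)" for p
    unfolding V_def
    by (rule image_eqI[of _ _ "restrict (\<lambda>(i, j). p i j) ({..<m} \<times> {..<m'})"]) (use that in \<open>auto intro!: sum.cong\<close>)
  have V0: "0 \<in> V" using VI[of "\<lambda>_ _. 0"] by (simp add: vals_0)
  have VE: "\<exists>p. (\<forall>i<m. \<forall>j<m'. p i j \<in> vals s (E * N)) \<and> u = (\<Sum>i<m. \<Sum>j<m'. p i j * (y ^ i * b ^ j))" if "u \<in> V" for u
  proof -
    obtain p where "p \<in> PiE ({..<m} \<times> {..<m'}) (\<lambda>_. vals s (E * N))" "u = (\<Sum>i<m. \<Sum>j<m'. p (i, j) * (y ^ i * b ^ j))"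
      using \<open>u \<in> V\<close> by (auto simp: V_def)
    then show ?thesis by (intro exI[of _ "\<lambda>i j. p (i, j)"]) auto
  qed
  have Vadd: "u + v \<in> V" if uv: "u \<in> V" "v \<in> V" for u v
  proof -
    obtain p q where pq: "\<And>i j. i < m \<Longrightarrow> j < m' \<Longrightarrow> p i j \<in> vals s (E * N)" "u = (\<Sum>i<m. \<Sum>j<m'. p i j * (y ^ i * b ^ j))"
      "\<And>i j. i < m \<Longrightarrow> j < m' \<Longrightarrow> q i j \<in> vals s (E * N)" "v = (\<Sum>i<m. \<Sum>j<m'. q i j * (y ^ i * b ^ j))"
      using VE[OF uv(1)] VE[OF uv(2)] by blast
    have "u + v = (\<Sum>i<m. \<Sum>j<m'. (p i j + q i j) * (y ^ i * b ^ j))"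
      unfolding pq(2,4) by (simp add: sum.distrib distrib_right)
    then show ?thesis using VI[of "\<lambda>i j. p i j + q i j"] pq(1,3) vals_add by simp
  qed
  have Vk: "c * u \<in> V" if cu: "c \<in> k" "u \<in> V" for c u
  proof -
    obtain p where p: "\<And>i j. i < m \<Longrightarrow> j < m' \<Longrightarrow> p i j \<in> vals s (E * N)" "u = (\<Sum>i<m. \<Sum>j<m'. p i j * (y ^ i * b ^ j))"
      using VE[OF cu(2)] by blast
    have "c * u = (\<Sum>i<m. \<Sum>j<m'. (c * p i j) * (y ^ i * b ^ j))"
      unfolding p(2) by (simp add: sum_distrib_left mult.assoc)
    then show ?thesis using VI[of "\<lambda>i j. c * p i j"] p(1) vals_mult[OF vals_k[OF cu(1), of s 0], of _ "E * N"] by simp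
  qed
  have Vsum: "sum f I \<in> V" if "\<And>i. i \<in> I \<Longrightarrow> f i \<in> V" for f :: "nat \<Rightarrow> 'a" and I
    using that by (induction I rule: infinite_finite_induct) (auto intro: V0 Vadd)
  have mono: "a m ^ N * a' m' ^ N * (y ^ i * b ^ j) \<in> V" if ij: "i \<le> N" "j \<le> N" for i j
  proof -
    obtain p where p: "\<And>i. i < m \<Longrightarrow> p i \<in> vals s (e * N)" "a m ^ N * y ^ i = (\<Sum>i<m. p i * y ^ i)"
      using power_reduction[OF y ij(1)] by blast
    obtain q where q: "\<And>i. i < m' \<Longrightarrow> q i \<in> vals s (e' * N)" "a' m' ^ N * b ^ j = (\<Sum>i<m'. q i * b ^ i)"
      using power_reduction[OF b ij(2)] by blast
    have "a m ^ N * a' m' ^ N * (y ^ i * b ^ j) = (a m ^ N * y ^ i) * (a' m' ^ N * b ^ j)" by (simp add: ac_simps)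
    also have "\<dots> = (\<Sum>i<m. \<Sum>j<m'. (p i * q j) * (y ^ i * b ^ j))"
      unfolding p(2) q(2) sum_product by (simp add: ac_simps)
    also have "\<dots> \<in> V"
      by (rule VI) (use vals_mult[OF p(1) q(1)] in \<open>simp add: E_def distrib_right\<close>)
    finally show ?thesis .
  qed
  have cV: "finite V" "card V \<le> card k ^ (Suc (E * N) * (m * m'))"
  proof -
    let ?G = "PiE ({..<m} \<times> {..<m'}) (\<lambda>_. vals s (E * N))"
    have fG: "finite ?G" using card_vals(1) by (intro finite_PiE) auto
    then show "finite V" unfolding V_def by simp
    have "card V \<le> card ?G" unfolding V_def by (rule card_image_le[OF fG])
    also have "\<dots> = card (vals s (E * N)) ^ (m * m')" by (simp add: card_PiE card_cartesian_product)
    also have "\<dots> \<le> (card k ^ Suc (E * N)) ^ (m * m')" by (intro power_mono card_vals) simp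
    finally show "card V \<le> card k ^ (Suc (E * N) * (m * m'))" by (simp only: power_mult)
  qed
  let ?I = "{..N} \<times> {..N}" and ?\<phi> = "\<lambda>c. \<Sum>i\<le>N. \<Sum>j\<le>N. c (i, j) * (y ^ i * b ^ j)"
  let ?C = "PiE ?I (\<lambda>_. k)"
  have nz: "a m ^ N * a' m' ^ N \<noteq> 0" using y b by (simp add: integral_eq_def)
  have "\<not> inj_on ?\<phi> ?C"
  proof
    assume "inj_on ?\<phi> ?C"
    then have inj: "inj_on (\<lambda>c. a m ^ N * a' m' ^ N * ?\<phi> c) ?C" using nz by (auto simp: inj_on_def)
    have "(\<lambda>c. a m ^ N * a' m' ^ N * ?\<phi> c) ` ?C \<subseteq> V"
    proof (rule image_subsetI)
      fix c assume c: "c \<in> ?C"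
      have "a m ^ N * a' m' ^ N * ?\<phi> c = (\<Sum>i\<le>N. \<Sum>j\<le>N. c (i, j) * (a m ^ N * a' m' ^ N * (y ^ i * b ^ j)))"
        by (simp add: sum_distrib_left ac_simps)
      also have "\<dots> \<in> V" by (intro Vsum Vk mono) (use c in \<open>auto simp: PiE_def Pi_def\<close>)
      finally show "a m ^ N * a' m' ^ N * ?\<phi> c \<in> V" .
    qed
    from card_inj_on_le[OF inj this cV(1)] cV(2)
    have "card k ^ (Suc N * Suc N) \<le> card k ^ (Suc (E * N) * (m * m'))"
      by (simp add: card_PiE card_cartesian_product)
    then have "Suc N * Suc N \<le> Suc (E * N) * (m * m')"
      using card_k2 by (subst (asm) power_increasing_iff) auto
    also have "\<dots> \<le> (E + 1) * Suc N * (m * m')" by (intro mult_le_mono1) simp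
    also have "\<dots> = N * Suc N" by (simp add: N_def algebra_simps)
    finally show False by simp
  qed
  then obtain c c' where c: "c \<in> ?C" "c' \<in> ?C" "c \<noteq> c'" "?\<phi> c = ?\<phi> c'" by (auto simp: inj_on_def)
  have "\<exists>i\<le>N. \<exists>j\<le>N. c (i, j) \<noteq> c' (i, j)"
  proof (rule ccontr)
    assume "\<not> ?thesis"
    then have "c = c'" using c(1,2) by (intro PiE_ext[OF c(1,2)]) auto
    then show False using c(3) by simp
  qed
  then show ?thesis using c
    by (intro exI[of _ N] exI[of _ "\<lambda>i j. if i \<le> N \<and> j \<le> N then c (i, j) - c' (i, j) else 0"])
      (auto simp: left_diff_distrib sum_subtractf PiE_def Pi_def intro!: zero_k diff_k)
qed

text \<open>A relation between \<open>y\<close> and \<open>b\<close> is ordered by powers of \<open>b\<close>; after division by the lowest one,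
  all terms but the first are multiples of \<open>b\<close>.\<close>

lemma dependent_pair_mod:
  assumes "(\<Sum>i\<le>N. \<Sum>j\<le>N. d i j * (y ^ i * b ^ j)) = 0" "\<And>i j. d i j \<in> k" "\<exists>i\<le>N. \<exists>j\<le>N. d i j \<noteq> 0"
    and "b \<noteq> 0" and R: "add_subgroup R" "k \<subseteq> R" "y \<in> R" "b \<in> R" "\<And>u v. u \<in> R \<Longrightarrow> v \<in> R \<Longrightarrow> u * v \<in> R"
  shows "\<exists>p w. p \<noteq> 0 \<and> kpoly p \<and> w \<in> R \<and> poly p y = b * w"
proof -
  define j0 where "j0 = (LEAST j. j \<le> N \<and> (\<exists>i\<le>N. d i j \<noteq> 0))"
  have "j0 \<le> N \<and> (\<exists>i\<le>N. d i j0 \<noteq> 0)" unfolding j0_def by (rule LeastI_ex) (use assms(3) in blast)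
  then obtain i0 where j0: "j0 \<le> N" "i0 \<le> N" "d i0 j0 \<noteq> 0" by blast
  have less: "d i j = 0" if "i \<le> N" "j < j0" for i j
    using not_less_Least[of j "\<lambda>j. j \<le> N \<and> (\<exists>i\<le>N. d i j \<noteq> 0)"] that j0 by (auto simp: j0_def)
  define p where "p j = (\<Sum>i\<le>N. Polynomial.monom (d i j) i)" for j
  have kp: "kpoly (p j)" for j unfolding p_def by (intro kpoly_sum kpoly_monom assms)
  have pv: "poly (p j) y = (\<Sum>i\<le>N. d i j * y ^ i)" for j by (simp add: p_def poly_sum poly_monom)
  have "Polynomial.coeff (p j0) i0 = d i0 j0" using j0 by (simp add: p_def coeff_sum)
  then have p0: "p j0 \<noteq> 0" using j0(3) by auto
  have pw: "u ^ n \<in> R" if "u \<in> R" for u n using that assms(6) one_k by (induction n) (auto intro: R)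
  have sR: "sum f I \<in> R" if "\<And>i. i \<in> I \<Longrightarrow> f i \<in> R" for f :: "nat \<Rightarrow> 'a" and I
    using that by (induction I rule: infinite_finite_induct) (auto intro: add_subgroupD[OF R(1)])
  have pR: "poly (p j) y \<in> R" for j unfolding pv
    by (intro sR R(5) pw R(3)) (use assms(2) R(2) in auto)
  have "0 = (\<Sum>j\<le>N. poly (p j) y * b ^ j)"
    using assms(1) by (subst (asm) sum.swap) (simp add: pv sum_distrib_right mult.assoc)
  also have "\<dots> = (\<Sum>j\<in>{j0..N}. poly (p j) y * b ^ j)"
    by (intro sum.mono_neutral_right) (auto simp: pv less)
  also have "\<dots> = poly (p j0) y * b ^ j0 + (\<Sum>j\<in>{Suc j0..N}. poly (p j) y * b ^ j)"
    using j0(1) by (simp add: sum.atLeast_Suc_atMost)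
  also have "(\<Sum>j\<in>{Suc j0..N}. poly (p j) y * b ^ j) = b ^ j0 * (b * (\<Sum>j\<in>{Suc j0..N}. poly (p j) y * b ^ (j - Suc j0)))"
    unfolding sum_distrib_left
  proof (rule sum.cong[OF refl])
    fix j assume "j \<in> {Suc j0..N}"
    then have "b ^ j = b ^ j0 * (b * b ^ (j - Suc j0))" by (simp flip: power_add power_Suc)
    then show "poly (p j) y * b ^ j = b ^ j0 * (b * (poly (p j) y * b ^ (j - Suc j0)))" by (simp add: ac_simps)
  qed
  finally have "b ^ j0 * (poly (p j0) y + b * (\<Sum>j\<in>{Suc j0..N}. poly (p j) y * b ^ (j - Suc j0))) = 0"
    by (simp add: distrib_left ac_simps)
  then have "poly (p j0) y = b * (- (\<Sum>j\<in>{Suc j0..N}. poly (p j) y * b ^ (j - Suc j0)))"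
    using assms(4) by (simp add: eq_neg_iff_add_eq_0)
  moreover have "- (\<Sum>j\<in>{Suc j0..N}. poly (p j) y * b ^ (j - Suc j0)) \<in> R"
    by (intro add_subgroupD(2)[OF R(1)] sR R(5) pw R(4) pR)
  ultimately show ?thesis using p0 kp by blast
qed

end

section \<open>Function fields of curves\<close>

lemma fun_field_simps [simp]:
  "carrier fun_field = UNIV" "x \<otimes>\<^bsub>fun_field\<^esub> y = x * y" "x \<oplus>\<^bsub>fun_field\<^esub> y = x + y"
  "\<zero>\<^bsub>fun_field\<^esub> = 0" "\<one>\<^bsub>fun_field\<^esub> = 1"
  by (simp_all add: ring_of_type_algebra_def)

lemma fun_field_field: "Ring.field (fun_field :: 'a::field ring)"
  by (rule field_from_type_algebra)

lemma fun_field_ring: "ring (fun_field :: 'a::field ring)"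
  by (rule ring_from_type_algebra)

lemma fun_field_uminus [simp]: "\<ominus>\<^bsub>fun_field\<^esub> x = - x"
proof -
  interpret R: ring "fun_field :: 'a ring" by (rule fun_field_ring)
  show ?thesis by (rule R.minus_equality) auto
qed

lemma fun_field_inv: assumes "x \<noteq> 0" shows "inv\<^bsub>fun_field\<^esub> x = inverse x"
proof -
  interpret R: Ring.field "fun_field :: 'a ring" by (rule fun_field_field)
  show ?thesis by (rule R.inv_char) (use assms in auto)
qed

lemma fun_field_pow [simp]: "x [^]\<^bsub>fun_field\<^esub> (n::nat) = x ^ n"
  by (induction n) (auto simp: nat_pow_def ac_simps)

lemma fun_field_eval:
  "ring.eval fun_field p x = (\<Sum>i<length p. p ! (length p - 1 - i) * x ^ i)"
proof (induction p)
  case Nil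
  interpret R: ring "fun_field :: 'a ring" by (rule fun_field_ring)
  show ?case by simp
next
  case (Cons a p)
  interpret R: ring "fun_field :: 'a ring" by (rule fun_field_ring)
  have "(\<Sum>i<length p. (a # p) ! (length p - i) * x ^ i) = (\<Sum>i<length p. p ! (length p - 1 - i) * x ^ i)"
  proof (rule sum.cong[OF refl])
    fix i assume "i \<in> {..<length p}"
    then have "length p - i = Suc (length p - 1 - i)" by auto
    then show "(a # p) ! (length p - i) * x ^ i = p ! (length p - 1 - i) * x ^ i" by simp
  qed
  then show ?case using Cons by simp
qed

lemma subfield_finite_subfield:
  assumes "subfield k (fun_field :: 'a::field ring)" "finite k" shows "finite_subfield k"
proof -
  interpret R: Ring.field "fun_field :: 'a ring" by (rule fun_field_field)
  note S = subfieldE[OF assms(1)]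
  show ?thesis
  proof
    show "finite k" by fact
    show "1 \<in> k" using subringE(3)[OF S(1)] by simp
    show "add_subgroup k"
      unfolding add_subgroup_def
    proof (intro conjI ballI)
      show "0 \<in> k" using subringE(2)[OF S(1)] by simp
      fix a b assume "a \<in> k" "b \<in> k"
      then show "a - b \<in> k" using subringE(7)[OF S(1), of a "- b"] subringE(5)[OF S(1), of b] by simp
    qed
    show "c * d \<in> k" if "c \<in> k" "d \<in> k" for c d using subringE(6)[OF S(1) that] by simp
    show "inverse c \<in> k" if "c \<in> k" for c
    proof (cases "c = 0")
      case False
      then show ?thesis using R.subfield_m_inv(1)[OF assms(1), of c] that by (simp add: fun_field_inv)
    qed (use \<open>c \<in> k\<close> in simp)
  qed
qed

context finite_subfield
begin

lemma generated_field_fractions: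
  assumes "z \<in> generate_field fun_field (insert t k)"
  shows "\<exists>p q. kpoly p \<and> kpoly q \<and> poly q t \<noteq> 0 \<and> z = poly p t / poly q t"
  using assms
proof (induction rule: generate_field.induct)
  case one
  show ?case by (intro exI[of _ 1]) (auto simp: kpoly_1)
next
  case (incl h)
  have "kpoly (Polynomial.monom 1 1)" "poly (Polynomial.monom 1 1) t = t"
    using kpoly_monom[OF one_k] by (auto simp: poly_monom)
  moreover have "kpoly (Polynomial.monom h 0)" "poly (Polynomial.monom h 0) t = h" if "h \<in> k"
    using kpoly_monom[OF that] by (auto simp: poly_monom)
  ultimately obtain p where "kpoly p" "poly p t = h" using incl by blast
  then show ?case by (intro exI[of _ p] exI[of _ 1]) (auto simp: kpoly_1)
next
  case (a_inv h)
  then obtain p q where "kpoly p" "kpoly q" "poly q t \<noteq> 0" "h = poly p t / poly q t" by blast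
  then show ?case by (intro exI[of _ "- p"] exI[of _ q]) (auto simp: kpoly_uminus)
next
  case (m_inv h)
  then obtain p q where "kpoly p" "kpoly q" "poly q t \<noteq> 0" "h = poly p t / poly q t" by blast
  then show ?case using m_inv by (intro exI[of _ q] exI[of _ p]) (auto simp: fun_field_inv)
next
  case (eng_add h h')
  then obtain p q p' q' where "kpoly p" "kpoly q" "poly q t \<noteq> 0" "h = poly p t / poly q t"
    "kpoly p'" "kpoly q'" "poly q' t \<noteq> 0" "h' = poly p' t / poly q' t" by blast
  then show ?case
    by - (rule exI[of _ "p * q' + p' * q"], rule exI[of _ "q * q'"],
      auto simp: add_frac_eq intro!: kpoly_mult kpoly_add)
next
  case (eng_mult h h')
  then obtain p q p' q' where "kpoly p" "kpoly q" "poly q t \<noteq> 0" "h = poly p t / poly q t"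
    "kpoly p'" "kpoly q'" "poly q' t \<noteq> 0" "h' = poly p' t / poly q' t" by blast
  then show ?case
    by - (rule exI[of _ "p * p'"], rule exI[of _ "q * q'"], auto intro!: kpoly_mult)
qed

lemma algebraic_integral_eq:
  assumes "(ring.algebraic fun_field over (generate_field fun_field (insert t k))) y"
  shows "\<exists>m e a. integral_eq t y m e a"
proof -
  interpret R: Ring.field "fun_field :: 'a ring" by (rule fun_field_field)
  let ?F = "generate_field fun_field (insert t k)"
  have F: "subring ?F fun_field"
    using R.generate_field_is_subfield[of "insert t k"] by (simp add: subfieldE)
  obtain p where p: "p \<in> carrier (?F[X]\<^bsub>fun_field\<^esub>)" "p \<noteq> []" "R.eval p y = 0"
    using R.algebraicE[OF F _ assms] by auto
  then have pol: "set p \<subseteq> ?F" "hd p \<noteq> 0"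
    using univ_poly_carrier[of fun_field ?F p] by (auto simp: polynomial_def)
  define m where "m = length p - 1"
  define c where "c i = p ! (m - i)" for i
  have len: "length p = Suc m" using p(2) by (simp add: m_def)
  have c: "c m \<noteq> 0" "(\<Sum>i\<le>m. c i * y ^ i) = 0" "c i \<in> ?F" for i
  proof -
    show "c m \<noteq> 0" using pol(2) p(2) by (simp add: c_def hd_conv_nth)
    show "(\<Sum>i\<le>m. c i * y ^ i) = 0"
      using p(3) unfolding fun_field_eval len by (simp add: c_def lessThan_Suc_atMost)
    have "m - i < length p" using len by simp
    then show "c i \<in> ?F" using pol(1) by (auto simp: c_def)
  qed
  have "\<forall>i. \<exists>q r. kpoly q \<and> kpoly r \<and> poly r t \<noteq> 0 \<and> c i = poly q t / poly r t"
    using generated_field_fractions[OF c(3)] by blast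
  then obtain q r where qr: "\<And>i. kpoly (q i)" "\<And>i. kpoly (r i)" "\<And>i. poly (r i) t \<noteq> 0"
    "\<And>i. c i = poly (q i) t / poly (r i) t" by metis
  define s where "s i = q i * (\<Prod>j\<in>{..m} - {i}. r j)" for i
  define Q where "Q = (\<Prod>j\<le>m. poly (r j) t)"
  have Q0: "Q \<noteq> 0" using qr(3) by (simp add: Q_def)
  have ks: "kpoly (s i)" for i unfolding s_def by (intro kpoly_mult kpoly_prod qr)
  have sv: "poly (s i) t = c i * Q" if "i \<le> m" for i
  proof -
    have "Q = poly (r i) t * (\<Prod>j\<in>{..m} - {i}. poly (r j) t)"
      unfolding Q_def using that by (subst prod.remove[of "{..m}" i]) auto
    then show ?thesis using qr(3)[of i] by (simp add: s_def qr(4)[of i] poly_prod)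
  qed
  define e where "e = (\<Sum>i\<le>m. Polynomial.degree (s i))"
  have "integral_eq t y m e (\<lambda>i. poly (s i) t)"
    unfolding integral_eq_def
  proof (intro conjI allI impI)
    show "poly (s m) t \<noteq> 0" using sv[of m] c(1) Q0 by simp
    fix i assume "i \<le> m"
    then show "poly (s i) t \<in> vals t e" by (intro valsI ks) (auto simp: e_def intro: member_le_sum)
  next
    have "(\<Sum>i\<le>m. poly (s i) t * y ^ i) = Q * (\<Sum>i\<le>m. c i * y ^ i)"
      unfolding sum_distrib_left by (rule sum.cong) (auto simp: sv)
    then show "(\<Sum>i\<le>m. poly (s i) t * y ^ i) = 0" using c(2) by simp
  qed
  then show ?thesis by blast
qed

text \<open>If two powers agreed, their difference would be an algebraic equation for \<open>t\<close>.\<close>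

lemma transcendental_powers:
  assumes "(ring.transcendental fun_field over k) t"
  shows "inj (\<lambda>n::nat. t ^ n)"
proof (rule injI)
  fix m n :: nat assume mn: "t ^ m = t ^ n"
  interpret R: Ring.field "fun_field :: 'a ring" by (rule fun_field_field)
  have inj: "inj_on (\<lambda>p. R.eval p t) (carrier (k[X]\<^bsub>fun_field\<^esub>))"
    using assms unfolding over_def R.transcendental_def .
  define h where "h n = (1::'a) # replicate n 0" for n :: nat
  have hc: "h n \<in> carrier (k[X]\<^bsub>fun_field\<^esub>)" for n
    using zero_k one_k by (auto simp: univ_poly_carrier[symmetric] polynomial_def h_def)
  have ev: "R.eval (h n) t = t ^ n" for n
  proof -
    have "(\<Sum>i<n. ((1::'a) # replicate n 0) ! (n - i) * t ^ i) = 0"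
      by (rule sum.neutral) (auto simp: nth_Cons')
    then show ?thesis unfolding fun_field_eval h_def by simp
  qed
  have "R.eval (h m) t = R.eval (h n) t" by (simp only: ev mn)
  from inj_onD[OF inj this hc hc] have "length (h m) = length (h n)" by simp
  then show "m = n" by (simp add: h_def)
qed

end

text \<open>A field of transcendence degree one over \<open>k\<close>.  That the degree is at most one is used in the form
  that, in any subring that contains \<open>k\<close>, an element \<open>y\<close> is algebraic over \<open>k\<close> modulo any nonzero \<open>b\<close>.\<close>

locale function_field = finite_subfield +
  assumes dependent: "\<lbrakk>b \<noteq> 0; add_subgroup R; k \<subseteq> R; y \<in> R; b \<in> R; \<And>u v. u \<in> R \<Longrightarrow> v \<in> R \<Longrightarrow> u * v \<in> R\<rbrakk>
      \<Longrightarrow> \<exists>p w. p \<noteq> 0 \<and> kpoly p \<and> w \<in> R \<and> poly p y = b * w"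
    and transcendental: "\<exists>t::'a. inj (\<lambda>n::nat. t ^ n)"

lemma trdeg_one_function_field:
  assumes "subfield k (fun_field :: 'a::field ring)" "finite k" "has_trdeg_one k"
  shows "function_field k"
proof -
  interpret finite_subfield k by (rule subfield_finite_subfield[OF assms(1,2)])
  obtain t where t: "(ring.transcendental fun_field over k) t"
    "\<And>a. (ring.algebraic fun_field over (generate_field fun_field (insert t k))) a"
    using assms(3) by (auto simp: has_trdeg_one_def)
  show ?thesis
  proof
    show "\<exists>t::'a. inj (\<lambda>n::nat. t ^ n)" using transcendental_powers[OF t(1)] by blast
    fix b y :: 'a and R
    assume R: "b \<noteq> 0" "add_subgroup R" "k \<subseteq> R" "y \<in> R" "b \<in> R" "\<And>u v. u \<in> R \<Longrightarrow> v \<in> R \<Longrightarrow> u * v \<in> R"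
    obtain m e a where "integral_eq t y m e a" using algebraic_integral_eq[OF t(2)] by blast
    moreover obtain m' e' a' where "integral_eq t b m' e' a'" using algebraic_integral_eq[OF t(2)] by blast
    ultimately have "\<exists>N d. (\<forall>i j. d i j \<in> k) \<and> (\<exists>i\<le>N. \<exists>j\<le>N. d i j \<noteq> 0) \<and>
      (\<Sum>i\<le>N. \<Sum>j\<le>N. d i j * (y ^ i * b ^ j)) = 0" by (rule dependent_pair)
    then obtain N d where "(\<forall>i j. d i j \<in> k) \<and> (\<exists>i\<le>N. \<exists>j\<le>N. d i j \<noteq> 0) \<and>
      (\<Sum>i\<le>N. \<Sum>j\<le>N. d i j * (y ^ i * b ^ j)) = 0" by (elim exE)
    note d = this[THEN conjunct1] this[THEN conjunct2, THEN conjunct1] this[THEN conjunct2, THEN conjunct2]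
    show "\<exists>p w. p \<noteq> 0 \<and> kpoly p \<and> w \<in> R \<and> poly p y = b * w"
      by (rule dependent_pair_mod[OF d(3) d(1)[rule_format] d(2) R(1-5)]) (rule R(6))
  qed
qed

section \<open>Finite quotients of affine coordinate rings\<close>

definition is_subring :: "'a::field set \<Rightarrow> bool" where
  "is_subring A \<longleftrightarrow> add_subgroup A \<and> 1 \<in> A \<and> (\<forall>a\<in>A. \<forall>b\<in>A. a * b \<in> A)"

definition ideal_of :: "'a::field set \<Rightarrow> 'a set \<Rightarrow> bool" where
  "ideal_of A J \<longleftrightarrow> J \<subseteq> A \<and> add_subgroup J \<and> (\<forall>a\<in>A. \<forall>x\<in>J. a * x \<in> J)"

lemma is_subringD:
  assumes "is_subring A"
  shows "add_subgroup A" "1 \<in> A" "0 \<in> A" "a \<in> A \<Longrightarrow> b \<in> A \<Longrightarrow> a * b \<in> A" "a \<in> A \<Longrightarrow> b \<in> A \<Longrightarrow> a + b \<in> A"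
    "a \<in> A \<Longrightarrow> b \<in> A \<Longrightarrow> a - b \<in> A" "a \<in> A \<Longrightarrow> - a \<in> A" "a \<in> A \<Longrightarrow> a ^ n \<in> A"
proof -
  show s: "add_subgroup A" and o: "1 \<in> A" and m: "a \<in> A \<Longrightarrow> b \<in> A \<Longrightarrow> a * b \<in> A" for a b
    using assms by (auto simp: is_subring_def)
  show "0 \<in> A" "a \<in> A \<Longrightarrow> b \<in> A \<Longrightarrow> a + b \<in> A" "a \<in> A \<Longrightarrow> b \<in> A \<Longrightarrow> a - b \<in> A" "a \<in> A \<Longrightarrow> - a \<in> A"
    using add_subgroupD[OF s] by auto
  show "a \<in> A \<Longrightarrow> a ^ n \<in> A" by (induction n) (auto intro: o m)
qed

lemma add_subgroup_sum: "add_subgroup B \<Longrightarrow> (\<And>i. i \<in> I \<Longrightarrow> f i \<in> B) \<Longrightarrow> sum f I \<in> B"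
  by (induction I rule: infinite_finite_induct) (auto intro: add_subgroupD)

lemma generate_ring_subring: "is_subring (generate_ring fun_field H)"
  unfolding is_subring_def add_subgroup_def
proof (intro conjI ballI)
  interpret R: ring "fun_field :: 'a ring" by (rule fun_field_ring)
  show "0 \<in> generate_ring fun_field H" using R.zero_in_generate[of H] by simp
  show "1 \<in> generate_ring fun_field H" using generate_ring.one[of fun_field H] by simp
  fix a b assume ab: "a \<in> generate_ring fun_field H" "b \<in> generate_ring fun_field H"
  show "a * b \<in> generate_ring fun_field H" using generate_ring.eng_mult[OF ab] by simp
  have "- b \<in> generate_ring fun_field H" using generate_ring.a_inv[OF ab(2)] by simp
  then show "a - b \<in> generate_ring fun_field H" using generate_ring.eng_add[OF ab(1)] by fastforce
qed

lemma generate_ring_stable: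
  assumes X: "add_subgroup M" and H: "\<And>h x. h \<in> H \<Longrightarrow> x \<in> M \<Longrightarrow> h * x \<in> M"
    and "z \<in> generate_ring fun_field H" "x \<in> M"
  shows "z * x \<in> M"
  using assms(3,4)
proof (induction arbitrary: x rule: generate_ring.induct)
  case (a_inv h)
  then show ?case using add_subgroupD(2)[OF X] by fastforce
next
  case (eng_add h h')
  then show ?case using add_subgroupD(4)[OF X] by (simp add: distrib_right)
qed (auto simp: mult.assoc intro: H)

context function_field
begin

text \<open>Each generator satisfies an equation over \<open>k\<close> modulo \<open>b\<close>, so that modulo \<open>b\<close> monomials of
  bounded degree span.\<close>

lemma finite_quotient:
  assumes A: "A = generate_ring fun_field (k \<union> Y)" and "finite Y" and b: "b \<in> A" "b \<noteq> 0"
  shows "finite (coset ((*) b ` A) ` A)"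
proof -
  have sA: "is_subring A" unfolding A by (rule generate_ring_subring)
  note AD = is_subringD[OF sA]
  have gen: "k \<subseteq> A" "Y \<subseteq> A" unfolding A by (auto intro: generate_ring.incl)
  define J where "J = (*) b ` A"
  have JI: "b * a \<in> J" if "a \<in> A" for a using that by (auto simp: J_def)
  have sJ: "add_subgroup J"
    unfolding add_subgroup_def
  proof (intro conjI ballI)
    show "0 \<in> J" using JI[OF AD(3)] by simp
    fix u v assume "u \<in> J" "v \<in> J"
    then obtain u' v' where "u' \<in> A" "v' \<in> A" "u = b * u'" "v = b * v'" by (auto simp: J_def)
    then show "u - v \<in> J" using JI[OF AD(6)[of u' v']] by (simp add: right_diff_distrib)
  qed
  have JA: "J \<subseteq> A" using AD(4)[OF b(1)] by (auto simp: J_def)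
  have aJ: "a * u \<in> J" if au: "a \<in> A" "u \<in> J" for a u
  proof -
    obtain u' where "u' \<in> A" "u = b * u'" using au(2) unfolding J_def by blast
    then show ?thesis using JI[OF AD(4)[OF au(1), of u']] by (simp add: ac_simps)
  qed
  \<comment> \<open>modules between \<open>J\<close> and \<open>A\<close>, finite modulo \<open>J\<close> and stable under the generators in \<open>Y'\<close>\<close>
  define good where "good M Y' \<longleftrightarrow> J \<subseteq> M \<and> M \<subseteq> A \<and> add_subgroup M \<and> 1 \<in> M \<and> (\<forall>c\<in>k. \<forall>x\<in>M. c * x \<in> M) \<and>
      (\<forall>y\<in>Y'. \<forall>x\<in>M. y * x \<in> M) \<and> finite (coset J ` M)" for M Y'
  have "\<exists>M. good M Y'" if "Y' \<subseteq> Y" for Y'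
    using finite_subset[OF that \<open>finite Y\<close>] that
  proof (induction Y' rule: finite_induct)
    case empty
    define M where "M = {c + u | c u. c \<in> k \<and> u \<in> J}"
    have MI: "c + u \<in> M" if "c \<in> k" "u \<in> J" for c u using that by (auto simp: M_def)
    have "J \<subseteq> M" using MI[OF zero_k] by auto
    moreover have "1 \<in> M" using MI[OF one_k add_subgroupD(1)[OF sJ]] by simp
    moreover have "M \<subseteq> A" using gen(1) JA AD(5) by (auto simp: M_def)
    moreover have "add_subgroup M"
      unfolding add_subgroup_def
    proof (intro conjI ballI)
      show "0 \<in> M" using \<open>J \<subseteq> M\<close> add_subgroupD(1)[OF sJ] by auto
      fix x y assume "x \<in> M" "y \<in> M"
      then obtain c u d v where "c \<in> k" "u \<in> J" "d \<in> k" "v \<in> J" "x = c + u" "y = d + v" by (auto simp: M_def)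
      then show "x - y \<in> M" using MI[of "c - d" "u - v"] diff_k add_subgroupD(3)[OF sJ] by (simp add: algebra_simps)
    qed
    moreover have "c * x \<in> M" if c: "c \<in> k" and x: "x \<in> M" for c x
    proof -
      obtain d u where "d \<in> k" "u \<in> J" "x = d + u" using x by (auto simp: M_def)
      moreover have "c * u \<in> J" using aJ[of c u] c gen(1) \<open>u \<in> J\<close> by auto
      ultimately show ?thesis using MI[of "c * d" "c * u"] mult_k[OF c] by (simp add: distrib_left)
    qed
    moreover have "finite (coset J ` M)"
    proof (rule finite_surj[OF finite_k])
      show "coset J ` M \<subseteq> coset J ` k"
      proof (rule image_subsetI)
        fix x assume "x \<in> M"
        then obtain c u where "c \<in> k" "u \<in> J" "x = c + u" by (auto simp: M_def)
        moreover from this have "coset J x = coset J c" by (simp add: coset_eq_iff[OF sJ])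
        ultimately show "coset J x \<in> coset J ` k" by simp
      qed
    qed
    ultimately have "good M {}" by (simp add: good_def)
    then show ?case by (rule exI)
  next
    case (insert y Y')
    then obtain M where gM: "good M Y'" by auto
    have M: "J \<subseteq> M" "M \<subseteq> A" "add_subgroup M" "1 \<in> M" "\<And>c x. c \<in> k \<Longrightarrow> x \<in> M \<Longrightarrow> c * x \<in> M"
      "\<And>z x. z \<in> Y' \<Longrightarrow> x \<in> M \<Longrightarrow> z * x \<in> M" "finite (coset J ` M)" using gM by (simp_all add: good_def)
    have yA: "y \<in> A" using insert.prems gen(2) by blast
    obtain p0 w0 where p0: "p0 \<noteq> 0" "kpoly p0" "w0 \<in> A" "poly p0 y = b * w0"
      using dependent[OF b(2) AD(1) gen(1) yA b(1) AD(4)] by blast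
    (* multiplying by the variable makes the degree positive *)
    define p where "p = pCons 0 p0"
    define w where "w = y * w0"
    have p: "p \<noteq> 0" "kpoly p" "w \<in> A" "poly p y = b * w"
      using p0 AD(4)[OF yA p0(3)] by (auto simp: p_def w_def kpoly_def coeff_pCons zero_k split: nat.split)
    define m where "m = Polynomial.degree p"
    have m: "m > 0" using p0(1) by (simp add: m_def p_def)
    define lc where "lc = inverse (Polynomial.coeff p m)"
    have lc: "lc \<in> k" "lc * Polynomial.coeff p m = 1"
      using p(1,2) inverse_k by (auto simp: lc_def m_def kpoly_def)
    \<comment> \<open>the powers of \<open>y\<close> below the degree of its equation modulo \<open>b\<close> suffice\<close>
    define M' where "M' = {(\<Sum>i<m. x i * y ^ i) | x. \<forall>i<m. x i \<in> M}"
    have MI: "(\<Sum>i<m. x i * y ^ i) \<in> M'" if "\<And>i. i < m \<Longrightarrow> x i \<in> M" for x using that by (auto simp: M'_def)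
    have ME: "\<exists>x. (\<forall>i<m. x i \<in> M) \<and> z = (\<Sum>i<m. x i * y ^ i)" if "z \<in> M'" for z using that by (auto simp: M'_def)
    have MM: "M \<subseteq> M'"
    proof
      fix z assume "z \<in> M"
      then have "(\<Sum>i<m. (if i = 0 then z else 0) * y ^ i) \<in> M'" using add_subgroupD(1)[OF M(3)] by (intro MI) auto
      also have "(\<Sum>i<m. (if i = 0 then z else 0) * y ^ i) = z"
        using m by (simp add: if_distrib[of "\<lambda>x. x * _"] cong: if_cong)
      finally show "z \<in> M'" .
    qed
    have "M' \<subseteq> A"
    proof
      fix z assume "z \<in> M'"
      then obtain x where "\<forall>i<m. x i \<in> M" "z = (\<Sum>i<m. x i * y ^ i)" using ME by blast
      then show "z \<in> A" using M(2) AD(8)[OF yA] by (auto intro!: add_subgroup_sum[OF AD(1)] AD(4))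
    qed
    moreover have "add_subgroup M'"
      unfolding add_subgroup_def
    proof (intro conjI ballI)
      show "0 \<in> M'" using MM add_subgroupD(1)[OF M(3)] by auto
      fix u v assume "u \<in> M'" "v \<in> M'"
      then obtain x x' where x: "\<forall>i<m. x i \<in> M" "u = (\<Sum>i<m. x i * y ^ i)" "\<forall>i<m. x' i \<in> M" "v = (\<Sum>i<m. x' i * y ^ i)"
        using ME by meson
      then have "u - v = (\<Sum>i<m. (x i - x' i) * y ^ i)" by (simp add: left_diff_distrib sum_subtractf)
      then show "u - v \<in> M'" using MI[of "\<lambda>i. x i - x' i"] x add_subgroupD(3)[OF M(3)] by simp
    qed
    moreover have mult: "c * z \<in> M'" if c: "\<And>x. x \<in> M \<Longrightarrow> c * x \<in> M" and z: "z \<in> M'" for c z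
    proof -
      obtain x where x: "\<forall>i<m. x i \<in> M" "z = (\<Sum>i<m. x i * y ^ i)" using ME[OF z] by blast
      then have "c * z = (\<Sum>i<m. (c * x i) * y ^ i)" by (simp add: sum_distrib_left mult.assoc)
      then show ?thesis using MI[of "\<lambda>i. c * x i"] x c by simp
    qed
    moreover have "y * z \<in> M'" if z: "z \<in> M'" for z
    proof -
      obtain x where x: "\<forall>i<m. x i \<in> M" "z = (\<Sum>i<m. x i * y ^ i)" using ME[OF z] by blast
      obtain l where l: "m = Suc l" using m by (cases m) auto
      define x' where "x' i = (if i = 0 then b * (lc * (x l * w)) else x (i - 1)) - lc * Polynomial.coeff p i * x l" for i
      have xl: "x l \<in> M" "x l \<in> A" using x(1) l M(2) by auto
      have "x' i \<in> M" if "i < m" for i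
      proof -
        have "b * (lc * (x l * w)) \<in> M" using JI[of "lc * (x l * w)"] xl p(3) lc(1) gen(1) M(1) AD(4) by blast
        moreover have "x (i - 1) \<in> M" using x(1) that by auto
        moreover have "lc * Polynomial.coeff p i * x l \<in> M"
          using M(5)[OF mult_k[OF lc(1)] xl(1)] p(2) by (auto simp: kpoly_def)
        ultimately show ?thesis unfolding x'_def by (auto intro: add_subgroupD(3)[OF M(3)])
      qed
      moreover have "y * z = (\<Sum>i<m. x' i * y ^ i)"
      proof -
        have "b * w = (\<Sum>i<m. Polynomial.coeff p i * y ^ i) + Polynomial.coeff p m * y ^ m"
          unfolding p(4)[symmetric] poly_altdef m_def[symmetric] lessThan_Suc_atMost[symmetric] by simp
        then have "lc * (b * w) = lc * (\<Sum>i<m. Polynomial.coeff p i * y ^ i) + (lc * Polynomial.coeff p m) * y ^ m"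
          by (simp add: distrib_left mult.assoc)
        then have top: "y ^ m = lc * (b * w) - lc * (\<Sum>i<m. Polynomial.coeff p i * y ^ i)" by (simp add: lc(2))
        have "y * z = (\<Sum>i<l. x i * y ^ Suc i) + x l * y ^ m"
          unfolding x(2) l by (simp add: sum_distrib_left algebra_simps)
        also have "\<dots> = (\<Sum>i<m. (if i = 0 then b * (lc * (x l * w)) else x (i - 1)) * y ^ i) -
            (\<Sum>i<m. lc * Polynomial.coeff p i * x l * y ^ i)"
          unfolding top unfolding l sum.lessThan_Suc_shift[of "\<lambda>i. (if i = 0 then _ i else _ i) * _ i"]
          by (simp add: sum_distrib_left algebra_simps)
        also have "\<dots> = (\<Sum>i<m. x' i * y ^ i)" by (simp add: x'_def left_diff_distrib sum_subtractf)
        finally show ?thesis .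
      qed
      ultimately show ?thesis using MI by simp
    qed
    moreover have "finite (coset J ` M')"
    proof -
      define rep where "rep c = (SOME x. x \<in> M \<and> coset J x = c)" for c
      have rep: "rep (coset J x) \<in> M \<and> coset J (rep (coset J x)) = coset J x" if "x \<in> M" for x
        unfolding rep_def by (rule someI[of _ x]) (use that in auto)
      let ?G = "PiE {..<m} (\<lambda>_. coset J ` M)"
      have fG: "finite ?G" using M(7) by (intro finite_PiE) auto
      show ?thesis
      proof (rule finite_surj[OF fG])
        show "coset J ` M' \<subseteq> (\<lambda>c. coset J (\<Sum>i<m. rep (c i) * y ^ i)) ` ?G"
        proof (rule image_subsetI)
          fix z assume "z \<in> M'"
          then obtain x where x: "\<forall>i<m. x i \<in> M" "z = (\<Sum>i<m. x i * y ^ i)" using ME by blast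
          let ?c = "restrict (\<lambda>i. coset J (x i)) {..<m}"
          have "z - (\<Sum>i<m. rep (?c i) * y ^ i) = (\<Sum>i<m. y ^ i * (x i - rep (coset J (x i))))"
            unfolding x(2) by (simp add: sum_subtractf right_diff_distrib ac_simps)
          also have "\<dots> \<in> J"
          proof (rule add_subgroup_sum[OF sJ], rule aJ[OF AD(8)[OF yA]])
            fix i assume "i \<in> {..<m}"
            then have "coset J (x i) = coset J (rep (coset J (x i)))" using rep x(1) by simp
            then show "x i - rep (coset J (x i)) \<in> J" by (simp only: coset_eq_iff[OF sJ])
          qed
          finally have "coset J z = coset J (\<Sum>i<m. rep (?c i) * y ^ i)" by (simp only: coset_eq_iff[OF sJ])
          moreover have "?c \<in> ?G" using x(1) by auto
          ultimately show "coset J z \<in> (\<lambda>c. coset J (\<Sum>i<m. rep (c i) * y ^ i)) ` ?G" by (rule image_eqI)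
        qed
      qed
    qed
    moreover have "J \<subseteq> M'" "1 \<in> M'" using M(1,4) MM by auto
    ultimately have "good M' (insert y Y')"
      using M(5,6) by (simp add: good_def)
    then show ?case by (rule exI)
  qed
  from this[OF order_refl] obtain M where "good M Y" by blast
  then have M: "add_subgroup M" "1 \<in> M" "\<forall>c\<in>k. \<forall>x\<in>M. c * x \<in> M"
    "\<forall>y\<in>Y. \<forall>x\<in>M. y * x \<in> M" "finite (coset J ` M)" by (simp_all add: good_def)
  have "A \<subseteq> M"
  proof
    fix z assume "z \<in> A"
    have "z * 1 \<in> M"
    proof (rule generate_ring_stable[OF M(1) _ _ M(2)])
      show "z \<in> generate_ring fun_field (k \<union> Y)" using \<open>z \<in> A\<close> by (simp only: A)
      show "h * x \<in> M" if "h \<in> k \<union> Y" "x \<in> M" for h x using that M(3,4) by blast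
    qed
    then show "z \<in> M" by simp
  qed
  from finite_subset[OF image_mono[OF this] M(5)] show ?thesis unfolding J_def .
qed

end

section \<open>Maximal ideals and local rings\<close>

definition max_ideal :: "'a::field set \<Rightarrow> 'a set \<Rightarrow> bool" where
  "max_ideal A M \<longleftrightarrow> ideal_of A M \<and> 1 \<notin> M \<and> (\<forall>J. ideal_of A J \<and> M \<subseteq> J \<longrightarrow> J = M \<or> J = A)"

lemma ideal_ofD:
  assumes "ideal_of A J"
  shows "J \<subseteq> A" "add_subgroup J" "a \<in> A \<Longrightarrow> u \<in> J \<Longrightarrow> a * u \<in> J" "a \<in> A \<Longrightarrow> u \<in> J \<Longrightarrow> u * a \<in> J"
  using assms by (auto simp: ideal_of_def mult.commute)

lemma ideal_eq_ring: "is_subring A \<Longrightarrow> ideal_of A J \<Longrightarrow> 1 \<in> J \<Longrightarrow> J = A"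
proof -
  assume "is_subring A" and J: "ideal_of A J" and 1: "1 \<in> J"
  have "a \<in> J" if "a \<in> A" for a using ideal_ofD(3)[OF J that 1] by simp
  then show "J = A" using ideal_ofD(1)[OF J] by blast
qed

lemma ideal_sum_line:
  assumes A: "is_subring A" and M: "ideal_of A M" and a: "a \<in> A"
  shows "ideal_of A {u + a * s | u s. u \<in> M \<and> s \<in> A}" (is "ideal_of A ?J")
proof -
  have JI: "u + a * s \<in> ?J" if "u \<in> M" "s \<in> A" for u s using that by blast
  have "add_subgroup ?J"
    unfolding add_subgroup_def
  proof (intro conjI ballI)
    show "0 \<in> ?J" using JI[OF add_subgroupD(1)[OF ideal_ofD(2)[OF M]] is_subringD(3)[OF A]] by simp
    fix y z assume "y \<in> ?J" "z \<in> ?J"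
    then obtain u s u' s' where "u \<in> M" "s \<in> A" "y = u + a * s" "u' \<in> M" "s' \<in> A" "z = u' + a * s'" by blast
    then show "y - z \<in> ?J"
      using JI[of "u - u'" "s - s'"] add_subgroupD(3)[OF ideal_ofD(2)[OF M]] is_subringD(6)[OF A]
      by (simp add: algebra_simps)
  qed
  moreover have "c * z \<in> ?J" if c: "c \<in> A" and z: "z \<in> ?J" for c z
  proof -
    obtain u s where us: "u \<in> M" "s \<in> A" "z = u + a * s" using z by blast
    have "c * u + a * (c * s) \<in> ?J" using us ideal_ofD(3)[OF M c] is_subringD(4)[OF A c] by (intro JI) auto
    then show ?thesis by (simp add: us(3) algebra_simps)
  qed
  moreover have "?J \<subseteq> A"
    using ideal_ofD(1)[OF M] is_subringD(4)[OF A a] is_subringD(5)[OF A] by blast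
  ultimately show ?thesis unfolding ideal_of_def by blast
qed

lemma max_ideal_inverse:
  assumes A: "is_subring A" and M: "max_ideal A M" and a: "a \<in> A" "a \<notin> M"
  shows "\<exists>s\<in>A. 1 - a * s \<in> M"
proof -
  have iM: "ideal_of A M" using M by (simp add: max_ideal_def)
  let ?J = "{u + a * s | u s. u \<in> M \<and> s \<in> A}"
  have J: "ideal_of A ?J" by (rule ideal_sum_line[OF A iM a(1)])
  have "M \<subseteq> ?J"
  proof
    fix u assume "u \<in> M"
    then have "u + a * 0 \<in> ?J" using is_subringD(3)[OF A] by blast
    then show "u \<in> ?J" by simp
  qed
  moreover have "0 + a * 1 \<in> ?J"
    using is_subringD(2)[OF A] add_subgroupD(1)[OF ideal_ofD(2)[OF iM]] by blast
  then have "?J \<noteq> M" using a by auto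
  ultimately have "?J = A" using M J unfolding max_ideal_def by blast
  then have "1 \<in> ?J" using is_subringD(2)[OF A] by simp
  then obtain u s where us: "u \<in> M" "s \<in> A" "1 = u + a * s" by blast
  then have "1 - a * s = u" by (metis add_diff_cancel_right')
  then show ?thesis using us by (intro bexI[of _ s]) simp_all
qed

lemma max_ideal_prime:
  assumes A: "is_subring A" and M: "max_ideal A M" and ab: "a \<in> A" "b \<in> A" "a * b \<in> M"
  shows "a \<in> M \<or> b \<in> M"
proof (rule ccontr)
  assume "\<not> ?thesis"
  then obtain s where s: "s \<in> A" "1 - a * s \<in> M" "b \<notin> M" using max_ideal_inverse[OF A M ab(1)] by blast
  have iM: "ideal_of A M" using M by (simp add: max_ideal_def)
  have "b * (1 - a * s) + s * (a * b) \<in> M"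
    using s ab ideal_ofD(3)[OF iM] by (intro add_subgroupD(4)[OF ideal_ofD(2)[OF iM]]) auto
  then show False using s by (simp add: algebra_simps)
qed

lemma ideal_iff:
  assumes "is_subring A"
  shows "ideal J (fun_field\<lparr>carrier := A\<rparr>) \<longleftrightarrow> ideal_of A J"
proof -
  interpret R: ring "fun_field :: 'a ring" by (rule fun_field_ring)
  have "subring A fun_field"
    using is_subringD[OF assms] by (intro R.subringI) auto
  then have rA: "ring (fun_field\<lparr>carrier := A\<rparr>)" using R.subring_is_ring by blast
  show ?thesis
  proof
    assume "ideal J (fun_field\<lparr>carrier := A\<rparr>)"
    then interpret J: ideal J "fun_field\<lparr>carrier := A\<rparr>" .
    have "J \<subseteq> A" using J.a_subset by simp
    moreover have "add_subgroup J"
      unfolding add_subgroup_def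
    proof (intro conjI ballI)
      show "0 \<in> J" using additive_subgroup.zero_closed[OF J.additive_subgroup_axioms] by simp
      fix a b assume ab: "a \<in> J" "b \<in> J"
      have "(-1) * b \<in> J" using J.I_l_closed[OF ab(2), of "-1"] is_subringD(2,7)[OF assms] by auto
      then show "a - b \<in> J" using additive_subgroup.a_closed[OF J.additive_subgroup_axioms ab(1), of "-b"] by simp
    qed
    moreover have "a * u \<in> J" if "a \<in> A" "u \<in> J" for a u using J.I_l_closed[OF that(2), of a] that by simp
    ultimately show "ideal_of A J" by (auto simp: ideal_of_def)
  next
    assume J: "ideal_of A J"
    show "ideal J (fun_field\<lparr>carrier := A\<rparr>)"
    proof (rule idealI[OF rA])
      interpret RA: ring "fun_field\<lparr>carrier := A\<rparr>" by (rule rA)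
      show "subgroup J (add_monoid (fun_field\<lparr>carrier := A\<rparr>))"
      proof (rule group.subgroupI)
        show "group (add_monoid (fun_field\<lparr>carrier := A\<rparr>))" by (rule RA.a_group)
        show "J \<subseteq> carrier (add_monoid (fun_field\<lparr>carrier := A\<rparr>))" "J \<noteq> {}"
          using ideal_ofD(1,2)[OF J] add_subgroupD(1) by auto
        fix a b assume ab: "a \<in> J" "b \<in> J"
        show "a \<otimes>\<^bsub>add_monoid (fun_field\<lparr>carrier := A\<rparr>)\<^esub> b \<in> J"
          using ab add_subgroupD(4)[OF ideal_ofD(2)[OF J]] by simp
        have a: "a \<in> A" "- a \<in> A" "- a \<in> J" using ab ideal_ofD(1)[OF J] add_subgroupD(2)[OF ideal_ofD(2)[OF J]] by auto
        have "inv\<^bsub>add_monoid (fun_field\<lparr>carrier := A\<rparr>)\<^esub> a = - a"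
          by (rule group.inv_equality[OF RA.a_group]) (use a in auto)
        then show "inv\<^bsub>add_monoid (fun_field\<lparr>carrier := A\<rparr>)\<^esub> a \<in> J" using a by simp
      qed
    qed (use ideal_ofD(3,4)[OF J] in auto)
  qed
qed

lemma maximalideal_iff:
  assumes "is_subring A"
  shows "maximalideal M (fun_field\<lparr>carrier := A\<rparr>) \<longleftrightarrow> max_ideal A M"
proof
  assume "maximalideal M (fun_field\<lparr>carrier := A\<rparr>)"
  then interpret M: maximalideal M "fun_field\<lparr>carrier := A\<rparr>" .
  have iM: "ideal_of A M" using M.is_ideal ideal_iff[OF assms] by blast
  have "1 \<notin> M" using M.I_notcarr ideal_eq_ring[OF assms iM] by auto
  moreover have "J = M \<or> J = A" if "ideal_of A J" "M \<subseteq> J" for J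
    using M.I_maximal[of J] that ideal_iff[OF assms, of J] ideal_ofD(1)[OF that(1)] by simp
  ultimately show "max_ideal A M" using iM by (auto simp: max_ideal_def)
next
  assume M: "max_ideal A M"
  then have iM: "ideal_of A M" "1 \<notin> M" by (auto simp: max_ideal_def)
  show "maximalideal M (fun_field\<lparr>carrier := A\<rparr>)"
  proof (rule maximalidealI)
    show "ideal M (fun_field\<lparr>carrier := A\<rparr>)" using iM ideal_iff[OF assms] by blast
    show "carrier (fun_field\<lparr>carrier := A\<rparr>) \<noteq> M" using iM(2) is_subringD(2)[OF assms] by auto
    fix J assume "ideal J (fun_field\<lparr>carrier := A\<rparr>)" "M \<subseteq> J" "J \<subseteq> carrier (fun_field\<lparr>carrier := A\<rparr>)"
    then show "J = M \<or> J = carrier (fun_field\<lparr>carrier := A\<rparr>)"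
      using M ideal_iff[OF assms, of J] by (auto simp: max_ideal_def)
  qed
qed

lemma line_ideal: assumes "is_subring A" "b \<in> A" shows "ideal_of A ((*) b ` A)"
proof -
  have "ideal_of A {0}" using is_subringD(3)[OF assms(1)] by (auto simp: ideal_of_def add_subgroup_def)
  from ideal_sum_line[OF assms(1) this assms(2)]
  have "ideal_of A {u + b * s |u s. u \<in> {0} \<and> s \<in> A}" .
  moreover have "{u + b * s |u s. u \<in> {0} \<and> s \<in> A} = (*) b ` A" by auto
  ultimately show ?thesis by simp
qed

text \<open>If the ring modulo \<open>b\<close> is finite, only finitely many ideals contain \<open>b\<close>; in particular maximal
  ones exist.\<close>

lemma finite_ideals_containing:
  assumes A: "is_subring A" and b: "b \<in> A" and fin: "finite (coset ((*) b ` A) ` A)"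
  shows "finite {J. ideal_of A J \<and> b \<in> J}"
proof -
  let ?B = "(*) b ` A"
  have sB: "add_subgroup ?B" using ideal_ofD(2)[OF line_ideal[OF A b]] .
  have *: "J \<subseteq> J'" if J: "ideal_of A J" "b \<in> J" and J': "ideal_of A J'" "b \<in> J'" and e: "coset ?B ` J = coset ?B ` J'" for J J'
  proof
    fix u assume "u \<in> J"
    then have "coset ?B u \<in> coset ?B ` J'" using e by blast
    then obtain v where v: "v \<in> J'" "coset ?B u = coset ?B v" by blast
    then have "u - v \<in> ?B" by (simp only: coset_eq_iff[OF sB])
    moreover have "?B \<subseteq> J'" using ideal_ofD(4)[OF J'(1) _ J'(2)] by auto
    ultimately have "u - v + v \<in> J'" using v(1) by (intro add_subgroupD(4)[OF ideal_ofD(2)[OF J'(1)]]) auto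
    then show "u \<in> J'" by simp
  qed
  have "inj_on ((`) (coset ?B)) {J. ideal_of A J \<and> b \<in> J}"
  proof (rule inj_onI)
    fix J J' assume a: "J \<in> {J. ideal_of A J \<and> b \<in> J}" "J' \<in> {J. ideal_of A J \<and> b \<in> J}" "coset ?B ` J = coset ?B ` J'"
    then show "J = J'" using *[of J J'] *[of J' J] by auto
  qed
  moreover have "(`) (coset ?B) ` {J. ideal_of A J \<and> b \<in> J} \<subseteq> Pow (coset ?B ` A)"
    by (intro image_subsetI PowI image_mono) (auto dest: ideal_ofD(1))
  then have "finite ((`) (coset ?B) ` {J. ideal_of A J \<and> b \<in> J})"
    by (rule finite_subset) (simp add: fin)
  ultimately show ?thesis by (rule finite_imageD[rotated])
qed

text \<open>The proper ideals containing \<open>b\<close> form a finite family, which has a maximal member above \<open>I\<close>.\<close>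

lemma max_ideal_exists:
  assumes A: "is_subring A" and b: "b \<in> A" and fin: "finite (coset ((*) b ` A) ` A)"
    and I: "ideal_of A I" "b \<in> I" "1 \<notin> I"
  shows "\<exists>M. max_ideal A M \<and> I \<subseteq> M"
proof -
  let ?F = "{J. ideal_of A J \<and> b \<in> J \<and> 1 \<notin> J}"
  have "finite ?F" by (rule finite_subset[OF _ finite_ideals_containing[OF A b fin]]) auto
  moreover have "I \<in> ?F" using I by simp
  ultimately have "\<exists>M\<in>?F. I \<subseteq> M \<and> (\<forall>J\<in>?F. M \<subseteq> J \<longrightarrow> M = J)" by (rule finite_has_maximal2)
  then obtain M where M: "M \<in> ?F" "I \<subseteq> M" "\<forall>J\<in>?F. M \<subseteq> J \<longrightarrow> M = J" by (elim bexE conjE)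
  have "J = M \<or> J = A" if J: "ideal_of A J" "M \<subseteq> J" for J
  proof (cases "1 \<in> J")
    case True
    then show ?thesis using ideal_eq_ring[OF A J(1)] by simp
  next
    case False
    then have "J \<in> ?F" using J M(1) by auto
    then show ?thesis using M(3) J(2) by blast
  qed
  then have "max_ideal A M" using M(1) by (simp add: max_ideal_def)
  then show ?thesis using M(2) by blast
qed

lemma (in dvr) is_subring: "is_subring P"
  using fideal_subgroup[of 0] by (auto simp: is_subring_def fideal_0 one_in mult_in)

lemma (in dvr) fideal_1: "fideal P 1 = {a \<in> P. \<forall>b\<in>P. a * b \<noteq> 1}"
proof (intro equalityI subsetI)
  fix a assume a: "a \<in> fideal P 1"
  have "a * b \<noteq> 1" if "b \<in> P" for b
  proof
    assume ab: "a * b = 1"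
    then have "a \<noteq> 0" "b \<noteq> 0" by auto
    then show False using a ord_mult[of a b] ord_nonneg[OF that] ab by (auto simp: fideal_def)
  qed
  moreover have "a \<in> P" using subsetD[OF fideal_antimono[of 0 1] a] by (simp add: fideal_0)
  ultimately show "a \<in> {a \<in> P. \<forall>b\<in>P. a * b \<noteq> 1}" by simp
next
  fix a assume a: "a \<in> {a \<in> P. \<forall>b\<in>P. a * b \<noteq> 1}"
  show "a \<in> fideal P 1"
  proof (cases "a = 0")
    case False
    have "inverse a \<notin> P"
    proof
      assume "inverse a \<in> P"
      then have "a * inverse a \<noteq> 1" using a by blast
      then show False using False by simp
    qed
    then show ?thesis using False by (simp add: fideal_def mem_iff ord_inverse)
  qed simp
qed

lemma (in dvr) not_UNIV: "P \<noteq> UNIV"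
  using uniformizer by (auto simp: is_uniformizer_def)

lemma localization_subring:
  assumes A: "is_subring A" and M: "max_ideal A M"
  shows "is_subring (localization_at A M)" "A \<subseteq> localization_at A M"
    "a \<in> A \<Longrightarrow> s \<in> A \<Longrightarrow> s \<notin> M \<Longrightarrow> a / s \<in> localization_at A M"
proof -
  let ?L = "localization_at A M"
  have iM: "ideal_of A M" "1 \<notin> M" using M by (auto simp: max_ideal_def)
  have M0: "0 \<in> M" using add_subgroupD(1)[OF ideal_ofD(2)[OF iM(1)]] .
  show LI: "a / s \<in> ?L" if "a \<in> A" "s \<in> A" "s \<notin> M" for a s using that by (auto simp: localization_at_def)
  have LE: "\<exists>a s. a \<in> A \<and> s \<in> A \<and> s \<notin> M \<and> s \<noteq> 0 \<and> z = a / s" if "z \<in> ?L" for z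
    using that M0 unfolding localization_at_def by blast
  show AL: "A \<subseteq> ?L" using LI[OF _ is_subringD(2)[OF A] iM(2)] by force
  show "is_subring ?L"
    unfolding is_subring_def add_subgroup_def
  proof (intro conjI ballI)
    show "0 \<in> ?L" "1 \<in> ?L" using AL is_subringD(2,3)[OF A] by auto
    fix y z assume "y \<in> ?L" "z \<in> ?L"
    then obtain a s b t where as: "a \<in> A" "s \<in> A" "s \<notin> M" "s \<noteq> 0" "y = a / s" "b \<in> A" "t \<in> A" "t \<notin> M" "t \<noteq> 0" "z = b / t"
      using LE by meson
    have st: "s * t \<in> A" "s * t \<notin> M" using as max_ideal_prime[OF A M] is_subringD(4)[OF A] by auto
    have "y - z = (a * t - b * s) / (s * t)" "y * z = (a * b) / (s * t)" using as by (auto simp: diff_frac_eq)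
    then show "y - z \<in> ?L" "y * z \<in> ?L"
      using LI[OF _ st] as is_subringD(4,6)[OF A] by auto
  qed
qed

text \<open>Modulo \<open>N\<close>, a fraction \<open>a / s\<close> equals \<open>a s'\<close> with \<open>s s' \<equiv> 1\<close> modulo \<open>M\<close>, so that the finitely many
  residues of \<open>A\<close> modulo \<open>b\<close> suffice.\<close>

lemma localization_residues:
  assumes A: "is_subring A" and M: "max_ideal A M" and b: "b \<in> M" and fin: "finite (coset ((*) b ` A) ` A)"
    and N: "add_subgroup N" "N \<subseteq> localization_at A M" "M \<subseteq> N" "\<And>a u. a \<in> localization_at A M \<Longrightarrow> u \<in> N \<Longrightarrow> a * u \<in> N"
  shows "finite (coset N ` localization_at A M)"
proof (rule finite_surj[OF fin])
  have iM: "ideal_of A M" "1 \<notin> M" using M by (auto simp: max_ideal_def)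
  have M0: "0 \<in> M" using add_subgroupD(1)[OF ideal_ofD(2)[OF iM(1)]] .
  let ?B = "(*) b ` A"
  have bA: "b \<in> A" using b ideal_ofD(1)[OF iM(1)] by auto
  have sB: "add_subgroup ?B" using ideal_ofD(2)[OF line_ideal[OF A bA]] .
  have BN: "?B \<subseteq> N" using ideal_ofD(4)[OF iM(1) _ b] N(3) by auto
  note L = localization_subring[OF A M]
  define h where "h Y = coset N (SOME a. a \<in> A \<and> coset ?B a = Y)" for Y
  show "coset N ` localization_at A M \<subseteq> h ` (coset ?B ` A)"
  proof (rule image_subsetI)
    fix z assume zL: "z \<in> localization_at A M"
    then obtain a s where as: "a \<in> A" "s \<in> A" "s \<notin> M" "z = a / s" by (auto simp: localization_at_def)
    have s0: "s \<noteq> 0" using as(3) M0 by auto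
    obtain r where r: "r \<in> A" "1 - s * r \<in> M" using max_ideal_inverse[OF A M as(2,3)] by blast
    have "z - a * r = z * (1 - s * r)" using s0 as(4) by (simp add: field_simps)
    also have "\<dots> \<in> N" using r(2) N(3) by (intro N(4)[OF zL]) auto
    finally have 1: "z - a * r \<in> N" .
    have arA: "a * r \<in> A" using as(1) r(1) by (rule is_subringD(4)[OF A])
    define c where "c = (SOME c. c \<in> A \<and> coset ?B c = coset ?B (a * r))"
    have "c \<in> A \<and> coset ?B c = coset ?B (a * r)" unfolding c_def by (rule someI[of _ "a * r"]) (simp add: arA)
    then have "c - a * r \<in> ?B" by (simp only: coset_eq_iff[OF sB])
    then have "c - a * r \<in> N" using BN by blast
    from add_subgroupD(3)[OF N(1) 1 this] have "z - c \<in> N" by simp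
    then have "coset N z = coset N c" by (simp only: coset_eq_iff[OF N(1)])
    then have "coset N z = h (coset ?B (a * r))" by (simp add: h_def c_def)
    then show "coset N z \<in> h ` (coset ?B ` A)" using arA by blast
  qed
qed

context function_field
begin

text \<open>The maximal ideal is generated by \<open>t\<close>.  An element \<open>a \<noteq> 0\<close> divides \<open>p(t)\<close> for some nonzero polynomial
  over \<open>k\<close>, which is a unit times a power of \<open>t\<close>; this bounds the power of \<open>t\<close> that can be extracted
  from \<open>a\<close>, and what remains is a unit.\<close>

lemma local_ring_dvr:
  assumes L: "is_subring L" "k \<subseteq> L" and reg: "regular_local_dim_one L"
    and frac: "\<And>z. \<exists>a\<in>L. \<exists>b\<in>L. b \<noteq> 0 \<and> z = a / b"
  shows "dvr L"
proof -
  note LD = is_subringD[OF L(1)]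
  obtain t where t: "t \<noteq> 0" "local_maximal_ideal L = (\<lambda>a. t * a) ` L" using reg by (auto simp: regular_local_dim_one_def)
  have "t \<in> local_maximal_ideal L" unfolding t(2) using LD(2) by (intro image_eqI[of _ _ 1]) auto
  then have tL: "t \<in> L" "\<And>b. b \<in> L \<Longrightarrow> t * b \<noteq> 1" by (auto simp: local_maximal_ideal_def)
  have unit: "unit_of L a" if a: "a \<in> L" "a \<notin> (\<lambda>a. t * a) ` L" for a
  proof -
    have "a \<notin> local_maximal_ideal L" using a(2) by (simp only: t(2) not_False_eq_True)
    then obtain c where c: "c \<in> L" "a * c = 1" using a(1) unfolding local_maximal_ideal_def by blast
    then have "inverse a = c" by (intro inverse_unique)
    then show ?thesis using a(1) c by (auto simp: unit_of_def)
  qed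
  have ku: "c \<notin> (\<lambda>a. t * a) ` L" if "c \<in> k" "c \<noteq> 0" for c
  proof
    assume "c \<in> (\<lambda>a. t * a) ` L"
    then obtain a where a: "a \<in> L" "c = t * a" by blast
    have "t * (a * inverse c) = 1" using that(2) by (metis a(2) mult.assoc right_inverse)
    moreover have "a * inverse c \<in> L" using inverse_k[OF that(1)] L(2) by (intro LD(4) a(1)) auto
    ultimately show False using tL(2) by blast
  qed
  have dec: "\<exists>n u. unit_of L u \<and> a = t ^ n * u" if a: "a \<in> L" "a \<noteq> 0" for a
  proof -
    have "\<exists>p w. p \<noteq> 0 \<and> kpoly p \<and> w \<in> L \<and> poly p t = a * w"
      by (rule dependent[OF a(2) LD(1) L(2) tL(1) a(1)]) (rule LD(4))
    then obtain p w where p: "p \<noteq> 0" "kpoly p" "w \<in> L" "poly p t = a * w" by blast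
    define n where "n = (LEAST i. Polynomial.coeff p i \<noteq> 0)"
    have "\<exists>i. Polynomial.coeff p i \<noteq> 0" using p(1) leading_coeff_0_iff by blast
    then have n: "Polynomial.coeff p n \<noteq> 0" unfolding n_def by (rule LeastI_ex)
    have nl: "Polynomial.coeff p i = 0" if "i < n" for i
      using not_less_Least[of i "\<lambda>i. Polynomial.coeff p i \<noteq> 0"] that unfolding n_def by blast
    have nd: "n \<le> Polynomial.degree p" using n by (rule le_degree)
    let ?c = "Polynomial.coeff p"
    define v where "v = (\<Sum>i\<in>{Suc n..Polynomial.degree p}. ?c i * t ^ (i - Suc n))"
    have ck: "?c i \<in> L" for i using p(2) L(2) by (auto simp: kpoly_def)
    have vL: "v \<in> L" unfolding v_def by (rule add_subgroup_sum[OF LD(1)]) (rule LD(4)[OF ck LD(8)[OF tL(1)]])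
    have "poly p t = (\<Sum>i\<in>{n..Polynomial.degree p}. ?c i * t ^ i)"
      unfolding poly_altdef by (rule sum.mono_neutral_right) (auto simp: nl)
    also have "\<dots> = ?c n * t ^ n + (\<Sum>i\<in>{Suc n..Polynomial.degree p}. ?c i * t ^ i)"
      using nd by (simp add: sum.atLeast_Suc_atMost)
    also have "(\<Sum>i\<in>{Suc n..Polynomial.degree p}. ?c i * t ^ i) = t ^ n * (t * v)"
      unfolding v_def sum_distrib_left
    proof (rule sum.cong[OF refl])
      fix j assume "j \<in> {Suc n..Polynomial.degree p}"
      then have "t ^ j = t ^ n * (t * t ^ (j - Suc n))" by (simp flip: power_add power_Suc)
      then show "?c j * t ^ j = t ^ n * (t * (?c j * t ^ (j - Suc n)))" by (simp add: ac_simps)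
    qed
    finally have pe: "a * w = t ^ n * (?c n + t * v)" using p(4) by (simp add: algebra_simps)
    \<comment> \<open>the lowest coefficient of \<open>p\<close> is a unit, hence no multiple of \<open>t\<close>\<close>
    have bound: "m \<le> n" if m: "a = t ^ m * a'" "a' \<in> L" for m a'
    proof (rule ccontr)
      assume "\<not> m \<le> n"
      then have tm: "t ^ m = t ^ n * (t * t ^ (m - Suc n))" by (simp flip: power_add power_Suc)
      have "t ^ n * (?c n + t * v) = t ^ n * (t * (t ^ (m - Suc n) * a' * w))"
        unfolding pe[symmetric] m(1) tm by (simp only: ac_simps)
      then have "?c n + t * v = t * (t ^ (m - Suc n) * a' * w)" using t(1) by (simp only: mult_cancel_left) simp
      then have "?c n = t * (t ^ (m - Suc n) * a' * w - v)" by (simp only: right_diff_distrib eq_diff_eq)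
      moreover have "t ^ (m - Suc n) * a' * w - v \<in> L"
        by (rule LD(6)[OF LD(4)[OF LD(4)[OF LD(8)[OF tL(1)] m(2)] p(3)] vL])
      ultimately have "?c n \<in> (\<lambda>a. t * a) ` L" by (rule image_eqI)
      then show False using ku[of "?c n"] n p(2) by (auto simp: kpoly_def)
    qed
    define m where "m = Max {m. \<exists>a'\<in>L. a = t ^ m * a'}"
    have fin: "finite {m. \<exists>a'\<in>L. a = t ^ m * a'}" by (rule finite_subset[of _ "{..n}"]) (use bound in auto)
    have "a = t ^ 0 * a" by simp
    then have "0 \<in> {m. \<exists>a'\<in>L. a = t ^ m * a'}" using a(1) by blast
    then have "m \<in> {m. \<exists>a'\<in>L. a = t ^ m * a'}" unfolding m_def using Max_in[OF fin] by blast
    then obtain a' where a': "a' \<in> L" "a = t ^ m * a'" by blast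
    have "a' \<notin> (\<lambda>a. t * a) ` L"
    proof
      assume "a' \<in> (\<lambda>a. t * a) ` L"
      then obtain a'' where "a'' \<in> L" "a = t ^ Suc m * a''" using a'(2) by (auto simp: ac_simps)
      then have "Suc m \<in> {m. \<exists>a'\<in>L. a = t ^ m * a'}" by blast
      then have "Suc m \<le> m" unfolding m_def using fin by (intro Max_ge) (simp_all add: m_def[symmetric])
      then show False by simp
    qed
    then show ?thesis using unit a' by blast
  qed
  show ?thesis
  proof
    show "1 \<in> L" "\<And>a b. a \<in> L \<Longrightarrow> b \<in> L \<Longrightarrow> a + b \<in> L" "\<And>a b. a \<in> L \<Longrightarrow> b \<in> L \<Longrightarrow> a * b \<in> L" "\<And>a. a \<in> L \<Longrightarrow> - a \<in> L"
      using LD by auto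
    show "\<exists>t. is_uniformizer L t"
      unfolding is_uniformizer_def
    proof (intro exI[of _ t] conjI allI impI)
      show "t \<noteq> 0" "t \<in> L" by fact+
      show "inverse t \<notin> L" using tL(2)[of "inverse t"] t(1) by auto
      fix z :: 'a assume "z \<noteq> 0"
      obtain a b where ab: "a \<in> L" "b \<in> L" "b \<noteq> 0" "z = a / b" using frac[of z] by blast
      then have "a \<noteq> 0" using \<open>z \<noteq> 0\<close> by auto
      obtain n u where u: "unit_of L u" "a = t ^ n * u" using dec[OF ab(1) \<open>a \<noteq> 0\<close>] by blast
      obtain m v where v: "unit_of L v" "b = t ^ m * v" using dec[OF ab(2,3)] by blast
      have uv: "u \<noteq> 0" "v \<noteq> 0" "u \<in> L" "v \<in> L" "inverse u \<in> L" "inverse v \<in> L" using u(1) v(1) by (auto simp: unit_of_def)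
      then have "unit_of L (u * inverse v)" using LD(4)[OF uv(3,6)] LD(4)[OF uv(5,4)] by (simp add: unit_of_def)
      moreover have "z = t powi (int n - int m) * (u * inverse v)"
        unfolding ab(4) u(2) v(2) using t(1) uv(1,2) by (simp add: power_int_diff field_simps)
      ultimately show "\<exists>i u. unit_of L u \<and> z = t powi i * u" by blast
    qed
  qed
qed

end

section \<open>The closed points of a projective curve\<close>

text \<open>The closed points of a smooth projective model, over which \<open>smooth_projective_curve\<close> quantifies
  existentially, with \<open>has_trdeg_one\<close> replaced by its consequences in \<open>function_field\<close>.\<close>

locale projective_curve = function_field k for k :: "'a::field set" +
  fixes d :: nat and x :: "nat \<Rightarrow> 'a"
  assumes some_coordinate: "\<exists>i\<le>d. x i \<noteq> 0"
    and generated: "generate_field fun_field (k \<union> {x j / x i | i j. i \<le> d \<and> j \<le> d \<and> x i \<noteq> 0}) = UNIV"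
    and regular: "P \<in> topspace (projective_model k d x) \<Longrightarrow> regular_local_dim_one P"
begin

abbreviation "A i \<equiv> chart_ring k d x i"
abbreviation "S \<equiv> topspace (projective_model k d x)"

lemma A_subring: "is_subring (A i)"
  unfolding chart_ring_def by (rule generate_ring_subring)

lemmas AD = is_subringD[OF A_subring]

lemma k_A: "k \<subseteq> A i"
  unfolding chart_ring_def by (auto intro: generate_ring.incl)

lemma coordinate_A: "j \<le> d \<Longrightarrow> x j / x i \<in> A i"
  unfolding chart_ring_def by (rule generate_ring.incl) auto

lemma A_finite_quotient:
  assumes "b \<in> A i" "b \<noteq> 0" shows "finite (coset ((*) b ` A i) ` A i)"
proof (rule finite_quotient[OF chart_ring_def[of k d x i] _ assms])
  have "{x j / x i |j. j \<le> d} = (\<lambda>j. x j / x i) ` {..d}" by auto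
  then show "finite {x j / x i |j. j \<le> d}" by simp
qed

lemma A_fractions:
  assumes i: "i \<le> d" "x i \<noteq> 0" shows "\<exists>a\<in>A i. \<exists>b\<in>A i. b \<noteq> 0 \<and> z = a / b"
proof -
  have "z \<in> generate_field fun_field (k \<union> {x j / x i | i j. i \<le> d \<and> j \<le> d \<and> x i \<noteq> 0})"
    using generated by simp
  then show ?thesis
  proof (induction rule: generate_field.induct)
    case one
    show ?case using AD(2)[of i] by (intro bexI[of _ 1]) auto
  next
    case (incl h)
    show ?case
    proof (cases "h \<in> k")
      case True
      then show ?thesis using k_A[of i] AD(2)[of i] by (intro bexI[of _ h] bexI[of _ 1]) auto
    next
      case False
      then obtain j l where jl: "l \<le> d" "j \<le> d" "x l \<noteq> 0" "h = x j / x l" using incl by auto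
      show ?thesis
      proof (intro bexI conjI)
        show "x l / x i \<noteq> 0" using jl i by simp
        show "h = (x j / x i) / (x l / x i)" using jl i by simp
      qed (use coordinate_A jl in auto)
    qed
  next
    case (a_inv h)
    then obtain a b where "a \<in> A i" "b \<in> A i" "b \<noteq> 0" "h = a / b" by blast
    then show ?case using AD(7)[of a i] by (intro bexI[of _ "- a"] bexI[of _ b]) auto
  next
    case (m_inv h)
    then obtain a b where "a \<in> A i" "b \<in> A i" "b \<noteq> 0" "h = a / b" by blast
    then show ?case using m_inv(2) by (intro bexI[of _ b] bexI[of _ a]) (auto simp: fun_field_inv)
  next
    case (eng_add h h')
    then obtain a b a' b' where ab: "a \<in> A i" "b \<in> A i" "b \<noteq> 0" "h = a / b" "a' \<in> A i" "b' \<in> A i" "b' \<noteq> 0" "h' = a' / b'" by blast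
    then show ?case
      by (intro bexI[of _ "a * b' + a' * b"] bexI[of _ "b * b'"]) (auto simp: add_frac_eq intro!: AD(4,5))
  next
    case (eng_mult h h')
    then obtain a b a' b' where ab: "a \<in> A i" "b \<in> A i" "b \<noteq> 0" "h = a / b" "a' \<in> A i" "b' \<in> A i" "b' \<noteq> 0" "h' = a' / b'" by blast
    then show ?case
      by (intro bexI[of _ "a * a'"] bexI[of _ "b * b'"]) (auto intro!: AD(4))
  qed
qed

lemma S_eq: "S = \<Union> {principal_open k d x i a | i a. i \<le> d \<and> x i \<noteq> 0 \<and> a \<in> A i}"
  unfolding projective_model_def by (rule topology_generated_by_topspace)

lemma principal_open_iff:
  "P \<in> principal_open k d x i a \<longleftrightarrow> (\<exists>M. P = localization_at (A i) M \<and> max_ideal (A i) M \<and> a \<notin> M)"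
  unfolding principal_open_def maximalideal_iff[OF A_subring] by blast

lemma S_iff: "P \<in> S \<longleftrightarrow> (\<exists>i M. i \<le> d \<and> x i \<noteq> 0 \<and> max_ideal (A i) M \<and> P = localization_at (A i) M)"
proof
  assume "P \<in> S"
  then obtain i a where "i \<le> d" "x i \<noteq> 0" "P \<in> principal_open k d x i a" unfolding S_eq by blast
  then show "\<exists>i M. i \<le> d \<and> x i \<noteq> 0 \<and> max_ideal (A i) M \<and> P = localization_at (A i) M"
    unfolding principal_open_iff by blast
next
  assume "\<exists>i M. i \<le> d \<and> x i \<noteq> 0 \<and> max_ideal (A i) M \<and> P = localization_at (A i) M"
  then obtain i M where iM: "i \<le> d" "x i \<noteq> 0" "max_ideal (A i) M" "P = localization_at (A i) M" by blast
  then have "P \<in> principal_open k d x i 1" unfolding principal_open_iff by (auto simp: max_ideal_def)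
  then show "P \<in> S" unfolding S_eq using iM AD(2) by blast
qed

lemma chart_point:
  assumes "i \<le> d" "x i \<noteq> 0" "max_ideal (A i) M" "P = localization_at (A i) M"
  shows "dvr P" "k \<subseteq> P" "A i \<subseteq> P" "M = A i \<inter> fideal P 1" "\<exists>b\<in>M. b \<noteq> 0"
    "finite (coset (fideal P 1) ` P)"
proof -
  have PS: "P \<in> S" unfolding S_iff using assms by blast
  have iM: "ideal_of (A i) M" "1 \<notin> M" using assms(3) by (auto simp: max_ideal_def)
  have M0: "0 \<in> M" using add_subgroupD(1)[OF ideal_ofD(2)[OF iM(1)]] .
  note L = localization_subring[OF A_subring assms(3), folded assms(4)]
  show kP: "k \<subseteq> P" and AP: "A i \<subseteq> P" using k_A L(2) by blast+
  show dvrP: "dvr P"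
  proof (rule local_ring_dvr[OF L(1) kP regular[OF PS]])
    fix z show "\<exists>a\<in>P. \<exists>b\<in>P. b \<noteq> 0 \<and> z = a / b" using A_fractions[OF assms(1,2), of z] AP by blast
  qed
  interpret dvr P by (rule dvrP)
  have MF: "M \<subseteq> fideal P 1"
  proof
    fix m assume m: "m \<in> M"
    have mP: "m \<in> P" using m ideal_ofD(1)[OF iM(1)] AP by blast
    have "m * c \<noteq> 1" if c: "c \<in> P" for c
    proof
      assume mc: "m * c = 1"
      obtain a s where as: "a \<in> A i" "s \<in> A i - M" "c = a / s" using c unfolding assms(4) localization_at_def by blast
      have "s \<noteq> 0" using as(2) M0 by auto
      then have "m * a = s" using mc as(3) by (simp add: field_simps)
      moreover have "m * a \<in> M" by (rule ideal_ofD(4)[OF iM(1) as(1) m])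
      ultimately show False using as(2) by simp
    qed
    then show "m \<in> fideal P 1" unfolding fideal_1 using mP by blast
  qed
  have I: "ideal_of (A i) (A i \<inter> fideal P 1)"
    unfolding ideal_of_def add_subgroup_def
  proof (intro conjI ballI)
    show "A i \<inter> fideal P 1 \<subseteq> A i" by blast
    show "0 \<in> A i \<inter> fideal P 1" using AD(3) by simp
    show "a - b \<in> A i \<inter> fideal P 1" if "a \<in> A i \<inter> fideal P 1" "b \<in> A i \<inter> fideal P 1" for a b
      using that AD(6) fideal_diff by simp
    show "a * b \<in> A i \<inter> fideal P 1" if "a \<in> A i" "b \<in> A i \<inter> fideal P 1" for a b
      using that AD(4) fideal_mult_left[of a b 1] AP by auto
  qed
  have "1 \<notin> fideal P 1" by (simp add: fideal_def)
  moreover have "M \<subseteq> A i \<inter> fideal P 1" using MF ideal_ofD(1)[OF iM(1)] by blast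
  ultimately show Meq: "M = A i \<inter> fideal P 1" using assms(3) I AD(2)[of i] unfolding max_ideal_def by blast
  have "uniformizer P \<in> P" using mem_iff[of "uniformizer P"] by simp
  then obtain a s where as: "a \<in> A i" "s \<in> A i - M" "uniformizer P = a / s" unfolding assms(4) localization_at_def by blast
  have "a \<in> M"
  proof (rule ccontr)
    assume "a \<notin> M"
    then have "s / a \<in> P" unfolding assms(4) localization_at_def using as(1,2) by blast
    then have "inverse (uniformizer P) \<in> P" using as(3) by simp
    then show False using uniformizer by (simp add: is_uniformizer_def)
  qed
  moreover have "a \<noteq> 0" using as(3) unif_neq_0 by auto
  ultimately show ex: "\<exists>b\<in>M. b \<noteq> 0" by blast
  then obtain b where b: "b \<in> M" "b \<noteq> 0" by blast
  have bA: "b \<in> A i" using b ideal_ofD(1)[OF iM(1)] by blast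
  show "finite (coset (fideal P 1) ` P)"
  proof (rule localization_residues[OF A_subring assms(3) b(1) A_finite_quotient[OF bA b(2)], folded assms(4)])
    show "add_subgroup (fideal P 1)" by (rule fideal_subgroup)
    show "fideal P 1 \<subseteq> P" using fideal_antimono[of 0 1] by (simp add: fideal_0)
    show "M \<subseteq> fideal P 1" by (rule MF)
    show "a * u \<in> fideal P 1" if "a \<in> P" "u \<in> fideal P 1" for a u by (rule fideal_mult_left[OF that])
  qed
qed

lemma S_dvr: "P \<in> S \<Longrightarrow> dvr P"
  using S_iff[of P] chart_point(1) by blast

text \<open>The coordinate ring of the chart is contained in \<open>P\<close>, and the functions in it that vanish at \<open>P\<close> form a
  maximal ideal because its quotient is finite.  The localization there is contained in \<open>P\<close>, hence
  equal to \<open>P\<close>, since discrete valuation rings are maximal subrings.\<close>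

lemma point_in_chart:
  assumes P: "P \<in> S" and i: "i \<le> d" "x i \<noteq> 0" and c: "\<And>j. j \<le> d \<Longrightarrow> x j / x i \<in> P"
  shows "max_ideal (A i) (A i \<inter> fideal P 1)" "P = localization_at (A i) (A i \<inter> fideal P 1)"
proof -
  interpret dvr P by (rule S_dvr[OF P])
  have kP: "k \<subseteq> P" using P[unfolded S_iff] chart_point(2) by blast
  have AP: "A i \<subseteq> P"
  proof
    fix z assume z: "z \<in> A i"
    have "z * 1 \<in> P"
    proof (rule generate_ring_stable[OF is_subringD(1)[OF is_subring] _ _ one_in])
      show "z \<in> generate_ring fun_field (k \<union> {x j / x i | j. j \<le> d})" using z by (simp only: chart_ring_def)
      show "h * y \<in> P" if "h \<in> k \<union> {x j / x i | j. j \<le> d}" "y \<in> P" for h y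
        using that kP c mult_in[of h y] by auto
    qed
    then show "z \<in> P" by simp
  qed
  let ?M = "A i \<inter> fideal P 1"
  have I: "ideal_of (A i) ?M"
    unfolding ideal_of_def add_subgroup_def
  proof (intro conjI ballI)
    show "0 \<in> ?M" using AD(3) by simp
    show "a - b \<in> ?M" if "a \<in> ?M" "b \<in> ?M" for a b
      using that AD(6) fideal_diff by simp
    show "a * b \<in> ?M" if "a \<in> A i" "b \<in> ?M" for a b
      using that AD(4) fideal_mult_left[of a b 1] AP by auto
  qed blast
  have one: "1 \<notin> ?M" by (simp add: fideal_def)
  have unit: "inverse a \<in> P" if "a \<in> A i" "a \<notin> ?M" for a
  proof -
    have "a \<noteq> 0" "a \<in> P" "ord P a \<ge> 0" "\<not> ord P a \<ge> 1" using that AP mem_iff by (auto simp: fideal_def)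
    then show ?thesis by (simp add: mem_iff ord_inverse)
  qed
  have ex: "\<exists>b\<in>?M. b \<noteq> 0"
  proof (rule ccontr)
    assume a: "\<not> ?thesis"
    have "z \<in> P" for z
    proof -
      obtain a b where ab: "a \<in> A i" "b \<in> A i" "b \<noteq> 0" "z = a / b" using A_fractions[OF i, of z] by blast
      have "inverse b \<in> P" using unit[OF ab(2)] a ab(2,3) by blast
      then have "a * inverse b \<in> P" using AP ab(1) by (intro mult_in) auto
      then show ?thesis by (simp add: ab(4) divide_inverse)
    qed
    then show False using not_UNIV by blast
  qed
  then obtain b where b: "b \<in> ?M" "b \<noteq> 0" by blast
  have sB: "add_subgroup ((*) b ` A i)" using ideal_ofD(2)[OF line_ideal[OF A_subring]] b(1) by blast
  have "J = ?M \<or> J = A i" if J: "ideal_of (A i) J" "?M \<subseteq> J" for J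
  proof (cases "J = ?M")
    case False
    then obtain a where a: "a \<in> J" "a \<notin> ?M" using J(2) by blast
    have aA: "a \<in> A i" using a(1) ideal_ofD(1)[OF J(1)] by blast
    (* the powers of a repeat modulo b, because the quotient is finite *)
    let ?f = "\<lambda>m::nat. coset ((*) b ` A i) (a ^ m)"
    have "range ?f \<subseteq> coset ((*) b ` A i) ` A i" using AD(8)[OF aA] by blast
    then have "finite (range ?f)" by (rule finite_subset) (rule A_finite_quotient, use b in auto)
    then have "\<not> inj ?f" using finite_imageD[of ?f UNIV] infinite_UNIV_nat by blast
    then obtain m n where "?f m = ?f n" "m \<noteq> n" by (auto simp: inj_def)
    then obtain m n where mn: "?f m = ?f n" "m < n" by (metis linorder_neqE_nat)
    then have "a ^ m - a ^ n \<in> (*) b ` A i" by (simp only: coset_eq_iff[OF sB])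
    then obtain c where c: "c \<in> A i" "a ^ m - a ^ n = b * c" by blast
    have "a ^ m - a ^ n = a ^ m * (1 - a ^ (n - m))" using mn(2) by (simp add: right_diff_distrib flip: power_add)
    then have 1: "a ^ m * (1 - a ^ (n - m)) \<in> fideal P 1"
      using c b(1) subsetD[OF AP c(1)] fideal_mult_left[of c b 1] by (simp add: mult.commute)
    have 2: "inverse (a ^ m) \<in> P" using power_in[OF unit[OF aA a(2)], of m] by (simp add: power_inverse)
    have "a \<noteq> 0" using a(2) add_subgroupD(1)[OF ideal_ofD(2)[OF I]] by metis
    then have "inverse (a ^ m) * (a ^ m * (1 - a ^ (n - m))) = 1 - a ^ (n - m)" by simp
    then have "1 - a ^ (n - m) \<in> fideal P 1" using fideal_mult_left[OF 2 1] by metis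
    moreover have "1 - a ^ (n - m) \<in> A i" by (rule AD(6)[OF AD(2) AD(8)[OF aA]])
    ultimately have "1 - a ^ (n - m) \<in> ?M" by (rule IntI[rotated])
    then have "1 - a ^ (n - m) \<in> J" by (rule subsetD[OF J(2)])
    moreover have "a ^ (n - m) \<in> J"
    proof -
      obtain e where "n - m = Suc e" using mn(2) by (metis Suc_diff_Suc)
      then show ?thesis using ideal_ofD(4)[OF J(1) AD(8)[OF aA, of e] a(1)] by simp
    qed
    ultimately have "1 - a ^ (n - m) + a ^ (n - m) \<in> J" by (rule add_subgroupD(4)[OF ideal_ofD(2)[OF J(1)]])
    then show ?thesis using ideal_eq_ring[OF A_subring J(1)] by simp
  qed simp
  then show M: "max_ideal (A i) ?M" using I one unfolding max_ideal_def by blast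
  let ?L = "localization_at (A i) ?M"
  have "dvr ?L" by (rule chart_point(1)[OF i M refl])
  then interpret L: dvr ?L .
  have "?L \<subseteq> P"
  proof
    fix z assume "z \<in> ?L"
    then obtain a s where as: "a \<in> A i" "s \<in> A i - ?M" "z = a / s" unfolding localization_at_def by blast
    have "a * inverse s \<in> P" using as(1) AP unit[of s] as(2) by (intro mult_in) auto
    then show "z \<in> P" by (simp add: as(3) divide_inverse)
  qed
  then show "P = ?L" using L.maximal_subring[of P] mult_in not_UNIV by blast
qed

text \<open>In each chart \<open>f = a / b\<close>, and a pole of \<open>f\<close> comes from a maximal ideal containing \<open>b\<close>.\<close>

lemma S_finite_poles: "finite {P \<in> S. f \<notin> P}"
proof -
  let ?I = "{i. i \<le> d \<and> x i \<noteq> 0}"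
  have "\<forall>i\<in>?I. \<exists>b. b \<in> A i \<and> b \<noteq> 0 \<and> (\<exists>a\<in>A i. f = a / b)"
  proof
    fix i assume "i \<in> ?I"
    then show "\<exists>b. b \<in> A i \<and> b \<noteq> 0 \<and> (\<exists>a\<in>A i. f = a / b)" using A_fractions[of i f] by blast
  qed
  from bchoice[OF this] obtain b where "\<forall>i\<in>?I. b i \<in> A i \<and> b i \<noteq> 0 \<and> (\<exists>a\<in>A i. f = a / b i)" by (elim exE)
  then have b: "\<And>i. i \<in> ?I \<Longrightarrow> b i \<in> A i" "\<And>i. i \<in> ?I \<Longrightarrow> b i \<noteq> 0" "\<And>i. i \<in> ?I \<Longrightarrow> \<exists>a\<in>A i. f = a / b i"
    by simp_all
  have "{P \<in> S. f \<notin> P} \<subseteq> (\<Union>i\<in>?I. localization_at (A i) ` {J. ideal_of (A i) J \<and> b i \<in> J})"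
  proof
    fix P assume "P \<in> {P \<in> S. f \<notin> P}"
    then obtain i M where iM: "i \<in> ?I" "max_ideal (A i) M" "P = localization_at (A i) M" "f \<notin> P" using S_iff[of P] by auto
    obtain a where a: "a \<in> A i" "f = a / b i" using b(3)[OF iM(1)] by blast
    have "b i \<in> M"
    proof (rule ccontr)
      assume "b i \<notin> M"
      then have "f \<in> P" unfolding iM(3) a(2) by (rule localization_subring(3)[OF A_subring iM(2) a(1) b(1)[OF iM(1)]])
      then show False using iM(4) by simp
    qed
    moreover have "ideal_of (A i) M" using iM(2) by (simp add: max_ideal_def)
    ultimately show "P \<in> (\<Union>i\<in>?I. localization_at (A i) ` {J. ideal_of (A i) J \<and> b i \<in> J})" using iM(1,3) by blast
  qed
  moreover have "finite (\<Union>i\<in>?I. localization_at (A i) ` {J. ideal_of (A i) J \<and> b i \<in> J})"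
  proof (intro finite_UN_I finite_imageI)
    show "finite ?I" by simp
    fix i assume i: "i \<in> ?I"
    show "finite {J. ideal_of (A i) J \<and> b i \<in> J}"
      by (rule finite_ideals_containing[OF A_subring b(1)[OF i] A_finite_quotient[OF b(1)[OF i] b(2)[OF i]]])
  qed
  ultimately show ?thesis by (rule finite_subset)
qed

subsection \<open>Global functions are constant\<close>

definition span :: "'a set \<Rightarrow> 'a set" where
  "span B = (\<lambda>c. \<Sum>m\<in>B. c m * m) ` (PiE B (\<lambda>_. k))"

lemma spanI: assumes "\<And>m. m \<in> B \<Longrightarrow> c m \<in> k" shows "(\<Sum>m\<in>B. c m * m) \<in> span B"
proof -
  have "(\<Sum>m\<in>B. c m * m) = (\<Sum>m\<in>B. restrict c B m * m)" by (rule sum.cong) auto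
  moreover have "restrict c B \<in> PiE B (\<lambda>_. k)" using assms by auto
  ultimately show ?thesis unfolding span_def by (rule image_eqI)
qed

lemma spanE: assumes "u \<in> span B" shows "\<exists>c. (\<forall>m\<in>B. c m \<in> k) \<and> u = (\<Sum>m\<in>B. c m * m)"
  using assms unfolding span_def by auto

lemma finite_span: "finite B \<Longrightarrow> finite (span B)"
  unfolding span_def by (intro finite_imageI finite_PiE finite_k)

lemma span_base: assumes "finite B" "m \<in> B" shows "m \<in> span B"
proof -
  have "(\<Sum>l\<in>B. (if l = m then 1 else 0) * l) \<in> span B" by (rule spanI) (auto simp: zero_k one_k)
  moreover have "(\<Sum>l\<in>B. (if l = m then 1 else 0) * l) = m"
    using assms by (simp add: if_distrib[of "\<lambda>z. z * _"] cong: if_cong)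
  ultimately show ?thesis by simp
qed

lemma span_add: assumes "u \<in> span B" "v \<in> span B" shows "u + v \<in> span B"
proof -
  obtain c where c: "\<forall>m\<in>B. c m \<in> k" "u = (\<Sum>m\<in>B. c m * m)" using spanE[OF assms(1)] by blast
  obtain e where e: "\<forall>m\<in>B. e m \<in> k" "v = (\<Sum>m\<in>B. e m * m)" using spanE[OF assms(2)] by blast
  have "u + v = (\<Sum>m\<in>B. (c m + e m) * m)" by (simp add: c(2) e(2) sum.distrib distrib_right)
  then show ?thesis using spanI[of B "\<lambda>m. c m + e m"] c(1) e(1) add_k by simp
qed

lemma span_scale: assumes "a \<in> k" "u \<in> span B" shows "a * u \<in> span B"
proof -
  obtain c where c: "\<forall>m\<in>B. c m \<in> k" "u = (\<Sum>m\<in>B. c m * m)" using spanE[OF assms(2)] by blast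
  have "a * u = (\<Sum>m\<in>B. (a * c m) * m)" by (simp add: c(2) sum_distrib_left mult.assoc)
  then show ?thesis using spanI[of B "\<lambda>m. a * c m"] c(1) mult_k[OF assms(1)] by simp
qed

lemma span_zero: "0 \<in> span B"
  using spanI[of B "\<lambda>_. 0"] zero_k by simp

lemma span_sum: "(\<And>i. i \<in> I \<Longrightarrow> f i \<in> span B) \<Longrightarrow> sum f I \<in> span B"
  by (induction I rule: infinite_finite_induct) (auto intro: span_zero span_add)

lemma span_mult:
  assumes "u \<in> span B" and H: "\<And>m. m \<in> B \<Longrightarrow> m * v \<in> span B'" shows "u * v \<in> span B'"
proof -
  obtain c where c: "\<forall>m\<in>B. c m \<in> k" "u = (\<Sum>m\<in>B. c m * m)" using spanE[OF assms(1)] by blast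
  have "u * v = (\<Sum>m\<in>B. c m * (m * v))" by (simp add: c(2) sum_distrib_right mult.assoc)
  moreover have "(\<Sum>m\<in>B. c m * (m * v)) \<in> span B'" by (intro span_sum span_scale H) (use c(1) in auto)
  ultimately show ?thesis by simp
qed

text \<open>The monomials of degree \<open>N\<close> in the homogeneous coordinates; they span the space \<open>H N\<close> of the values
  of the forms of degree \<open>N\<close>.\<close>

definition monomials :: "nat \<Rightarrow> 'a set" where
  "monomials N = (\<lambda>l. prod_list (map x l)) ` {l. set l \<subseteq> {..d} \<and> length l = N}"

abbreviation "H N \<equiv> span (monomials N)"

lemma monomialsI: "set l \<subseteq> {..d} \<Longrightarrow> prod_list (map x l) \<in> monomials (length l)"
  unfolding monomials_def by (rule imageI) simp

lemma finite_monomials: "finite (monomials N)"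
  unfolding monomials_def by (intro finite_imageI finite_lists_length_eq) simp

lemma H_base: "set l \<subseteq> {..d} \<Longrightarrow> prod_list (map x l) \<in> H (length l)"
  using span_base[OF finite_monomials monomialsI] .

lemma H_mult: assumes "u \<in> H M" "v \<in> H N" shows "u * v \<in> H (M + N)"
proof (rule span_mult[OF assms(1)])
  fix m assume m: "m \<in> monomials M"
  have "v * m \<in> H (M + N)"
  proof (rule span_mult[OF assms(2)])
    fix m' assume "m' \<in> monomials N"
    with m obtain l l' where l: "set l \<subseteq> {..d}" "length l = M" "m = prod_list (map x l)"
      "set l' \<subseteq> {..d}" "length l' = N" "m' = prod_list (map x l')" unfolding monomials_def by blast
    have "prod_list (map x (l @ l')) \<in> H (length (l @ l'))" by (rule H_base) (use l in auto)
    then show "m' * m \<in> H (M + N)" using l by (simp add: mult.commute)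
  qed
  then show "m * v \<in> H (M + N)" by (simp add: mult.commute)
qed

lemma H_coordinate: "j \<le> d \<Longrightarrow> x j \<in> H 1"
  using H_base[of "[j]"] by simp

lemma H_power: "j \<le> d \<Longrightarrow> x j ^ N \<in> H N"
  using H_base[of "replicate N j"] by (cases "N = 0") (simp_all add: prod_list_replicate)

lemma homogenize:
  assumes i: "i \<le> d" "x i \<noteq> 0" and z: "z \<in> A i" shows "\<exists>N. x i ^ N * z \<in> H N"
  using z unfolding chart_ring_def
proof (induction rule: generate_ring.induct)
  case one
  show ?case using H_power[OF i(1), of 0] by (intro exI[of _ 0]) simp
next
  case (incl h)
  show ?case
  proof (cases "h \<in> k")
    case True
    then show ?thesis using span_scale[OF True H_power[OF i(1), of 0]] by (intro exI[of _ 0]) simp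
  next
    case False
    then obtain j where "j \<le> d" "h = x j / x i" using incl by blast
    then show ?thesis using H_coordinate[of j] i by (intro exI[of _ 1]) simp
  qed
next
  case (a_inv h)
  then obtain N where "x i ^ N * h \<in> H N" by blast
  from span_scale[OF uminus_k[OF one_k] this] show ?case by (intro exI[of _ N]) simp
next
  case (eng_add h h')
  then obtain N N' where N: "x i ^ N * h \<in> H N" "x i ^ N' * h' \<in> H N'" by blast
  have "x i ^ (N + N') * (h + h') = (x i ^ N * h) * x i ^ N' + x i ^ N * (x i ^ N' * h')"
    by (simp only: power_add distrib_left distrib_right ac_simps)
  moreover have "\<dots> \<in> H (N + N')"
    by (rule span_add[OF H_mult[OF N(1) H_power[OF i(1)]] H_mult[OF H_power[OF i(1)] N(2)]])
  ultimately have "x i ^ (N + N') * (h \<oplus>\<^bsub>fun_field\<^esub> h') \<in> H (N + N')" by (simp only: fun_field_simps)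
  then show ?case by (rule exI)
next
  case (eng_mult h h')
  then obtain N N' where N: "x i ^ N * h \<in> H N" "x i ^ N' * h' \<in> H N'" by blast
  have "x i ^ (N + N') * (h * h') = (x i ^ N * h) * (x i ^ N' * h')"
    by (simp only: power_add ac_simps)
  moreover have "\<dots> \<in> H (N + N')" by (rule H_mult[OF N])
  ultimately have "x i ^ (N + N') * (h \<otimes>\<^bsub>fun_field\<^esub> h') \<in> H (N + N')" by (simp only: fun_field_simps)
  then show ?case by (rule exI)
qed

text \<open>A rational function without poles lies in every affine coordinate ring: its ideal of
  denominators is contained in no maximal ideal.\<close>

lemma global_in_chart:
  assumes f: "f \<in> \<Inter> S" and i: "i \<le> d" "x i \<noteq> 0" shows "f \<in> A i"
proof -
  let ?I = "{a \<in> A i. a * f \<in> A i}"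
  have I: "ideal_of (A i) ?I"
    unfolding ideal_of_def add_subgroup_def
  proof (intro conjI ballI)
    show "0 \<in> ?I" using AD(3) by simp
    show "a - b \<in> ?I" if ab: "a \<in> ?I" "b \<in> ?I" for a b
    proof -
      have "a * f - b * f \<in> A i" by (rule AD(6)) (use ab in auto)
      then show ?thesis using AD(6)[of a i b] ab by (simp add: left_diff_distrib)
    qed
    show "a * b \<in> ?I" if ab: "a \<in> A i" "b \<in> ?I" for a b
    proof -
      have "a * (b * f) \<in> A i" by (rule AD(4)) (use ab in auto)
      then show ?thesis using AD(4)[of a i b] ab by (simp add: mult.assoc)
    qed
  qed blast
  obtain a b where ab: "a \<in> A i" "b \<in> A i" "b \<noteq> 0" "f = a / b" using A_fractions[OF i, of f] by blast
  have bI: "b \<in> ?I" using ab by simp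
  have "1 \<in> ?I"
  proof (rule ccontr)
    assume "1 \<notin> ?I"
    then obtain M where M: "max_ideal (A i) M" "?I \<subseteq> M"
      using max_ideal_exists[OF A_subring ab(2) A_finite_quotient[OF ab(2,3)] I bI] by blast
    have "localization_at (A i) M \<in> S" unfolding S_iff using i M(1) by blast
    then have "f \<in> localization_at (A i) M" using f by blast
    then obtain c s where cs: "c \<in> A i" "s \<in> A i - M" "f = c / s" unfolding localization_at_def by blast
    have "0 \<in> M" using M(1) add_subgroupD(1)[OF ideal_ofD(2)] unfolding max_ideal_def by blast
    then have "s * f = c" using cs by auto
    then have "s \<in> ?I" using cs by auto
    then show False using cs(2) M(2) by blast
  qed
  then show ?thesis by simp
qed

lemma prod_list_extract:
  "prod_list (map x l) = x i ^ count_list l i * prod_list (map x (filter (\<lambda>j. j \<noteq> i) l))"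
  "length l = count_list l i + length (filter (\<lambda>j. j \<noteq> i) l)"
  by (induction l) (auto simp: ac_simps)

text \<open>Multiplication by a function without poles maps the finite set \<open>H N\<close> into itself for large \<open>N\<close>, so
  that its powers repeat.\<close>

lemma global_torsion:
  assumes f: "f \<in> \<Inter> S" shows "f = 0 \<or> (\<exists>n>0. f ^ n = 1)"
proof -
  let ?I = "{i. i \<le> d \<and> x i \<noteq> 0}"
  have "\<forall>i\<in>?I. \<exists>N. x i ^ N * f \<in> H N"
  proof
    fix i assume "i \<in> ?I"
    then show "\<exists>N. x i ^ N * f \<in> H N" using homogenize[OF _ _ global_in_chart[OF f]] by simp
  qed
  from bchoice[OF this] obtain e where "\<forall>i\<in>?I. x i ^ e i * f \<in> H (e i)" by (elim exE)
  then have e: "\<And>i. i \<in> ?I \<Longrightarrow> x i ^ e i * f \<in> H (e i)" by simp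
  \<comment> \<open>in every monomial of this degree, some \<open>x i\<close> occurs more than \<open>e i\<close> times\<close>
  define N where "N = (\<Sum>i\<le>d. e i) + 1"
  have "m * f \<in> H N" if m: "m \<in> monomials N" for m
  proof (cases "m = 0")
    case True
    then show ?thesis by (simp add: span_zero)
  next
    case False
    obtain l where l: "set l \<subseteq> {..d}" "length l = N" "m = prod_list (map x l)" using m unfolding monomials_def by blast
    have "\<exists>i\<le>d. count_list l i > e i"
    proof (rule ccontr)
      assume "\<not> ?thesis"
      then have le: "\<And>i. i \<le> d \<Longrightarrow> count_list l i \<le> e i" by force
      have "length l = (\<Sum>i\<in>set l. count_list l i)" by (simp add: sum_count_set[OF order_refl finite_set])
      also have "\<dots> \<le> (\<Sum>i\<le>d. count_list l i)" using l(1) by (intro sum_mono2) auto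
      also have "\<dots> \<le> (\<Sum>i\<le>d. e i)" using le by (intro sum_mono) auto
      finally show False using l(2) by (simp add: N_def)
    qed
    then obtain i where i: "i \<le> d" "count_list l i > e i" by blast
    then have "i \<in> set l" using count_notin[of i l] by fastforce
    then have "x i \<noteq> 0" using False l(3) by (auto simp: prod_list_zero_iff)
    then have iI: "i \<in> ?I" using i by simp
    let ?l = "replicate (count_list l i - e i) i @ filter (\<lambda>j. j \<noteq> i) l"
    have "m = x i ^ e i * prod_list (map x ?l)"
      using prod_list_extract(1)[of l i] i(2) l(3) by (simp add: prod_list_replicate flip: power_add mult.assoc)
    then have "m * f = (x i ^ e i * f) * prod_list (map x ?l)" by (simp add: ac_simps)
    moreover have "\<dots> \<in> H (e i + length ?l)" using l(1) i(1) by (intro H_mult e[OF iI] H_base) auto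
    moreover have "e i + length ?l = N" using prod_list_extract(2)[of l i] i(2) l(2) by simp
    ultimately show ?thesis by metis
  qed
  then have stable: "u * f \<in> H N" if u: "u \<in> H N" for u by (intro span_mult[OF u])
  obtain i where i: "i \<le> d" "x i \<noteq> 0" using some_coordinate by blast
  have pw: "x i ^ N * f ^ n \<in> H N" for n
  proof (induction n)
    case 0
    show ?case using H_power[OF i(1)] by simp
  next
    case (Suc n)
    then show ?case using stable[OF Suc] by (simp add: ac_simps)
  qed
  have "finite (range (\<lambda>n. x i ^ N * f ^ n))"
    by (rule finite_subset[OF _ finite_span[OF finite_monomials]]) (use pw in blast)
  then have "\<not> inj (\<lambda>n. x i ^ N * f ^ n)" using finite_imageD[of "\<lambda>n. x i ^ N * f ^ n" UNIV] infinite_UNIV_nat by blast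
  then obtain a b where "x i ^ N * f ^ a = x i ^ N * f ^ b" and ab: "a \<noteq> b" unfolding inj_def by blast
  then have fab: "f ^ a = f ^ b" using i(2) by simp
  have "\<exists>m n. f ^ m = f ^ n \<and> m < n"
  proof (cases "a < b")
    case True
    then show ?thesis using fab by blast
  next
    case False
    then have "b < a" using ab by simp
    then show ?thesis using fab[symmetric] by blast
  qed
  then obtain m n where mn: "f ^ m = f ^ n" "m < n" by blast
  have "f ^ n = f ^ m * f ^ (n - m)" using mn(2) by (simp flip: power_add)
  then have "f ^ m * (f ^ (n - m) - 1) = 0" using mn(1) by (simp only: right_diff_distrib mult_1_right) simp
  then have "f = 0 \<or> f ^ (n - m) = 1" by auto
  then show ?thesis using mn(2) by (metis zero_less_diff)
qed

end

sublocale projective_curve \<subseteq> places k "topspace (projective_model k d x)"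
proof (rule places.intro)
  show "finite k" by (rule finite_k)
  show "add_subgroup k" by (rule k_subgroup)
  show "1 \<in> k" by (rule one_k)
  show "inverse c \<in> k" if "c \<in> k" for c by (rule inverse_k[OF that])
  show "c * e \<in> k" if "c \<in> k" "e \<in> k" for c e by (rule mult_k[OF that])
  show dvr: "dvr P" if "P \<in> S" for P by (rule S_dvr[OF that])
  show "k \<subseteq> P" if "P \<in> S" for P using that[unfolded S_iff] chart_point(2) by blast
  show fres: "finite (coset (fideal P 1) ` P)" if "P \<in> S" for P
  proof -
    obtain i M where iM: "i \<le> d" "x i \<noteq> 0" "max_ideal (A i) M" "P = localization_at (A i) M"
      using S_iff[of P] \<open>P \<in> S\<close> by blast
    show ?thesis by (rule chart_point(6)[OF iM])
  qed
  show "finite {P \<in> S. f \<notin> P}" for f by (rule S_finite_poles)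
  obtain t :: 'a where t: "inj (\<lambda>n::nat. t ^ n)" using transcendental by blast
  show inf: "infinite (UNIV :: 'a set)"
    using finite_imageD[OF _ t] finite_subset[OF subset_UNIV] infinite_UNIV_nat by blast
  show "P = Q" if PQ: "P \<in> S" "Q \<in> S" "P \<subseteq> Q" for P Q
  proof -
    interpret P: dvr P by (rule dvr[OF PQ(1)])
    interpret Q: dvr Q by (rule dvr[OF PQ(2)])
    show ?thesis using P.maximal_subring[OF PQ(3) Q.mult_in Q.not_UNIV] by simp
  qed
  have "t \<notin> \<Inter> S"
  proof
    assume "t \<in> \<Inter> S"
    from global_torsion[OF this] consider "t = 0" | n where "n > 0" "t ^ n = 1" by blast
    then show False
    proof cases
      case 1
      then have "t ^ 1 = t ^ 2" by simp
      then show False using injD[OF t, of 1 2] by simp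
    next
      case 2
      then have "t ^ n = t ^ 0" by simp
      then show False using injD[OF t, of n 0] 2(1) by simp
    qed
  qed
  then obtain P where P: "P \<in> S" by blast
  interpret dvr P by (rule dvr[OF P])
  have "inj_on (coset (fideal P 1)) (\<Inter> S)"
  proof (rule inj_onI)
    fix f g assume f: "f \<in> \<Inter> S" and g: "g \<in> \<Inter> S" and e: "coset (fideal P 1) f = coset (fideal P 1) g"
    have d: "f - g \<in> fideal P 1" using e by (simp only: coset_eq_iff[OF fideal_subgroup])
    have "f - g \<in> \<Inter> S"
    proof
      fix Q assume "Q \<in> S"
      then show "f - g \<in> Q" using f g dvr.diff_in[OF dvr] by blast
    qed
    from global_torsion[OF this] show "f = g"
    proof
      assume "\<exists>n>0. (f - g) ^ n = 1"
      then obtain n where n: "n > 0" "(f - g) ^ n = 1" by blast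
      then have nz: "f - g \<noteq> 0" by (metis power_0_left not_gr0 zero_neq_one)
      then have "int n * ord P (f - g) = 0" using ord_power[of "f - g" n] n(2) by simp
      then show "f = g" using n(1) d nz by (auto simp: fideal_def)
    qed simp
  qed
  moreover have "coset (fideal P 1) ` (\<Inter> S) \<subseteq> coset (fideal P 1) ` P" using P by blast
  then have "finite (coset (fideal P 1) ` (\<Inter> S))" by (rule finite_subset) (rule fres[OF P])
  ultimately show "finite (\<Inter> S)" by (rule finite_imageD[rotated])
qed

context projective_curve
begin

text \<open>It suffices to remove a single closed point \<open>Q\<close>.  A point \<open>P \<noteq> Q\<close> has a principal open neighbourhood
  without \<open>Q\<close>: either \<open>Q\<close> is not in the chart of \<open>P\<close>, or some element of its coordinate ring vanishes
  at \<open>Q\<close> but not at \<open>P\<close>.\<close>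

lemma cofinite_open:
  assumes "U \<subseteq> S" "finite (S - U)" shows "openin (projective_model k d x) U"
proof -
  have single: "openin (projective_model k d x) (S - {Q})" for Q
  proof (subst openin_subopen, intro ballI)
    fix P assume "P \<in> S - {Q}"
    then have P: "P \<in> S" "P \<noteq> Q" by auto
    then obtain i M where iM: "i \<le> d" "x i \<noteq> 0" "max_ideal (A i) M" "P = localization_at (A i) M"
      using S_iff[of P] by blast
    have "\<exists>a\<in>A i. a \<notin> M \<and> Q \<notin> principal_open k d x i a"
    proof (cases "\<exists>N. max_ideal (A i) N \<and> Q = localization_at (A i) N")
      case False
      have "1 \<in> A i" "1 \<notin> M" using AD(2) iM(3) by (auto simp: max_ideal_def)
      then show ?thesis using False unfolding principal_open_iff by blast
    next
      case True
      then obtain N where N: "max_ideal (A i) N" "Q = localization_at (A i) N" by blast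
      have "N \<noteq> M" using P(2) N(2) iM(4) by blast
      moreover have "ideal_of (A i) M" "M \<noteq> A i" "ideal_of (A i) N"
        using iM(3) N(1) AD(2)[of i] by (auto simp: max_ideal_def)
      ultimately have "\<not> N \<subseteq> M" using N(1) unfolding max_ideal_def by blast
      then obtain a where a: "a \<in> N" "a \<notin> M" by blast
      have "Q \<notin> principal_open k d x i a"
      proof
        assume "Q \<in> principal_open k d x i a"
        then obtain N' where N': "Q = localization_at (A i) N'" "max_ideal (A i) N'" "a \<notin> N'"
          unfolding principal_open_iff by blast
        have "N = A i \<inter> fideal Q 1" "N' = A i \<inter> fideal Q 1"
          using chart_point(4)[OF iM(1,2)] N N' by blast+
        then show False using a(1) N'(3) by blast
      qed
      moreover have "a \<in> A i" using a(1) ideal_ofD(1)[OF \<open>ideal_of (A i) N\<close>] by blast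
      ultimately show ?thesis using a(2) by blast
    qed
    then obtain a where a: "a \<in> A i" "a \<notin> M" "Q \<notin> principal_open k d x i a" by blast
    have "principal_open k d x i a \<in> {principal_open k d x i a | i a. i \<le> d \<and> x i \<noteq> 0 \<and> a \<in> A i}"
      using iM(1,2) a(1) by blast
    then have "openin (projective_model k d x) (principal_open k d x i a)"
      unfolding projective_model_def by (rule topology_generated_by_Basis)
    moreover from openin_subset[OF this] have "principal_open k d x i a \<subseteq> S - {Q}" using a(3) by blast
    moreover have "P \<in> principal_open k d x i a" unfolding principal_open_iff using iM(3,4) a(2) by blast
    ultimately show "\<exists>T. openin (projective_model k d x) T \<and> P \<in> T \<and> T \<subseteq> S - {Q}" by blast
  qed
  have "openin (projective_model k d x) (S - F)" if "finite F" for F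
    using that
  proof (induction F rule: finite_induct)
    case empty
    show ?case by simp
  next
    case (insert Q F)
    have "S - insert Q F = (S - {Q}) \<inter> (S - F)" by blast
    then show ?case using openin_Int[OF single insert.IH] by simp
  qed
  from this[OF assms(2)] show ?thesis using assms(1) by (simp add: double_diff)
qed

lemma principal_open_cofinite:
  assumes i: "i \<le> d" "x i \<noteq> 0" and a: "a \<in> A i" "a \<noteq> 0"
  shows "finite (S - principal_open k d x i a)"
proof -
  have "S - principal_open k d x i a \<subseteq> (\<Union>j\<le>d. {P \<in> S. x j / x i \<notin> P}) \<union> {P \<in> S. inverse a \<notin> P}"
  proof
    fix P assume P: "P \<in> S - principal_open k d x i a"
    show "P \<in> (\<Union>j\<le>d. {P \<in> S. x j / x i \<notin> P}) \<union> {P \<in> S. inverse a \<notin> P}"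
    proof (rule ccontr)
      assume n: "\<not> ?thesis"
      have c: "x j / x i \<in> P" if "j \<le> d" for j using n P that by blast
      have ia: "inverse a \<in> P" using n P by blast
      have PS: "P \<in> S" using P by blast
      interpret dvr P by (rule dvr_S[OF PS])
      have "a \<notin> fideal P 1"
      proof
        assume "a \<in> fideal P 1"
        then have "a * inverse a \<noteq> 1" unfolding fideal_1 using ia by blast
        then show False using a(2) by simp
      qed
      then have "P \<in> principal_open k d x i a"
        unfolding principal_open_iff using point_in_chart[OF PS i c] by blast
      then show False using P by blast
    qed
  qed
  moreover have "finite ((\<Union>j\<le>d. {P \<in> S. x j / x i \<notin> P}) \<union> {P \<in> S. inverse a \<notin> P})"
    using S_finite_poles by simp
  ultimately show ?thesis by (rule finite_subset)
qed

lemma open_cofinite: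
  assumes "openin (projective_model k d x) U" "U \<noteq> {}" shows "finite (S - U)"
proof -
  let ?B = "{principal_open k d x i a | i a. i \<le> d \<and> x i \<noteq> 0 \<and> a \<in> A i}"
  have "generate_topology_on ?B U"
    using assms(1) unfolding projective_model_def by (simp add: openin_topology_generated_by)
  then have "U = {} \<or> finite (S - U)"
  proof (induction rule: generate_topology_on.induct)
    case (Int a b)
    have "S - a \<inter> b = (S - a) \<union> (S - b)" by blast
    then show ?case using Int by auto
  next
    case (UN K)
    show ?case
    proof (cases "\<exists>u\<in>K. u \<noteq> {}")
      case True
      then obtain u where u: "u \<in> K" "u \<noteq> {}" by blast
      then have "finite (S - u)" using UN by blast
      moreover have "S - \<Union> K \<subseteq> S - u" using u by blast
      ultimately show ?thesis using finite_subset by blast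
    qed auto
  next
    case (Basis s)
    then obtain i a where ia: "i \<le> d" "x i \<noteq> 0" "a \<in> A i" "s = principal_open k d x i a" by blast
    show ?case
    proof (cases "a = 0")
      case True
      have "a \<in> M" if M: "max_ideal (A i) M" for M
        using M add_subgroupD(1)[OF ideal_ofD(2)] True unfolding max_ideal_def by blast
      then have "s = {}" unfolding ia(4) set_eq_iff principal_open_iff by blast
      then show ?thesis by simp
    next
      case False
      then show ?thesis using principal_open_cofinite[OF ia(1-3)] ia(4) by simp
    qed
  qed simp
  then show ?thesis using assms(2) by simp
qed

lemma openin_iff:
  "openin (projective_model k d x) U \<longleftrightarrow> U = {} \<or> U \<subseteq> S \<and> finite (S - U)"
  using cofinite_open open_cofinite openin_subset by (metis openin_empty)

end

lemma smooth_projective_curve_obtains: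
  assumes "smooth_projective_curve k C"
  obtains d x where "projective_curve k d x" "C = projective_model k d x"
proof -
  have *: "subfield k fun_field" "finite k" "has_trdeg_one k"
    "\<exists>d x. C = projective_model k d x \<and> (\<exists>i\<le>d. x i \<noteq> 0) \<and>
      generate_field fun_field (k \<union> {x j / x i | i j. i \<le> d \<and> j \<le> d \<and> x i \<noteq> 0}) = UNIV"
    "\<forall>P \<in> topspace C. regular_local_dim_one P"
    using assms unfolding smooth_projective_curve_def by blast+
  obtain d x where dx: "C = projective_model k d x" "\<exists>i\<le>d. x i \<noteq> 0"
    "generate_field fun_field (k \<union> {x j / x i | i j. i \<le> d \<and> j \<le> d \<and> x i \<noteq> 0}) = UNIV" using *(4) by blast
  have "projective_curve k d x"
    by (intro projective_curve.intro projective_curve_axioms.intro trdeg_one_function_field[OF *(1-3)] dx(2,3))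
      (use *(5) dx(1) in blast)
  then show ?thesis using that dx(1) by blast
qed

section \<open>Matrices over a discrete valuation ring\<close>

definition minv :: "'a::field mat \<Rightarrow> 'a mat" where
  "minv A = inverse (det A) \<cdot>\<^sub>m adj_mat A"

lemma minv:
  assumes "A \<in> carrier_mat n n" "det A \<noteq> 0"
  shows "minv A \<in> carrier_mat n n" "A * minv A = 1\<^sub>m n" "minv A * A = 1\<^sub>m n" "det (minv A) = inverse (det A)"
proof -
  note a = adj_mat[OF assms(1)]
  show c: "minv A \<in> carrier_mat n n" using a(1) by (simp add: minv_def)
  have "A * minv A = inverse (det A) \<cdot>\<^sub>m (A * adj_mat A)"
    unfolding minv_def by (rule mult_smult_distrib[OF assms(1) a(1)])
  then show 1: "A * minv A = 1\<^sub>m n" using assms(2) unfolding a(2) by (auto intro!: eq_matI)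
  have "minv A * A = inverse (det A) \<cdot>\<^sub>m (adj_mat A * A)"
    unfolding minv_def by (rule mult_smult_assoc_mat[OF a(1) assms(1)])
  then show "minv A * A = 1\<^sub>m n" using assms(2) unfolding a(3) by (auto intro!: eq_matI)
  have "det A * det (minv A) = 1" using det_mult[OF assms(1) c] 1 by simp
  then show "det (minv A) = inverse (det A)" using assms(2) by (simp add: field_simps)
qed

lemma minv_minv:
  assumes "A \<in> carrier_mat n n" "det A \<noteq> 0" shows "minv (minv A) = A"
proof -
  note m = minv[OF assms]
  have d: "det (minv A) \<noteq> 0" using m(4) assms(2) by simp
  note mm = minv[OF m(1) d]
  have "minv (minv A) = A * minv A * minv (minv A)" using m(2) mm(1) by simp
  also have "\<dots> = A * (minv A * minv (minv A))" by (rule assoc_mult_mat[OF assms(1) m(1) mm(1)])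
  finally show ?thesis using mm(2) assms(1) by simp
qed

lemma minv_unique:
  assumes "A \<in> carrier_mat n n" "B \<in> carrier_mat n n" "A * B = 1\<^sub>m n" shows "det A \<noteq> 0" "minv A = B"
proof -
  have "det A * det B = 1" using det_mult[OF assms(1,2)] assms(3) by simp
  then show d: "det A \<noteq> 0" by auto
  note m = minv[OF assms(1) d]
  have "minv A * (A * B) = minv A * A * B" by (rule assoc_mult_mat[OF m(1) assms(1,2), symmetric])
  then show "minv A = B" using m(1,3) assms(2,3) by simp
qed

lemma minv_mult:
  assumes "A \<in> carrier_mat n n" "det A \<noteq> 0" "B \<in> carrier_mat n n" "det B \<noteq> 0"
  shows "minv (A * B) = minv B * minv A" "A * B \<in> carrier_mat n n" "det (A * B) \<noteq> 0"
proof -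
  note a = minv[OF assms(1,2)] and b = minv[OF assms(3,4)]
  have "(A * B) * (minv B * minv A) = A * (B * (minv B * minv A))"
    by (rule assoc_mult_mat[OF assms(1,3)]) (rule mult_carrier_mat[OF b(1) a(1)])
  also have "B * (minv B * minv A) = (B * minv B) * minv A" by (rule assoc_mult_mat[OF assms(3) b(1) a(1), symmetric])
  finally have "(A * B) * (minv B * minv A) = 1\<^sub>m n" using a b by simp
  from minv_unique[OF mult_carrier_mat[OF assms(1,3)] mult_carrier_mat[OF b(1) a(1)] this]
  show "minv (A * B) = minv B * minv A" "det (A * B) \<noteq> 0" by auto
  show "A * B \<in> carrier_mat n n" using assms by simp
qed

lemma minv_one: "minv (1\<^sub>m n :: 'a::field mat) = 1\<^sub>m n"
  by (rule minv_unique(2)) auto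

lemma mat_mult_entry:
  assumes "A \<in> carrier_mat n n" "B \<in> carrier_mat n n" "i < n" "j < n"
  shows "(A * B) $$ (i, j) = (\<Sum>l<n. A $$ (i, l) * B $$ (l, j))"
  using assms by (simp add: scalar_prod_def lessThan_atLeast0)

definition conj_mat :: "'a::field mat \<Rightarrow> 'a mat \<Rightarrow> 'a mat" where
  "conj_mat h A = h * A * minv h"

lemma conj_mat_carrier: "h \<in> carrier_mat n n \<Longrightarrow> det h \<noteq> 0 \<Longrightarrow> A \<in> carrier_mat n n \<Longrightarrow> conj_mat h A \<in> carrier_mat n n"
  unfolding conj_mat_def by (intro mult_carrier_mat[of _ n n _ n] minv(1))

lemma conj_mat_conj_mat:
  assumes g: "g \<in> carrier_mat n n" "det g \<noteq> 0" and h: "h \<in> carrier_mat n n" "det h \<noteq> 0" and A: "A \<in> carrier_mat n n"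
  shows "conj_mat g (conj_mat h A) = conj_mat (g * h) A"
proof -
  note gi = minv(1)[OF g] and hi = minv(1)[OF h]
  show ?thesis
    unfolding conj_mat_def minv_mult(1)[OF g h]
    using g(1) h(1) A gi hi by (simp add: assoc_mult_mat[of _ n n _ n _ n])
qed

lemma conj_mat_one: "A \<in> carrier_mat n n \<Longrightarrow> conj_mat (1\<^sub>m n) A = A"
  by (simp add: conj_mat_def minv_one)

lemma conj_mat_mult:
  assumes h: "h \<in> carrier_mat n n" "det h \<noteq> 0" and A: "A \<in> carrier_mat n n" and B: "B \<in> carrier_mat n n"
  shows "conj_mat h (A * B) = conj_mat h A * conj_mat h B"
proof -
  note hi = minv[OF h]
  have "conj_mat h A * conj_mat h B = h * A * (minv h * h) * B * minv h"
    unfolding conj_mat_def using h(1) A B hi(1) by (simp add: assoc_mult_mat[of _ n n _ n _ n])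
  also have "\<dots> = h * (A * B) * minv h"
    unfolding hi(3) using h(1) A B hi(1) by (simp add: assoc_mult_mat[of _ n n _ n _ n])
  finally show ?thesis by (simp add: conj_mat_def)
qed

lemma conj_mat_add:
  assumes h: "h \<in> carrier_mat n n" "det h \<noteq> 0" and A: "A \<in> carrier_mat n n" and B: "B \<in> carrier_mat n n"
  shows "conj_mat h (A + B) = conj_mat h A + conj_mat h B"
  unfolding conj_mat_def
  using h(1) A B minv(1)[OF h] by (simp add: mult_add_distrib_mat[of _ n n _ n] add_mult_distrib_mat[of _ n n _ _ n])

lemma conj_mat_smult:
  assumes h: "h \<in> carrier_mat n n" "det h \<noteq> 0" and A: "A \<in> carrier_mat n n"
  shows "conj_mat h (c \<cdot>\<^sub>m A) = c \<cdot>\<^sub>m conj_mat h A"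
  unfolding conj_mat_def
  using h(1) A minv(1)[OF h] mult_smult_distrib[OF h(1) A] mult_smult_assoc_mat[of "h * A" n n "minv h" n] by simp

lemma conj_mat_unit:
  assumes "h \<in> carrier_mat n n" "det h \<noteq> 0" shows "conj_mat h (1\<^sub>m n) = 1\<^sub>m n"
  using assms minv[OF assms] by (simp add: conj_mat_def)

lemma conj_mat_zero:
  assumes "h \<in> carrier_mat n n" "det h \<noteq> 0" shows "conj_mat h (0\<^sub>m n n) = 0\<^sub>m n n"
  using assms minv[OF assms] by (simp add: conj_mat_def)

lemma conj_mat_cancel:
  assumes h: "h \<in> carrier_mat n n" "det h \<noteq> 0" and A: "A \<in> carrier_mat n n"
  shows "conj_mat (minv h) (conj_mat h A) = A" "conj_mat h (conj_mat (minv h) A) = A"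
proof -
  note hi = minv[OF h]
  have d: "det (minv h) \<noteq> 0" using hi(4) h(2) by simp
  show "conj_mat (minv h) (conj_mat h A) = A" "conj_mat h (conj_mat (minv h) A) = A"
    unfolding conj_mat_conj_mat[OF hi(1) d h A] conj_mat_conj_mat[OF h hi(1) d A] hi(2,3)
    using A by (simp_all add: conj_mat_one)
qed

definition entries_in :: "nat \<Rightarrow> 'a::field set \<Rightarrow> 'a mat set" where
  "entries_in n M = {A \<in> carrier_mat n n. \<forall>i<n. \<forall>j<n. A $$ (i, j) \<in> M}"

lemma entries_inI: "A \<in> carrier_mat n n \<Longrightarrow> (\<And>i j. i < n \<Longrightarrow> j < n \<Longrightarrow> A $$ (i, j) \<in> M) \<Longrightarrow> A \<in> entries_in n M"
  by (auto simp: entries_in_def)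

lemma entries_inD: "A \<in> entries_in n M \<Longrightarrow> A \<in> carrier_mat n n" "A \<in> entries_in n M \<Longrightarrow> i < n \<Longrightarrow> j < n \<Longrightarrow> A $$ (i, j) \<in> M"
  by (auto simp: entries_in_def)

lemma entries_in_mono: "M \<subseteq> N \<Longrightarrow> entries_in n M \<subseteq> entries_in n N"
  by (auto simp: entries_in_def)

context dvr
begin

lemma entries_mult:
  assumes "A \<in> entries_in n (fideal P i)" "B \<in> entries_in n (fideal P j)"
  shows "A * B \<in> entries_in n (fideal P (i + j))"
proof (rule entries_inI)
  note A = entries_inD[OF assms(1)] and B = entries_inD[OF assms(2)]
  show "A * B \<in> carrier_mat n n" using A(1) B(1) by simp
  fix a b assume ab: "a < n" "b < n"
  show "(A * B) $$ (a, b) \<in> fideal P (i + j)"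
    unfolding mat_mult_entry[OF A(1) B(1) ab] using A(2) B(2) ab by (intro fideal_sum fideal_mult) auto
qed

lemma entries_int_mult: "A \<in> entries_in n P \<Longrightarrow> B \<in> entries_in n P \<Longrightarrow> A * B \<in> entries_in n P"
  using entries_mult[of A n 0 B 0] by (simp add: fideal_0)

lemma entries_add: "A \<in> entries_in n (fideal P i) \<Longrightarrow> B \<in> entries_in n (fideal P i) \<Longrightarrow> A + B \<in> entries_in n (fideal P i)"
  by (auto simp: entries_in_def intro!: fideal_add)

lemma entries_smult: "c \<in> P \<Longrightarrow> A \<in> entries_in n (fideal P i) \<Longrightarrow> c \<cdot>\<^sub>m A \<in> entries_in n (fideal P i)"
  by (auto simp: entries_in_def intro!: fideal_mult_left)

lemma entries_one: "1\<^sub>m n \<in> entries_in n P"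
  using one_in zero_in by (intro entries_inI) auto

lemma det_int:
  assumes "A \<in> carrier_mat m m" "\<And>i j. i < m \<Longrightarrow> j < m \<Longrightarrow> A $$ (i, j) \<in> P" shows "det A \<in> P"
  unfolding det_def'[OF assms(1)]
proof (rule sum_in)
  fix p assume "p \<in> {p. p permutes {0..<m}}"
  then have p: "p permutes {0..<m}" by simp
  have "(\<Prod>i = 0..<m. A $$ (i, p i)) \<in> P"
    by (rule prod_in) (use permutes_in_image[OF p] in \<open>auto intro!: assms(2)\<close>)
  moreover have "signof p \<in> P" using one_in uminus_in[OF one_in] by (simp add: sign_def)
  ultimately show "signof p * (\<Prod>i = 0..<m. A $$ (i, p i)) \<in> P" by (intro mult_in)
qed

lemma minv_int:
  assumes "A \<in> entries_in n P" "unit_of P (det A)" shows "minv A \<in> entries_in n P"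
proof (rule entries_inI)
  note A = entries_inD[OF assms(1)]
  have d: "det A \<noteq> 0" "inverse (det A) \<in> P" using assms(2) by (auto simp: unit_of_def)
  show "minv A \<in> carrier_mat n n" by (rule minv(1)[OF A(1) d(1)])
  fix i j assume ij: "i < n" "j < n"
  have "det (mat_delete A j i) \<in> P"
  proof (rule det_int)
    show "mat_delete A j i \<in> carrier_mat (n - 1) (n - 1)" using A(1) by (rule mat_delete_carrier)
    fix a b assume "a < n - 1" "b < n - 1"
    then show "mat_delete A j i $$ (a, b) \<in> P" using A(1) by (auto simp: mat_delete_def intro!: A(2))
  qed
  moreover have "(-1) ^ (j + i) \<in> P" by (intro power_in uminus_in one_in)
  ultimately have "inverse (det A) * cofactor A j i \<in> P"
    unfolding cofactor_def by (intro mult_in d(2))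
  then show "minv A $$ (i, j) \<in> P" using ij A(1) by (simp add: minv_def adj_mat_def)
qed

lemma entries_bounded: assumes "A \<in> carrier_mat n n" shows "\<exists>N. A \<in> entries_in n (fideal P (- int N))"
proof -
  define N where "N = nat (\<Sum>i<n. \<Sum>j<n. \<bar>ord P (A $$ (i, j))\<bar>)"
  have "A $$ (i, j) \<in> fideal P (- int N)" if ij: "i < n" "j < n" for i j
  proof -
    have "\<bar>ord P (A $$ (i, j))\<bar> \<le> (\<Sum>j<n. \<bar>ord P (A $$ (i, j))\<bar>)" using ij by (intro member_le_sum) auto
    also have "\<dots> \<le> (\<Sum>i<n. \<Sum>j<n. \<bar>ord P (A $$ (i, j))\<bar>)"
      using ij by (intro member_le_sum[of i "{..<n}" "\<lambda>i. \<Sum>j<n. \<bar>ord P (A $$ (i, j))\<bar>"]) (auto intro: sum_nonneg)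
    finally have "- int N \<le> ord P (A $$ (i, j))" unfolding N_def by linarith
    then show ?thesis by (simp add: fideal_def)
  qed
  then show ?thesis using assms by (auto simp: entries_in_def)
qed

lemma conj_int:
  assumes "u \<in> entries_in n P" "unit_of P (det u)" "A \<in> entries_in n P" shows "conj_mat u A \<in> entries_in n P"
  unfolding conj_mat_def by (intro entries_int_mult assms minv_int)

end

text \<open>The ring of endomorphisms of the lattice spanned over \<open>P\<close> by the columns of \<open>h\<close>.\<close>

definition local_order :: "'a::field set \<Rightarrow> nat \<Rightarrow> 'a mat \<Rightarrow> 'a mat set" where
  "local_order P n h = {A \<in> carrier_mat n n. conj_mat (minv h) A \<in> entries_in n P}"

lemma local_order_eq:
  assumes h: "h \<in> carrier_mat n n" "det h \<noteq> 0" shows "local_order P n h = conj_mat h ` entries_in n P"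
proof (intro equalityI subsetI)
  fix A assume "A \<in> local_order P n h"
  then have A: "A \<in> carrier_mat n n" "conj_mat (minv h) A \<in> entries_in n P" by (auto simp: local_order_def)
  then show "A \<in> conj_mat h ` entries_in n P" using conj_mat_cancel(2)[OF h A(1)] by (intro image_eqI[of _ _ "conj_mat (minv h) A"]) auto
next
  fix A assume "A \<in> conj_mat h ` entries_in n P"
  then obtain B where B: "B \<in> entries_in n P" "A = conj_mat h B" by blast
  then show "A \<in> local_order P n h"
    unfolding local_order_def using conj_mat_cancel(1)[OF h entries_inD(1)[OF B(1)]] conj_mat_carrier[OF h entries_inD(1)[OF B(1)]] by simp
qed

text \<open>Two invertible matrices differing by an invertible integral matrix span the same lattice.\<close>

lemma (in dvr) local_order_unit:
  assumes h: "h \<in> carrier_mat n n" "det h \<noteq> 0" and u: "u \<in> entries_in n P" "unit_of P (det u)"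
  shows "local_order P n (h * u) = local_order P n h"
proof -
  have uc: "u \<in> carrier_mat n n" "det u \<noteq> 0" using u by (auto simp: unit_of_def entries_in_def)
  have e: "conj_mat (h * u) A = conj_mat h (conj_mat u A)" if "A \<in> entries_in n P" for A
    using conj_mat_conj_mat[OF h uc entries_inD(1)[OF that]] by simp
  have ui: "minv u \<in> entries_in n P" "unit_of P (det (minv u))"
    using minv_int[OF u] u(2) minv(4)[OF uc] unit_inverse by auto
  have "conj_mat u ` entries_in n P = entries_in n P"
  proof (intro equalityI subsetI)
    fix A assume "A \<in> conj_mat u ` entries_in n P"
    then show "A \<in> entries_in n P" using conj_int[OF u] by auto
  next
    fix A assume A: "A \<in> entries_in n P"
    then show "A \<in> conj_mat u ` entries_in n P"
      using conj_int[OF ui A] conj_mat_cancel(2)[OF uc entries_inD(1)[OF A]] by (intro image_eqI[of _ _ "conj_mat (minv u) A"]) auto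
  qed
  note im = this
  have "conj_mat (h * u) ` entries_in n P = (\<lambda>A. conj_mat h (conj_mat u A)) ` entries_in n P"
    by (rule image_cong[OF refl e])
  also have "\<dots> = conj_mat h ` (conj_mat u ` entries_in n P)" by (simp only: image_image)
  finally have "conj_mat (h * u) ` entries_in n P = conj_mat h ` entries_in n P" by (simp only: im)
  then show ?thesis using local_order_eq[OF minv_mult(2,3)[OF h uc]] local_order_eq[OF h] by simp
qed

lemma smult_inverse_smult:
  "c \<noteq> (0::'a::field) \<Longrightarrow> c \<cdot>\<^sub>m (inverse c \<cdot>\<^sub>m B) = B" "c \<noteq> 0 \<Longrightarrow> inverse c \<cdot>\<^sub>m (c \<cdot>\<^sub>m B) = B"
  by (rule eq_matI; simp)+

definition unit_mat :: "nat \<Rightarrow> nat \<Rightarrow> nat \<Rightarrow> 'a::zero \<Rightarrow> 'a mat" where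
  "unit_mat n i j a = mat n n (\<lambda>(r, s). if r = i \<and> s = j then a else 0)"

lemma unit_mat_carrier [simp]: "unit_mat n i j a \<in> carrier_mat n n"
  by (simp add: unit_mat_def)

lemma unit_mat_sandwich:
  fixes A B :: "'a::field mat"
  assumes A: "A \<in> carrier_mat n n" and B: "B \<in> carrier_mat n n" and "i < n" "a < n" "b < n" "j < n"
  shows "(A * unit_mat n a b 1 * B) $$ (i, j) = A $$ (i, a) * B $$ (b, j)"
proof -
  let ?E = "unit_mat n a b (1::'a)"
  have 1: "(A * ?E) $$ (i, l) = (if l = b then A $$ (i, a) else 0)" if l: "l < n" for l
  proof -
    have "(A * ?E) $$ (i, l) = (\<Sum>r<n. if r = a then (if l = b then A $$ (i, a) else 0) else 0)"
      unfolding mat_mult_entry[OF A unit_mat_carrier \<open>i < n\<close> l] by (rule sum.cong) (use l in \<open>auto simp: unit_mat_def\<close>)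
    then show ?thesis using \<open>a < n\<close> by simp
  qed
  have "(A * ?E * B) $$ (i, j) = (\<Sum>l<n. if l = b then A $$ (i, a) * B $$ (b, j) else 0)"
    unfolding mat_mult_entry[OF mult_carrier_mat[OF A unit_mat_carrier] B \<open>i < n\<close> \<open>j < n\<close>] by (rule sum.cong) (auto simp: 1)
  then show ?thesis using \<open>b < n\<close> by simp
qed

section \<open>Orders of endomorphisms of vector bundles\<close>

text \<open>From now on the projective model matters only through its topology: the nonempty open sets are
  the cofinite ones.\<close>

locale curve = places k "topspace C" for k :: "'a::field set" and C :: "'a set topology" +
  assumes openin_iff: "openin C U \<longleftrightarrow> U = {} \<or> U \<subseteq> topspace C \<and> finite (topspace C - U)"
begin

abbreviation "S \<equiv> topspace C"

text \<open>A vector bundle with generic fibre \<open>K\<^sup>n\<close> is given by its stalks \<open>g P P\<^sup>n\<close>; all but finitely many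
  of them are standard.\<close>

definition vbundle :: "nat \<Rightarrow> ('a set \<Rightarrow> 'a mat) \<Rightarrow> bool" where
  "vbundle n g \<longleftrightarrow> (\<forall>P\<in>S. g P \<in> carrier_mat n n \<and> det (g P) \<noteq> 0) \<and> finite {P \<in> S. g P \<noteq> 1\<^sub>m n}"

text \<open>The sheaf of endomorphisms.  Its values on the empty set and outside the open sets are those
  that a subsheaf of the constant sheaf must take.\<close>

definition End_order :: "nat \<Rightarrow> ('a set \<Rightarrow> 'a mat) \<Rightarrow> 'a set set \<Rightarrow> 'a mat set" where
  "End_order n g U = (if openin C U then
     if U = {} then {0\<^sub>m n n} else {A \<in> carrier_mat n n. \<forall>P\<in>U. A \<in> local_order P n (g P)}
   else undefined)"

lemma vbundleD: assumes "vbundle n g" "P \<in> S" shows "g P \<in> carrier_mat n n" "det (g P) \<noteq> 0"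
  using assms by (auto simp: vbundle_def)

lemma vbundle_finite: "vbundle n g \<Longrightarrow> finite {P \<in> S. g P \<noteq> 1\<^sub>m n}"
  by (simp add: vbundle_def)

lemma openI: "U \<subseteq> S \<Longrightarrow> finite (S - U) \<Longrightarrow> openin C U"
  by (simp add: openin_iff)

lemma finite_nonintegral: "finite {P \<in> S. A \<notin> entries_in n P}" if A: "A \<in> carrier_mat n n"
proof -
  have "{P \<in> S. A \<notin> entries_in n P} \<subseteq> (\<Union>i<n. \<Union>j<n. {P \<in> S. A $$ (i, j) \<notin> P})"
    using A by (auto simp: entries_in_def)
  moreover have "finite (\<Union>i<n. \<Union>j<n. {P \<in> S. A $$ (i, j) \<notin> P})" using finite_poles by simp
  ultimately show ?thesis by (rule finite_subset)
qed

lemma local_order_subring: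
  assumes P: "P \<in> S" and h: "h \<in> carrier_mat n n" "det h \<noteq> 0"
  shows "local_order P n h \<subseteq> carrier_mat n n" "0\<^sub>m n n \<in> local_order P n h" "1\<^sub>m n \<in> local_order P n h"
    "A \<in> local_order P n h \<Longrightarrow> B \<in> local_order P n h \<Longrightarrow> A + B \<in> local_order P n h"
    "A \<in> local_order P n h \<Longrightarrow> B \<in> local_order P n h \<Longrightarrow> A * B \<in> local_order P n h"
    "c \<in> P \<Longrightarrow> A \<in> local_order P n h \<Longrightarrow> c \<cdot>\<^sub>m A \<in> local_order P n h"
proof -
  interpret dvr P by (rule dvr_S[OF P])
  note hi = minv(1)[OF h]
  have d: "det (minv h) \<noteq> 0" using minv(4)[OF h] h(2) by simp
  show "local_order P n h \<subseteq> carrier_mat n n" by (auto simp: local_order_def)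
  show "1\<^sub>m n \<in> local_order P n h" by (simp add: local_order_def conj_mat_unit[OF hi d] entries_one)
  show "0\<^sub>m n n \<in> local_order P n h"
    using zero_in by (auto simp: local_order_def conj_mat_zero[OF hi d] entries_in_def)
  show "A + B \<in> local_order P n h" if "A \<in> local_order P n h" "B \<in> local_order P n h" for A B
    using that entries_add[of _ n 0] conj_mat_add[OF hi d] by (auto simp: local_order_def fideal_0)
  show "A * B \<in> local_order P n h" if "A \<in> local_order P n h" "B \<in> local_order P n h" for A B
    using that entries_int_mult conj_mat_mult[OF hi d] by (auto simp: local_order_def)
  show "c \<cdot>\<^sub>m A \<in> local_order P n h" if "c \<in> P" "A \<in> local_order P n h" for c A
    using that entries_smult[of c _ n 0] conj_mat_smult[OF hi d] by (auto simp: local_order_def fideal_0)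
qed

lemma bundle_order:
  assumes "vbundle n g" "P \<in> S"
  shows "local_order P n (g P) \<subseteq> carrier_mat n n" "0\<^sub>m n n \<in> local_order P n (g P)" "1\<^sub>m n \<in> local_order P n (g P)"
    "A \<in> local_order P n (g P) \<Longrightarrow> B \<in> local_order P n (g P) \<Longrightarrow> A + B \<in> local_order P n (g P)"
    "A \<in> local_order P n (g P) \<Longrightarrow> B \<in> local_order P n (g P) \<Longrightarrow> A * B \<in> local_order P n (g P)"
    "c \<in> P \<Longrightarrow> A \<in> local_order P n (g P) \<Longrightarrow> c \<cdot>\<^sub>m A \<in> local_order P n (g P)"
  by (fact local_order_subring[OF assms(2) vbundleD[OF assms]])+

lemma End_order_open:
  "openin C U \<Longrightarrow> U \<noteq> {} \<Longrightarrow> End_order n g U = {A \<in> carrier_mat n n. \<forall>P\<in>U. A \<in> local_order P n (g P)}"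
  by (simp add: End_order_def)

lemma End_order_subsheaf:
  assumes g: "vbundle n g" shows "matrix_subsheaf C n (End_order n g)"
  unfolding matrix_subsheaf_def
proof (intro conjI allI impI)
  show "End_order n g \<in> extensional {U. openin C U}" by (auto simp: extensional_def End_order_def)
  show "End_order n g {} = {0\<^sub>m n n}" by (simp add: End_order_def)
next
  fix U assume U: "openin C U \<and> U \<noteq> {}"
  then have US: "U \<subseteq> S" using openin_subset by blast
  have E: "End_order n g U = {A \<in> carrier_mat n n. \<forall>P\<in>U. A \<in> local_order P n (g P)}" using U End_order_open by blast
  note L = bundle_order[OF g subsetD[OF US]]
  show "End_order n g U \<subseteq> carrier_mat n n" unfolding E by blast
  show "0\<^sub>m n n \<in> End_order n g U" unfolding E using L(2) by simp
  show "\<forall>A\<in>End_order n g U. \<forall>B\<in>End_order n g U. A + B \<in> End_order n g U" unfolding E by (simp add: L(4))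
  show "\<forall>c\<in>structure_sheaf U. \<forall>A\<in>End_order n g U. c \<cdot>\<^sub>m A \<in> End_order n g U"
    unfolding E structure_sheaf_def by (simp add: L(6))
next
  fix \<U> assume \<U>: "\<U> \<noteq> {} \<and> (\<forall>W\<in>\<U>. openin C W \<and> W \<noteq> {})"
  then have "openin C (\<Union>\<U>)" "\<Union>\<U> \<noteq> {}" by blast+
  then have 1: "End_order n g (\<Union>\<U>) = {A \<in> carrier_mat n n. \<forall>P\<in>\<Union>\<U>. A \<in> local_order P n (g P)}" by (rule End_order_open)
  have 2: "(\<Inter>W\<in>\<U>. End_order n g W) = (\<Inter>W\<in>\<U>. {A \<in> carrier_mat n n. \<forall>P\<in>W. A \<in> local_order P n (g P)})"
    using \<U> End_order_open by (intro INF_cong) auto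
  show "End_order n g (\<Union>\<U>) = (\<Inter>W\<in>\<U>. End_order n g W)" unfolding 1 2 using \<U> by blast
qed

lemma index_bound: "a < n \<Longrightarrow> b < n \<Longrightarrow> a * n + b < n * n" for a b n :: nat
proof -
  assume ab: "a < n" "b < n"
  have "a * n + b < a * n + n" using ab by simp
  also have "\<dots> = (a + 1) * n" by simp
  also have "\<dots> \<le> n * n" using ab by (intro mult_le_mono1) simp
  finally show ?thesis .
qed

lemma sum_div_mod:
  fixes f :: "nat \<Rightarrow> nat \<Rightarrow> 'b::comm_monoid_add"
  assumes "n > 0" shows "(\<Sum>l<n * n. f (l div n) (l mod n)) = (\<Sum>a<n. \<Sum>b<n. f a b)"
proof -
  have "(\<Sum>a<n. \<Sum>b<n. f a b) = (\<Sum>(a, b)\<in>{..<n} \<times> {..<n}. f a b)" by (rule sum.cartesian_product)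
  also have "\<dots> = (\<Sum>l<n * n. f (l div n) (l mod n))"
  proof (rule sum.reindex_bij_witness[where i = "\<lambda>l. (l div n, l mod n)" and j = "\<lambda>(a, b). a * n + b"])
    fix p assume "p \<in> {..<n} \<times> {..<n}"
    then obtain a b where ab: "p = (a, b)" "a < n" "b < n" by auto
    then show "(\<lambda>l. (l div n, l mod n)) (case p of (a, b) \<Rightarrow> a * n + b) = p" by simp
    show "(case p of (a, b) \<Rightarrow> a * n + b) \<in> {..<n * n}" using ab index_bound by simp
    show "f ((case p of (a, b) \<Rightarrow> a * n + b) div n) ((case p of (a, b) \<Rightarrow> a * n + b) mod n) = (case p of (a, b) \<Rightarrow> f a b)"
      using ab by simp
  next
    fix l assume "l \<in> {..<n * n}"
    then show "(l div n, l mod n) \<in> {..<n} \<times> {..<n}" using assms by (auto simp: less_mult_imp_div_less)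
    show "(case (l div n, l mod n) of (a, b) \<Rightarrow> a * n + b) = l" by simp
  qed
  finally show ?thesis by simp
qed

text \<open>The basis \<open>h E\<^sub>a\<^sub>b h\<^sup>-\<^sup>1\<close> of the matrix algebra, numbered by \<open>l = a n + b\<close>.\<close>

definition conj_basis :: "nat \<Rightarrow> 'a mat \<Rightarrow> nat \<Rightarrow> 'a mat" where
  "conj_basis n h l = mat n n (\<lambda>(i, j). h $$ (i, l div n) * minv h $$ (l mod n, j))"

lemma mat_lincomb_conj_basis:
  assumes n: "n > 0" and h: "h \<in> carrier_mat n n" "det h \<noteq> 0"
  shows "mat_lincomb n (n * n) (conj_basis n h) c = conj_mat h (mat n n (\<lambda>(a, b). c (a * n + b)))"
proof (rule eq_matI)
  let ?M = "mat n n (\<lambda>(a, b). c (a * n + b))"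
  have M: "?M \<in> carrier_mat n n" by simp
  note hi = minv(1)[OF h]
  fix i j assume "i < dim_row (conj_mat h ?M)" "j < dim_col (conj_mat h ?M)"
  then have ij: "i < n" "j < n" using conj_mat_carrier[OF h M] by auto
  have "mat_lincomb n (n * n) (conj_basis n h) c $$ (i, j) =
      (\<Sum>l<n * n. c (l div n * n + l mod n) * (h $$ (i, l div n) * minv h $$ (l mod n, j)))"
    using ij by (simp add: mat_lincomb_def conj_basis_def)
  also have "\<dots> = (\<Sum>a<n. \<Sum>b<n. c (a * n + b) * (h $$ (i, a) * minv h $$ (b, j)))"
    using sum_div_mod[OF n, of "\<lambda>a b. c (a * n + b) * (h $$ (i, a) * minv h $$ (b, j))"] .
  also have "\<dots> = (\<Sum>b<n. \<Sum>a<n. c (a * n + b) * (h $$ (i, a) * minv h $$ (b, j)))" by (rule sum.swap)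
  also have "\<dots> = (\<Sum>b<n. (h * ?M) $$ (i, b) * minv h $$ (b, j))"
  proof (rule sum.cong[OF refl])
    fix b assume b: "b \<in> {..<n}"
    then have "(h * ?M) $$ (i, b) = (\<Sum>a<n. h $$ (i, a) * c (a * n + b))" using mat_mult_entry[OF h(1) M ij(1)] by simp
    then show "(\<Sum>a<n. c (a * n + b) * (h $$ (i, a) * minv h $$ (b, j))) = (h * ?M) $$ (i, b) * minv h $$ (b, j)"
      by (simp only: sum_distrib_right) (simp only: ac_simps)
  qed
  also have "\<dots> = conj_mat h ?M $$ (i, j)"
    unfolding conj_mat_def using mat_mult_entry[OF mult_carrier_mat[OF h(1) M] hi ij] by simp
  finally show "mat_lincomb n (n * n) (conj_basis n h) c $$ (i, j) = conj_mat h ?M $$ (i, j)" .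
qed (use conj_mat_carrier[OF h, of "mat n n (\<lambda>(a, b). c (a * n + b))"] in \<open>auto simp: mat_lincomb_def\<close>)

lemma bij_conj_basis:
  assumes n: "n > 0" and h: "h \<in> carrier_mat n n" "det h \<noteq> 0"
  shows "bij_betw (mat_lincomb n (n * n) (conj_basis n h)) ({..<n * n} \<rightarrow>\<^sub>E R)
    {A \<in> carrier_mat n n. conj_mat (minv h) A \<in> entries_in n R}"
proof (rule bij_betw_imageI)
  let ?M = "\<lambda>c. mat n n (\<lambda>(a, b). c (a * n + b))"
  let ?L = "mat_lincomb n (n * n) (conj_basis n h)"
  have L: "?L c = conj_mat h (?M c)" for c by (rule mat_lincomb_conj_basis[OF n h])
  have inv: "conj_mat (minv h) (?L c) = ?M c" for c unfolding L by (rule conj_mat_cancel(1)[OF h]) simp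
  show "inj_on ?L ({..<n * n} \<rightarrow>\<^sub>E R)"
  proof (rule inj_onI)
    fix c e assume ce: "c \<in> {..<n * n} \<rightarrow>\<^sub>E R" "e \<in> {..<n * n} \<rightarrow>\<^sub>E R" "?L c = ?L e"
    from arg_cong[OF ce(3), of "conj_mat (minv h)"] have M: "?M c = ?M e" by (simp only: inv)
    show "c = e"
    proof (rule PiE_ext[OF ce(1,2)])
      fix l assume "l \<in> {..<n * n}"
      then have "l div n < n" "l mod n < n" using n by (auto simp: less_mult_imp_div_less)
      then have "?M c $$ (l div n, l mod n) = c l" "?M e $$ (l div n, l mod n) = e l" by simp_all
      then show "c l = e l" using M by simp
    qed
  qed
  show "?L ` ({..<n * n} \<rightarrow>\<^sub>E R) = {A \<in> carrier_mat n n. conj_mat (minv h) A \<in> entries_in n R}"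
  proof (intro equalityI subsetI)
    fix A assume "A \<in> ?L ` ({..<n * n} \<rightarrow>\<^sub>E R)"
    then obtain c where c: "c \<in> {..<n * n} \<rightarrow>\<^sub>E R" "A = ?L c" by blast
    have "?M c \<in> entries_in n R" using c(1) index_bound by (intro entries_inI) auto
    then show "A \<in> {A \<in> carrier_mat n n. conj_mat (minv h) A \<in> entries_in n R}"
      using c(2) inv[of c] by (simp add: mat_lincomb_def)
  next
    fix A assume "A \<in> {A \<in> carrier_mat n n. conj_mat (minv h) A \<in> entries_in n R}"
    then have A: "A \<in> carrier_mat n n" "conj_mat (minv h) A \<in> entries_in n R" by auto
    let ?B = "conj_mat (minv h) A"
    define c where "c = restrict (\<lambda>l. ?B $$ (l div n, l mod n)) {..<n * n}"
    have "c \<in> {..<n * n} \<rightarrow>\<^sub>E R"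
      using entries_inD(2)[OF A(2)] n by (auto simp: c_def less_mult_imp_div_less)
    moreover have "?M c = ?B"
      using entries_inD(1)[OF A(2)] index_bound by (intro eq_matI) (auto simp: c_def)
    then have "?L c = A" unfolding L using conj_mat_cancel(2)[OF h A(1)] by simp
    ultimately show "A \<in> ?L ` ({..<n * n} \<rightarrow>\<^sub>E R)" by blast
  qed
qed

lemma entries_in_Inter: "W \<noteq> {} \<Longrightarrow> A \<in> entries_in n (\<Inter> W) \<longleftrightarrow> (\<forall>Q\<in>W. A \<in> entries_in n Q)"
  by (auto simp: entries_in_def)

lemma End_order_locally_free:
  assumes n: "n > 0" and g: "vbundle n g" shows "locally_free C n (n * n) (End_order n g)"
  unfolding locally_free_def
proof
  fix P assume P: "P \<in> S"
  define h where "h = g P"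
  have h: "h \<in> carrier_mat n n" "det h \<noteq> 0" using vbundleD[OF g P] by (auto simp: h_def)
  note hi = minv[OF h]
  define U where "U = insert P {Q \<in> S. g Q = 1\<^sub>m n \<and> h \<in> entries_in n Q \<and> minv h \<in> entries_in n Q}"
  have US: "U \<subseteq> S" using P by (auto simp: U_def)
  have "S - U \<subseteq> {Q \<in> S. g Q \<noteq> 1\<^sub>m n} \<union> {Q \<in> S. h \<notin> entries_in n Q} \<union> {Q \<in> S. minv h \<notin> entries_in n Q}"
    by (auto simp: U_def)
  then have "finite (S - U)"
    by (rule finite_subset) (intro finite_UnI vbundle_finite[OF g] finite_nonintegral h(1) hi(1))
  then have U: "openin C U" by (rule openI[OF US])
  have lo: "local_order Q n (g Q) = local_order Q n h" if Q: "Q \<in> U" for Q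
  proof (cases "Q = P")
    case False
    then have Q': "Q \<in> S" "g Q = 1\<^sub>m n" "h \<in> entries_in n Q" "minv h \<in> entries_in n Q" using Q by (auto simp: U_def)
    interpret dvr Q by (rule dvr_S[OF Q'(1)])
    have "det h \<in> Q" "det (minv h) \<in> Q" using det_int[OF h(1)] det_int[OF hi(1)] Q' by (auto simp: entries_in_def)
    then have "unit_of Q (det h)" using h(2) hi(4) by (simp add: unit_of_def)
    from local_order_unit[OF _ _ Q'(3) this, of "1\<^sub>m n"] show ?thesis using h(1) Q'(2) by simp
  qed (simp add: h_def)
  show "\<exists>U e. openin C U \<and> P \<in> U \<and> (\<forall>W. openin C W \<and> W \<noteq> {} \<and> W \<subseteq> U \<longrightarrow>
      bij_betw (mat_lincomb n (n * n) e) ({..<n * n} \<rightarrow>\<^sub>E structure_sheaf W) (End_order n g W))"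
  proof (rule exI[of _ U], rule exI[of _ "conj_basis n h"], intro conjI allI impI)
    show "openin C U" "P \<in> U" using U by (auto simp: U_def)
    fix W assume W: "openin C W \<and> W \<noteq> {} \<and> W \<subseteq> U"
    then have "End_order n g W = {A \<in> carrier_mat n n. \<forall>Q\<in>W. A \<in> local_order Q n (g Q)}" using End_order_open by blast
    also have "\<dots> = {A \<in> carrier_mat n n. \<forall>Q\<in>W. A \<in> local_order Q n h}" using W lo by blast
    also have "\<dots> = {A \<in> carrier_mat n n. conj_mat (minv h) A \<in> entries_in n (structure_sheaf W)}"
      unfolding structure_sheaf_def using W entries_in_Inter[of W] by (auto simp: local_order_def)
    finally show "bij_betw (mat_lincomb n (n * n) (conj_basis n h)) ({..<n * n} \<rightarrow>\<^sub>E structure_sheaf W) (End_order n g W)"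
      using bij_conj_basis[OF n h] by simp
  qed
qed

theorem End_order_order:
  assumes n: "n > 0" and g: "vbundle n g" shows "matrix_order C n (End_order n g)"
  unfolding matrix_order_def matrix_lattice_def
proof (intro conjI allI impI)
  show "matrix_subsheaf C n (End_order n g)" "locally_free C n (n * n) (End_order n g)"
    using End_order_subsheaf[OF g] End_order_locally_free[OF n g] by auto
  fix U assume U: "openin C U \<and> U \<noteq> {}"
  then have US: "U \<subseteq> S" using openin_subset by blast
  have E: "End_order n g U = {A \<in> carrier_mat n n. \<forall>P\<in>U. A \<in> local_order P n (g P)}" using U End_order_open by blast
  note L = bundle_order[OF g subsetD[OF US]]
  show "1\<^sub>m n \<in> End_order n g U" unfolding E using L(3) by simp
  show "\<forall>A\<in>End_order n g U. \<forall>B\<in>End_order n g U. A * B \<in> End_order n g U" unfolding E by (auto simp: L(5) intro: mult_carrier_mat)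
qed

text \<open>A matrix in the local order at \<open>P\<close> lies in the local orders at all but finitely many other points,
  hence is a section over a neighbourhood of \<open>P\<close>.\<close>

lemma stalk_End_order:
  assumes g: "vbundle n g" and P: "P \<in> S" shows "stalk C (End_order n g) P = local_order P n (g P)"
proof (intro equalityI subsetI)
  fix A assume "A \<in> stalk C (End_order n g) P"
  then obtain U where "openin C U" "P \<in> U" "A \<in> End_order n g U" unfolding stalk_def by blast
  then show "A \<in> local_order P n (g P)" using End_order_open[of U n g] by blast
next
  fix A assume A: "A \<in> local_order P n (g P)"
  then have Ac: "A \<in> carrier_mat n n" by (simp add: local_order_def)
  define U where "U = {Q \<in> S. A \<in> local_order Q n (g Q)}"
  have "S - U \<subseteq> {Q \<in> S. g Q \<noteq> 1\<^sub>m n} \<union> {Q \<in> S. A \<notin> entries_in n Q}"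
    using Ac by (auto simp: U_def local_order_def minv_one conj_mat_one)
  then have "finite (S - U)" by (rule finite_subset) (intro finite_UnI vbundle_finite[OF g] finite_nonintegral Ac)
  then have U: "openin C U" by (intro openI) (auto simp: U_def)
  have "P \<in> U" using P A by (simp add: U_def)
  moreover have "A \<in> End_order n g U" using End_order_open[OF U] \<open>P \<in> U\<close> Ac by (auto simp: U_def)
  ultimately show "A \<in> stalk C (End_order n g) P" using U unfolding stalk_def by blast
qed

end

context curve
begin

lemma order_restrict:
  assumes F: "matrix_order C n F" and "openin C V" "openin C W" "W \<noteq> {}" "W \<subseteq> V"
  shows "F V \<subseteq> F W"
proof -
  have sh: "\<forall>\<U>. \<U> \<noteq> {} \<and> (\<forall>W\<in>\<U>. openin C W \<and> W \<noteq> {}) \<longrightarrow> F (\<Union>\<U>) = (\<Inter>W\<in>\<U>. F W)"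
    using F unfolding matrix_order_def matrix_lattice_def matrix_subsheaf_def by (elim conjE)
  have "F (\<Union>{V, W}) = (\<Inter>W\<in>{V, W}. F W)" by (rule sh[rule_format]) (use assms in auto)
  moreover have "\<Union>{V, W} = V" using assms(5) by blast
  ultimately have "F V = F V \<inter> F W" by simp
  then show ?thesis by blast
qed

lemma order_sections:
  assumes F: "matrix_order C n F" and U: "openin C U" "U \<noteq> {}"
  shows "F U \<subseteq> carrier_mat n n" "0\<^sub>m n n \<in> F U" "1\<^sub>m n \<in> F U"
    "A \<in> F U \<Longrightarrow> B \<in> F U \<Longrightarrow> A + B \<in> F U" "A \<in> F U \<Longrightarrow> B \<in> F U \<Longrightarrow> A * B \<in> F U"
    "c \<in> structure_sheaf U \<Longrightarrow> A \<in> F U \<Longrightarrow> c \<cdot>\<^sub>m A \<in> F U"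
proof -
  have 1: "F U \<subseteq> carrier_mat n n \<and> 0\<^sub>m n n \<in> F U \<and>
        (\<forall>A\<in>F U. \<forall>B\<in>F U. A + B \<in> F U) \<and>
        (\<forall>c\<in>structure_sheaf U. \<forall>A\<in>F U. c \<cdot>\<^sub>m A \<in> F U)"
  proof -
    have "\<forall>U. openin C U \<and> U \<noteq> {} \<longrightarrow>
        F U \<subseteq> carrier_mat n n \<and> 0\<^sub>m n n \<in> F U \<and>
        (\<forall>A\<in>F U. \<forall>B\<in>F U. A + B \<in> F U) \<and>
        (\<forall>c\<in>structure_sheaf U. \<forall>A\<in>F U. c \<cdot>\<^sub>m A \<in> F U)"
      using F unfolding matrix_order_def matrix_lattice_def matrix_subsheaf_def by (elim conjE)
    then show ?thesis using U by simp
  qed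
  have 2: "1\<^sub>m n \<in> F U \<and> (\<forall>A\<in>F U. \<forall>B\<in>F U. A * B \<in> F U)"
  proof -
    have "\<forall>U. openin C U \<and> U \<noteq> {} \<longrightarrow> 1\<^sub>m n \<in> F U \<and> (\<forall>A\<in>F U. \<forall>B\<in>F U. A * B \<in> F U)"
      using F unfolding matrix_order_def by (elim conjE)
    then show ?thesis using U by simp
  qed
  show "F U \<subseteq> carrier_mat n n" "0\<^sub>m n n \<in> F U" "1\<^sub>m n \<in> F U" using 1 2 by auto
  show "A \<in> F U \<Longrightarrow> B \<in> F U \<Longrightarrow> A + B \<in> F U" using 1 by simp
  show "A \<in> F U \<Longrightarrow> B \<in> F U \<Longrightarrow> A * B \<in> F U" using 2 by simp
  show "c \<in> structure_sheaf U \<Longrightarrow> A \<in> F U \<Longrightarrow> c \<cdot>\<^sub>m A \<in> F U" using 1 by simp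
qed

lemma whole_open: "openin C S" by (rule openI) auto

lemma stalkI: "openin C U \<Longrightarrow> P \<in> U \<Longrightarrow> A \<in> F U \<Longrightarrow> A \<in> stalk C F P"
  unfolding stalk_def by blast

lemma stalkE: assumes "A \<in> stalk C F P" obtains U where "openin C U" "P \<in> U" "A \<in> F U"
  using assms unfolding stalk_def by blast

lemma regular_locus_open: "openin C {Q \<in> S. c \<in> Q}"
proof (rule openI)
  have "S - {Q \<in> S. c \<in> Q} = {Q \<in> S. c \<notin> Q}" by blast
  then show "finite (S - {Q \<in> S. c \<in> Q})" using finite_poles by simp
qed blast

lemma stalk_common:
  assumes F: "matrix_order C n F" and "A \<in> stalk C F P" "B \<in> stalk C F P"
  obtains U where "openin C U" "P \<in> U" "A \<in> F U" "B \<in> F U"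
proof -
  obtain U where U: "openin C U" "P \<in> U" "A \<in> F U" by (rule stalkE[where F = F, OF assms(2)])
  obtain V where V: "openin C V" "P \<in> V" "B \<in> F V" by (rule stalkE[where F = F, OF assms(3)])
  have W: "openin C (U \<inter> V)" "U \<inter> V \<noteq> {}" "P \<in> U \<inter> V" using U V openin_Int by auto
  have "A \<in> F (U \<inter> V)" using order_restrict[OF F U(1) W(1,2)] U(3) by blast
  moreover have "B \<in> F (U \<inter> V)" using order_restrict[OF F V(1) W(1,2)] V(3) by blast
  ultimately show ?thesis using that W(1,3) by blast
qed

lemma stalk_order:
  assumes F: "matrix_order C n F" and P: "P \<in> S"
  shows "stalk C F P \<subseteq> carrier_mat n n" "0\<^sub>m n n \<in> stalk C F P" "1\<^sub>m n \<in> stalk C F P"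
    "A \<in> stalk C F P \<Longrightarrow> B \<in> stalk C F P \<Longrightarrow> A + B \<in> stalk C F P"
    "A \<in> stalk C F P \<Longrightarrow> B \<in> stalk C F P \<Longrightarrow> A * B \<in> stalk C F P"
    "c \<in> P \<Longrightarrow> A \<in> stalk C F P \<Longrightarrow> c \<cdot>\<^sub>m A \<in> stalk C F P"
proof -
  have ne: "U \<noteq> {}" if "P \<in> U" for U :: "'a set set" using that by blast
  show "stalk C F P \<subseteq> carrier_mat n n"
  proof
    fix A assume "A \<in> stalk C F P"
    then obtain U where U: "openin C U" "P \<in> U" "A \<in> F U" by (rule stalkE[where F = F])
    then show "A \<in> carrier_mat n n" using order_sections(1)[OF F U(1) ne[OF U(2)]] by blast
  qed
  note s = order_sections[OF F whole_open ne[OF P]]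
  show "0\<^sub>m n n \<in> stalk C F P" "1\<^sub>m n \<in> stalk C F P" by (rule stalkI[where F = F, OF whole_open P], rule s)+
  show "A + B \<in> stalk C F P" "A * B \<in> stalk C F P" if AB: "A \<in> stalk C F P" "B \<in> stalk C F P" for A B
  proof -
    obtain U where U: "openin C U" "P \<in> U" "A \<in> F U" "B \<in> F U" by (rule stalk_common[OF F AB])
    note s = order_sections[OF F U(1) ne[OF U(2)]]
    show "A + B \<in> stalk C F P" by (rule stalkI[where F = F, OF U(1,2)], rule s(4)[OF U(3,4)])
    show "A * B \<in> stalk C F P" by (rule stalkI[where F = F, OF U(1,2)], rule s(5)[OF U(3,4)])
  qed
  show "c \<cdot>\<^sub>m A \<in> stalk C F P" if c: "c \<in> P" and A: "A \<in> stalk C F P" for c A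
  proof -
    obtain U where U: "openin C U" "P \<in> U" "A \<in> F U" by (rule stalkE[where F = F, OF A])
    let ?W = "U \<inter> {Q \<in> S. c \<in> Q}"
    have W: "openin C ?W" "P \<in> ?W" using U c P openin_Int[OF U(1) regular_locus_open] by auto
    have "A \<in> F ?W" using order_restrict[OF F U(1) W(1) ne[OF W(2)]] U(3) by blast
    moreover have "c \<in> structure_sheaf ?W" by (auto simp: structure_sheaf_def)
    ultimately have "c \<cdot>\<^sub>m A \<in> F ?W" using order_sections(6)[OF F W(1) ne[OF W(2)]] by blast
    then show ?thesis by (rule stalkI[where F = F, OF W])
  qed
qed

text \<open>Local freeness at \<open>P0\<close> provides a basis for the stalks at all points near \<open>P0\<close>.\<close>

lemma stalk_lincomb:
  assumes F: "matrix_order C n F" and P0: "P0 \<in> S"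
  obtains U e where "openin C U" "P0 \<in> U"
    "\<And>Q A. Q \<in> U \<Longrightarrow> A \<in> stalk C F Q \<Longrightarrow> \<exists>c. (\<forall>l<n * n. c l \<in> Q) \<and> A = mat_lincomb n (n * n) e c"
proof -
  have "locally_free C n (n * n) F" using F by (simp add: matrix_order_def matrix_lattice_def)
  then obtain U e where U: "openin C U" "P0 \<in> U" and
    bij: "\<forall>W. openin C W \<and> W \<noteq> {} \<and> W \<subseteq> U \<longrightarrow>
           bij_betw (mat_lincomb n (n * n) e) ({..<n * n} \<rightarrow>\<^sub>E structure_sheaf W) (F W)"
    using P0 unfolding locally_free_def by blast
  show ?thesis
  proof (rule that[OF U])
    fix Q A assume Q: "Q \<in> U" and A: "A \<in> stalk C F Q"
    obtain V where V: "openin C V" "Q \<in> V" "A \<in> F V" by (rule stalkE[where F = F, OF A])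
    let ?W = "V \<inter> U"
    have W: "openin C ?W" "?W \<noteq> {}" "Q \<in> ?W" using openin_Int[OF V(1) U(1)] V(2) Q by auto
    have "A \<in> F ?W" using order_restrict[OF F V(1) W(1,2)] V(3) by blast
    moreover have "mat_lincomb n (n * n) e ` ({..<n * n} \<rightarrow>\<^sub>E structure_sheaf ?W) = F ?W"
      using bij W(1,2) by (intro bij_betw_imp_surj_on) blast
    ultimately have "A \<in> mat_lincomb n (n * n) e ` ({..<n * n} \<rightarrow>\<^sub>E structure_sheaf ?W)" by simp
    then obtain c where c: "c \<in> {..<n * n} \<rightarrow>\<^sub>E structure_sheaf ?W" "A = mat_lincomb n (n * n) e c" by blast
    have "c l \<in> Q" if "l < n * n" for l using c(1) that W(3) by (auto simp: structure_sheaf_def PiE_def Pi_def)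
    then show "\<exists>c. (\<forall>l<n * n. c l \<in> Q) \<and> A = mat_lincomb n (n * n) e c" using c(2) by blast
  qed
qed

lemma (in dvr) lincomb_entries:
  assumes "\<And>l. l < r \<Longrightarrow> c l \<in> P" "\<And>l. l < r \<Longrightarrow> mat n n (\<lambda>(i, j). e l $$ (i, j)) \<in> entries_in n (fideal P m)"
  shows "mat_lincomb n r e c \<in> entries_in n (fideal P m)"
proof (rule entries_inI)
  show "mat_lincomb n r e c \<in> carrier_mat n n" by (simp add: mat_lincomb_def)
  fix i j assume ij: "i < n" "j < n"
  have "(\<Sum>l<r. c l * e l $$ (i, j)) \<in> fideal P m"
  proof (rule fideal_sum)
    fix l assume "l \<in> {..<r}"
    then have l: "l < r" by simp
    have "e l $$ (i, j) \<in> fideal P m" using entries_inD(2)[OF assms(2)[OF l] ij] ij by simp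
    then show "c l * e l $$ (i, j) \<in> fideal P m" by (rule fideal_mult_left[OF assms(1)[OF l]])
  qed
  then show "mat_lincomb n r e c $$ (i, j) \<in> fideal P m" using ij by (simp add: mat_lincomb_def)
qed

lemma stalk_bounded:
  assumes F: "matrix_order C n F" and P: "P \<in> S"
  obtains N where "stalk C F P \<subseteq> entries_in n (fideal P (- int N))"
proof -
  interpret dvr P by (rule dvr_S[OF P])
  obtain U e where U: "openin C U" "P \<in> U"
    "\<And>Q A. Q \<in> U \<Longrightarrow> A \<in> stalk C F Q \<Longrightarrow> \<exists>c. (\<forall>l<n * n. c l \<in> Q) \<and> A = mat_lincomb n (n * n) e c"
    using stalk_lincomb[OF F P] by blast
  let ?e = "\<lambda>l. mat n n (\<lambda>(i, j). e l $$ (i, j))"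
  have "\<forall>l. \<exists>N. ?e l \<in> entries_in n (fideal P (- int N))" by (intro allI entries_bounded) simp
  from choice[OF this] obtain M where M: "\<And>l. ?e l \<in> entries_in n (fideal P (- int (M l)))" by blast
  define N where "N = (\<Sum>l<n * n. M l)"
  have e: "?e l \<in> entries_in n (fideal P (- int N))" if "l < n * n" for l
  proof -
    have "M l \<le> N" unfolding N_def using that by (intro member_le_sum) auto
    then have "fideal P (- int (M l)) \<subseteq> fideal P (- int N)" by (intro fideal_antimono) simp
    then show ?thesis using M[of l] entries_in_mono by blast
  qed
  show ?thesis
  proof (rule that, rule subsetI)
    fix A assume "A \<in> stalk C F P"
    from U(3)[OF U(2) this] obtain c where c: "\<forall>l<n * n. c l \<in> P" "A = mat_lincomb n (n * n) e c" by blast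
    show "A \<in> entries_in n (fideal P (- int N))" unfolding c(2) by (rule lincomb_entries) (use c(1) e in auto)
  qed
qed

text \<open>Near a given point, the stalks are spanned by one and the same finite family, which is integral at
  all but finitely many points; one neighbourhood contains all but finitely many points.\<close>

lemma stalk_almost_integral:
  assumes F: "matrix_order C n F" shows "finite {Q \<in> S. \<not> stalk C F Q \<subseteq> entries_in n Q}"
proof -
  obtain P0 where P0: "P0 \<in> S" by (rule point_exists)
  obtain U e where U: "openin C U" "P0 \<in> U"
    "\<And>Q A. Q \<in> U \<Longrightarrow> A \<in> stalk C F Q \<Longrightarrow> \<exists>c. (\<forall>l<n * n. c l \<in> Q) \<and> A = mat_lincomb n (n * n) e c"
    using stalk_lincomb[OF F P0] by blast
  let ?e = "\<lambda>l. mat n n (\<lambda>(i, j). e l $$ (i, j))"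
  have "{Q \<in> S. \<not> stalk C F Q \<subseteq> entries_in n Q} \<subseteq> (S - U) \<union> (\<Union>l<n * n. {Q \<in> S. ?e l \<notin> entries_in n Q})"
  proof
    fix Q assume "Q \<in> {Q \<in> S. \<not> stalk C F Q \<subseteq> entries_in n Q}"
    then obtain A where Q: "Q \<in> S" and A: "A \<in> stalk C F Q" "A \<notin> entries_in n Q" by blast
    interpret dvr Q by (rule dvr_S[OF Q])
    show "Q \<in> (S - U) \<union> (\<Union>l<n * n. {Q \<in> S. ?e l \<notin> entries_in n Q})"
    proof (rule ccontr)
      assume n: "\<not> ?thesis"
      then have QU: "Q \<in> U" using Q by blast
      have e: "?e l \<in> entries_in n (fideal Q 0)" if "l < n * n" for l using n Q that unfolding fideal_0 by blast
      from U(3)[OF QU A(1)] obtain c where c: "\<forall>l<n * n. c l \<in> Q" "A = mat_lincomb n (n * n) e c" by blast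
      have "A \<in> entries_in n (fideal Q 0)" unfolding c(2) by (rule lincomb_entries) (use c(1) e in auto)
      then show False using A(2) by (simp add: fideal_0)
    qed
  qed
  moreover have "finite (S - U)" using U(1,2) unfolding openin_iff by blast
  then have "finite ((S - U) \<union> (\<Union>l<n * n. {Q \<in> S. ?e l \<notin> entries_in n Q}))"
    using finite_nonintegral by simp
  ultimately show ?thesis by (rule finite_subset)
qed

text \<open>An order acts on the lattice that it generates from the standard one.  Among the invertible
  matrices with columns in this lattice, one with determinant of minimal valuation has columns
  that form a basis, by Cramer's rule.\<close>

lemma stalk_in_local_order:
  assumes F: "matrix_order C n F" and P: "P \<in> S"
  shows "\<exists>h. h \<in> carrier_mat n n \<and> det h \<noteq> 0 \<and> stalk C F P \<subseteq> local_order P n h"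
proof -
  interpret dvr P by (rule dvr_S[OF P])
  define D where "D = stalk C F P"
  note D = stalk_order[OF F P, folded D_def]
  obtain N where N: "D \<subseteq> entries_in n (fideal P (- int N))" using stalk_bounded[OF F P] by (auto simp: D_def)
  \<comment> \<open>the columns \<open>f\<close> in the lattice generated by \<open>D\<close> from the standard basis vectors\<close>
  define inM where "inM f \<longleftrightarrow> (\<exists>A. (\<forall>l<n. A l \<in> D) \<and> (\<forall>i<n. f i = (\<Sum>l<n. A l $$ (i, l))))" for f
  \<comment> \<open>matrices with columns in this lattice\<close>
  define T where "T = {G \<in> carrier_mat n n. \<forall>j<n. inM (\<lambda>i. G $$ (i, j))}"
  have one: "1\<^sub>m n \<in> T"
  proof -
    have "inM (\<lambda>i. 1\<^sub>m n $$ (i, j))" if j: "j < n" for j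
      unfolding inM_def
    proof (intro exI[of _ "\<lambda>l. if l = j then 1\<^sub>m n else 0\<^sub>m n n"] conjI allI impI)
      fix l assume "l < n"
      show "(if l = j then 1\<^sub>m n else 0\<^sub>m n n) \<in> D" using D(2,3) by simp
    next
      fix i assume i: "i < n"
      have "(\<Sum>l<n. (if l = j then 1\<^sub>m n else 0\<^sub>m n n) $$ (i, l)) = (\<Sum>l<n. if l = j then (1\<^sub>m n :: 'a mat) $$ (i, j) else 0)"
        using i by (intro sum.cong) auto
      then show "(1\<^sub>m n :: 'a mat) $$ (i, j) = (\<Sum>l<n. (if l = j then 1\<^sub>m n else 0\<^sub>m n n) $$ (i, l))" using j by simp
    qed
    then show ?thesis by (simp add: T_def)
  qed
  have inM_bound: "f i \<in> fideal P (- int N)" if f: "inM f" and i: "i < n" for f i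
  proof -
    from f[unfolded inM_def] obtain A where A: "\<forall>l<n. A l \<in> D" "\<forall>i<n. f i = (\<Sum>l<n. A l $$ (i, l))" by (elim exE conjE)
    have "(\<Sum>l<n. A l $$ (i, l)) \<in> fideal P (- int N)"
    proof (rule fideal_sum)
      fix l assume "l \<in> {..<n}"
      then show "A l $$ (i, l) \<in> fideal P (- int N)" using A(1) N i by (auto simp: entries_in_def)
    qed
    then show ?thesis using A(2) i by simp
  qed
  have bound: "ord P (det G) \<ge> - int (n * N)" if G: "G \<in> T" "det G \<noteq> 0" for G
  proof -
    let ?t = "uniformizer P ^ N"
    have Gc: "G \<in> carrier_mat n n" using G by (simp add: T_def)
    have "det (?t \<cdot>\<^sub>m G) \<in> P"
    proof (rule det_int)
      show "?t \<cdot>\<^sub>m G \<in> carrier_mat n n" using Gc by simp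
      fix i j assume ij: "i < n" "j < n"
      have "G $$ (i, j) \<in> fideal P (- int N)" using inM_bound[of "\<lambda>i. G $$ (i, j)"] G ij by (simp add: T_def)
      moreover have "?t \<in> fideal P (int N)" by (simp add: fideal_def ord_power)
      ultimately have "?t * G $$ (i, j) \<in> fideal P (int N + - int N)" by (intro fideal_mult)
      then show "(?t \<cdot>\<^sub>m G) $$ (i, j) \<in> P" using ij Gc by (simp add: fideal_0)
    qed
    then have "?t ^ n * det G \<in> P" using Gc by simp
    then have "ord P (?t ^ n * det G) \<ge> 0" using G(2) by (simp add: mem_iff)
    then show ?thesis using G(2) by (simp add: ord_mult ord_power algebra_simps)
  qed
  define msr where "msr G = nat (ord P (det G) + int (n * N))" for G
  have "(\<lambda>G. G \<in> T \<and> det G \<noteq> 0) (1\<^sub>m n)" using one by simp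
  from ex_has_least_nat[of "\<lambda>G. G \<in> T \<and> det G \<noteq> 0", OF this, of msr]
  obtain G where G: "G \<in> T" "det G \<noteq> 0" and min: "\<And>H. H \<in> T \<Longrightarrow> det H \<noteq> 0 \<Longrightarrow> msr G \<le> msr H" by blast
  have Gc: "G \<in> carrier_mat n n" using G by (simp add: T_def)
  note Gi = minv[OF Gc G(2)]
  have "D \<subseteq> local_order P n G"
  proof
    fix B assume B: "B \<in> D"
    then have Bc: "B \<in> carrier_mat n n" using D(1) by blast
    define H where "H = minv G * B * G"
    have GB: "minv G * B \<in> carrier_mat n n" by (rule mult_carrier_mat[OF Gi(1) Bc])
    have Hc: "H \<in> carrier_mat n n" unfolding H_def by (rule mult_carrier_mat[OF GB Gc])
    have "G * H = G * (minv G * B) * G" unfolding H_def by (rule assoc_mult_mat[OF Gc GB Gc, symmetric])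
    also have "G * (minv G * B) = G * minv G * B" by (rule assoc_mult_mat[OF Gc Gi(1) Bc, symmetric])
    finally have GH: "G * H = B * G" using Gi(2) Bc by simp
    have "H \<in> entries_in n P"
    proof (rule entries_inI[OF Hc])
      fix a j assume aj: "a < n" "j < n"
      \<comment> \<open>by Cramer's rule, an entry of \<open>H\<close> is a quotient of two determinants of matrices in \<open>T\<close>\<close>
      let ?R = "replace_col G (G *\<^sub>v col H j) a"
      have Rc: "?R \<in> carrier_mat n n" using Gc by (auto simp: replace_col_def)
      have cr: "det ?R = H $$ (a, j) * det G"
        using cramer_lemma_mat[OF Gc _ aj(1), of "col H j"] Hc aj by simp
      have w: "(G *\<^sub>v col H j) $ i = (\<Sum>l<n. B $$ (i, l) * G $$ (l, j))" if "i < n" for i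
      proof -
        have "G *\<^sub>v col H j = col (B * G) j" using col_mult2[OF Gc Hc aj(2)] GH by simp
        then show ?thesis using mat_mult_entry[OF Bc Gc that aj(2)] that aj(2) Bc Gc by simp
      qed
      have "inM (\<lambda>i. (G *\<^sub>v col H j) $ i)"
      proof -
        have "inM (\<lambda>i. G $$ (i, j))" using G(1) aj(2) by (simp add: T_def)
        then obtain A where A: "\<forall>l<n. A l \<in> D" "\<forall>i<n. G $$ (i, j) = (\<Sum>l<n. A l $$ (i, l))" unfolding inM_def by blast
        have "(G *\<^sub>v col H j) $ i = (\<Sum>m<n. (B * A m) $$ (i, m))" if i: "i < n" for i
        proof -
          have "(G *\<^sub>v col H j) $ i = (\<Sum>l<n. \<Sum>m<n. B $$ (i, l) * A m $$ (l, m))"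
            unfolding w[OF i] using A(2) by (simp add: sum_distrib_left)
          also have "\<dots> = (\<Sum>m<n. \<Sum>l<n. B $$ (i, l) * A m $$ (l, m))" by (rule sum.swap)
          also have "\<dots> = (\<Sum>m<n. (B * A m) $$ (i, m))"
            using A(1) D(1) by (intro sum.cong refl mat_mult_entry[OF Bc _ i, symmetric]) auto
          finally show ?thesis .
        qed
        moreover have "\<forall>m<n. B * A m \<in> D" using D(5)[OF B] A(1) by blast
        ultimately show ?thesis unfolding inM_def by (intro exI[of _ "\<lambda>m. B * A m"]) auto
      qed
      then have RT: "?R \<in> T"
      proof -
        assume w: "inM (\<lambda>i. (G *\<^sub>v col H j) $ i)"
        have inM_cong: "inM f \<Longrightarrow> (\<And>i. i < n \<Longrightarrow> f i = f' i) \<Longrightarrow> inM f'" for f f' unfolding inM_def by simp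
        have "inM (\<lambda>i. ?R $$ (i, b))" if b: "b < n" for b
        proof (cases "b = a")
          case True
          show ?thesis by (rule inM_cong[OF w]) (use True b Gc in \<open>simp add: replace_col_def\<close>)
        next
          case False
          have "inM (\<lambda>i. G $$ (i, b))" using G(1) b by (simp add: T_def)
          then show ?thesis by (rule inM_cong) (use False b Gc in \<open>simp add: replace_col_def\<close>)
        qed
        then show ?thesis using Rc by (simp add: T_def)
      qed
      show "H $$ (a, j) \<in> P"
      proof (cases "H $$ (a, j) = 0")
        case True
        then show ?thesis using zero_in by simp
      next
        case False
        then have d: "det ?R \<noteq> 0" using cr G(2) by simp
        have "msr G \<le> msr ?R" by (rule min[OF RT d])
        then have "ord P (det G) \<le> ord P (det ?R)" using bound[OF G] bound[OF RT d] by (simp add: msr_def nat_le_eq_zle)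
        then have "0 \<le> ord P (H $$ (a, j))" unfolding cr using False G(2) by (simp add: ord_mult)
        then show ?thesis by (simp add: mem_iff)
      qed
    qed
    then show "B \<in> local_order P n G" using Bc by (simp add: local_order_def conj_mat_def minv_minv[OF Gc G(2)] H_def)
  qed
  then show ?thesis using Gc G(2) by (auto simp: D_def)
qed

text \<open>Every stalk of an order acts on some lattice, which may be the standard one at almost all points.
  So the order is contained in the order of endomorphisms of a bundle, and equal to it by
  maximality.\<close>

theorem maximal_order_End:
  assumes n: "n > 0" and D: "D \<in> maximal_orders C n" obtains g where "vbundle n g" "D = End_order n g"
proof -
  have F: "matrix_order C n D" using D by (simp add: maximal_orders_def)
  have "\<forall>P. \<exists>h. P \<in> S \<longrightarrow> h \<in> carrier_mat n n \<and> det h \<noteq> 0 \<and> stalk C D P \<subseteq> local_order P n h"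
  proof
    fix P
    show "\<exists>h. P \<in> S \<longrightarrow> h \<in> carrier_mat n n \<and> det h \<noteq> 0 \<and> stalk C D P \<subseteq> local_order P n h"
    proof (cases "P \<in> S")
      case True
      from stalk_in_local_order[OF F True]
      obtain h where "h \<in> carrier_mat n n \<and> det h \<noteq> 0 \<and> stalk C D P \<subseteq> local_order P n h" by (elim exE)
      then show ?thesis by (intro exI[of _ h] impI)
    qed simp
  qed
  from choice[OF this] obtain h where
    h: "\<And>P. P \<in> S \<Longrightarrow> h P \<in> carrier_mat n n \<and> det (h P) \<noteq> 0 \<and> stalk C D P \<subseteq> local_order P n (h P)" by blast
  define g where "g P = (if stalk C D P \<subseteq> entries_in n P then 1\<^sub>m n else h P)" for P
  have "{P \<in> S. g P \<noteq> 1\<^sub>m n} \<subseteq> {P \<in> S. \<not> stalk C D P \<subseteq> entries_in n P}" by (auto simp: g_def)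
  then have "finite {P \<in> S. g P \<noteq> 1\<^sub>m n}" by (rule finite_subset) (rule stalk_almost_integral[OF F])
  then have g: "vbundle n g" using h by (simp add: vbundle_def g_def)
  have st: "stalk C D P \<subseteq> local_order P n (g P)" if P: "P \<in> S" for P
  proof (cases "stalk C D P \<subseteq> entries_in n P")
    case True
    then have "A \<in> local_order P n (g P)" if "A \<in> stalk C D P" for A
      using that True entries_inD(1)[of A n P] by (auto simp: g_def local_order_def minv_one conj_mat_one)
    then show ?thesis by blast
  next
    case False
    then show ?thesis using h[OF P] by (simp add: g_def)
  qed
  have "D U \<subseteq> End_order n g U" if U: "openin C U" for U
  proof (cases "U = {}")
    case True
    have "D {} = {0\<^sub>m n n}" using F by (simp add: matrix_order_def matrix_lattice_def matrix_subsheaf_def)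
    then show ?thesis using True U by (simp add: End_order_def)
  next
    case False
    show ?thesis
    proof
      fix A assume A: "A \<in> D U"
      have "A \<in> local_order P n (g P)" if "P \<in> U" for P
        using st[of P] stalkI[of U P A D, OF U that A] openin_subset[OF U] that by blast
      then show "A \<in> End_order n g U"
        unfolding End_order_open[OF U False] using order_sections(1)[OF F U False] A by blast
    qed
  qed
  then have "End_order n g = D" using D End_order_order[OF n g] unfolding maximal_orders_def by blast
  then show ?thesis using that[OF g] by simp
qed

lemma unit_mat_mult:
  fixes A :: "'a mat"
  assumes ij: "i < n" "j < n" and A: "A \<in> carrier_mat n n"
  shows "unit_mat n i i 1 * A * unit_mat n j i 1 = unit_mat n i i (A $$ (i, j))"
proof (rule eq_matI)
  fix r s assume "r < dim_row (unit_mat n i i (A $$ (i, j)))" "s < dim_col (unit_mat n i i (A $$ (i, j)))"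
  then have rs: "r < n" "s < n" by (auto simp: unit_mat_def)
  have 1: "(unit_mat n i i 1 * A) $$ (r, l) = (if r = i then A $$ (i, l) else 0)" if l: "l < n" for l
  proof -
    have "(unit_mat n i i 1 * A) $$ (r, l) = (\<Sum>m<n. (if r = i \<and> m = i then 1 else 0) * A $$ (m, l))"
      using mat_mult_entry[OF unit_mat_carrier A rs(1) l] rs by (simp add: unit_mat_def)
    also have "\<dots> = (\<Sum>m<n. if m = i then (if r = i then A $$ (i, l) else 0) else 0)"
      by (rule sum.cong) auto
    finally show ?thesis using ij by simp
  qed
  have "(unit_mat n i i 1 * A * unit_mat n j i 1) $$ (r, s) = (\<Sum>l<n. (unit_mat n i i 1 * A) $$ (r, l) * unit_mat n j i 1 $$ (l, s))"
    by (rule mat_mult_entry[OF mult_carrier_mat[OF unit_mat_carrier A] unit_mat_carrier rs])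
  also have "\<dots> = (\<Sum>l<n. if l = j then (if r = i \<and> s = i then A $$ (i, j) else 0) else 0)"
    by (rule sum.cong) (use 1 rs in \<open>auto simp: unit_mat_def\<close>)
  also have "\<dots> = unit_mat n i i (A $$ (i, j)) $$ (r, s)" using ij rs by (simp add: unit_mat_def)
  finally show "(unit_mat n i i 1 * A * unit_mat n j i 1) $$ (r, s) = unit_mat n i i (A $$ (i, j)) $$ (r, s)" .
qed (auto simp: unit_mat_def)

lemma unit_mat_power_mult:
  fixes a b :: 'a
  assumes i: "i < n" shows "unit_mat n i i a * unit_mat n i i b = unit_mat n i i (a * b)"
proof (rule eq_matI)
  fix r s assume "r < dim_row (unit_mat n i i (a * b))" "s < dim_col (unit_mat n i i (a * b))"
  then have rs: "r < n" "s < n" by (auto simp: unit_mat_def)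
  have "(unit_mat n i i a * unit_mat n i i b) $$ (r, s) = (\<Sum>l<n. unit_mat n i i a $$ (r, l) * unit_mat n i i b $$ (l, s))"
    by (rule mat_mult_entry[OF unit_mat_carrier unit_mat_carrier rs])
  also have "\<dots> = (\<Sum>l<n. if l = i then (if r = i \<and> s = i then a * b else 0) else 0)"
    by (rule sum.cong) (use rs in \<open>auto simp: unit_mat_def\<close>)
  also have "\<dots> = unit_mat n i i (a * b) $$ (r, s)" using i rs by (simp add: unit_mat_def)
  finally show "(unit_mat n i i a * unit_mat n i i b) $$ (r, s) = unit_mat n i i (a * b) $$ (r, s)" .
qed (auto simp: unit_mat_def)

text \<open>A ring strictly containing a matrix ring over a valuation ring contains the powers of a
  nonintegral scalar, so that it is not bounded.\<close>

lemma bounded_ring_in_local_order: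
  assumes P: "P \<in> S" and h: "h \<in> carrier_mat n n" "det h \<noteq> 0"
    and F: "local_order P n h \<subseteq> F" "F \<subseteq> entries_in n (fideal P (- int N))" "\<And>A B. A \<in> F \<Longrightarrow> B \<in> F \<Longrightarrow> A * B \<in> F"
  shows "F \<subseteq> local_order P n h"
proof
  fix A assume A: "A \<in> F"
  interpret dvr P by (rule dvr_S[OF P])
  have Ac: "A \<in> carrier_mat n n" using A F(2) by (auto simp: entries_in_def)
  note hi = minv[OF h]
  have d: "det (minv h) \<noteq> 0" using hi(4) h(2) by simp
  define B where "B = conj_mat (minv h) A"
  have Bc: "B \<in> carrier_mat n n" unfolding B_def by (rule conj_mat_carrier[OF hi(1) d Ac])
  have AB: "A = conj_mat h B" unfolding B_def by (rule conj_mat_cancel(2)[OF h Ac, symmetric])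
  have "B \<in> entries_in n P"
  proof (rule entries_inI[OF Bc], rule ccontr)
    fix i j assume ij: "i < n" "j < n" and nP: "B $$ (i, j) \<notin> P"
    define a where "a = B $$ (i, j)"
    have a: "a \<noteq> 0" "ord P a \<le> - 1" using nP by (auto simp: a_def mem_iff)
    have unitF: "conj_mat h (unit_mat n r s 1) \<in> F" for r s
    proof -
      have "unit_mat n r s 1 \<in> entries_in n P" using one_in zero_in by (auto simp: entries_in_def unit_mat_def)
      then have "conj_mat h (unit_mat n r s 1) \<in> local_order P n h" unfolding local_order_eq[OF h] by (rule imageI)
      then show ?thesis using F(1) by blast
    qed
    have "conj_mat h (unit_mat n i i 1) * A * conj_mat h (unit_mat n j i 1) = conj_mat h (unit_mat n i i 1 * B * unit_mat n j i 1)"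
      unfolding AB conj_mat_mult[OF h mult_carrier_mat[OF unit_mat_carrier Bc] unit_mat_carrier]
        conj_mat_mult[OF h unit_mat_carrier Bc] ..
    then have aF: "conj_mat h (unit_mat n i i a) \<in> F"
      using F(3)[OF F(3)[OF unitF[of i i] A] unitF[of j i]] unit_mat_mult[OF ij Bc] by (simp add: a_def)
    have pF: "conj_mat h (unit_mat n i i (a ^ Suc m)) \<in> F" for m
    proof (induction m)
      case 0
      then show ?case using aF by simp
    next
      case (Suc m)
      have "conj_mat h (unit_mat n i i a) * conj_mat h (unit_mat n i i (a ^ Suc m)) = conj_mat h (unit_mat n i i (a ^ Suc (Suc m)))"
        using conj_mat_mult[OF h, of "unit_mat n i i a" "unit_mat n i i (a ^ Suc m)"] unit_mat_power_mult[OF ij(1)] by simp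
      then show ?case using F(3)[OF aF Suc] by simp
    qed
    obtain N1 where N1: "h \<in> entries_in n (fideal P (- int N1))" using entries_bounded[OF h(1)] by blast
    obtain N2 where N2: "minv h \<in> entries_in n (fideal P (- int N2))" using entries_bounded[OF hi(1)] by blast
    define M where "M = N2 + N + N1"
    have "- int M \<le> ord P (a ^ Suc m)" for m
    proof -
      let ?u = "unit_mat n i i (a ^ Suc m)"
      have e: "minv h * conj_mat h ?u * h = ?u"
        using conj_mat_cancel(1)[OF h unit_mat_carrier, of i i "a ^ Suc m"]
        unfolding conj_mat_def[of "minv h"] minv_minv[OF h] .
      have "conj_mat h ?u \<in> entries_in n (fideal P (- int N))" using F(2) pF[of m] by blast
      from entries_mult[OF entries_mult[OF N2 this] N1]
      have "?u \<in> entries_in n (fideal P (- int N2 + - int N + - int N1))" unfolding e .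
      from entries_inD(2)[OF this ij(1) ij(1)]
      have "a ^ Suc m \<in> fideal P (- int N2 + - int N + - int N1)" using ij(1) by (simp add: unit_mat_def)
      then show ?thesis using a(1) by (simp add: fideal_def M_def)
    qed
    from this[of M] have "- int M \<le> int (Suc M) * ord P a" using ord_power[OF a(1), of "Suc M"] by simp
    moreover have "int (Suc M) * ord P a \<le> int (Suc M) * (- 1)" using a(2) by (intro mult_left_mono) auto
    ultimately show False by simp
  qed
  then show "A \<in> local_order P n h" using Ac by (simp add: local_order_def B_def)
qed

text \<open>The stalks of an order are bounded, hence \<open>bounded_ring_in_local_order\<close> applies to them.\<close>

theorem End_order_maximal:
  assumes n: "n > 0" and g: "vbundle n g" shows "End_order n g \<in> maximal_orders C n"
proof -
  let ?E = "End_order n g"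
  have *: "F = ?E" if F: "matrix_order C n F" and sub: "\<And>U. openin C U \<Longrightarrow> ?E U \<subseteq> F U" for F
  proof
    fix U
    have sh: "matrix_subsheaf C n F" "matrix_subsheaf C n ?E"
      using F End_order_subsheaf[OF g] by (auto simp: matrix_order_def matrix_lattice_def)
    consider "\<not> openin C U" | "U = {}" | "openin C U" "U \<noteq> {}" by blast
    then show "F U = ?E U"
    proof cases
      case 1
      then show ?thesis using sh unfolding matrix_subsheaf_def extensional_def by simp
    next
      case 2
      then show ?thesis using sh unfolding matrix_subsheaf_def by simp
    next
      case 3
      have "F U \<subseteq> ?E U"
      proof
        fix A assume A: "A \<in> F U"
        have "A \<in> local_order P n (g P)" if PU: "P \<in> U" for P
        proof -
          have P: "P \<in> S" using PU openin_subset[OF 3(1)] by blast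
          obtain N where N: "stalk C F P \<subseteq> entries_in n (fideal P (- int N))" using stalk_bounded[OF F P] by blast
          have "local_order P n (g P) \<subseteq> stalk C F P"
          proof
            fix B assume "B \<in> local_order P n (g P)"
            then have "B \<in> stalk C ?E P" by (simp only: stalk_End_order[OF g P])
            then obtain V where V: "openin C V" "P \<in> V" "B \<in> ?E V" by (rule stalkE[where F = ?E])
            then have "B \<in> F V" using sub[OF V(1)] by blast
            then show "B \<in> stalk C F P" by (rule stalkI[where F = F, OF V(1,2)])
          qed
          then have "stalk C F P \<subseteq> local_order P n (g P)"
            by (rule bounded_ring_in_local_order[OF P vbundleD[OF g P] _ N]) (rule stalk_order(5)[OF F P])
          moreover have "A \<in> stalk C F P" by (rule stalkI[where F = F, OF 3(1) PU A])
          ultimately show ?thesis by blast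
        qed
        then show "A \<in> ?E U" unfolding End_order_open[OF 3] using order_sections(1)[OF F 3] A by blast
      qed
      then show ?thesis using sub[OF 3(1)] by blast
    qed
  qed
  show ?thesis
    unfolding maximal_orders_def
  proof (intro CollectI conjI allI impI)
    show "matrix_order C n ?E" by (rule End_order_order[OF n g])
    fix E assume "matrix_order C n E \<and> (\<forall>U. openin C U \<longrightarrow> ?E U \<subseteq> E U)"
    then have E: "matrix_order C n E" "\<And>U. openin C U \<Longrightarrow> ?E U \<subseteq> E U" by simp_all
    show "E = ?E" by (rule *[OF E])
  qed
qed

end

section \<open>Completions\<close>

context dvr
begin

lemma ord_values: obtains c where "c \<noteq> 0" "ord P c = i"
  by (rule that[of "uniformizer P powi i"]) auto

lemma image_mult_eq_fideal: assumes "c \<noteq> 0" shows "(\<lambda>a. c * a) ` P = fideal P (ord P c)"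
proof (intro equalityI subsetI)
  fix z assume "z \<in> (\<lambda>a. c * a) ` P"
  then obtain a where a: "a \<in> P" "z = c * a" by blast
  have "c \<in> fideal P (ord P c)" by (simp add: fideal_def)
  from fideal_mult_left[OF a(1) this] show "z \<in> fideal P (ord P c)" by (simp add: a(2) mult.commute)
next
  fix z assume z: "z \<in> fideal P (ord P c)"
  have "inverse c * z \<in> P"
    using z assms by (cases "z = 0") (auto simp: fideal_def mem_iff ord_mult ord_inverse)
  moreover have "z = c * (inverse c * z)" using assms by simp
  ultimately show "z \<in> (\<lambda>a. c * a) ` P" by blast
qed

text \<open>A condition on \<open>c\<close> that depends on its order only is a condition on integers.\<close>

lemma all_ord_iff: "(\<forall>c. c \<noteq> 0 \<longrightarrow> Q (ord P c)) \<longleftrightarrow> (\<forall>m. Q m)"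
  by (metis ord_values)

lemma null_at_iff: "null_at P f \<longleftrightarrow> (\<forall>m. \<forall>\<^sub>F i in sequentially. f i \<in> fideal P m)"
proof -
  have "null_at P f \<longleftrightarrow> (\<forall>c. c \<noteq> 0 \<longrightarrow> (\<exists>N. \<forall>i\<ge>N. f i \<in> fideal P (ord P c)))"
    by (simp add: null_at_def image_mult_eq_fideal cong: imp_cong)
  also have "\<dots> \<longleftrightarrow> (\<forall>m. \<exists>N. \<forall>i\<ge>N. f i \<in> fideal P m)" by (rule all_ord_iff)
  finally show ?thesis by (simp add: eventually_sequentially)
qed

lemma Cauchy_at_iff: "Cauchy_at P f \<longleftrightarrow> (\<forall>m. \<exists>N. \<forall>i\<ge>N. \<forall>j\<ge>N. f i - f j \<in> fideal P m)"
proof -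
  have "Cauchy_at P f \<longleftrightarrow> (\<forall>c. c \<noteq> 0 \<longrightarrow> (\<exists>N. \<forall>i\<ge>N. \<forall>j\<ge>N. f i - f j \<in> fideal P (ord P c)))"
    by (simp add: Cauchy_at_def image_mult_eq_fideal cong: imp_cong)
  also have "\<dots> \<longleftrightarrow> (\<forall>m. \<exists>N. \<forall>i\<ge>N. \<forall>j\<ge>N. f i - f j \<in> fideal P m)" by (rule all_ord_iff)
  finally show ?thesis .
qed

lemma CauchyD: assumes "Cauchy_at P f" obtains N where "\<And>i j. i \<ge> N \<Longrightarrow> j \<ge> N \<Longrightarrow> f i - f j \<in> fideal P m"
  using assms unfolding Cauchy_at_iff by meson

lemma Cauchy_const [simp]: "Cauchy_at P (\<lambda>i. c)"
  by (simp add: Cauchy_at_iff)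

lemma Cauchy_comb:
  assumes f: "Cauchy_at P f" and g: "Cauchy_at P g"
    and h: "\<And>i j m. f i - f j \<in> fideal P m \<Longrightarrow> g i - g j \<in> fideal P m \<Longrightarrow> h i - h j \<in> fideal P m"
  shows "Cauchy_at P h"
  unfolding Cauchy_at_iff
proof
  fix m
  obtain M where M: "\<And>i j. i \<ge> M \<Longrightarrow> j \<ge> M \<Longrightarrow> f i - f j \<in> fideal P m" using CauchyD[OF f] by blast
  obtain N where N: "\<And>i j. i \<ge> N \<Longrightarrow> j \<ge> N \<Longrightarrow> g i - g j \<in> fideal P m" using CauchyD[OF g] by blast
  show "\<exists>N. \<forall>i\<ge>N. \<forall>j\<ge>N. h i - h j \<in> fideal P m"
    by (rule exI[of _ "max M N"]) (simp add: h M N)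
qed

lemma Cauchy_add: assumes "Cauchy_at P f" "Cauchy_at P g" shows "Cauchy_at P (\<lambda>i. f i + g i)"
proof (rule Cauchy_comb[OF assms])
  fix i j m assume "f i - f j \<in> fideal P m" "g i - g j \<in> fideal P m"
  from fideal_add[OF this] show "f i + g i - (f j + g j) \<in> fideal P m" by (simp add: algebra_simps)
qed

lemma Cauchy_uminus: assumes "Cauchy_at P f" shows "Cauchy_at P (\<lambda>i. - f i)"
proof (rule Cauchy_comb[OF assms assms])
  fix i j m assume "f i - f j \<in> fideal P m"
  from fideal_uminus[OF this] show "- f i - - f j \<in> fideal P m" by simp
qed

lemma Cauchy_bounded:
  assumes "Cauchy_at P f" obtains m where "\<forall>\<^sub>F i in sequentially. f i \<in> fideal P m" "m \<le> 0"
proof -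
  obtain N where N: "\<And>i j. i \<ge> N \<Longrightarrow> j \<ge> N \<Longrightarrow> f i - f j \<in> fideal P 0" using CauchyD[OF assms] by blast
  define m where "m = min 0 (ord P (f N))"
  have "f i \<in> fideal P m" if i: "i \<ge> N" for i
  proof -
    have "f i - f N \<in> fideal P m" using N[OF i order.refl] fideal_antimono[of m 0] by (auto simp: m_def)
    moreover have "f N \<in> fideal P m" using fideal_self fideal_antimono[of m "ord P (f N)"] by (auto simp: m_def)
    ultimately have "(f i - f N) + f N \<in> fideal P m" by (rule fideal_add)
    then show ?thesis by simp
  qed
  then show thesis by (intro that[of m]) (auto simp: eventually_sequentially m_def)
qed

lemma null_imp_Cauchy: assumes "null_at P f" shows "Cauchy_at P f"
  unfolding Cauchy_at_iff
proof
  fix m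
  obtain N where "\<forall>i\<ge>N. f i \<in> fideal P m" using assms unfolding null_at_iff eventually_sequentially by meson
  then show "\<exists>N. \<forall>i\<ge>N. \<forall>j\<ge>N. f i - f j \<in> fideal P m" by (intro exI[of _ N]) (auto intro: fideal_diff)
qed

lemma null_add: assumes "null_at P f" "null_at P g" shows "null_at P (\<lambda>i. f i + g i)"
  unfolding null_at_iff
proof
  fix m
  have "\<forall>\<^sub>F i in sequentially. f i \<in> fideal P m" "\<forall>\<^sub>F i in sequentially. g i \<in> fideal P m"
    using assms unfolding null_at_iff by auto
  then show "\<forall>\<^sub>F i in sequentially. f i + g i \<in> fideal P m" by eventually_elim (rule fideal_add)
qed

lemma null_uminus: "null_at P f \<Longrightarrow> null_at P (\<lambda>i. - f i)"
  unfolding null_at_iff by (auto elim!: eventually_mono intro: fideal_uminus)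

lemma null_zero: "null_at P (\<lambda>i. 0)"
  by (simp add: null_at_iff)

lemma null_mult: assumes f: "Cauchy_at P f" and g: "null_at P g" shows "null_at P (\<lambda>i. f i * g i)"
  unfolding null_at_iff
proof
  fix m
  obtain l where l: "\<forall>\<^sub>F i in sequentially. f i \<in> fideal P l" using Cauchy_bounded[OF f] by blast
  have "\<forall>\<^sub>F i in sequentially. g i \<in> fideal P (m - l)" using g unfolding null_at_iff by blast
  with l show "\<forall>\<^sub>F i in sequentially. f i * g i \<in> fideal P m"
  proof eventually_elim
    case (elim i)
    from fideal_mult[OF elim] show ?case by simp
  qed
qed

lemma Cauchy_mult: assumes f: "Cauchy_at P f" and g: "Cauchy_at P g" shows "Cauchy_at P (\<lambda>i. f i * g i)"
  unfolding Cauchy_at_iff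
proof
  fix m
  obtain k1 where k1: "\<forall>\<^sub>F i in sequentially. f i \<in> fideal P k1" "k1 \<le> 0" using Cauchy_bounded[OF f] by blast
  obtain k2 where k2: "\<forall>\<^sub>F i in sequentially. g i \<in> fideal P k2" "k2 \<le> 0" using Cauchy_bounded[OF g] by blast
  obtain N1 where N1: "\<And>i. i \<ge> N1 \<Longrightarrow> f i \<in> fideal P k1" using k1 by (auto simp: eventually_sequentially)
  obtain N2 where N2: "\<And>i. i \<ge> N2 \<Longrightarrow> g i \<in> fideal P k2" using k2 by (auto simp: eventually_sequentially)
  obtain M1 where M1: "\<And>i j. i \<ge> M1 \<Longrightarrow> j \<ge> M1 \<Longrightarrow> f i - f j \<in> fideal P (m - k2)" using CauchyD[OF f] by blast
  obtain M2 where M2: "\<And>i j. i \<ge> M2 \<Longrightarrow> j \<ge> M2 \<Longrightarrow> g i - g j \<in> fideal P (m - k1)" using CauchyD[OF g] by blast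
  define N where "N = max (max N1 N2) (max M1 M2)"
  show "\<exists>N. \<forall>i\<ge>N. \<forall>j\<ge>N. f i * g i - f j * g j \<in> fideal P m"
  proof (intro exI[of _ N] allI impI)
    fix i j assume "i \<ge> N" "j \<ge> N"
    then have b: "i \<ge> M1" "j \<ge> M1" "i \<ge> M2" "j \<ge> M2" "i \<ge> N2" "j \<ge> N1" by (auto simp: N_def)
    have "(f i - f j) * g i \<in> fideal P (m - k2 + k2)" by (rule fideal_mult[OF M1[OF b(1,2)] N2[OF b(5)]])
    moreover have "f j * (g i - g j) \<in> fideal P (k1 + (m - k1))" by (rule fideal_mult[OF N1[OF b(6)] M2[OF b(3,4)]])
    ultimately have "(f i - f j) * g i + f j * (g i - g j) \<in> fideal P m" by (intro fideal_add) simp_all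
    then show "f i * g i - f j * g j \<in> fideal P m" by (simp add: algebra_simps)
  qed
qed

lemma Cauchy_sum: "(\<And>x. x \<in> I \<Longrightarrow> Cauchy_at P (f x)) \<Longrightarrow> Cauchy_at P (\<lambda>i. \<Sum>x\<in>I. f x i)"
  by (induction I rule: infinite_finite_induct) (auto intro: Cauchy_add)

lemma Cauchy_prod: "(\<And>x. x \<in> I \<Longrightarrow> Cauchy_at P (f x)) \<Longrightarrow> Cauchy_at P (\<lambda>i. \<Prod>x\<in>I. f x i)"
  by (induction I rule: infinite_finite_induct) (auto intro: Cauchy_mult)

text \<open>Once the differences are smaller than some term, the ultrametric inequality fixes the order.\<close>

lemma Cauchy_ord_const:
  assumes f: "Cauchy_at P f" and n: "\<not> null_at P f"
  obtains v where "\<forall>\<^sub>F i in sequentially. f i \<noteq> 0 \<and> ord P (f i) = v"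
proof -
  obtain m where m: "\<not> (\<forall>\<^sub>F i in sequentially. f i \<in> fideal P m)" using n unfolding null_at_iff by blast
  obtain N where N: "\<And>i j. i \<ge> N \<Longrightarrow> j \<ge> N \<Longrightarrow> f i - f j \<in> fideal P m" using CauchyD[OF f] by blast
  obtain i where i: "i \<ge> N" "f i \<notin> fideal P m" using m unfolding eventually_sequentially by blast
  have fi: "f i \<noteq> 0" "ord P (f i) < m" using i(2) by (auto simp: fideal_def)
  have "f j \<noteq> 0 \<and> ord P (f j) = ord P (f i)" if j: "j \<ge> N" for j
  proof -
    have "f j - f i \<in> fideal P (ord P (f i) + 1)"
      using N[OF j i(1)] fideal_antimono[of "ord P (f i) + 1" m] fi(2) by auto
    from ord_add_dominant[OF fi(1) this] show ?thesis by simp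
  qed
  then show thesis by (intro that[of "ord P (f i)"]) (auto simp: eventually_sequentially)
qed

lemma Cauchy_ring_simps:
  "carrier (Cauchy_ring P) = {f. Cauchy_at P f}" "x \<otimes>\<^bsub>Cauchy_ring P\<^esub> y = (\<lambda>i. x i * y i)"
  "\<one>\<^bsub>Cauchy_ring P\<^esub> = (\<lambda>i. 1)" "\<zero>\<^bsub>Cauchy_ring P\<^esub> = (\<lambda>i. 0)" "x \<oplus>\<^bsub>Cauchy_ring P\<^esub> y = (\<lambda>i. x i + y i)"
  by (simp_all add: Cauchy_ring_def)

lemma cring_Cauchy: "cring (Cauchy_ring P)"
proof (rule cringI)
  show "abelian_group (Cauchy_ring P)"
  proof (rule abelian_groupI)
    fix f assume f: "f \<in> carrier (Cauchy_ring P)"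
    show "\<exists>y\<in>carrier (Cauchy_ring P). y \<oplus>\<^bsub>Cauchy_ring P\<^esub> f = \<zero>\<^bsub>Cauchy_ring P\<^esub>"
      by (rule bexI[of _ "\<lambda>i. - f i"]) (use f in \<open>auto simp: Cauchy_ring_simps intro: Cauchy_uminus\<close>)
  qed (auto simp: Cauchy_ring_simps algebra_simps intro: Cauchy_add)
  show "comm_monoid (Cauchy_ring P)"
    by (rule comm_monoidI) (auto simp: Cauchy_ring_simps algebra_simps intro: Cauchy_mult)
qed (auto simp: Cauchy_ring_simps algebra_simps)

lemma Cauchy_ring_uminus: assumes "Cauchy_at P f" shows "\<ominus>\<^bsub>Cauchy_ring P\<^esub> f = (\<lambda>i. - f i)"
proof -
  interpret cring "Cauchy_ring P" by (rule cring_Cauchy)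
  show ?thesis
    by (rule minus_equality) (use assms in \<open>auto simp: Cauchy_ring_simps intro: Cauchy_uminus\<close>)
qed

lemma null_ideal: "ideal {f. null_at P f} (Cauchy_ring P)"
proof -
  interpret cring "Cauchy_ring P" by (rule cring_Cauchy)
  show ?thesis
  proof (rule idealI)
    show "ring (Cauchy_ring P)" by (rule ring_axioms)
    show "subgroup {f. null_at P f} (add_monoid (Cauchy_ring P))"
    proof (rule add.subgroupI)
      show "{f. null_at P f} \<subseteq> carrier (Cauchy_ring P)" by (auto simp: Cauchy_ring_simps null_imp_Cauchy)
      show "{f. null_at P f} \<noteq> {}" using null_zero by blast
      fix f assume f: "f \<in> {f. null_at P f}"
      then show "\<ominus>\<^bsub>Cauchy_ring P\<^esub> f \<in> {f. null_at P f}" by (auto simp: Cauchy_ring_uminus null_imp_Cauchy null_uminus)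
      fix g assume "g \<in> {f. null_at P f}"
      with f show "f \<oplus>\<^bsub>Cauchy_ring P\<^esub> g \<in> {f. null_at P f}" by (auto simp: Cauchy_ring_simps null_add)
    qed
    fix a x assume ax: "a \<in> {f. null_at P f}" "x \<in> carrier (Cauchy_ring P)"
    then show "x \<otimes>\<^bsub>Cauchy_ring P\<^esub> a \<in> {f. null_at P f}" by (auto simp: Cauchy_ring_simps null_mult)
    then show "a \<otimes>\<^bsub>Cauchy_ring P\<^esub> x \<in> {f. null_at P f}" by (simp add: Cauchy_ring_simps mult.commute)
  qed
qed

lemma cring_completion: "cring (completion P)"
  unfolding completion_def by (rule ideal.quotient_is_cring[OF null_ideal cring_Cauchy])

lemma limit_hom: "ring_hom_cring (Cauchy_ring P) (completion P) (limit_class P)"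
proof -
  have "limit_class P = (+>\<^bsub>Cauchy_ring P\<^esub>) {h. null_at P h}" by (simp add: limit_class_def fun_eq_iff)
  then show ?thesis
    using ideal.rcos_ring_hom_cring[OF null_ideal cring_Cauchy] by (simp add: completion_def)
qed

lemma limit_eq_iff:
  assumes "Cauchy_at P f" "Cauchy_at P g" shows "limit_class P f = limit_class P g \<longleftrightarrow> null_at P (\<lambda>i. f i - g i)"
proof -
  interpret cring "Cauchy_ring P" by (rule cring_Cauchy)
  have "f \<ominus>\<^bsub>Cauchy_ring P\<^esub> g = (\<lambda>i. f i - g i)"
    using assms by (simp add: a_minus_def Cauchy_ring_uminus) (simp add: Cauchy_ring_simps)
  then show ?thesis
    using quotient_eq_iff_same_a_r_cos[OF null_ideal, of f g] assms by (simp add: limit_class_def Cauchy_ring_simps)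
qed

lemma carrier_completion: "carrier (completion P) = limit_class P ` {f. Cauchy_at P f}"
  by (auto simp: completion_def FactRing_def A_RCOSETS_def' limit_class_def Cauchy_ring_simps)

lemma limit_sum:
  assumes "\<And>x. x \<in> I \<Longrightarrow> Cauchy_at P (f x)"
  shows "(\<Oplus>\<^bsub>completion P\<^esub>x\<in>I. limit_class P (f x)) = limit_class P (\<lambda>i. \<Sum>x\<in>I. f x i)"
proof -
  interpret ring_hom_cring "Cauchy_ring P" "completion P" "limit_class P" by (rule limit_hom)
  show ?thesis
    using assms
  proof (induction I rule: infinite_finite_induct)
  case (infinite A)
  then show ?case using hom_zero by (simp add: Cauchy_ring_simps)
next
  case empty
  then show ?case using hom_zero by (simp add: Cauchy_ring_simps)
next
  case (insert x F)
  have c: "f y \<in> carrier (Cauchy_ring P)" if "y \<in> insert x F" for y using insert.prems[of y] \<open>y \<in> insert x F\<close> by (simp add: Cauchy_ring_simps)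
  have s: "(\<lambda>i. \<Sum>y\<in>F. f y i) \<in> carrier (Cauchy_ring P)"
    using insert.prems by (simp add: Cauchy_ring_simps Cauchy_sum)
  have IH: "(\<Oplus>\<^bsub>completion P\<^esub>x\<in>F. limit_class P (f x)) = limit_class P (\<lambda>i. \<Sum>x\<in>F. f x i)"
    using insert.IH insert.prems by simp
  have "(\<Oplus>\<^bsub>completion P\<^esub>y\<in>insert x F. limit_class P (f y)) = limit_class P (f x) \<oplus>\<^bsub>completion P\<^esub> limit_class P (\<lambda>i. \<Sum>x\<in>F. f x i)"
    using insert.hyps c by (subst S.finsum_insert) (auto simp: IH)
  also have "\<dots> = limit_class P (f x \<oplus>\<^bsub>Cauchy_ring P\<^esub> (\<lambda>i. \<Sum>x\<in>F. f x i))" using hom_add c s by simp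
  also have "\<dots> = limit_class P (\<lambda>i. \<Sum>x\<in>insert x F. f x i)" using insert.hyps by (simp add: Cauchy_ring_simps)
  finally show ?case .
  qed
qed

lemma limit_prod:
  assumes "\<And>x. x \<in> I \<Longrightarrow> Cauchy_at P (f x)"
  shows "(\<Otimes>\<^bsub>completion P\<^esub>x\<in>I. limit_class P (f x)) = limit_class P (\<lambda>i. \<Prod>x\<in>I. f x i)"
proof -
  interpret ring_hom_cring "Cauchy_ring P" "completion P" "limit_class P" by (rule limit_hom)
  show ?thesis
    using assms
  proof (induction I rule: infinite_finite_induct)
  case (infinite A)
  then show ?case using hom_one by (simp add: Cauchy_ring_simps)
next
  case empty
  then show ?case using hom_one by (simp add: Cauchy_ring_simps)
next
  case (insert x F)
  have c: "f y \<in> carrier (Cauchy_ring P)" if "y \<in> insert x F" for y using insert.prems[of y] \<open>y \<in> insert x F\<close> by (simp add: Cauchy_ring_simps)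
  have s: "(\<lambda>i. \<Prod>y\<in>F. f y i) \<in> carrier (Cauchy_ring P)"
    using insert.prems by (simp add: Cauchy_ring_simps Cauchy_prod)
  have IH: "(\<Otimes>\<^bsub>completion P\<^esub>x\<in>F. limit_class P (f x)) = limit_class P (\<lambda>i. \<Prod>x\<in>F. f x i)"
    using insert.IH insert.prems by simp
  have "(\<Otimes>\<^bsub>completion P\<^esub>y\<in>insert x F. limit_class P (f y)) = limit_class P (f x) \<otimes>\<^bsub>completion P\<^esub> limit_class P (\<lambda>i. \<Prod>x\<in>F. f x i)"
    using insert.hyps c by (subst S.finprod_insert) (auto simp: IH)
  also have "\<dots> = limit_class P (f x \<otimes>\<^bsub>Cauchy_ring P\<^esub> (\<lambda>i. \<Prod>x\<in>F. f x i))" using hom_mult c s by simp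
  also have "\<dots> = limit_class P (\<lambda>i. \<Prod>x\<in>insert x F. f x i)" using insert.hyps by (simp add: Cauchy_ring_simps)
  finally show ?case .
  qed
qed

lemma limit_mult: "Cauchy_at P f \<Longrightarrow> Cauchy_at P g \<Longrightarrow>
    limit_class P f \<otimes>\<^bsub>completion P\<^esub> limit_class P g = limit_class P (\<lambda>i. f i * g i)"
  using ring_hom_cring.axioms(3)[OF limit_hom] ring_hom_mult[of "limit_class P" "Cauchy_ring P" "completion P" f g]
  by (simp add: ring_hom_cring_axioms_def Cauchy_ring_simps)

lemma limit_power: "Cauchy_at P f \<Longrightarrow> limit_class P f [^]\<^bsub>completion P\<^esub> (m::nat) = limit_class P (\<lambda>i. f i ^ m)"
proof (induction m)
  case 0
  interpret ring_hom_cring "Cauchy_ring P" "completion P" "limit_class P" by (rule limit_hom)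
  show ?case using hom_one by (simp add: Cauchy_ring_simps)
next
  case (Suc m)
  have "Cauchy_at P (\<lambda>i. f i ^ m)" using Cauchy_prod[of "{..<m}" "\<lambda>x. f"] Suc.prems by simp
  then show ?case using Suc by (simp add: limit_mult mult.commute)
qed

lemma limit_one: "\<one>\<^bsub>completion P\<^esub> = limit_class P (\<lambda>i. 1)"
  and limit_zero: "\<zero>\<^bsub>completion P\<^esub> = limit_class P (\<lambda>i. 0)"
  and limit_uminus_one: "\<ominus>\<^bsub>completion P\<^esub> \<one>\<^bsub>completion P\<^esub> = limit_class P (\<lambda>i. - 1)"
proof -
  interpret ring_hom_cring "Cauchy_ring P" "completion P" "limit_class P" by (rule limit_hom)
  show 1: "\<one>\<^bsub>completion P\<^esub> = limit_class P (\<lambda>i. 1)" using hom_one by (simp add: Cauchy_ring_simps)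
  show "\<zero>\<^bsub>completion P\<^esub> = limit_class P (\<lambda>i. 0)" using hom_zero by (simp add: Cauchy_ring_simps)
  show "\<ominus>\<^bsub>completion P\<^esub> \<one>\<^bsub>completion P\<^esub> = limit_class P (\<lambda>i. - 1)"
    using hom_a_inv[of "\<lambda>i. 1"] Cauchy_ring_uminus[of "\<lambda>i. 1"] unfolding 1 by (simp add: Cauchy_ring_simps(1))
qed

end

subsection \<open>Matrices over the completion\<close>

text \<open>Matrices over the completed field are handled through entrywise Cauchy sequences of matrices over
  the function field.\<close>

definition Cauchy_mat :: "'a::field set \<Rightarrow> nat \<Rightarrow> (nat \<Rightarrow> 'a mat) \<Rightarrow> bool" where
  "Cauchy_mat P n f \<longleftrightarrow> (\<forall>m. f m \<in> carrier_mat n n) \<and> (\<forall>i<n. \<forall>j<n. Cauchy_at P (\<lambda>m. f m $$ (i, j)))"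

definition limit_mat :: "'a::field set \<Rightarrow> nat \<Rightarrow> (nat \<Rightarrow> 'a mat) \<Rightarrow> (nat \<Rightarrow> 'a) set mat" where
  "limit_mat P n f = mat n n (\<lambda>(i, j). limit_class P (\<lambda>m. f m $$ (i, j)))"

lemma completed_stalk_eq:
  assumes "stalk C F P \<subseteq> carrier_mat n n"
  shows "completed_stalk C n F P = {limit_mat P n f | f. Cauchy_mat P n f \<and> (\<forall>m. f m \<in> stalk C F P)}"
  using assms by (auto simp: completed_stalk_def limit_mat_def Cauchy_mat_def)

lemma limit_mat_const: "h \<in> carrier_mat n n \<Longrightarrow> map_mat (to_completion P) h = limit_mat P n (\<lambda>m. h)"
  by (rule eq_matI) (auto simp: limit_mat_def to_completion_def)

context dvr
begin

lemma Cauchy_matD: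
  assumes "Cauchy_mat P n f"
  shows "f m \<in> carrier_mat n n" "i < n \<Longrightarrow> j < n \<Longrightarrow> Cauchy_at P (\<lambda>m. f m $$ (i, j))"
  using assms by (auto simp: Cauchy_mat_def)

lemma Cauchy_mat_const: "h \<in> carrier_mat n n \<Longrightarrow> Cauchy_mat P n (\<lambda>m. h)"
  by (simp add: Cauchy_mat_def)

lemma Cauchy_mat_mult:
  assumes f: "Cauchy_mat P n f" and g: "Cauchy_mat P n g" shows "Cauchy_mat P n (\<lambda>m. f m * g m)"
  unfolding Cauchy_mat_def
proof (intro conjI allI impI)
  show "f m * g m \<in> carrier_mat n n" for m
    by (rule mult_carrier_mat[OF Cauchy_matD(1)[OF f] Cauchy_matD(1)[OF g]])
  fix i j assume ij: "i < n" "j < n"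
  have "Cauchy_at P (\<lambda>m. \<Sum>l<n. f m $$ (i, l) * g m $$ (l, j))"
    using ij by (intro Cauchy_sum Cauchy_mult Cauchy_matD(2)[OF f] Cauchy_matD(2)[OF g]) auto
  then show "Cauchy_at P (\<lambda>m. (f m * g m) $$ (i, j))"
    by (simp only: mat_mult_entry[OF Cauchy_matD(1)[OF f] Cauchy_matD(1)[OF g] ij])
qed

lemma limit_mat_entry: "i < n \<Longrightarrow> j < n \<Longrightarrow> limit_mat P n f $$ (i, j) = limit_class P (\<lambda>m. f m $$ (i, j))"
  by (simp add: limit_mat_def)

lemma limit_mat_mult:
  assumes f: "Cauchy_mat P n f" and g: "Cauchy_mat P n g"
  shows "limit_mat P n f \<otimes>\<^bsub>mat_ring (completion P) n\<^esub> limit_mat P n g = limit_mat P n (\<lambda>m. f m * g m)"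
proof (rule eq_matI)
  fix i j assume "i < dim_row (limit_mat P n (\<lambda>m. f m * g m))" "j < dim_col (limit_mat P n (\<lambda>m. f m * g m))"
  then have ij: "i < n" "j < n" by (auto simp: limit_mat_def)
  interpret Q: cring "completion P" by (rule cring_completion)
  have "(limit_mat P n f \<otimes>\<^bsub>mat_ring (completion P) n\<^esub> limit_mat P n g) $$ (i, j) =
      (\<Oplus>\<^bsub>completion P\<^esub>l\<in>{..<n}. limit_mat P n f $$ (i, l) \<otimes>\<^bsub>completion P\<^esub> limit_mat P n g $$ (l, j))"
    using ij by (simp add: mat_ring_def)
  also have "\<dots> = (\<Oplus>\<^bsub>completion P\<^esub>l\<in>{..<n}. limit_class P (\<lambda>m. f m $$ (i, l) * g m $$ (l, j)))"
  proof (rule Q.finsum_cong'[OF refl])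
    show "(\<lambda>l. limit_class P (\<lambda>m. f m $$ (i, l) * g m $$ (l, j))) \<in> {..<n} \<rightarrow> carrier (completion P)"
      unfolding carrier_completion
      using ij by (intro Pi_I imageI CollectI Cauchy_mult Cauchy_matD(2)[OF f] Cauchy_matD(2)[OF g]) auto
    fix l assume "l \<in> {..<n}"
    then have l: "l < n" by simp
    show "limit_mat P n f $$ (i, l) \<otimes>\<^bsub>completion P\<^esub> limit_mat P n g $$ (l, j) = limit_class P (\<lambda>m. f m $$ (i, l) * g m $$ (l, j))"
      unfolding limit_mat_entry[OF ij(1) l] limit_mat_entry[OF l ij(2)]
      by (rule limit_mult[OF Cauchy_matD(2)[OF f ij(1) l] Cauchy_matD(2)[OF g l ij(2)]])
  qed
  also have "\<dots> = limit_class P (\<lambda>m. \<Sum>l<n. f m $$ (i, l) * g m $$ (l, j))"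
    using ij by (intro limit_sum Cauchy_mult Cauchy_matD(2)[OF f] Cauchy_matD(2)[OF g]) auto
  also have "\<dots> = limit_mat P n (\<lambda>m. f m * g m) $$ (i, j)"
    unfolding limit_mat_entry[OF ij] mat_mult_entry[OF Cauchy_matD(1)[OF f] Cauchy_matD(1)[OF g] ij] ..
  finally show "(limit_mat P n f \<otimes>\<^bsub>mat_ring (completion P) n\<^esub> limit_mat P n g) $$ (i, j) = limit_mat P n (\<lambda>m. f m * g m) $$ (i, j)" .
qed (simp_all add: mat_ring_def limit_mat_def)

lemma limit_mat_one: "\<one>\<^bsub>mat_ring (completion P) n\<^esub> = limit_mat P n (\<lambda>m. 1\<^sub>m n)"
  by (rule eq_matI) (auto simp: mat_ring_def limit_mat_def limit_one limit_zero)

lemma carrier_mat_ring: "carrier (mat_ring (completion P) n) = limit_mat P n ` {f. Cauchy_mat P n f}"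
proof (intro equalityI subsetI)
  fix A assume "A \<in> carrier (mat_ring (completion P) n)"
  then have A: "A \<in> carrier_mat n n" "\<And>i j. i < n \<Longrightarrow> j < n \<Longrightarrow> A $$ (i, j) \<in> limit_class P ` Collect (Cauchy_at P)"
    by (auto simp: mat_ring_def carrier_completion)
  then have "\<exists>f. Cauchy_at P f \<and> A $$ (i, j) = limit_class P f" if "i < n" "j < n" for i j
    using A(2)[OF \<open>i < n\<close> \<open>j < n\<close>] by blast
  note A = A(1) this
  define F where "F i j = (SOME f. Cauchy_at P f \<and> A $$ (i, j) = limit_class P f)" for i j
  have F: "Cauchy_at P (F i j)" "A $$ (i, j) = limit_class P (F i j)" if "i < n" "j < n" for i j
    using someI_ex[OF A(2)[OF \<open>i < n\<close> \<open>j < n\<close>]] unfolding F_def by auto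
  define f where "f m = mat n n (\<lambda>(i, j). F i j m)" for m
  have "Cauchy_mat P n f" using F(1) by (auto simp: Cauchy_mat_def f_def)
  moreover have "A = limit_mat P n f"
    using A(1) F(2) by (intro eq_matI) (auto simp: limit_mat_def f_def)
  ultimately show "A \<in> limit_mat P n ` {f. Cauchy_mat P n f}" by blast
next
  fix A assume "A \<in> limit_mat P n ` {f. Cauchy_mat P n f}"
  then show "A \<in> carrier (mat_ring (completion P) n)"
    by (auto simp: mat_ring_def limit_mat_def carrier_completion Cauchy_mat_def)
qed

lemma monoid_mat_ring: "monoid (mat_ring (completion P) n)"
proof (rule monoidI)
  note D = Cauchy_matD(1)
  show "\<one>\<^bsub>mat_ring (completion P) n\<^esub> \<in> carrier (mat_ring (completion P) n)"
    unfolding limit_mat_one carrier_mat_ring by (intro imageI CollectI Cauchy_mat_const) simp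
  fix A assume "A \<in> carrier (mat_ring (completion P) n)"
  then obtain f where f: "Cauchy_mat P n f" "A = limit_mat P n f" unfolding carrier_mat_ring by blast
  have o: "Cauchy_mat P n (\<lambda>m. 1\<^sub>m n)" by (rule Cauchy_mat_const) simp
  show "\<one>\<^bsub>mat_ring (completion P) n\<^esub> \<otimes>\<^bsub>mat_ring (completion P) n\<^esub> A = A"
    "A \<otimes>\<^bsub>mat_ring (completion P) n\<^esub> \<one>\<^bsub>mat_ring (completion P) n\<^esub> = A"
    unfolding f(2) limit_mat_one limit_mat_mult[OF o f(1)] limit_mat_mult[OF f(1) o]
      left_mult_one_mat[OF D[OF f(1)]] right_mult_one_mat[OF D[OF f(1)]] by simp_all
  fix B assume "B \<in> carrier (mat_ring (completion P) n)"
  then obtain g where g: "Cauchy_mat P n g" "B = limit_mat P n g" unfolding carrier_mat_ring by blast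
  note fg = Cauchy_mat_mult[OF f(1) g(1)]
  show "A \<otimes>\<^bsub>mat_ring (completion P) n\<^esub> B \<in> carrier (mat_ring (completion P) n)"
    unfolding f(2) g(2) limit_mat_mult[OF f(1) g(1)] carrier_mat_ring using fg by blast
  fix E assume "E \<in> carrier (mat_ring (completion P) n)"
  then obtain h where h: "Cauchy_mat P n h" "E = limit_mat P n h" unfolding carrier_mat_ring by blast
  note gh = Cauchy_mat_mult[OF g(1) h(1)]
  show "A \<otimes>\<^bsub>mat_ring (completion P) n\<^esub> B \<otimes>\<^bsub>mat_ring (completion P) n\<^esub> E =
      A \<otimes>\<^bsub>mat_ring (completion P) n\<^esub> (B \<otimes>\<^bsub>mat_ring (completion P) n\<^esub> E)"
    unfolding f(2) g(2) h(2) limit_mat_mult[OF f(1) g(1)] limit_mat_mult[OF g(1) h(1)]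
      limit_mat_mult[OF fg h(1)] limit_mat_mult[OF f(1) gh]
      assoc_mult_mat[OF D[OF f(1)] D[OF g(1)] D[OF h(1)]] ..
qed

lemma limit_mat_eqD:
  assumes "limit_mat P n f = limit_mat P n g" "Cauchy_mat P n f" "Cauchy_mat P n g" "i < n" "j < n"
  shows "\<forall>\<^sub>F m in sequentially. f m $$ (i, j) - g m $$ (i, j) \<in> fideal P l"
proof -
  have "limit_class P (\<lambda>m. f m $$ (i, j)) = limit_class P (\<lambda>m. g m $$ (i, j))"
    using arg_cong[OF assms(1), of "\<lambda>A. A $$ (i, j)"] by (simp add: limit_mat_entry assms(4,5))
  then have "null_at P (\<lambda>m. f m $$ (i, j) - g m $$ (i, j))"
    using limit_eq_iff[OF Cauchy_matD(2)[OF assms(2,4,5)] Cauchy_matD(2)[OF assms(3-5)]] by simp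
  then show ?thesis unfolding null_at_iff by blast
qed

lemma limit_mat_unit:
  assumes f: "Cauchy_mat P n f" and g: "Cauchy_mat P n g"
    and fg: "limit_mat P n (\<lambda>m. f m * g m) = limit_mat P n (\<lambda>m. 1\<^sub>m n)"
      "limit_mat P n (\<lambda>m. g m * f m) = limit_mat P n (\<lambda>m. 1\<^sub>m n)"
  shows "limit_mat P n f \<in> Units (mat_ring (completion P) n)"
    "inv\<^bsub>mat_ring (completion P) n\<^esub> limit_mat P n f = limit_mat P n g"
proof -
  interpret M: monoid "mat_ring (completion P) n" by (rule monoid_mat_ring)
  have c: "limit_mat P n f \<in> carrier (mat_ring (completion P) n)" "limit_mat P n g \<in> carrier (mat_ring (completion P) n)"
    unfolding carrier_mat_ring using f g by auto
  have e: "limit_mat P n f \<otimes>\<^bsub>mat_ring (completion P) n\<^esub> limit_mat P n g = \<one>\<^bsub>mat_ring (completion P) n\<^esub>"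
    "limit_mat P n g \<otimes>\<^bsub>mat_ring (completion P) n\<^esub> limit_mat P n f = \<one>\<^bsub>mat_ring (completion P) n\<^esub>"
    unfolding limit_mat_one limit_mat_mult[OF f g] limit_mat_mult[OF g f] by (rule fg(1) fg(2))+
  show "limit_mat P n f \<in> Units (mat_ring (completion P) n)" using c e by (auto simp: Units_def)
  show "inv\<^bsub>mat_ring (completion P) n\<^esub> limit_mat P n f = limit_mat P n g"
    using M.inv_unique'[OF c e] by simp
qed

lemma conj_by_limit:
  assumes f: "Cauchy_mat P n f" and g: "Cauchy_mat P n g" and A: "Cauchy_mat P n A"
    and fg: "limit_mat P n (\<lambda>m. f m * g m) = limit_mat P n (\<lambda>m. 1\<^sub>m n)"
      "limit_mat P n (\<lambda>m. g m * f m) = limit_mat P n (\<lambda>m. 1\<^sub>m n)"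
  shows "conj_by (mat_ring (completion P) n) (limit_mat P n f) (limit_mat P n A) = limit_mat P n (\<lambda>m. f m * A m * g m)"
  unfolding conj_by_def limit_mat_unit(2)[OF f g fg] limit_mat_mult[OF f A]
  by (rule limit_mat_mult[OF Cauchy_mat_mult[OF f A] g])

lemma Cauchy_conj_mat:
  assumes "h \<in> carrier_mat n n" "det h \<noteq> 0" "Cauchy_mat P n A" shows "Cauchy_mat P n (\<lambda>m. conj_mat h (A m))"
  unfolding conj_mat_def by (intro Cauchy_mat_mult Cauchy_mat_const minv(1)[OF assms(1,2)] assms(1,3))

lemma conj_by_const:
  assumes h: "h \<in> carrier_mat n n" "det h \<noteq> 0" and A: "Cauchy_mat P n A"
  shows "limit_mat P n (\<lambda>m. h) \<in> Units (mat_ring (completion P) n)"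
    "conj_by (mat_ring (completion P) n) (limit_mat P n (\<lambda>m. h)) (limit_mat P n A) = limit_mat P n (\<lambda>m. conj_mat h (A m))"
proof -
  note m = minv[OF h]
  have e: "limit_mat P n (\<lambda>m. h * minv h) = limit_mat P n (\<lambda>m. 1\<^sub>m n)"
    "limit_mat P n (\<lambda>m. minv h * h) = limit_mat P n (\<lambda>m. 1\<^sub>m n)" unfolding m(2,3) by simp_all
  note c = Cauchy_mat_const[OF h(1)] Cauchy_mat_const[OF m(1)]
  show "limit_mat P n (\<lambda>m. h) \<in> Units (mat_ring (completion P) n)" by (rule limit_mat_unit(1)[OF c e])
  show "conj_by (mat_ring (completion P) n) (limit_mat P n (\<lambda>m. h)) (limit_mat P n A) = limit_mat P n (\<lambda>m. conj_mat h (A m))"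
    unfolding conj_mat_def by (rule conj_by_limit[OF c A e])
qed

lemma limit_det:
  assumes f: "Cauchy_mat P n f"
  shows "ring_det (completion P) n (limit_mat P n f) = limit_class P (\<lambda>m. det (f m))" "Cauchy_at P (\<lambda>m. det (f m))"
proof -
  interpret Q: cring "completion P" by (rule cring_completion)
  let ?s = "\<lambda>p. if evenperm p then 1 else - 1 :: 'a"
  let ?t = "\<lambda>p m. ?s p * (\<Prod>i\<in>{..<n}. f m $$ (i, p i))"
  have lt: "p i < n" if "p permutes {..<n}" "i < n" for p i
    using permutes_in_image[OF \<open>p permutes {..<n}\<close>, of i] \<open>i < n\<close> by simp
  have c: "Cauchy_at P (\<lambda>m. f m $$ (i, p i))" if "p permutes {..<n}" "i < n" for p i
    by (rule Cauchy_matD(2)[OF f \<open>i < n\<close> lt[OF \<open>p permutes {..<n}\<close> \<open>i < n\<close>]])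
  have ct: "Cauchy_at P (?t p)" if "p permutes {..<n}" for p
    by (intro Cauchy_mult Cauchy_prod Cauchy_const c[OF \<open>p permutes {..<n}\<close>]) simp
  have d: "det (f m) = (\<Sum>p | p permutes {..<n}. ?t p m)" for m
    unfolding det_def'[OF Cauchy_matD(1)[OF f]] lessThan_atLeast0 by (rule sum.cong) (auto simp: sign_def)
  show "Cauchy_at P (\<lambda>m. det (f m))" unfolding d by (intro Cauchy_sum ct) simp
  have "ring_det (completion P) n (limit_mat P n f) = (\<Oplus>\<^bsub>completion P\<^esub>p\<in>{p. p permutes {..<n}}. limit_class P (?t p))"
    unfolding ring_det_def
  proof (rule Q.finsum_cong'[OF refl])
    show "(\<lambda>p. limit_class P (?t p)) \<in> {p. p permutes {..<n}} \<rightarrow> carrier (completion P)"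
      unfolding carrier_completion using ct by (intro Pi_I imageI CollectI) simp
    fix p assume "p \<in> {p. p permutes {..<n}}"
    then have p: "p permutes {..<n}" by simp
    have "(\<Otimes>\<^bsub>completion P\<^esub>i\<in>{..<n}. limit_mat P n f $$ (i, p i)) = (\<Otimes>\<^bsub>completion P\<^esub>i\<in>{..<n}. limit_class P (\<lambda>m. f m $$ (i, p i)))"
      unfolding carrier_completion using c[OF p] lt[OF p]
      by (intro Q.finprod_cong'[OF refl]) (auto simp: carrier_completion limit_mat_entry)
    also have "\<dots> = limit_class P (\<lambda>m. \<Prod>i\<in>{..<n}. f m $$ (i, p i))" using c[OF p] by (intro limit_prod) simp
    finally have 1: "(\<Otimes>\<^bsub>completion P\<^esub>i\<in>{..<n}. limit_mat P n f $$ (i, p i)) = limit_class P (\<lambda>m. \<Prod>i\<in>{..<n}. f m $$ (i, p i))" .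
    have 2: "(if evenperm p then \<one>\<^bsub>completion P\<^esub> else \<ominus>\<^bsub>completion P\<^esub> \<one>\<^bsub>completion P\<^esub>) = limit_class P (\<lambda>m. ?s p)"
      unfolding limit_uminus_one unfolding limit_one by simp
    show "(if evenperm p then \<one>\<^bsub>completion P\<^esub> else \<ominus>\<^bsub>completion P\<^esub> \<one>\<^bsub>completion P\<^esub>) \<otimes>\<^bsub>completion P\<^esub>
        (\<Otimes>\<^bsub>completion P\<^esub>i\<in>{..<n}. limit_mat P n f $$ (i, p i)) = limit_class P (?t p)"
      unfolding 1 2 using c[OF p] by (intro limit_mult Cauchy_const Cauchy_prod) simp
  qed
  also have "\<dots> = limit_class P (\<lambda>m. det (f m))" unfolding d using ct by (intro limit_sum) simp
  finally show "ring_det (completion P) n (limit_mat P n f) = limit_class P (\<lambda>m. det (f m))" .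
qed

lemma prod_cong_mod:
  assumes "finite I" "\<And>i. i \<in> I \<Longrightarrow> a i \<in> P" "\<And>i. i \<in> I \<Longrightarrow> b i \<in> P" "\<And>i. i \<in> I \<Longrightarrow> a i - b i \<in> fideal P l"
  shows "prod a I - prod b I \<in> fideal P l"
  using assms
proof (induction I rule: finite_induct)
  case (insert x F)
  have "prod b F \<in> P" using insert.prems by (intro prod_in) auto
  from fideal_mult_left[OF this insert.prems(3)[OF insertI1]]
  have 1: "(a x - b x) * prod b F \<in> fideal P l" by (simp only: mult.commute)
  have "prod a F - prod b F \<in> fideal P l" using insert by simp
  from fideal_mult_left[OF insert.prems(1)[OF insertI1] this]
  have "a x * (prod a F - prod b F) + (a x - b x) * prod b F \<in> fideal P l" using 1 by (rule fideal_add)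
  then show ?case using insert.hyps by (simp add: algebra_simps)
qed simp

text \<open>The determinant is a polynomial in the entries, so that it respects congruences.\<close>

lemma det_cong_mod:
  assumes A: "A \<in> entries_in n P" and B: "B \<in> entries_in n P"
    and AB: "\<And>i j. i < n \<Longrightarrow> j < n \<Longrightarrow> A $$ (i, j) - B $$ (i, j) \<in> fideal P l"
  shows "det A - det B \<in> fideal P l"
proof -
  note Ac = entries_inD(1)[OF A] and Bc = entries_inD(1)[OF B]
  have "(\<Sum>p | p permutes {0..<n}. signof p * (\<Prod>i = 0..<n. A $$ (i, p i)) - signof p * (\<Prod>i = 0..<n. B $$ (i, p i))) \<in> fideal P l"
  proof (rule fideal_sum)
    fix p assume "p \<in> {p. p permutes {0..<n}}"
    then have "p i < n" if "i < n" for i using permutes_in_image[of p "{0..<n}" i] \<open>i < n\<close> by simp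
    then have "(\<Prod>i = 0..<n. A $$ (i, p i)) - (\<Prod>i = 0..<n. B $$ (i, p i)) \<in> fideal P l"
      by (intro prod_cong_mod) (auto intro: entries_inD(2)[OF A] entries_inD(2)[OF B] AB)
    moreover have "signof p \<in> P" using one_in uminus_in[OF one_in] by (simp add: sign_def)
    ultimately have "signof p * ((\<Prod>i = 0..<n. A $$ (i, p i)) - (\<Prod>i = 0..<n. B $$ (i, p i))) \<in> fideal P l"
      by (intro fideal_mult_left)
    then show "signof p * (\<Prod>i = 0..<n. A $$ (i, p i)) - signof p * (\<Prod>i = 0..<n. B $$ (i, p i)) \<in> fideal P l"
      by (simp only: right_diff_distrib)
  qed
  then show ?thesis unfolding det_def'[OF Ac] det_def'[OF Bc] by (simp only: sum_subtractf)
qed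

text \<open>Let \<open>c\<close> be an entry of \<open>x\<close> of minimal order.  Then \<open>x / c\<close> is integral, and so is \<open>c y\<close> since the products
  of entries of \<open>x\<close> and \<open>y\<close> are.  The product of these two matrices is congruent to 1 modulo the maximal
  ideal, so both determinants are units and \<open>det x\<close> has the order of \<open>c ^ n\<close>.  This expresses that the
  normalizer of the matrix ring over \<open>P\<close> consists of the scalars times the invertible integral
  matrices.\<close>

lemma almost_inverse_pair:
  assumes n: "n > 0" and x: "x \<in> carrier_mat n n" and y: "y \<in> carrier_mat n n"
    and xy: "\<And>i a b j. i < n \<Longrightarrow> a < n \<Longrightarrow> b < n \<Longrightarrow> j < n \<Longrightarrow> x $$ (i, a) * y $$ (b, j) \<in> P"
    and one: "\<And>i j. i < n \<Longrightarrow> j < n \<Longrightarrow> (x * y) $$ (i, j) - 1\<^sub>m n $$ (i, j) \<in> fideal P 1"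
  shows "det x \<noteq> 0" "\<exists>c. ord P (det x) = int n * c"
proof -
  define T where "T = {(i, a). i < n \<and> a < n \<and> x $$ (i, a) \<noteq> 0}"
  have "finite T" by (rule finite_subset[of _ "{..<n} \<times> {..<n}"]) (auto simp: T_def)
  moreover have "T \<noteq> {}"
  proof
    assume "T = {}"
    then have "x $$ (0, a) = 0" if "a < n" for a using n \<open>a < n\<close> by (auto simp: T_def)
    then have "(x * y) $$ (0, 0) = 0" using n by (simp add: mat_mult_entry[OF x y])
    then have "(- 1 :: 'a) \<in> fideal P 1" using one[OF n n] n by simp
    then show False using ord_uminus[of 1] by (simp add: fideal_def)
  qed
  ultimately obtain p where p: "is_arg_min (\<lambda>(i, a). ord P (x $$ (i, a))) (\<lambda>q. q \<in> T) p"
    using ex_is_arg_min_if_finite[of T] by blast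
  obtain i0 a0 where p': "p = (i0, a0)" by (cases p)
  define c where "c = x $$ (i0, a0)"
  have i0: "i0 < n" "a0 < n" "c \<noteq> 0" using p by (auto simp: is_arg_min_def p' T_def c_def)
  have min: "ord P c \<le> ord P (x $$ (i, a))" if "i < n" "a < n" "x $$ (i, a) \<noteq> 0" for i a
    using p \<open>i < n\<close> \<open>a < n\<close> \<open>x $$ (i, a) \<noteq> 0\<close> unfolding is_arg_min_linorder by (auto simp: p' T_def c_def)
  define x' where "x' = inverse c \<cdot>\<^sub>m x"
  define y' where "y' = c \<cdot>\<^sub>m y"
  have x': "x' \<in> entries_in n P"
  proof (rule entries_inI)
    show "x' \<in> carrier_mat n n" using x by (simp add: x'_def)
    fix i a assume ia: "i < n" "a < n"
    show "x' $$ (i, a) \<in> P"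
    proof (cases "x $$ (i, a) = 0")
      case False
      then show ?thesis using ia x i0(3) min[OF ia False] by (simp add: x'_def mem_iff ord_mult ord_inverse)
    qed (use ia x zero_in in \<open>simp add: x'_def\<close>)
  qed
  have y': "y' \<in> entries_in n P"
    using y xy[OF i0(1,2)] by (intro entries_inI) (auto simp: y'_def c_def)
  have e: "x' * y' = x * y"
  proof (rule eq_matI)
    fix i j assume "i < dim_row (x * y)" "j < dim_col (x * y)"
    then have ij: "i < n" "j < n" using x y by auto
    have s: "x' $$ (i, l) * y' $$ (l, j) = x $$ (i, l) * y $$ (l, j)" if "l < n" for l
      using \<open>l < n\<close> ij x y i0(3) by (simp add: x'_def y'_def)
    show "(x' * y') $$ (i, j) = (x * y) $$ (i, j)"
      unfolding mat_mult_entry[OF entries_inD(1)[OF x'] entries_inD(1)[OF y'] ij] mat_mult_entry[OF x y ij]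
      by (rule sum.cong[OF refl]) (simp add: s)
  qed (use x y in \<open>auto simp: x'_def y'_def\<close>)
  have "det (x' * y') - det (1\<^sub>m n :: 'a mat) \<in> fideal P 1"
    by (rule det_cong_mod[OF entries_int_mult[OF x' y'] entries_one]) (simp only: e one)
  then have "1 + (det (x' * y') - 1) \<noteq> 0" "ord P (1 + (det (x' * y') - 1)) = ord P 1"
    using ord_add_dominant[of 1 "det (x' * y') - 1"] by (auto simp: det_one)
  then have "det (x' * y') \<noteq> 0" "ord P (det (x' * y')) = 0" by simp_all
  then have d: "det x' \<noteq> 0" "det y' \<noteq> 0" "ord P (det x') + ord P (det y') = 0"
    using det_mult[OF entries_inD(1)[OF x'] entries_inD(1)[OF y']] ord_mult by auto
  moreover have "det x' \<in> P" "det y' \<in> P"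
    by (rule det_int[OF entries_inD(1)[OF x'] entries_inD(2)[OF x']] det_int[OF entries_inD(1)[OF y'] entries_inD(2)[OF y']]; assumption)+
  ultimately have "ord P (det x') = 0" using ord_nonneg[of "det x'"] ord_nonneg[of "det y'"] by auto
  moreover have "x = c \<cdot>\<^sub>m x'" using i0(3) by (simp add: x'_def smult_inverse_smult)
  then have "det x = c ^ n * det x'" using det_smult[of c x'] entries_inD(1)[OF x'] by simp
  ultimately show "det x \<noteq> 0" "\<exists>c. ord P (det x) = int n * c"
    using d(1) i0(3) by (auto simp: ord_mult ord_power)
qed

end

section \<open>Spinor genera and divisor classes\<close>

context dvr
begin

text \<open>The matrix \<open>g' / g\<close> transports one lattice to the other.  Multiplied by a diagonal matrix with unit
  entries, it has the determinant \<open>a ^ n det h\<close> required for \<open>w h\<close>.\<close>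

lemma local_order_conj_transport:
  assumes n: "n > 0" and g: "g \<in> carrier_mat n n" "det g \<noteq> 0" and g': "g' \<in> carrier_mat n n" "det g' \<noteq> 0"
    and h: "h \<in> carrier_mat n n" "det h \<noteq> 0"
    and ord: "ord P (det g') = ord P (det g) + ord P (det h) + int n * b"
  obtains w a where "w \<in> carrier_mat n n" "a \<noteq> 0" "det w = a ^ n"
    "local_order P n g' = conj_mat (w * h) ` local_order P n g"
proof -
  define a where "a = uniformizer P powi b"
  have a: "a \<noteq> 0" "ord P a = b" by (simp_all add: a_def)
  \<comment> \<open>a unit by the assumption on orders, chosen to give \<open>w\<close> the determinant \<open>a ^ n\<close>\<close>
  define u0 where "u0 = a ^ n * det g * det h / det g'"
  have u0: "u0 \<noteq> 0" "ord P u0 = 0"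
    using a g h g' ord by (simp_all add: u0_def ord_divide ord_mult ord_power)
  define u where "u = multrow_mat n 0 u0"
  have u: "u \<in> carrier_mat n n" "det u = u0" using n by (simp_all add: u_def det_multrow_mat)
  have "u \<in> entries_in n P"
    using u0 one_in zero_in by (intro entries_inI u(1)) (auto simp: u_def multrow_mat_def mem_iff)
  moreover have "unit_of P (det u)" using u0 u(2) by (simp add: unit_iff)
  ultimately have lo: "local_order P n (g' * u) = local_order P n g'" by (rule local_order_unit[OF g'])
  note gi = minv[OF g] and hi = minv[OF h]
  have dg: "det (minv g) \<noteq> 0" "det (minv h) \<noteq> 0" using gi(4) hi(4) g(2) h(2) by simp_all
  have g'u: "g' * u \<in> carrier_mat n n" "det (g' * u) \<noteq> 0" using g' u u0 det_mult[OF g'(1) u(1)] by simp_all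
  define v where "v = g' * u * minv g"
  have v: "v \<in> carrier_mat n n" "det v \<noteq> 0" using minv_mult(2,3)[OF g'u gi(1) dg(1)] by (simp_all add: v_def)
  define w where "w = v * minv h"
  have w: "w \<in> carrier_mat n n" using v(1) hi(1) by (simp add: w_def)
  have "det w = det g' * u0 * inverse (det g) * inverse (det h)"
    unfolding w_def v_def det_mult[OF v(1)[unfolded v_def] hi(1)] det_mult[OF g'u(1) gi(1)] det_mult[OF g'(1) u(1)] gi(4) hi(4) u(2) ..
  then have dw: "det w = a ^ n" using g' g h by (simp add: u0_def field_simps)
  have "w * h = v * (minv h * h)" unfolding w_def by (rule assoc_mult_mat[OF v(1) hi(1) h(1)])
  then have wh: "w * h = v" using hi(3) v(1) by simp
  have "conj_mat v (conj_mat g A) = conj_mat (g' * u) A" if "A \<in> carrier_mat n n" for A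
  proof -
    have "v * g = g' * u * (minv g * g)" unfolding v_def by (rule assoc_mult_mat[OF g'u(1) gi(1) g(1)])
    then have "v * g = g' * u" unfolding gi(3) right_mult_one_mat[OF g'u(1)] .
    then show ?thesis using conj_mat_conj_mat[OF v g \<open>A \<in> carrier_mat n n\<close>] by simp
  qed
  then have "conj_mat v ` conj_mat g ` entries_in n P = conj_mat (g' * u) ` entries_in n P"
    unfolding image_image by (intro image_cong refl) (auto simp: entries_in_def)
  then have "local_order P n g' = conj_mat (w * h) ` local_order P n g"
    unfolding lo[symmetric] local_order_eq[OF g'u] local_order_eq[OF g] wh by simp
  then show thesis by (rule that[OF w a(1) dw])
qed

lemma completed_conj_image:
  assumes v: "v \<in> carrier_mat n n" "det v \<noteq> 0" and h: "h \<in> carrier_mat n n" "det h \<noteq> 0"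
    and L: "L \<subseteq> carrier_mat n n" and L': "L' = conj_mat (v * h) ` L"
  shows "{limit_mat P n f | f. Cauchy_mat P n f \<and> (\<forall>m. f m \<in> L')} =
    (\<lambda>A. conj_by (mat_ring (completion P) n) (limit_mat P n (\<lambda>m. v))
      (conj_by (mat_ring (completion P) n) (map_mat (to_completion P) h) A)) `
      {limit_mat P n f | f. Cauchy_mat P n f \<and> (\<forall>m. f m \<in> L)}" (is "?A = ?T ` ?B")
proof -
  note vh = minv_mult(2,3)[OF v h]
  have T: "?T (limit_mat P n f) = limit_mat P n (\<lambda>m. conj_mat (v * h) (f m))" if f: "Cauchy_mat P n f" for f
    unfolding limit_mat_const[OF h(1)] conj_by_const(2)[OF h f] conj_by_const(2)[OF v Cauchy_conj_mat[OF h f]]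
      conj_mat_conj_mat[OF v h Cauchy_matD(1)[OF f]] ..
  show ?thesis
  proof (intro equalityI subsetI)
    fix A assume "A \<in> ?A"
    then obtain f where f: "A = limit_mat P n f" "Cauchy_mat P n f" "\<And>m. f m \<in> L'" by blast
    have "\<exists>B\<in>L. f m = conj_mat (v * h) B" for m using f(3)[of m] unfolding L' by blast
    then obtain B where B: "\<And>m. B m \<in> L" "\<And>m. f m = conj_mat (v * h) (B m)" by metis
    have Bc: "B m \<in> carrier_mat n n" for m using B(1) L by blast
    have dm: "det (minv (v * h)) \<noteq> 0" using minv(4)[OF vh] vh(2) by simp
    have "(\<lambda>m. conj_mat (minv (v * h)) (f m)) = B"
      unfolding B(2) by (rule ext) (rule conj_mat_cancel(1)[OF vh Bc])
    then have CB: "Cauchy_mat P n B" using Cauchy_conj_mat[OF minv(1)[OF vh] dm f(2)] by simp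
    have "A = ?T (limit_mat P n B)" unfolding T[OF CB] f(1) B(2) ..
    moreover have "limit_mat P n B \<in> ?B" using CB B(1) by blast
    ultimately show "A \<in> ?T ` ?B" by (rule image_eqI)
  next
    fix A assume "A \<in> ?T ` ?B"
    then obtain f where f: "A = ?T (limit_mat P n f)" "Cauchy_mat P n f" "\<And>m. f m \<in> L" by blast
    have "Cauchy_mat P n (\<lambda>m. conj_mat (v * h) (f m))" by (rule Cauchy_conj_mat[OF vh f(2)])
    moreover have "conj_mat (v * h) (f m) \<in> L'" for m unfolding L' using f(3) by blast
    ultimately show "A \<in> ?A" unfolding f(1) T[OF f(2)] by blast
  qed
qed

text \<open>The completion is not the zero ring.\<close>

lemma unit_limit_not_null:
  assumes u: "u \<in> Units (completion P)" obtains v where "Cauchy_at P v" "u = limit_class P v" "\<not> null_at P v"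
proof -
  interpret Q: cring "completion P" by (rule cring_completion)
  obtain v where v: "Cauchy_at P v" "u = limit_class P v" using Q.Units_closed[OF u] unfolding carrier_completion by blast
  have "\<not> null_at P v"
  proof
    assume "null_at P v"
    then have "u = \<zero>\<^bsub>completion P\<^esub>" unfolding v(2) limit_zero using limit_eq_iff[OF v(1) Cauchy_const[of 0]] by simp
    then have "\<one>\<^bsub>completion P\<^esub> = \<zero>\<^bsub>completion P\<^esub>" using Q.Units_r_inv[OF u] Q.Units_inv_closed[OF u] by simp
    then have "null_at P (\<lambda>i. 1)" unfolding limit_one limit_zero
      using limit_eq_iff[OF Cauchy_const[of 1] Cauchy_const[of 0]] by simp
    then have "\<forall>\<^sub>F i in sequentially. (1::'a) \<in> fideal P 1" unfolding null_at_iff by blast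
    then show False by (auto simp: fideal_def)
  qed
  then show thesis by (rule that[OF v])
qed

lemma ord_eventually_eq:
  assumes f: "Cauchy_at P f" and g: "\<forall>\<^sub>F i in sequentially. g i \<noteq> 0 \<and> ord P (g i) = k"
    and fg: "null_at P (\<lambda>i. f i - g i)"
  shows "\<forall>\<^sub>F i in sequentially. f i \<noteq> 0 \<and> ord P (f i) = k"
proof -
  have "\<forall>\<^sub>F i in sequentially. f i - g i \<in> fideal P (k + 1)" using fg unfolding null_at_iff by blast
  with g show ?thesis
  proof eventually_elim
    case (elim i)
    then show ?case using ord_add_dominant[of "g i" "f i - g i"] by simp
  qed
qed

text \<open>Rewritten in terms of bases of the two lattices, the isomorphism becomes an inclusion of the
  integral matrices into themselves, conjugation by the limit of a sequence \<open>x\<close> with inverse the limit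
  of \<open>y\<close>.  Evaluated at the matrix units, it shows that \<open>x m\<close> and \<open>y m\<close> satisfy the assumptions of
  \<open>almost_inverse_pair\<close> for large \<open>m\<close>.\<close>

lemma spinor_local_ord:
  assumes n: "n > 0" and g: "g \<in> carrier_mat n n" "det g \<noteq> 0" and g': "g' \<in> carrier_mat n n" "det g' \<noteq> 0"
    and h: "h \<in> carrier_mat n n" "det h \<noteq> 0"
    and G: "G \<in> Units (mat_ring (completion P) n)"
    and u: "u \<in> Units (completion P)" "ring_det (completion P) n G = u [^]\<^bsub>completion P\<^esub> n"
    and incl: "\<And>A. A \<in> local_order P n g \<Longrightarrow>
      conj_by (mat_ring (completion P) n) G
        (conj_by (mat_ring (completion P) n) (map_mat (to_completion P) h) (limit_mat P n (\<lambda>m. A)))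
      \<in> {limit_mat P n f | f. Cauchy_mat P n f \<and> (\<forall>m. f m \<in> local_order P n g')}"
  shows "\<exists>b. ord P (det g') = ord P (det g) + ord P (det h) + int n * b"
proof -
  let ?M = "mat_ring (completion P) n"
  interpret M: monoid ?M by (rule monoid_mat_ring)
  obtain c where c: "Cauchy_mat P n c" "G = limit_mat P n c" using M.Units_closed[OF G] unfolding carrier_mat_ring by blast
  obtain d where d: "Cauchy_mat P n d" "inv\<^bsub>?M\<^esub> G = limit_mat P n d"
    using M.Units_inv_closed[OF G] unfolding carrier_mat_ring by blast
  have cd: "limit_mat P n (\<lambda>m. c m * d m) = limit_mat P n (\<lambda>m. 1\<^sub>m n)"
    using M.Units_r_inv[OF G] unfolding d(2) unfolding c(2) limit_mat_mult[OF c(1) d(1)] limit_mat_one .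
  have dc: "limit_mat P n (\<lambda>m. d m * c m) = limit_mat P n (\<lambda>m. 1\<^sub>m n)"
    using M.Units_l_inv[OF G] unfolding d(2) unfolding c(2) limit_mat_mult[OF d(1) c(1)] limit_mat_one .
  note cc = Cauchy_matD(1)[OF c(1)] and dd = Cauchy_matD(1)[OF d(1)]
  note gi = minv[OF g] and g'i = minv[OF g'] and hi = minv[OF h]
  define x where "x m = minv g' * c m * (h * g)" for m
  define y where "y m = (minv g * minv h) * d m * g'" for m
  have hg: "h * g \<in> carrier_mat n n" "minv g * minv h \<in> carrier_mat n n" using h(1) g(1) gi(1) hi(1) by simp_all
  have xc: "x m \<in> carrier_mat n n" and yc: "y m \<in> carrier_mat n n" for m
    using g'i(1) cc[of m] hg dd[of m] g'(1) by (simp_all add: x_def y_def)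
  have x: "Cauchy_mat P n x" unfolding x_def
    by (intro Cauchy_mat_mult Cauchy_mat_const c(1) hg g'i(1) h(1) g(1))
  have y: "Cauchy_mat P n y" unfolding y_def
    by (intro Cauchy_mat_mult Cauchy_mat_const d(1) hg g'(1) gi(1) hi(1))
  have hgi: "(h * g) * (minv g * minv h) = 1\<^sub>m n"
    using minv(2)[OF minv_mult(2,3)[OF h g]] unfolding minv_mult(1)[OF h g] .
  have conj_lim: "limit_mat P n (\<lambda>m. minv g' * f m * g') = limit_mat P n (\<lambda>m. minv g' * f' m * g')"
    if f: "Cauchy_mat P n f" and f': "Cauchy_mat P n f'" and eq: "limit_mat P n f = limit_mat P n f'" for f f'
  proof -
    note k = Cauchy_mat_const[OF g'i(1)] Cauchy_mat_const[OF g'(1)]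
    show ?thesis
      unfolding limit_mat_mult[OF Cauchy_mat_mult[OF k(1) f] k(2), symmetric] limit_mat_mult[OF k(1) f, symmetric]
        limit_mat_mult[OF Cauchy_mat_mult[OF k(1) f'] k(2), symmetric] limit_mat_mult[OF k(1) f', symmetric] eq ..
  qed
  have xy: "x m * y m = minv g' * (c m * d m) * g'" for m
  proof -
    have "x m * y m = minv g' * c m * ((h * g) * (minv g * minv h)) * d m * g'"
      unfolding x_def y_def
      using g'i(1) cc[of m] hg dd[of m] g'(1) by (simp add: assoc_mult_mat[of _ n n _ n _ n])
    also have "\<dots> = minv g' * (c m * d m) * g'"
      unfolding hgi using g'i(1) cc[of m] dd[of m] g'(1) by (simp add: assoc_mult_mat[of _ n n _ n _ n])
    finally show ?thesis .
  qed
  have one: "Cauchy_mat P n (\<lambda>m. 1\<^sub>m n)" by (rule Cauchy_mat_const) simp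
  have xy1: "limit_mat P n (\<lambda>m. x m * y m) = limit_mat P n (\<lambda>m. 1\<^sub>m n)"
    using conj_lim[OF Cauchy_mat_mult[OF c(1) d(1)] one cd] unfolding xy using g'i(1,3) by simp
  have ev_one: "\<forall>\<^sub>F m in sequentially. (x m * y m) $$ (i, j) - 1\<^sub>m n $$ (i, j) \<in> fideal P 1" if "i < n" "j < n" for i j
    by (rule limit_mat_eqD[OF xy1 Cauchy_mat_mult[OF x y] one \<open>i < n\<close> \<open>j < n\<close>])
  have ev_int: "\<forall>\<^sub>F m in sequentially. x m $$ (i, a) * y m $$ (b, j) \<in> P" if "i < n" "a < n" "b < n" "j < n" for i a b j
  proof -
    \<comment> \<open>the entry \<open>(i, j)\<close> of \<open>x E\<^sub>a\<^sub>b y\<close> is \<open>x\<^sub>i\<^sub>a y\<^sub>b\<^sub>j\<close>\<close>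
    let ?E = "unit_mat n a b 1"
    have E: "?E \<in> entries_in n P" using one_in zero_in by (auto simp: entries_in_def unit_mat_def)
    have Ec: "?E \<in> carrier_mat n n" by (rule unit_mat_carrier)
    define A where "A = conj_mat g ?E"
    have Ac: "A \<in> carrier_mat n n" unfolding A_def by (rule conj_mat_carrier[OF g Ec])
    have Al: "A \<in> local_order P n g" unfolding A_def local_order_eq[OF g] using E by blast
    have hA: "conj_mat h A \<in> carrier_mat n n" by (rule conj_mat_carrier[OF h Ac])
    obtain f where f: "Cauchy_mat P n f" "\<And>m. f m \<in> local_order P n g'"
      "conj_by ?M G (conj_by ?M (map_mat (to_completion P) h) (limit_mat P n (\<lambda>m. A))) = limit_mat P n f"
      using incl[OF Al] by blast
    have "limit_mat P n (\<lambda>m. c m * conj_mat h A * d m) = limit_mat P n f"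
      using f(3) unfolding limit_mat_const[OF h(1)] conj_by_const(2)[OF h Cauchy_mat_const[OF Ac]]
      unfolding c(2) conj_by_limit[OF c(1) d(1) Cauchy_mat_const[OF hA] cd dc] .
    from conj_lim[OF Cauchy_mat_mult[OF Cauchy_mat_mult[OF c(1) Cauchy_mat_const[OF hA]] d(1)] f(1) this]
    have "limit_mat P n (\<lambda>m. minv g' * (c m * conj_mat h A * d m) * g') = limit_mat P n (\<lambda>m. minv g' * f m * g')" .
    moreover have "minv g' * (c m * conj_mat h A * d m) * g' = x m * ?E * y m" for m
    proof -
      have "conj_mat h A = (h * g) * ?E * (minv g * minv h)"
        unfolding A_def conj_mat_conj_mat[OF h g Ec] unfolding conj_mat_def minv_mult(1)[OF h g] ..
      then show ?thesis unfolding x_def y_def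
        using g'i(1) cc[of m] hg dd[of m] g'(1) Ec by (simp add: assoc_mult_mat[of _ n n _ n _ n] mult_carrier_mat[of _ n n _ n])
    qed
    ultimately have lim: "limit_mat P n (\<lambda>m. x m * ?E * y m) = limit_mat P n (\<lambda>m. minv g' * f m * g')" by simp
    have C: "Cauchy_mat P n (\<lambda>m. x m * ?E * y m)" "Cauchy_mat P n (\<lambda>m. minv g' * f m * g')"
      by (intro Cauchy_mat_mult Cauchy_mat_const x y Ec g'i(1) g'(1) f(1))+
    have "\<forall>\<^sub>F m in sequentially. (x m * ?E * y m) $$ (i, j) - (minv g' * f m * g') $$ (i, j) \<in> fideal P 0"
      by (rule limit_mat_eqD[OF lim C \<open>i < n\<close> \<open>j < n\<close>])
    then show ?thesis
    proof eventually_elim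
      case (elim m)
      have "minv g' * f m * g' \<in> entries_in n P"
        using f(2)[of m] unfolding local_order_def conj_mat_def minv_minv[OF g'] by blast
      then have "(minv g' * f m * g') $$ (i, j) \<in> P" using entries_inD(2) \<open>i < n\<close> \<open>j < n\<close> by blast
      then have "(x m * ?E * y m) $$ (i, j) \<in> P" using elim add_in by (fastforce simp: fideal_0)
      moreover have "(x m * ?E * y m) $$ (i, j) = x m $$ (i, a) * y m $$ (b, j)"
        by (rule unit_mat_sandwich[OF xc yc \<open>i < n\<close> \<open>a < n\<close> \<open>b < n\<close> \<open>j < n\<close>])
      ultimately show ?case by simp
    qed
  qed
  obtain v where v: "Cauchy_at P v" "u = limit_class P v" "\<not> null_at P v" using unit_limit_not_null[OF u(1)] .
  obtain k where k: "\<forall>\<^sub>F m in sequentially. v m \<noteq> 0 \<and> ord P (v m) = k" using Cauchy_ord_const[OF v(1,3)] .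
  have vn: "Cauchy_at P (\<lambda>m. v m ^ n)" using Cauchy_prod[of "{..<n}" "\<lambda>x. v"] v(1) by simp
  have "limit_class P (\<lambda>m. det (c m)) = limit_class P (\<lambda>m. v m ^ n)"
    using u(2) unfolding c(2) limit_det(1)[OF c(1)] v(2) limit_power[OF v(1)] .
  then have nl: "null_at P (\<lambda>m. det (c m) - v m ^ n)" using limit_eq_iff[OF limit_det(2)[OF c(1)] vn] by simp
  have "\<forall>\<^sub>F m in sequentially. v m ^ n \<noteq> 0 \<and> ord P (v m ^ n) = int n * k"
    using k by eventually_elim (simp add: ord_power)
  from ord_eventually_eq[OF limit_det(2)[OF c(1)] this nl]
  have ev_det: "\<forall>\<^sub>F m in sequentially. det (c m) \<noteq> 0 \<and> ord P (det (c m)) = int n * k" .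
  have "\<forall>\<^sub>F m in sequentially. \<forall>i\<in>{..<n}. \<forall>j\<in>{..<n}. (x m * y m) $$ (i, j) - 1\<^sub>m n $$ (i, j) \<in> fideal P 1"
    using ev_one by (intro eventually_ball_finite ballI) auto
  moreover have "\<forall>\<^sub>F m in sequentially. \<forall>i\<in>{..<n}. \<forall>a\<in>{..<n}. \<forall>b\<in>{..<n}. \<forall>j\<in>{..<n}. x m $$ (i, a) * y m $$ (b, j) \<in> P"
    using ev_int by (intro eventually_ball_finite ballI) auto
  ultimately have "\<forall>\<^sub>F m in sequentially. (\<forall>i\<in>{..<n}. \<forall>j\<in>{..<n}. (x m * y m) $$ (i, j) - 1\<^sub>m n $$ (i, j) \<in> fideal P 1) \<and>
    (\<forall>i\<in>{..<n}. \<forall>a\<in>{..<n}. \<forall>b\<in>{..<n}. \<forall>j\<in>{..<n}. x m $$ (i, a) * y m $$ (b, j) \<in> P) \<and>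
    det (c m) \<noteq> 0 \<and> ord P (det (c m)) = int n * k"
    using ev_det by (simp add: eventually_conj_iff)
  from eventually_happens'[OF sequentially_bot this]
  obtain m where m: "\<forall>i\<in>{..<n}. \<forall>j\<in>{..<n}. (x m * y m) $$ (i, j) - 1\<^sub>m n $$ (i, j) \<in> fideal P 1"
    "\<forall>i\<in>{..<n}. \<forall>a\<in>{..<n}. \<forall>b\<in>{..<n}. \<forall>j\<in>{..<n}. x m $$ (i, a) * y m $$ (b, j) \<in> P"
    "det (c m) \<noteq> 0" "ord P (det (c m)) = int n * k"
    by (elim exE conjE) (rule that)
  have "\<exists>l. ord P (det (x m)) = int n * l"
  proof (rule almost_inverse_pair(2)[OF n xc yc])
    show "x m $$ (i, a) * y m $$ (b, j) \<in> P" if "i < n" "a < n" "b < n" "j < n" for i a b j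
      using m(2) \<open>i < n\<close> \<open>a < n\<close> \<open>b < n\<close> \<open>j < n\<close> by simp
    show "(x m * y m) $$ (i, j) - 1\<^sub>m n $$ (i, j) \<in> fideal P 1" if "i < n" "j < n" for i j
      using m(1) \<open>i < n\<close> \<open>j < n\<close> by simp
  qed
  then obtain l where l: "ord P (det (x m)) = int n * l" ..
  have "det (x m) = inverse (det g') * det (c m) * (det h * det g)"
    unfolding x_def det_mult[OF mult_carrier_mat[OF g'i(1) cc[of m]] hg(1)] det_mult[OF g'i(1) cc[of m]] det_mult[OF h(1) g(1)] g'i(4) ..
  then have "ord P (det (x m)) = - ord P (det g') + int n * k + ord P (det h) + ord P (det g)"
    using m(3,4) g(2) g'(2) h(2) by (simp add: ord_mult ord_inverse)
  with l have "ord P (det g') = ord P (det g) + ord P (det h) + int n * (k - l)" by (simp add: algebra_simps)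
  then show ?thesis by blast
qed

end

context curve
begin

text \<open>The divisor of the determinant bundle: the sections of \<open>O(det_div g)\<close> form the highest exterior power
  of the bundle.\<close>

definition det_div :: "('a set \<Rightarrow> 'a mat) \<Rightarrow> 'a set \<Rightarrow> int" where
  "det_div g P = (if P \<in> S then - ord P (det (g P)) else 0)"

lemma det_div_Div: assumes g: "vbundle n g" shows "det_div g \<in> Div"
proof (rule DivI[OF vbundle_finite[OF g]])
  fix P assume "P \<notin> {P \<in> S. g P \<noteq> 1\<^sub>m n}"
  then show "det_div g P = 0" using dvr.ord_1[OF dvr_S] by (auto simp: det_div_def)
qed auto

lemma Units_mat_alg: "h \<in> Units (mat_alg n) \<longleftrightarrow> h \<in> carrier_mat n n \<and> det (h :: 'a mat) \<noteq> 0"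
proof
  assume h: "h \<in> Units (mat_alg n :: 'a mat ring)"
  then have "h \<in> carrier_mat n n" by (auto simp: Units_def ring_mat_def)
  then show "h \<in> carrier_mat n n \<and> det h \<noteq> 0" using unit_imp_det_non_zero[OF h] by simp
next
  assume "h \<in> carrier_mat n n \<and> det h \<noteq> 0"
  then show "h \<in> Units (mat_alg n)" using det_non_zero_imp_unit[of h n "()"] by simp
qed

lemma completed_stalk_End_order:
  assumes g: "vbundle n g" and P: "P \<in> S"
  shows "completed_stalk C n (End_order n g) P =
    {limit_mat P n f | f. Cauchy_mat P n f \<and> (\<forall>m. f m \<in> local_order P n (g P))}"
  using completed_stalk_eq[of C "End_order n g" P n] bundle_order(1)[OF g P]
  unfolding stalk_End_order[OF g P] by blast

text \<open>An isomorphism given by \<open>h\<close> and local conjugations determines the difference of the determinant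
  divisors up to \<open>n\<close> times a divisor by \<open>spinor_local_ord\<close>.  Conversely a function \<open>f\<close> that relates the
  two divisors is the inverse determinant of a diagonal matrix \<open>h\<close>, and the local conjugations
  are supplied by \<open>local_order_conj_transport\<close>.\<close>

theorem same_spinor_genus_iff:
  assumes n: "n > 0" and g: "vbundle n g" and g': "vbundle n g'"
  shows "same_spinor_genus C n (End_order n g) (End_order n g') \<longleftrightarrow> (det_div g, det_div g') \<in> class_rel n"
proof
  assume "same_spinor_genus C n (End_order n g) (End_order n g')"
  then obtain h G where h: "h \<in> Units (mat_alg n)" and G: "\<And>P. P \<in> S \<Longrightarrow>
      G P \<in> Units (mat_ring (completion P) n) \<and>
        (\<exists>u \<in> Units (completion P). ring_det (completion P) n (G P) = u [^]\<^bsub>completion P\<^esub> n) \<and>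
        completed_stalk C n (End_order n g') P =
          (\<lambda>A. conj_by (mat_ring (completion P) n) (G P)
                 (conj_by (mat_ring (completion P) n) (map_mat (to_completion P) h) A))
            ` completed_stalk C n (End_order n g) P"
    unfolding same_spinor_genus_def by blast
  have h: "h \<in> carrier_mat n n" "det h \<noteq> 0" using h by (simp_all add: Units_mat_alg)
  have "\<exists>b. ord P (det (g' P)) = ord P (det (g P)) + ord P (det h) + int n * b" if P: "P \<in> S" for P
  proof -
    interpret dvr P by (rule dvr_S[OF P])
    from G[OF P] obtain u where GP: "G P \<in> Units (mat_ring (completion P) n)"
      and u: "u \<in> Units (completion P)" "ring_det (completion P) n (G P) = u [^]\<^bsub>completion P\<^esub> n"
      and im: "completed_stalk C n (End_order n g') P =
          (\<lambda>A. conj_by (mat_ring (completion P) n) (G P)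
                 (conj_by (mat_ring (completion P) n) (map_mat (to_completion P) h) A))
            ` completed_stalk C n (End_order n g) P"
      by blast
    show ?thesis
    proof (rule spinor_local_ord[OF n vbundleD[OF g P] vbundleD[OF g' P] h GP u])
      fix A assume A: "A \<in> local_order P n (g P)"
      then have "A \<in> carrier_mat n n" using bundle_order(1)[OF g P] by blast
      then have "limit_mat P n (\<lambda>m. A) \<in> completed_stalk C n (End_order n g) P"
        unfolding completed_stalk_End_order[OF g P] using A Cauchy_mat_const by blast
      then show "conj_by (mat_ring (completion P) n) (G P)
          (conj_by (mat_ring (completion P) n) (map_mat (to_completion P) h) (limit_mat P n (\<lambda>m. A)))
        \<in> {limit_mat P n f | f. Cauchy_mat P n f \<and> (\<forall>m. f m \<in> local_order P n (g' P))}"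
        unfolding completed_stalk_End_order[OF g' P, symmetric] im by (rule imageI)
    qed
  qed
  then obtain b where b: "\<And>P. P \<in> S \<Longrightarrow> ord P (det (g' P)) = ord P (det (g P)) + ord P (det h) + int n * b P" by metis
  define B where "B P = (if P \<in> S then - b P else 0)" for P
  define f where "f = inverse (det h)"
  have f: "f \<noteq> 0" using h(2) by (simp add: f_def)
  have eq: "det_div g' P = det_div g P + prin f P + int n * B P" for P
    using b[of P] prin_inverse[OF h(2)] by (auto simp: det_div_def B_def f_def prin_def fun_eq_iff)
  have "(\<lambda>P. det_div g' P - det_div g P - prin f P) \<in> Div"
    by (intro Div_diff det_div_Div[OF g] det_div_Div[OF g'] prin_Div f)
  also have "(\<lambda>P. det_div g' P - det_div g P - prin f P) = (\<lambda>P. int n * B P)" by (simp add: eq)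
  finally have nB: "(\<lambda>P. int n * B P) \<in> Div" .
  have "B \<in> Div"
  proof (rule DivI[OF Div_finite[OF nB]])
    show "{P. int n * B P \<noteq> 0} \<subseteq> S" by (auto simp: B_def)
    show "B P = 0" if "P \<notin> {P. int n * B P \<noteq> 0}" for P using that n by simp
  qed
  then show "(det_div g, det_div g') \<in> class_rel n" by (rule class_relI[OF det_div_Div[OF g] f _ eq])
next
  assume "(det_div g, det_div g') \<in> class_rel n"
  then obtain f B where f: "f \<noteq> 0" and B: "B \<in> Div" and eq: "\<And>P. det_div g' P = det_div g P + prin f P + int n * B P"
    unfolding class_rel_def by blast
  define h where "h = multrow_mat n 0 (inverse f)"
  have h: "h \<in> carrier_mat n n" "det h \<noteq> 0" "det h = inverse f" using n f by (simp_all add: h_def det_multrow_mat)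
  have "\<exists>w. w \<in> carrier_mat n n \<and> (\<exists>a. a \<noteq> 0 \<and> det w = a ^ n) \<and>
      local_order P n (g' P) = conj_mat (w * h) ` local_order P n (g P)" if P: "P \<in> S" for P
  proof -
    interpret dvr P by (rule dvr_S[OF P])
    have "ord P (det (g' P)) = ord P (det (g P)) + ord P (det h) + int n * (- B P)"
      using eq[of P] P f by (simp add: det_div_def prin_def h(3) ord_inverse)
    from local_order_conj_transport[OF n vbundleD[OF g P] vbundleD[OF g' P] h(1,2) this]
    show ?thesis by metis
  qed
  then obtain w where w: "\<And>P. P \<in> S \<Longrightarrow> w P \<in> carrier_mat n n \<and> (\<exists>a. a \<noteq> 0 \<and> det (w P) = a ^ n) \<and>
      local_order P n (g' P) = conj_mat (w P * h) ` local_order P n (g P)" by metis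
  show "same_spinor_genus C n (End_order n g) (End_order n g')"
    unfolding same_spinor_genus_def
  proof (intro bexI[of _ h] exI[of _ "\<lambda>P. limit_mat P n (\<lambda>m. w P)"] ballI conjI)
    show "h \<in> Units (mat_alg n)" using h by (simp add: Units_mat_alg)
    fix P assume P: "P \<in> S"
    interpret dvr P by (rule dvr_S[OF P])
    from w[OF P] obtain a where wP: "w P \<in> carrier_mat n n" "a \<noteq> 0" "det (w P) = a ^ n"
      and lo: "local_order P n (g' P) = conj_mat (w P * h) ` local_order P n (g P)" by blast
    have d: "det (w P) \<noteq> 0" using wP by simp
    show "limit_mat P n (\<lambda>m. w P) \<in> Units (mat_ring (completion P) n)"
      by (rule conj_by_const(1)[OF wP(1) d Cauchy_mat_const[OF wP(1)]])
    interpret Q: cring "completion P" by (rule cring_completion)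
    show "\<exists>u\<in>Units (completion P). ring_det (completion P) n (limit_mat P n (\<lambda>m. w P)) = u [^]\<^bsub>completion P\<^esub> n"
    proof (rule bexI)
      show "ring_det (completion P) n (limit_mat P n (\<lambda>m. w P)) = limit_class P (\<lambda>m. a) [^]\<^bsub>completion P\<^esub> n"
        unfolding limit_det(1)[OF Cauchy_mat_const[OF wP(1)]] wP(3) limit_power[OF Cauchy_const] ..
      have "limit_class P (\<lambda>m. a) \<otimes>\<^bsub>completion P\<^esub> limit_class P (\<lambda>m. inverse a) = \<one>\<^bsub>completion P\<^esub>"
        "limit_class P (\<lambda>m. inverse a) \<otimes>\<^bsub>completion P\<^esub> limit_class P (\<lambda>m. a) = \<one>\<^bsub>completion P\<^esub>"
        unfolding limit_mult[OF Cauchy_const Cauchy_const] limit_one using wP(2) by simp_all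
      moreover have "limit_class P (\<lambda>m. c) \<in> carrier (completion P)" for c
        unfolding carrier_completion by simp
      ultimately show "limit_class P (\<lambda>m. a) \<in> Units (completion P)"
        unfolding Units_def by blast
    qed
    show "completed_stalk C n (End_order n g') P =
      (\<lambda>A. conj_by (mat_ring (completion P) n) (limit_mat P n (\<lambda>m. w P))
         (conj_by (mat_ring (completion P) n) (map_mat (to_completion P) h) A)) ` completed_stalk C n (End_order n g) P"
      unfolding completed_stalk_End_order[OF g P] completed_stalk_End_order[OF g' P]
      by (rule completed_conj_image[OF wP(1) d h(1,2) bundle_order(1)[OF g P] lo])
  qed
qed

text \<open>The extension of \<open>O\<^sup>n\<^sup>-\<^sup>1\<close> by \<open>O(D)\<close> that is given by the class of \<open>a\<close> in \<open>H\<^sup>1(O(D))\<close> on the first of the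
  \<open>n - 1\<close> summands: its stalks consist of the vectors \<open>w\<close> with \<open>w\<^sub>i\<close> integral for \<open>i > 0\<close> and
  \<open>w\<^sub>0 - a P w\<^sub>1\<close> in the stalk of \<open>O(D)\<close>.\<close>

definition extension :: "nat \<Rightarrow> ('a set \<Rightarrow> int) \<Rightarrow> ('a set \<Rightarrow> 'a) \<Rightarrow> 'a set \<Rightarrow> 'a mat" where
  "extension n D a P = mat n n (\<lambda>(i, j). if i = j then if i = 0 then uniformizer P powi (- D P) else 1
     else if i = 0 \<and> j = 1 then a P else 0)"

lemma det_extension:
  assumes n: "n > 0" and P: "P \<in> S" shows "det (extension n D a P) = uniformizer P powi (- D P)"
proof -
  have "upper_triangular (extension n D a P)" by (auto simp: upper_triangular_def extension_def)
  then have "det (extension n D a P) = prod_list (diag_mat (extension n D a P))"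
    by (rule det_upper_triangular[of _ n]) (simp add: extension_def)
  also have "diag_mat (extension n D a P) = map (\<lambda>i. if i = 0 then uniformizer P powi (- D P) else 1) [0..<n]"
    by (simp add: diag_mat_def extension_def)
  also have "[0..<n] = 0 # [1..<n]" using n by (simp add: upt_conv_Cons)
  also have "prod_list (map (\<lambda>i. if i = 0 then uniformizer P powi (- D P) else 1) (0 # [1..<n])) = uniformizer P powi (- D P) * prod_list (map (\<lambda>i. 1) [1..<n])"
  proof -
    have "map (\<lambda>i. if i = 0 then uniformizer P powi (- D P) else 1) [1..<n] = map (\<lambda>i. 1) [1..<n]"
      by (rule map_cong) auto
    then show ?thesis by (simp only: list.map) simp
  qed
  finally show ?thesis by (simp add: map_replicate_const)
qed

lemma extension_bundle:
  assumes n: "n > 0" and D: "D \<in> Div" and a: "finite {P \<in> S. a P \<noteq> 0}"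
  shows "vbundle n (extension n D a)" "det_div (extension n D a) = D"
proof -
  show "vbundle n (extension n D a)"
    unfolding vbundle_def
  proof (intro conjI ballI)
    fix P assume P: "P \<in> S"
    show "extension n D a P \<in> carrier_mat n n" by (simp add: extension_def)
    show "det (extension n D a P) \<noteq> 0"
      unfolding det_extension[OF n P] using dvr.unif_neq_0[OF dvr_S[OF P]] by simp
  next
    show "finite {P \<in> S. extension n D a P \<noteq> 1\<^sub>m n}"
    proof (rule finite_subset[of _ "{P. D P \<noteq> 0} \<union> {P \<in> S. a P \<noteq> 0}"])
      show "{P \<in> S. extension n D a P \<noteq> 1\<^sub>m n} \<subseteq> {P. D P \<noteq> 0} \<union> {P \<in> S. a P \<noteq> 0}"
        by (auto intro!: eq_matI simp: extension_def)
    qed (simp add: a Div_finite[OF D])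
  qed
  show "det_div (extension n D a) = D"
    using dvr.ord_unif_powi[OF dvr_S] Div_outside[OF D] by (auto simp: det_div_def det_extension[OF n] fun_eq_iff)
qed

definition genus_of :: "nat \<Rightarrow> ('a set \<Rightarrow> int) set \<Rightarrow> ('a set set \<Rightarrow> 'a mat set) set" where
  "genus_of n c = {End_order n g | g. vbundle n g \<and> det_div g \<in> c}"

theorem spinor_genera_eq:
  assumes n: "n > 0" shows "bij_betw (genus_of n) (class_group n) (spinor_genera C n)"
proof -
  let ?R = "{(D, D'). D \<in> maximal_orders C n \<and> D' \<in> maximal_orders C n \<and> same_spinor_genus C n D D'}"
  have cl: "?R `` {End_order n g} = genus_of n (class_rel n `` {det_div g})" if g: "vbundle n g" for g
  proof (intro equalityI subsetI)
    fix E assume "E \<in> ?R `` {End_order n g}"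
    then have E: "E \<in> maximal_orders C n" "same_spinor_genus C n (End_order n g) E" by simp_all
    obtain g' where g': "vbundle n g'" "E = End_order n g'" using maximal_order_End[OF n E(1)] .
    then have "(det_div g, det_div g') \<in> class_rel n" using same_spinor_genus_iff[OF n g g'(1)] E(2) by simp
    then show "E \<in> genus_of n (class_rel n `` {det_div g})" using g' unfolding genus_of_def by blast
  next
    fix E assume "E \<in> genus_of n (class_rel n `` {det_div g})"
    then obtain g' where g': "vbundle n g'" "E = End_order n g'" "(det_div g, det_div g') \<in> class_rel n"
      unfolding genus_of_def by blast
    then show "E \<in> ?R `` {End_order n g}"
      using same_spinor_genus_iff[OF n g g'(1)] End_order_maximal[OF n g] End_order_maximal[OF n g'(1)] by simp
  qed
  have ex: "\<exists>g. vbundle n g \<and> det_div g = D" if "D \<in> Div" for D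
    using extension_bundle[OF n \<open>D \<in> Div\<close>, of "\<lambda>P. 0"] by auto
  have sg: "spinor_genera C n = genus_of n ` class_group n"
  proof (intro equalityI subsetI)
    fix s assume "s \<in> spinor_genera C n"
    then obtain E where E: "E \<in> maximal_orders C n" "s = ?R `` {E}" unfolding spinor_genera_def by (rule quotientE)
    obtain g where g: "vbundle n g" "E = End_order n g" using maximal_order_End[OF n E(1)] .
    have "s = genus_of n (class_rel n `` {det_div g})" unfolding E(2) g(2) by (rule cl[OF g(1)])
    then show "s \<in> genus_of n ` class_group n" using quotientI[OF det_div_Div[OF g(1)]] by blast
  next
    fix s assume "s \<in> genus_of n ` class_group n"
    then obtain D where D: "D \<in> Div" "s = genus_of n (class_rel n `` {D})" by (auto elim: quotientE)
    obtain g where g: "vbundle n g" "det_div g = D" using ex[OF D(1)] by blast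
    have "s = ?R `` {End_order n g}" unfolding D(2) g(2)[symmetric] by (rule cl[OF g(1), symmetric])
    then show "s \<in> spinor_genera C n"
      unfolding spinor_genera_def using quotientI[OF End_order_maximal[OF n g(1)]] by blast
  qed
  have "inj_on (genus_of n) (class_group n)"
  proof (rule inj_onI)
    fix c e assume c: "c \<in> class_group n" and e: "e \<in> class_group n" and ce: "genus_of n c = genus_of n e"
    obtain D where D: "D \<in> Div" "c = class_rel n `` {D}" using c by (rule quotientE)
    obtain g where g: "vbundle n g" "det_div g = D" using ex[OF D(1)] by blast
    have Dc: "D \<in> c" unfolding D(2) by (rule equiv_class_self[OF class_rel_equiv D(1)])
    have "End_order n g \<in> genus_of n c" unfolding genus_of_def using g Dc by blast
    then obtain g' where g': "End_order n g = End_order n g'" "vbundle n g'" "det_div g' \<in> e"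
      unfolding ce unfolding genus_of_def by blast
    have "(det_div g, det_div g) \<in> class_rel n" using class_rel_equiv D(1) g(2) unfolding equiv_def refl_on_def by blast
    then have "same_spinor_genus C n (End_order n g) (End_order n g)" using same_spinor_genus_iff[OF n g(1) g(1)] by simp
    then have "same_spinor_genus C n (End_order n g) (End_order n g')" using g'(1) by simp
    then have "(D, det_div g') \<in> class_rel n" using same_spinor_genus_iff[OF n g(1) g'(2)] g(2) by simp
    then show "c = e" using quotient_eqI[OF class_rel_equiv c e Dc g'(3)] by simp
  qed
  then show ?thesis unfolding bij_betw_def using sg by simp
qed

end

section \<open>A nonsplit maximal order\<close>

context dvr
begin

lemma fideal_prod: "(\<And>i. i \<in> I \<Longrightarrow> f i \<in> fideal P (d i)) \<Longrightarrow> finite I \<Longrightarrow> prod f I \<in> fideal P (sum d I)"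
proof (induction I rule: infinite_finite_induct)
  case (insert x F)
  then show ?case using fideal_mult[of "f x" "d x" "prod f F" "sum d F"] by simp
qed (auto simp: fideal_def)

lemma signed_fideal: "a \<in> fideal P i \<Longrightarrow> of_int (sign p) * a \<in> fideal P i"
  using fideal_uminus by (simp add: sign_def)

text \<open>The assumption says that the projections onto the lines spanned by the columns of \<open>Y\<close> preserve the
  standard lattice, which is therefore the direct sum of its intersections with these lines.\<close>

lemma diagonal_lattice:
  assumes Y: "Y \<in> carrier_mat n n" "det Y \<noteq> 0"
    and int: "\<And>r i s. r < n \<Longrightarrow> i < n \<Longrightarrow> s < n \<Longrightarrow> Y $$ (r, i) * minv Y $$ (i, s) \<in> P"
  obtains d where "\<And>r i. r < n \<Longrightarrow> i < n \<Longrightarrow> Y $$ (r, i) \<in> fideal P (d i)"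
    "\<And>i s. i < n \<Longrightarrow> s < n \<Longrightarrow> minv Y $$ (i, s) \<in> fideal P (- d i)"
    "ord P (det Y) = (\<Sum>i<n. d i)"
proof -
  note m = minv[OF Y]
  have one: "(\<Sum>s<n. minv Y $$ (i, s) * Y $$ (s, i)) = 1" if "i < n" for i
    using mat_mult_entry[OF m(1) Y(1) \<open>i < n\<close> \<open>i < n\<close>] m(3) \<open>i < n\<close> by simp
  have "\<exists>e. (\<forall>r<n. Y $$ (r, i) \<in> fideal P e) \<and> (\<forall>s<n. minv Y $$ (i, s) \<in> fideal P (- e))" if i: "i < n" for i
  proof -
    let ?T = "{r. r < n \<and> Y $$ (r, i) \<noteq> 0}"
    have "?T \<noteq> {}"
    proof
      assume "?T = {}"
      then have "(\<Sum>s<n. minv Y $$ (i, s) * Y $$ (s, i)) = 0" by (intro sum.neutral) auto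
      then show False using one[OF i] by simp
    qed
    then obtain r0 where "is_arg_min (\<lambda>r. ord P (Y $$ (r, i))) (\<lambda>r. r \<in> ?T) r0"
      using ex_is_arg_min_if_finite[of ?T] by fastforce
    then have r0: "r0 < n" "Y $$ (r0, i) \<noteq> 0" "\<And>r. r < n \<Longrightarrow> Y $$ (r, i) \<noteq> 0 \<Longrightarrow> ord P (Y $$ (r0, i)) \<le> ord P (Y $$ (r, i))"
      by (auto simp: is_arg_min_linorder)
    define e where "e = ord P (Y $$ (r0, i))"
    have "Y $$ (r, i) \<in> fideal P e" if "r < n" for r using r0(3)[OF \<open>r < n\<close>] by (auto simp: fideal_def e_def)
    moreover have "minv Y $$ (i, s) \<in> fideal P (- e)" if "s < n" for s
    proof -
      have "inverse (Y $$ (r0, i)) \<in> fideal P (- e)" using r0(2) by (simp add: fideal_def e_def ord_inverse)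
      from fideal_mult_left[OF int[OF r0(1) i \<open>s < n\<close>] this] show ?thesis using r0(2) by (simp add: field_simps)
    qed
    ultimately show ?thesis by blast
  qed
  then obtain d where d: "\<And>r i. r < n \<Longrightarrow> i < n \<Longrightarrow> Y $$ (r, i) \<in> fideal P (d i)"
    "\<And>i s. i < n \<Longrightarrow> s < n \<Longrightarrow> minv Y $$ (i, s) \<in> fideal P (- d i)" by metis
  have "det Y \<in> fideal P (\<Sum>i<n. d i)"
    unfolding det_def'[OF Y(1)]
  proof (intro fideal_sum signed_fideal)
    fix p assume "p \<in> {p. p permutes {0..<n}}"
    then have p: "p permutes {0..<n}" by simp
    have "p i < n" if "i < n" for i using permutes_in_image[OF p, of i] \<open>i < n\<close> by simp
    then have "(\<Prod>i = 0..<n. Y $$ (i, p i)) \<in> fideal P (\<Sum>i = 0..<n. d (p i))" by (intro fideal_prod d(1)) auto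
    then show "(\<Prod>i = 0..<n. Y $$ (i, p i)) \<in> fideal P (\<Sum>i<n. d i)"
      using sum.permute[OF p, of d] by (simp add: comp_def lessThan_atLeast0)
  qed
  then have 1: "(\<Sum>i<n. d i) \<le> ord P (det Y)" using Y(2) by (simp add: fideal_def)
  have "det (minv Y) \<in> fideal P (\<Sum>i<n. - d i)"
    unfolding det_def'[OF m(1)]
  proof (intro fideal_sum signed_fideal)
    fix p assume "p \<in> {p. p permutes {0..<n}}"
    then have p: "p permutes {0..<n}" by simp
    have "p i < n" if "i < n" for i using permutes_in_image[OF p, of i] \<open>i < n\<close> by simp
    then have "(\<Prod>i = 0..<n. minv Y $$ (i, p i)) \<in> fideal P (\<Sum>i = 0..<n. - d i)" by (intro fideal_prod d(2)) auto
    then show "(\<Prod>i = 0..<n. minv Y $$ (i, p i)) \<in> fideal P (\<Sum>i<n. - d i)" by (simp add: lessThan_atLeast0)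
  qed
  then have "(\<Sum>i<n. - d i) \<le> ord P (det (minv Y))" using m(4) Y(2) by (simp add: fideal_def)
  then have "ord P (det Y) \<le> (\<Sum>i<n. d i)" using m(4) Y(2) by (simp add: ord_inverse sum_negf)
  with 1 have dY: "ord P (det Y) = (\<Sum>i<n. d i)" by simp
  show thesis by (rule that[OF _ _ dY]) (rule d; assumption)+
qed

text \<open>An integral matrix with integral inverse has a unit in every column, which is what the equation
  \<open>minv Y * Y = 1\<close> says modulo the maximal ideal.\<close>

lemma diagonal_lattice_zero:
  assumes Y: "Y \<in> entries_in n P" "det Y \<noteq> 0" and Yi: "minv Y \<in> entries_in n P" and i: "i < n"
    and d: "\<And>r. r < n \<Longrightarrow> Y $$ (r, i) \<in> fideal P d" "\<And>s. s < n \<Longrightarrow> minv Y $$ (i, s) \<in> fideal P (- d)"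
  shows "d = 0"
proof (rule ccontr)
  assume "d \<noteq> 0"
  note Yc = entries_inD(1)[OF Y(1)]
  have "minv Y $$ (i, s) * Y $$ (s, i) \<in> fideal P 1" if s: "s < n" for s
  proof (cases "d > 0")
    case True
    then have "Y $$ (s, i) \<in> fideal P 1" using d(1)[OF s] fideal_antimono[of 1 d] by auto
    then show ?thesis by (rule fideal_mult_left[OF entries_inD(2)[OF Yi i s]])
  next
    case False
    then have "minv Y $$ (i, s) \<in> fideal P 1" using d(2)[OF s] fideal_antimono[of 1 "- d"] \<open>d \<noteq> 0\<close> by auto
    from fideal_mult_left[OF entries_inD(2)[OF Y(1) s i] this] show ?thesis by (simp only: mult.commute)
  qed
  then have "(\<Sum>s<n. minv Y $$ (i, s) * Y $$ (s, i)) \<in> fideal P 1" by (intro fideal_sum) simp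
  moreover have "(\<Sum>s<n. minv Y $$ (i, s) * Y $$ (s, i)) = 1"
    using mat_mult_entry[OF minv(1)[OF Yc Y(2)] Yc i i] minv(3)[OF Yc Y(2)] i by simp
  ultimately show False by (simp add: fideal_def)
qed

end

lemma mult_mat_vec_entry:
  assumes "A \<in> carrier_mat n n" "v \<in> carrier_vec n" "i < n"
  shows "(A *\<^sub>v v) $ i = (\<Sum>l<n. A $$ (i, l) * v $ l)"
  using assms by (simp add: scalar_prod_def lessThan_atLeast0)

context curve
begin

text \<open>Membership in the stalk at \<open>P\<close>, written in coordinates of \<open>K\<^sup>n\<close>.\<close>

definition in_extension :: "nat \<Rightarrow> ('a set \<Rightarrow> int) \<Rightarrow> ('a set \<Rightarrow> 'a) \<Rightarrow> 'a set \<Rightarrow> 'a vec \<Rightarrow> bool" where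
  "in_extension n D a P w \<longleftrightarrow> w $ 0 - a P * w $ 1 \<in> fideal P (- D P) \<and> (\<forall>i\<in>{1..<n}. w $ i \<in> P)"

lemma in_extension_iff:
  assumes n: "n \<ge> 2" and P: "P \<in> S" and v: "v \<in> carrier_vec n"
  shows "in_extension n D a P (extension n D a P *\<^sub>v v) \<longleftrightarrow> (\<forall>j<n. v $ j \<in> P)"
proof -
  interpret dvr P by (rule dvr_S[OF P])
  let ?g = "extension n D a P" and ?t = "uniformizer P powi (- D P)"
  have g: "?g \<in> carrier_mat n n" by (simp add: extension_def)
  have w0: "(?g *\<^sub>v v) $ 0 = ?t * v $ 0 + a P * v $ 1"
  proof -
    have "(?g *\<^sub>v v) $ 0 = (\<Sum>l<n. ?g $$ (0, l) * v $ l)" using n by (intro mult_mat_vec_entry[OF g v]) simp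
    also have "\<dots> = (\<Sum>l\<in>{0, 1}. ?g $$ (0, l) * v $ l)"
      using n by (intro sum.mono_neutral_right) (auto simp: extension_def)
    finally show ?thesis using n by (simp add: extension_def)
  qed
  have wi: "(?g *\<^sub>v v) $ i = v $ i" if "i \<in> {1..<n}" for i
  proof -
    have "(?g *\<^sub>v v) $ i = (\<Sum>l<n. ?g $$ (i, l) * v $ l)" using \<open>i \<in> {1..<n}\<close> by (intro mult_mat_vec_entry[OF g v]) simp
    also have "\<dots> = (\<Sum>l\<in>{i}. ?g $$ (i, l) * v $ l)"
      using \<open>i \<in> {1..<n}\<close> by (intro sum.mono_neutral_right) (auto simp: extension_def)
    finally show ?thesis using \<open>i \<in> {1..<n}\<close> by (simp add: extension_def)
  qed
  have "(?g *\<^sub>v v) $ 0 - a P * (?g *\<^sub>v v) $ 1 = ?t * v $ 0" using w0 wi[of 1] n by simp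
  moreover have "?t * v $ 0 \<in> fideal P (- D P) \<longleftrightarrow> v $ 0 \<in> P"
    by (cases "v $ 0 = 0") (auto simp: fideal_def mem_iff ord_mult)
  ultimately have "in_extension n D a P (?g *\<^sub>v v) \<longleftrightarrow> v $ 0 \<in> P \<and> (\<forall>i\<in>{1..<n}. v $ i \<in> P)"
    unfolding in_extension_def using wi by simp
  also have "\<dots> \<longleftrightarrow> (\<forall>j<n. v $ j \<in> P)"
  proof -
    have "v $ j \<in> P" if "v $ 0 \<in> P" "\<forall>i\<in>{1..<n}. v $ i \<in> P" "j < n" for j
      using \<open>v $ 0 \<in> P\<close> \<open>\<forall>i\<in>{1..<n}. v $ i \<in> P\<close> \<open>j < n\<close> by (cases "j = 0") auto
    then show ?thesis using n by auto
  qed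
  finally show ?thesis .
qed

text \<open>A splitting of the order decomposes the bundle as a direct sum of line bundles, spanned by
  the columns of the conjugating matrix.\<close>

lemma split_line_bundles:
  assumes n: "n \<ge> 2" and D: "D \<in> Div" and a: "finite {P \<in> S. a P \<noteq> 0}"
    and split: "split_order C n (End_order n (extension n D a))"
  obtains h L where "h \<in> carrier_mat n n" "det h \<noteq> 0" "\<forall>i<n. L i \<in> Div"
    "(\<Sum>i<n. deg (L i)) = deg D"
    "\<forall>P\<in>S. \<forall>c\<in>carrier_vec n.
      in_extension n D a P (h *\<^sub>v c) \<longleftrightarrow> (\<forall>i<n. c $ i \<in> fideal P (- L i P))"
proof -
  let ?g = "extension n D a"
  have n0: "n > 0" using n by simp
  note E = extension_bundle[OF n0 D a]
  obtain h where hU: "h \<in> Units (mat_alg n)" and sp: "\<forall>U. openin C U \<and> U \<noteq> {} \<longrightarrow>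
      (\<forall>c \<in> {..<n} \<rightarrow> structure_sheaf U. conj_by (mat_alg n) h (mat_diag n c) \<in> End_order n ?g U)"
    using split unfolding split_order_def by (elim bexE)
  have h: "h \<in> carrier_mat n n" "det h \<noteq> 0" using hU unfolding Units_mat_alg by simp_all
  note hi = minv[OF h]
  have inv_h: "inv\<^bsub>mat_alg n\<^esub> h = minv h"
  proof -
    interpret R: ring "mat_alg n :: 'a mat ring" by (rule ring_mat)
    show ?thesis using R.inv_unique'[of h "minv h"] h hi by (simp add: ring_mat_def)
  qed
  have S0: "S \<noteq> {}" using point_exists by blast
  define Y where "Y P = minv (?g P) * h" for P
  have Y: "Y P \<in> carrier_mat n n" "det (Y P) \<noteq> 0" "minv (Y P) = minv h * ?g P" "?g P * Y P = h"
    "ord P (det (Y P)) = prin (det h) P + D P" if P: "P \<in> S" for P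
  proof -
    note gP = vbundleD[OF E(1) P]
    note gi = minv[OF gP]
    have d: "det (minv (?g P)) \<noteq> 0" using gi(4) gP(2) by simp
    show c: "Y P \<in> carrier_mat n n" "det (Y P) \<noteq> 0" "minv (Y P) = minv h * ?g P"
      unfolding Y_def using minv_mult[OF gi(1) d h] minv_minv[OF gP] by auto
    have "?g P * Y P = ?g P * minv (?g P) * h" unfolding Y_def by (rule assoc_mult_mat[OF gP(1) gi(1) h(1), symmetric])
    then show "?g P * Y P = h" using gi(2) h(1) by simp
    interpret dvr P by (rule dvr_S[OF P])
    have "ord P (det (?g P)) = - D P" using fun_cong[OF E(2), of P] P by (simp add: det_div_def)
    moreover have "det (Y P) = inverse (det (?g P)) * det h" unfolding Y_def det_mult[OF gi(1) h(1)] gi(4) ..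
    ultimately show "ord P (det (Y P)) = prin (det h) P + D P"
      using gP(2) h(2) P by (simp add: ord_mult ord_inverse prin_def)
  qed
  have int: "Y P $$ (r, i) * minv (Y P) $$ (i, s) \<in> P" if P: "P \<in> S" and ris: "r < n" "i < n" "s < n" for P r i s
  proof -
    interpret dvr P by (rule dvr_S[OF P])
    let ?E = "unit_mat n i i (1::'a)"
    have Ec: "?E \<in> carrier_mat n n" by (rule unit_mat_carrier)
    let ?c = "\<lambda>l. if l = i then 1 else 0 :: 'a"
    have "?c \<in> {..<n} \<rightarrow> structure_sheaf S"
      unfolding structure_sheaf_def using dvr.one_in[OF dvr_S] dvr.zero_in[OF dvr_S] by auto
    then have "conj_by (mat_alg n) h (mat_diag n ?c) \<in> End_order n ?g S"
      using sp openI[of S] S0 by simp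
    moreover have "mat_diag n ?c = ?E" by (rule eq_matI) (auto simp: mat_diag_def unit_mat_def)
    moreover have "conj_by (mat_alg n) h ?E = conj_mat h ?E" unfolding conj_by_def inv_h conj_mat_def by (simp add: ring_mat_def)
    ultimately have "conj_mat h ?E \<in> End_order n ?g S" by simp
    then have lo: "conj_mat h ?E \<in> local_order P n (?g P)"
      using End_order_open[OF openI[of S] S0] P by auto
    note gP = vbundleD[OF E(1) P]
    note gi = minv[OF gP]
    have d: "det (minv (?g P)) \<noteq> 0" using gi(4) gP(2) by simp
    have "conj_mat (minv (?g P)) (conj_mat h ?E) = conj_mat (Y P) ?E"
      unfolding Y_def by (rule conj_mat_conj_mat[OF gi(1) d h Ec])
    then have "conj_mat (Y P) ?E \<in> entries_in n P" using lo by (simp add: local_order_def)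
    from entries_inD(2)[OF this ris(1,3)] have "conj_mat (Y P) ?E $$ (r, s) \<in> P" .
    moreover have "conj_mat (Y P) ?E $$ (r, s) = Y P $$ (r, i) * minv (Y P) $$ (i, s)"
      unfolding conj_mat_def by (rule unit_mat_sandwich[OF Y(1)[OF P] minv(1)[OF Y(1,2)[OF P]] ris(1,2,2,3)])
    ultimately show ?thesis by simp
  qed
  have "\<exists>d. (\<forall>r<n. \<forall>i<n. Y P $$ (r, i) \<in> fideal P (d i)) \<and> (\<forall>i<n. \<forall>s<n. minv (Y P) $$ (i, s) \<in> fideal P (- d i)) \<and>
      ord P (det (Y P)) = (\<Sum>i<n. d i)" if P: "P \<in> S" for P
  proof (rule dvr.diagonal_lattice[OF dvr_S[OF P] Y(1,2)[OF P]])
    show "Y P $$ (r, i) * minv (Y P) $$ (i, s) \<in> P" if "r < n" "i < n" "s < n" for r i s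
      by (rule int[OF P \<open>r < n\<close> \<open>i < n\<close> \<open>s < n\<close>])
    fix d assume "\<And>r i. r < n \<Longrightarrow> i < n \<Longrightarrow> Y P $$ (r, i) \<in> fideal P (d i)"
      "\<And>i s. i < n \<Longrightarrow> s < n \<Longrightarrow> minv (Y P) $$ (i, s) \<in> fideal P (- d i)"
      "ord P (det (Y P)) = (\<Sum>i<n. d i)"
    then show ?thesis by (intro exI[of _ d]) simp
  qed
  then obtain d where d: "\<And>P. P \<in> S \<Longrightarrow> (\<forall>r<n. \<forall>i<n. Y P $$ (r, i) \<in> fideal P (d P i)) \<and>
      (\<forall>i<n. \<forall>s<n. minv (Y P) $$ (i, s) \<in> fideal P (- d P i)) \<and> ord P (det (Y P)) = (\<Sum>i<n. d P i)" by metis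
  define L where "L i P = (if P \<in> S then d P i else 0)" for i P
  \<comment> \<open>the stalk of the \<open>i\<close>-th line bundle consists of the \<open>c\<close> with \<open>c\<close> times the \<open>i\<close>-th column of \<open>h\<close> in the bundle\<close>
  have L: "Y P $$ (r, i) \<in> fideal P (L i P)" "minv (Y P) $$ (i, r) \<in> fideal P (- L i P)"
    if "P \<in> S" "r < n" "i < n" for P r i using d[OF \<open>P \<in> S\<close>] \<open>P \<in> S\<close> \<open>r < n\<close> \<open>i < n\<close> by (simp_all add: L_def)
  have LD: "L i \<in> Div" if i: "i < n" for i
  proof (rule DivI)
    let ?F = "{P \<in> S. ?g P \<noteq> 1\<^sub>m n} \<union> {P \<in> S. h \<notin> entries_in n P} \<union> {P \<in> S. minv h \<notin> entries_in n P}"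
    show "finite ?F" by (intro finite_UnI vbundle_finite[OF E(1)] finite_nonintegral h(1) hi(1))
    show "?F \<subseteq> S" by blast
    fix P assume nF: "P \<notin> ?F"
    show "L i P = 0"
    proof (cases "P \<in> S")
      case P: True
      then have 1: "?g P = 1\<^sub>m n" "h \<in> entries_in n P" "minv h \<in> entries_in n P" using nF by auto
      have Yh: "Y P = h" unfolding Y_def 1(1) minv_one using h(1) by simp
      show ?thesis
        by (rule dvr.diagonal_lattice_zero[OF dvr_S[OF P] 1(2) h(2) 1(3) i]) (use L[OF P] i in \<open>simp_all add: Yh\<close>)
    qed (simp add: L_def)
  qed
  have "(\<Sum>i<n. L i P) = prin (det h) P + D P" for P
    using d[of P] Y(5)[of P] Div_outside[OF D] by (auto simp: L_def prin_def)
  then have "deg (\<lambda>P. \<Sum>i<n. L i P) = deg D" using deg_add[OF prin_Div[OF h(2)] D] deg_prin[OF h(2)] by simp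
  moreover have "deg (\<lambda>P. \<Sum>i<m. L i P) = (\<Sum>i<m. deg (L i)) \<and> (\<lambda>P. \<Sum>i<m. L i P) \<in> Div" if "m \<le> n" for m
    using \<open>m \<le> n\<close>
  proof (induction m)
    case (Suc m)
    then show ?case using LD[of m] deg_add[of "\<lambda>P. \<Sum>i<m. L i P" "L m"] Div_add[of "\<lambda>P. \<Sum>i<m. L i P" "L m"] by simp
  qed (simp add: Div_zero)
  ultimately have deg: "(\<Sum>i<n. deg (L i)) = deg D" by simp
  have "in_extension n D a P (h *\<^sub>v c) \<longleftrightarrow> (\<forall>i<n. c $ i \<in> fideal P (- L i P))"
    if P: "P \<in> S" and c: "c \<in> carrier_vec n" for P c
  proof -
    interpret dvr P by (rule dvr_S[OF P])
    note gP = vbundleD[OF E(1) P] and Yi = minv[OF Y(1,2)[OF P]]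
    define v where "v = Y P *\<^sub>v c"
    have v: "v \<in> carrier_vec n" unfolding v_def by (rule mult_mat_vec_carrier[OF Y(1)[OF P] c])
    have "h *\<^sub>v c = ?g P *\<^sub>v v"
      unfolding v_def Y(4)[OF P, symmetric] by (rule assoc_mult_mat_vec[OF gP(1) Y(1)[OF P] c])
    then have "in_extension n D a P (h *\<^sub>v c) \<longleftrightarrow> (\<forall>j<n. v $ j \<in> P)" by (simp only: in_extension_iff[OF n P v])
    also have "\<dots> \<longleftrightarrow> (\<forall>i<n. c $ i \<in> fideal P (- L i P))"
    proof (intro iffI allI impI)
      fix i assume vP: "\<forall>j<n. v $ j \<in> P" and i: "i < n"
      have "minv (Y P) *\<^sub>v v = (minv (Y P) * Y P) *\<^sub>v c"
        unfolding v_def by (rule assoc_mult_mat_vec[OF Yi(1) Y(1)[OF P] c, symmetric])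
      then have "c $ i = (minv (Y P) *\<^sub>v v) $ i" using Yi(3) c by simp
      also have "\<dots> = (\<Sum>l<n. v $ l * minv (Y P) $$ (i, l))"
        unfolding mult_mat_vec_entry[OF Yi(1) v i] by (simp only: mult.commute)
      also have "\<dots> \<in> fideal P (- L i P)" using vP L(2)[OF P _ i] by (intro fideal_sum fideal_mult_left) simp_all
      finally show "c $ i \<in> fideal P (- L i P)" .
    next
      fix j assume cF: "\<forall>i<n. c $ i \<in> fideal P (- L i P)" and j: "j < n"
      have "v $ j = (\<Sum>l<n. Y P $$ (j, l) * c $ l)" unfolding v_def by (rule mult_mat_vec_entry[OF Y(1)[OF P] c j])
      also have "\<dots> \<in> fideal P 0"
      proof (rule fideal_sum)
        fix l assume "l \<in> {..<n}"
        then show "Y P $$ (j, l) * c $ l \<in> fideal P 0"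
          using fideal_mult[OF L(1)[OF P j, of l], of "c $ l" "- L l P"] cF by simp
      qed
      finally show "v $ j \<in> P" by (simp only: fideal_0)
    qed
    finally show ?thesis .
  qed
  then show thesis using LD by (intro that[OF h _ deg]) blast+
qed

end

context curve
begin

text \<open>The bundle is an extension of a trivial bundle by \<open>O(D)\<close>, whose class does not vanish.  When
  it is a direct sum of line bundles, either one of these is the subbundle \<open>O(D)\<close>, which is then a
  direct summand, or the degrees force all of them but one to be trivial; then there are enough
  global sections to lift those of the trivial quotient.  In both cases the extension splits.\<close>

theorem extension_not_split:
  assumes n: "n \<ge> 2" and D: "D \<in> Div" and a: "finite {P \<in> S. a P \<noteq> 0}"
    and na: "\<not> (\<exists>f. \<forall>P\<in>S. f - a P \<in> fideal P (- D P))"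
    and \<delta>: "\<delta> > 0" "deg D = - \<delta>" "\<And>D. D \<in> Div \<Longrightarrow> deg D > 0 \<Longrightarrow> \<delta> \<le> deg D"
  shows "\<not> split_order C n (End_order n (extension n D a))"
proof
  assume split: "split_order C n (End_order n (extension n D a))"
  obtain h L where h: "h \<in> carrier_mat n n" "det h \<noteq> 0" and LD: "\<forall>i<n. L i \<in> Div"
    and deg_sum: "(\<Sum>i<n. deg (L i)) = deg D"
    and coord: "\<forall>P\<in>S. \<forall>c\<in>carrier_vec n.
      in_extension n D a P (h *\<^sub>v c) \<longleftrightarrow> (\<forall>i<n. c $ i \<in> fideal P (- L i P))"
    using split_line_bundles[OF n D a split] .
  note LD = LD[rule_format] and coord = coord[rule_format]
  note hi = minv[OF h]
  have n0: "0 < n" "1 < n" using n by simp_all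
  have unit_entry: "(h *\<^sub>v (c \<cdot>\<^sub>v unit_vec n i)) $ j = c * h $$ (j, i)" if "i < n" "j < n" for i j c
  proof -
    have "(h *\<^sub>v (c \<cdot>\<^sub>v unit_vec n i)) $ j = (\<Sum>l<n. h $$ (j, l) * (c \<cdot>\<^sub>v unit_vec n i) $ l)"
      using \<open>j < n\<close> by (intro mult_mat_vec_entry[OF h(1)]) auto
    also have "\<dots> = (\<Sum>l<n. if l = i then c * h $$ (j, i) else 0)" using \<open>i < n\<close> by (intro sum.cong) auto
    finally show ?thesis using \<open>i < n\<close> by simp
  qed
  have column: "in_extension n D a P (h *\<^sub>v (c \<cdot>\<^sub>v unit_vec n i))" if P: "P \<in> S" and i: "i < n" and c: "c \<in> fideal P (- L i P)" for P i c
  proof -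
    have "c \<cdot>\<^sub>v unit_vec n i \<in> carrier_vec n" by simp
    moreover have "(c \<cdot>\<^sub>v unit_vec n i) $ j \<in> fideal P (- L i P)" if "j < n" for j
      using c \<open>j < n\<close> i dvr.zero_fideal[OF dvr_S[OF P]] by simp
    moreover have "(c \<cdot>\<^sub>v unit_vec n i) $ j = 0" if "j < n" "j \<noteq> i" for j using \<open>j < n\<close> \<open>j \<noteq> i\<close> i by simp
    ultimately show ?thesis using coord[OF P] dvr.zero_fideal[OF dvr_S[OF P]] by metis
  qed
  show False
  proof (cases "\<exists>i<n. \<forall>j\<in>{1..<n}. h $$ (j, i) = 0")
    case True
    then obtain i where i: "i < n" "\<And>j. j \<in> {1..<n} \<Longrightarrow> h $$ (j, i) = 0" by blast
    define z where "z = h $$ (0, i)"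
    have inv0: "minv h $$ (i, 0) * z = 1"
    proof -
      have "(minv h * h) $$ (i, i) = (\<Sum>l<n. minv h $$ (i, l) * h $$ (l, i))" by (rule mat_mult_entry[OF hi(1) h(1) i(1) i(1)])
      also have "\<dots> = (\<Sum>l\<in>{0}. minv h $$ (i, l) * h $$ (l, i))"
        using n0 i(2) by (intro sum.mono_neutral_right) auto
      finally show ?thesis using hi(3) i(1) by (simp add: z_def)
    qed
    have "- (z * minv h $$ (i, 1)) - a P \<in> fideal P (- D P)" if P: "P \<in> S" for P
    proof -
      interpret dvr P by (rule dvr_S[OF P])
      \<comment> \<open>an element of the stalk over the first basis vector of the quotient; its component in the \<open>i\<close>-th summand\<close>
      define b where "b = vec n (\<lambda>j. if j = 0 then a P else if j = 1 then 1 else 0)"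
      have b: "b \<in> carrier_vec n" by (simp add: b_def)
      define c where "c = minv h *\<^sub>v b"
      have c: "c \<in> carrier_vec n" unfolding c_def by (rule mult_mat_vec_carrier[OF hi(1) b])
      have "h *\<^sub>v c = (h * minv h) *\<^sub>v b" unfolding c_def by (rule assoc_mult_mat_vec[OF h(1) hi(1) b, symmetric])
      then have hc: "h *\<^sub>v c = b" using hi(2) b by simp
      have "in_extension n D a P b" using n0 one_in zero_in by (auto simp: in_extension_def b_def)
      then have ci: "c $ i \<in> fideal P (- L i P)" using coord[OF P c] i(1) by (simp add: hc)
      have "c $ i = (\<Sum>l<n. minv h $$ (i, l) * b $ l)" unfolding c_def by (rule mult_mat_vec_entry[OF hi(1) b i(1)])
      also have "\<dots> = (\<Sum>l\<in>{0, 1}. minv h $$ (i, l) * b $ l)"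
        using n0 by (intro sum.mono_neutral_right) (auto simp: b_def)
      finally have c_eq: "c $ i = minv h $$ (i, 0) * a P + minv h $$ (i, 1)" using n0 by (simp add: b_def)
      have "c $ i * h $$ (0, i) - a P * (c $ i * h $$ (1, i)) \<in> fideal P (- D P)"
        using column[OF P i(1) ci] unit_entry[OF i(1)] n0 by (simp add: in_extension_def)
      then have "c $ i * z \<in> fideal P (- D P)" using i(2)[of 1] n0 by (simp add: z_def)
      also have "c $ i * z = (minv h $$ (i, 0) * z) * a P + z * minv h $$ (i, 1)" unfolding c_eq by (simp add: algebra_simps)
      finally have "a P + z * minv h $$ (i, 1) \<in> fideal P (- D P)" by (simp add: inv0)
      from fideal_uminus[OF this] show ?thesis by (simp only: minus_add_distrib minus_diff_commute) (simp only: diff_conv_add_uminus add.commute)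
    qed
    then show False using na by blast
  next
    case False
    \<comment> \<open>a nonzero coordinate of the \<open>i\<close>-th column is a nonzero map \<open>O(L i) \<rightarrow> O\<close>\<close>
    define j where "j i = (SOME j. j \<in> {1..<n} \<and> h $$ (j, i) \<noteq> 0)" for i
    have j: "j i \<in> {1..<n}" "h $$ (j i, i) \<noteq> 0" if "i < n" for i
    proof -
      have "\<exists>j. j \<in> {1..<n} \<and> h $$ (j, i) \<noteq> 0" using False \<open>i < n\<close> by blast
      from someI_ex[OF this] show "j i \<in> {1..<n}" "h $$ (j i, i) \<noteq> 0" by (simp_all add: j_def)
    qed
    define z where "z i = h $$ (j i, i)" for i
    have z: "z i \<noteq> 0" if "i < n" for i using j(2)[OF \<open>i < n\<close>] by (simp add: z_def)
    have L_le: "L i P \<le> prin (z i) P" if i: "i < n" for i P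
    proof (cases "P \<in> S")
      case P: True
      interpret dvr P by (rule dvr_S[OF P])
      define t where "t = uniformizer P powi (- L i P)"
      have t: "t \<noteq> 0" "ord P t = - L i P" by (simp_all add: t_def)
      have "t \<in> fideal P (- L i P)" using t(2) by (simp add: fideal_def)
      from column[OF P i this] have "(h *\<^sub>v (t \<cdot>\<^sub>v unit_vec n i)) $ j i \<in> P"
        using j(1)[OF i] by (simp add: in_extension_def)
      then have "t * z i \<in> P" using unit_entry[OF i, of "j i"] j(1)[OF i] by (simp add: z_def)
      then show ?thesis using t z[OF i] P by (simp add: mem_iff ord_mult prin_def)
    next
      case False
      then show ?thesis using Div_outside[OF LD[OF i]] by (simp add: prin_def)
    qed
    have deg_le: "deg (L i) \<le> 0" if i: "i < n" for i
      using deg_mono[OF LD[OF i] prin_Div[OF z[OF i]] L_le[OF i]] deg_prin[OF z[OF i]] by simp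
    have "\<exists>i0<n. deg (L i0) < 0"
    proof (rule ccontr)
      assume "\<not> (\<exists>i0<n. deg (L i0) < 0)"
      then have "0 \<le> (\<Sum>i<n. deg (L i))" by (intro sum_nonneg) auto
      then show False using deg_sum \<delta>(1,2) by simp
    qed
    then obtain i0 where i0: "i0 < n" "deg (L i0) < 0" by blast
    have "\<delta> \<le> deg (\<lambda>P. - L i0 P)"
      using deg_scale[OF LD[OF i0(1)], of "-1"] i0(2) Div_scale[OF LD[OF i0(1)], of "-1"] by (intro \<delta>(3)) simp_all
    then have "deg (L i0) \<le> - \<delta>" using deg_scale[OF LD[OF i0(1)], of "-1"] by simp
    moreover have "(\<Sum>i<n. deg (L i)) = deg (L i0) + (\<Sum>i\<in>{..<n} - {i0}. deg (L i))"
      using i0(1) by (subst sum.remove[of _ i0]) auto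
    ultimately have rest: "0 \<le> (\<Sum>i\<in>{..<n} - {i0}. deg (L i))" using deg_sum \<delta>(2) by simp
    have deg_0: "deg (L i) = 0" if i: "i < n" "i \<noteq> i0" for i
    proof -
      have "(\<Sum>i\<in>{..<n} - {i0}. deg (L i)) \<le> deg (L i)"
        using i deg_le by (subst sum.remove[of _ i]) (auto intro!: sum_nonpos)
      then show ?thesis using rest deg_le[OF i(1)] by simp
    qed
    define q where "q = card (sections (\<lambda>P. 0))"
    have card_q: "card (sections (L i)) = q" if i: "i < n" "i \<noteq> i0" for i
    proof -
      have "(\<lambda>P. prin (z i) P - L i P) \<in> Div" by (intro Div_diff prin_Div z LD i)
      moreover have "deg (\<lambda>P. prin (z i) P - L i P) = 0"
        using deg_diff[OF prin_Div[OF z[OF i(1)]] LD[OF i(1)]] deg_prin[OF z[OF i(1)]] deg_0[OF i] by simp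
      ultimately have "prin (z i) P - L i P = 0" for P
        by (intro effective_deg_0[of "\<lambda>P. prin (z i) P - L i P"]) (simp_all add: L_le[OF i(1)])
      then have "L i = (\<lambda>P. 0 - prin (inverse (z i)) P)" by (simp add: prin_inverse[OF z[OF i(1)]] fun_eq_iff)
      then show ?thesis unfolding q_def using card_sections_scale[of "inverse (z i)" "\<lambda>P. 0"] z[OF i(1)] by simp
    qed
    let ?A = "PiE {..<n} (\<lambda>i. sections (L i))" and ?B = "{1..<n} \<rightarrow>\<^sub>E sections (\<lambda>P. 0)"
    \<comment> \<open>the map on global sections from the sum of line bundles to the trivial quotient\<close>
    define \<psi> where "\<psi> c = restrict (\<lambda>r. (h *\<^sub>v vec n c) $ r) {1..<n}" for c
    have ext: "in_extension n D a P (h *\<^sub>v vec n c)" if "c \<in> ?A" "P \<in> S" for c P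
      using coord[OF \<open>P \<in> S\<close>, of "vec n c"] \<open>c \<in> ?A\<close> \<open>P \<in> S\<close> by (auto simp: sections_def PiE_iff)
    have map: "\<psi> ` ?A \<subseteq> ?B"
    proof
      fix w assume "w \<in> \<psi> ` ?A"
      then obtain c where c: "c \<in> ?A" "w = \<psi> c" by blast
      have "(h *\<^sub>v vec n c) $ r \<in> sections (\<lambda>P. 0)" if "r \<in> {1..<n}" for r
        unfolding sections_zero using ext[OF c(1)] \<open>r \<in> {1..<n}\<close> by (auto simp: in_extension_def)
      then show "w \<in> ?B" by (auto simp: c(2) \<psi>_def)
    qed
    have inj: "inj_on \<psi> ?A"
    proof (rule inj_onI)
      fix c e assume c: "c \<in> ?A" and e: "e \<in> ?A" and eq: "\<psi> c = \<psi> e"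
      let ?w = "h *\<^sub>v vec n c" and ?v = "h *\<^sub>v vec n e"
      have r: "?w $ r = ?v $ r" if "r \<in> {1..<n}" for r using fun_cong[OF eq, of r] \<open>r \<in> {1..<n}\<close> by (simp add: \<psi>_def)
      have "?w $ 0 - ?v $ 0 \<in> sections D"
        unfolding sections_def
      proof (intro CollectI ballI)
        fix P assume P: "P \<in> S"
        interpret dvr P by (rule dvr_S[OF P])
        have "?w $ 0 - a P * ?w $ 1 - (?v $ 0 - a P * ?v $ 1) \<in> fideal P (- D P)"
          by (rule fideal_diff[OF conjunct1[OF ext[OF c P, unfolded in_extension_def]] conjunct1[OF ext[OF e P, unfolded in_extension_def]]])
        then show "?w $ 0 - ?v $ 0 \<in> fideal P (- D P)" using r[of 1] n0 by simp
      qed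
      from section_deg_nonneg(4)[OF D _ this] have w0: "?w $ 0 - ?v $ 0 = 0" using \<delta>(1,2) by linarith
      have "?w $ r = ?v $ r" if "r < n" for r using w0 r[of r] \<open>r < n\<close> by (cases "r = 0") auto
      then have "?w = ?v" using h(1) by (intro eq_vecI) auto
      then have "minv h *\<^sub>v ?w = minv h *\<^sub>v ?v" by simp
      moreover have "minv h *\<^sub>v (h *\<^sub>v vec n x) = vec n x" for x
        using assoc_mult_mat_vec[OF hi(1) h(1), of "vec n x"] hi(3) by simp
      ultimately have v: "vec n c = vec n e" by simp
      show "c = e"
      proof (rule PiE_ext[OF c e])
        fix i assume "i \<in> {..<n}"
        then show "c i = e i" using arg_cong[OF v, of "\<lambda>u. vec_index u i"] by simp
      qed
    qed
    have finB: "finite ?B" by (intro finite_PiE finite_sections Div_zero) simp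
    have "card ?B = q ^ (n - 1)" by (simp add: card_PiE q_def)
    also have "\<dots> = (\<Prod>i\<in>{..<n} - {i0}. card (sections (L i)))" using card_q i0(1) by (simp add: q_def)
    also have "\<dots> \<le> card (sections (L i0)) * (\<Prod>i\<in>{..<n} - {i0}. card (sections (L i)))"
      using card_sections_pos[OF LD[OF i0(1)]] by simp
    also have "\<dots> = card ?A" using i0(1) by (simp add: card_PiE prod.remove[of _ i0])
    also have "\<dots> = card (\<psi> ` ?A)" by (rule card_image[OF inj, symmetric])
    finally have surj: "\<psi> ` ?A = ?B" using card_subset_eq[OF finB map] card_mono[OF finB map] by simp
    \<comment> \<open>a global section over this one solves the approximation problem posed by \<open>a\<close>\<close>
    define u where "u = restrict (\<lambda>r. if r = 1 then 1 else 0 :: 'a) {1..<n}"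
    have "(1::'a) \<in> sections (\<lambda>P. 0)" "(0::'a) \<in> sections (\<lambda>P. 0)"
      unfolding sections_zero using dvr.one_in[OF dvr_S] dvr.zero_in[OF dvr_S] by auto
    then have "u \<in> ?B" by (auto simp: u_def)
    then have "u \<in> \<psi> ` ?A" by (simp only: surj)
    then obtain c where c: "c \<in> ?A" "\<psi> c = u" by (elim imageE) (rule that, simp_all)
    have "(h *\<^sub>v vec n c) $ 1 = 1" using fun_cong[OF c(2), of 1] n0 by (simp add: \<psi>_def u_def)
    then have "\<forall>P\<in>S. (h *\<^sub>v vec n c) $ 0 - a P \<in> fideal P (- D P)"
      using ext[OF c(1)] by (simp add: in_extension_def)
    then show False using na by blast
  qed
qed

text \<open>For \<open>n = 1\<close> all divisors are equivalent and the bound is 0.\<close>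

theorem nonsplit_spinor_genera:
  assumes n: "n > 0"
  shows "finite (spinor_genera C n) \<and>
    real (card {s \<in> spinor_genera C n. \<exists>D\<in>s. \<not> split_order C n D}) \<ge> real (card (spinor_genera C n)) / real n - 1"
proof -
  note bij = spinor_genera_eq[OF n]
  have fin: "finite (spinor_genera C n)" using bij_betw_finite[OF bij] finite_class_group[OF n] by simp
  have N: "card (spinor_genera C n) = card (class_group n)" using bij_betw_same_card[OF bij] by simp
  let ?X = "{s \<in> spinor_genera C n. \<exists>D\<in>s. \<not> split_order C n D}"
  have "real (card (class_group n)) / real n - 1 \<le> real (card ?X)"
  proof (cases "n = 1")
    case True
    have "card (class_group n) \<le> 1"
    proof (rule card_le_Suc0_iff_eq[THEN iffD2, OF finite_class_group[OF n], folded One_nat_def], intro ballI)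
      fix c e assume c: "c \<in> class_group n" and e: "e \<in> class_group n"
      obtain A where A: "A \<in> Div" "c = class_rel n `` {A}" using c by (rule quotientE)
      obtain B where B: "B \<in> Div" "e = class_rel n `` {B}" using e by (rule quotientE)
      have "(A, B) \<in> class_rel n"
        by (rule class_relI[OF A(1), of 1 "\<lambda>P. B P - A P"]) (use A B True in \<open>simp_all add: prin_1 Div_diff\<close>)
      then show "c = e" unfolding A(2) B(2) by (rule equiv_class_eq[OF class_rel_equiv])
    qed
    then show ?thesis using True by simp
  next
    case False
    then have n2: "n \<ge> 2" using n by simp
    show ?thesis
    proof (rule class_count[OF n])
      assume "card (class_group n) \<le> n"
      then have "real (card (class_group n)) / real n \<le> 1" using n by simp
      then show ?thesis by simp
    next
      fix \<delta> assume nonvanishing: "\<delta> > 0" "\<And>D. D \<in> Div \<Longrightarrow> deg D > 0 \<Longrightarrow> \<delta> \<le> deg D"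
        "\<And>D. D \<in> Div \<Longrightarrow> deg D = - \<delta> \<Longrightarrow> \<not> approximable D"
        "card (class_group n) \<le> n * card {c \<in> class_group n. \<exists>D\<in>c. deg D = - \<delta>}"
      let ?Y = "{c \<in> class_group n. \<exists>D\<in>c. deg D = - \<delta>}"
      have "genus_of n ` ?Y \<subseteq> ?X"
      proof
        fix s assume "s \<in> genus_of n ` ?Y"
        then obtain c D where c: "c \<in> class_group n" "s = genus_of n c" and D: "D \<in> c" "deg D = - \<delta>" by blast
        have DD: "D \<in> Div" using in_quotient_imp_subset[OF class_rel_equiv c(1)] D(1) by blast
        obtain a where a: "finite {P \<in> S. a P \<noteq> 0}" "\<not> (\<exists>f. \<forall>P\<in>S. f - a P \<in> fideal P (- D P))"
          using nonvanishing(3)[OF DD D(2)] unfolding approximable_def by blast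
        note E = extension_bundle[OF n DD a(1)]
        have "\<not> split_order C n (End_order n (extension n D a))"
          by (rule extension_not_split[OF n2 DD a nonvanishing(1) D(2) nonvanishing(2)])
        moreover have "det_div (extension n D a) \<in> c" using D(1) E(2) by simp
        then have "End_order n (extension n D a) \<in> s" unfolding c(2) genus_of_def using E(1) by blast
        ultimately have "\<exists>D\<in>s. \<not> split_order C n D" by (rule bexI)
        moreover have "s \<in> spinor_genera C n" unfolding c(2) by (rule bij_betw_apply[OF bij c(1)])
        ultimately show "s \<in> ?X" by simp
      qed
      moreover have "inj_on (genus_of n) ?Y" by (rule inj_on_subset[OF bij_betw_imp_inj_on[OF bij]]) simp
      moreover have "finite ?X" using fin by (rule finite_subset[rotated]) blast
      ultimately have "card ?Y \<le> card ?X" by (intro card_inj_on_le[of "genus_of n"])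
      then have "n * card ?Y \<le> n * card ?X" by (rule mult_le_mono2)
      with nonvanishing(4) have "card (class_group n) \<le> n * card ?X" by (rule le_trans)
      then have "real (card (class_group n)) \<le> real n * real (card ?X)" by (simp only: of_nat_mult[symmetric] of_nat_le_iff)
      then have "real (card (class_group n)) / real n \<le> real (card ?X)" using n by (simp add: field_simps)
      then show ?thesis by simp
    qed
  qed
  then show ?thesis unfolding N using fin by blast
qed

end

theorem proposition11:
  fixes k :: "'a::field set" and C :: "'a set topology" and n :: nat
  assumes "smooth_projective_curve k C"
    and "n > 0"
  shows "finite (spinor_genera C n) \<and>
    real (card {\<S> \<in> spinor_genera C n. \<exists>D\<in>\<S>. \<not> split_order C n D})
      \<ge> real (card (spinor_genera C n)) / real n - 1"
proof -
  obtain d x where dx: "projective_curve k d x" "C = projective_model k d x"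
    using smooth_projective_curve_obtains[OF assms(1)] .
  interpret pc: projective_curve k d x by (rule dx(1))
  interpret curve k C
    unfolding dx(2) by unfold_locales (rule pc.openin_iff)
  show ?thesis by (rule nonsplit_spinor_genera[OF assms(2)])
qed

end
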